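(* Let $\Omega=F\setminus(\bar G_1\cup\dots\cup\bar G_n)$ with $F\subset\mathbf{R}^2$ bounded, open and convex with smooth boundary, and $G_1,\dots,G_n$ ($n\ge 1$) open disks with centers $p_1,\dots,p_n$ respectively and common radius $r>0$, whose closures are pairwise disjoint and contained in $F$. Let $A$ be a closed smooth real one-form on $\Omega$ having flux $\Phi_j$ around $\partial G_j$, $j=1,\dots,n$. Then $$\lambda_1(\Omega,A)\ \geq\ \frac{4\pi^2}{|\partial F|^2}\,\frac{\beta(\Omega)^2}{B(\Omega)^2}\cdot\gamma^2$$ with $\gamma=\min_{j=1,\dots,n}d(\Phi_j,\mathbf{Z})$, where $|\partial F|$ is the length of $\partial F$ and $\beta(\Omega),B(\Omega)$ are the minimal and maximal widths of $\Omega$.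
   Context: Magnetic Laplacian. For a smooth real one-form $A$ on a bounded planar domain $\Omega$ and complex-valued $u$, set $\nabla^A u=\nabla u-iA^\sharp u$ (i.e. $\nabla^A_Xu=\nabla_Xu-iA(X)u$), where $A^\sharp$ is the dual vector field of $A$. $\lambda_1(\Omega,A)$ denotes the first eigenvalue of $\Delta_A=(\nabla^A)^\star\nabla^A$ on $\Omega$ with magnetic Neumann boundary conditions $\nabla^A_Nu=0$ on $\partial\Omega$; it is given by $$\lambda_1(\Omega,A)=\inf_{u\in H^1(\Omega,\mathbf{C})\setminus\{0\}}\frac{\int_\Omega|\nabla^Au|^2\,dx}{\int_\Omega|u|^2\,dx}.$$ Flux. For a closed one-form $A$ the flux of $A$ around the hole $G_j$ is $\Phi_j=\frac1{2\pi}\oint_cA$, where $c$ is a loop in $\Omega$ travelling once around $G_j$ and around no other hole (the orientation is irrelevant). For a real number $\Phi$, $d(\Phi,\mathbf{Z})=\min\{|\Phi-k|:k\in\mathbf{Z}\}$. Widths. The inner boundary of $\Omega$ is $\partial G_1\cup\dots\cup\partial G_n$. An orthogonal ray of $\Omega$ is a line segment contained in $\Omega$ (up to its endpoints) which hits the inner boundary orthogonally: for $x\in\partial G_j$ it starts at $x$ in the direction of the normal pointing out of $G_j$ and is continued until it first meets $\partial\Omega$ again. The minimal width $\beta(\Omega)$ (resp. maximal width $B(\Omega)$) is the minimal (resp. maximal) length of an orthogonal ray. *)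

theory Defs
  imports "HOL-Analysis.Analysis" "HOL-Complex_Analysis.Complex_Analysis"
begin

text \<open>The plane is \<^typ>\<open>real^2\<close>. A real one-form is represented by its dual vector field \<open>A\<close>:
  its value on a tangent vector \<open>v\<close> at \<open>x\<close> is \<open>A x \<bullet> v\<close>.\<close>

subsection \<open>Smoothness\<close>

text \<open>Meant for open \<open>S\<close>: all iterated directional derivatives up to order \<open>k\<close> exist and are
  continuous on \<open>S\<close>.\<close>

primrec Ck_on :: "nat \<Rightarrow> ('a::euclidean_space \<Rightarrow> 'b::real_normed_vector) \<Rightarrow> 'a set \<Rightarrow> bool" where
  "Ck_on 0 f S \<longleftrightarrow> continuous_on S f"
| "Ck_on (Suc k) f S \<longleftrightarrow> (\<forall>x\<in>S. f differentiable (at x)) \<and>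
     (\<forall>v. Ck_on k (\<lambda>x. frechet_derivative f (at x) v) S)"

definition smooth_on :: "('a::euclidean_space \<Rightarrow> 'b::real_normed_vector) \<Rightarrow> 'a set \<Rightarrow> bool" where
  "smooth_on f S \<longleftrightarrow> (\<forall>k. Ck_on k f S)"

text \<open>The boundary of \<open>F\<close> is smooth if, near each of its points, \<open>F\<close> is a sublevel set of a smooth
  function without critical points.\<close>

definition smooth_boundary :: "(real^2) set \<Rightarrow> bool" where
  "smooth_boundary F \<longleftrightarrow> (\<forall>x\<in>frontier F. \<exists>U g. open U \<and> x \<in> U \<and>
     smooth_on (g :: real^2 \<Rightarrow> real) U \<and>
     (\<forall>y\<in>U. frechet_derivative g (at y) \<noteq> (\<lambda>v. 0)) \<and>
     g x = 0 \<and> F \<inter> U = {y \<in> U. g y < 0})"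

subsection \<open>Length of the boundary\<close>

text \<open>Supremum of the lengths of inscribed polygons; to be used for rectifiable curves only, since
  the supremum of an unbounded set of reals is unspecified.\<close>

definition curve_length :: "(real \<Rightarrow> real^2) \<Rightarrow> real" where
  "curve_length c = Sup {\<Sum>i<N. dist (c (t i)) (c (t (Suc i))) | N t.
     mono (t :: nat \<Rightarrow> real) \<and> range t \<subseteq> {0..1}}"

text \<open>For \<open>F\<close> bounded, open, convex and nonempty, the boundary is a simple closed curve, and the
  length does not depend on the chosen simple parametrization.\<close>

definition boundary_length :: "(real^2) set \<Rightarrow> real" where
  "boundary_length F = curve_length
     (SOME c. simple_path c \<and> pathfinish c = pathstart c \<and> path_image c = frontier F)"

subsection \<open>Closed one-forms and their fluxes\<close>

definition closed_form_on :: "(real^2 \<Rightarrow> real^2) \<Rightarrow> (real^2) set \<Rightarrow> bool" where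
  "closed_form_on A S \<longleftrightarrow> (\<forall>x\<in>S.
     frechet_derivative A (at x) (axis 1 1) $ 2 = frechet_derivative A (at x) (axis 2 1) $ 1)"

definition line_integral :: "(real^2 \<Rightarrow> real^2) \<Rightarrow> (real \<Rightarrow> real^2) \<Rightarrow> real" where
  "line_integral A c = integral {0..1} (\<lambda>t. A (c t) \<bullet> vector_derivative c (at t within {0..1}))"

definition to_complex :: "real^2 \<Rightarrow> complex" where
  "to_complex x = Complex (x $ 1) (x $ 2)"

definition plane_winding_number :: "(real \<Rightarrow> real^2) \<Rightarrow> real^2 \<Rightarrow> complex" where
  "plane_winding_number c z = winding_number (to_complex \<circ> c) (to_complex z)"

text \<open>\<open>c\<close> is a piecewise \<open>C\<^sup>1\<close> loop in \<open>\<Omega>\<close> travelling once, in either direction, around the hole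
  \<open>G j\<close> and around none of the other holes \<open>G 1, \<dots>, G n\<close>.\<close>

definition loop_once_around ::
    "(real^2) set \<Rightarrow> nat \<Rightarrow> (nat \<Rightarrow> (real^2) set) \<Rightarrow> nat \<Rightarrow> (real \<Rightarrow> real^2) \<Rightarrow> bool" where
  "loop_once_around \<Omega> n G j c \<longleftrightarrow>
     valid_path c \<and> pathfinish c = pathstart c \<and> path_image c \<subseteq> \<Omega> \<and>
     (\<forall>z\<in>G j. plane_winding_number c z \<in> {1, -1}) \<and>
     (\<forall>k\<in>{1..n} - {j}. \<forall>z\<in>G k. plane_winding_number c z = 0)"

text \<open>For a closed form the integral depends on the loop only through its orientation, so the flux
  is well defined up to sign, and its distance to the integers is well defined.\<close>

definition has_flux ::
    "(real^2) set \<Rightarrow> nat \<Rightarrow> (nat \<Rightarrow> (real^2) set) \<Rightarrow> (real^2 \<Rightarrow> real^2) \<Rightarrow> nat \<Rightarrow> real \<Rightarrow> bool" where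
  "has_flux \<Omega> n G A j \<Phi> \<longleftrightarrow>
     (\<exists>c. loop_once_around \<Omega> n G j c \<and> \<Phi> = line_integral A c / (2 * pi))"

subsection \<open>Widths\<close>

definition ray_length :: "(real^2) set \<Rightarrow> real^2 \<Rightarrow> real^2 \<Rightarrow> real" where
  "ray_length \<Omega> x \<nu> = Inf {t. 0 < t \<and> x + t *\<^sub>R \<nu> \<in> frontier \<Omega>}"

text \<open>The inner boundary consists of the circles with centers \<open>p 1, \<dots>, p n\<close> and radius \<open>r\<close>; the
  outward unit normal of the disk around \<open>p j\<close> at \<open>x\<close> is \<open>(x - p j) /\<^sub>R r\<close>.\<close>

definition orthogonal_ray_lengths ::
    "(real^2) set \<Rightarrow> nat \<Rightarrow> (nat \<Rightarrow> real^2) \<Rightarrow> real \<Rightarrow> real set" where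
  "orthogonal_ray_lengths \<Omega> n p r =
     {ray_length \<Omega> x ((x - p j) /\<^sub>R r) | j x. j \<in> {1..n} \<and> x \<in> sphere (p j) r}"

definition min_width :: "(real^2) set \<Rightarrow> nat \<Rightarrow> (nat \<Rightarrow> real^2) \<Rightarrow> real \<Rightarrow> real" where
  "min_width \<Omega> n p r = Inf (orthogonal_ray_lengths \<Omega> n p r)"

text \<open>A supremum, as the ray length may jump at rays tangent to another disk, so that the maximum
  need not be attained.\<close>

definition max_width :: "(real^2) set \<Rightarrow> nat \<Rightarrow> (nat \<Rightarrow> real^2) \<Rightarrow> real \<Rightarrow> real" where
  "max_width \<Omega> n p r = Sup (orthogonal_ray_lengths \<Omega> n p r)"

subsection \<open>The first eigenvalue of the magnetic Neumann Laplacian\<close>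

definition test_function_on :: "(real^2) set \<Rightarrow> (real^2 \<Rightarrow> real) \<Rightarrow> bool" where
  "test_function_on \<Omega> \<phi> \<longleftrightarrow> smooth_on \<phi> UNIV \<and>
     (\<exists>K. compact K \<and> K \<subseteq> \<Omega> \<and> (\<forall>x. x \<notin> K \<longrightarrow> \<phi> x = 0))"

definition L2_on :: "(real^2) set \<Rightarrow> (real^2 \<Rightarrow> 'b::euclidean_space) \<Rightarrow> bool" where
  "L2_on \<Omega> f \<longleftrightarrow> set_borel_measurable lborel \<Omega> f \<and>
     (\<integral>\<^sup>+x\<in>\<Omega>. ennreal ((norm (f x))\<^sup>2) \<partial>lborel) < \<infinity>"

definition has_weak_gradient ::
    "(real^2) set \<Rightarrow> (real^2 \<Rightarrow> complex) \<Rightarrow> (real^2 \<Rightarrow> complex^2) \<Rightarrow> bool" where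
  "has_weak_gradient \<Omega> u g \<longleftrightarrow> (\<forall>\<phi>. test_function_on \<Omega> \<phi> \<longrightarrow> (\<forall>i.
     (LINT x:\<Omega>|lborel. frechet_derivative \<phi> (at x) (axis i 1) *\<^sub>R u x) =
     - (LINT x:\<Omega>|lborel. \<phi> x *\<^sub>R (g x $ i))))"

text \<open>\<open>u\<close> belongs to the Sobolev space \<open>H\<^sup>1(\<Omega>, \<complex>)\<close> and has weak gradient \<open>g\<close>, which is unique up
  to null sets.\<close>

definition H1_with_gradient ::
    "(real^2) set \<Rightarrow> (real^2 \<Rightarrow> complex) \<Rightarrow> (real^2 \<Rightarrow> complex^2) \<Rightarrow> bool" where
  "H1_with_gradient \<Omega> u g \<longleftrightarrow> L2_on \<Omega> u \<and> L2_on \<Omega> g \<and> has_weak_gradient \<Omega> u g"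

definition magnetic_gradient ::
    "(real^2 \<Rightarrow> real^2) \<Rightarrow> (real^2 \<Rightarrow> complex) \<Rightarrow> (real^2 \<Rightarrow> complex^2) \<Rightarrow> real^2 \<Rightarrow> complex^2" where
  "magnetic_gradient A u g x = (\<chi> i. g x $ i - \<i> * complex_of_real (A x $ i) * u x)"

text \<open>The infimum is taken in the extended nonnegative reals: the energy may be infinite if \<open>A\<close> is
  unbounded near the boundary, and denominators are positive and finite.\<close>

definition lambda1 :: "(real^2) set \<Rightarrow> (real^2 \<Rightarrow> real^2) \<Rightarrow> ennreal" where
  "lambda1 \<Omega> A =
     (INF (u, g) \<in> {(u, g). H1_with_gradient \<Omega> u g \<and> \<not> (AE x in lborel. x \<in> \<Omega> \<longrightarrow> u x = 0)}.
        (\<integral>\<^sup>+x\<in>\<Omega>. ennreal ((norm (magnetic_gradient A u g x))\<^sup>2) \<partial>lborel) /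
        (\<integral>\<^sup>+x\<in>\<Omega>. ennreal ((norm (u x))\<^sup>2) \<partial>lborel))"

end

theory Submission
  imports Defs
begin

text \<open>Let \<open>L\<close> be the length of \<open>\<partial>F\<close>, and \<open>\<beta> \<le> B\<close> the widths. Cut \<open>F\<close> into the Voronoi cells of the centers; it suffices to
  prove the Rayleigh quotient estimate on each cell minus its disk. There \<open>A\<close> equals \<open>\<Phi>\<close> times the angle form up to
  an exact form. Foliate the punctured cell by polygons interpolating between one circumscribed about the disk
  and one inscribed in the cell, with vertices on the same \<open>N\<close> rays. These loops are no longer than the polygon
  inscribed in \<open>F\<close>, hence have length at most \<open>L\<close>, and the normal speed of the family lies between \<open>m\<close> and \<open>B\<close>, where
  \<open>m\<close> tends to the distance from the disk to the boundary of the cell as \<open>N\<close> grows. After gauging \<open>A\<close> away, a test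
  function restricted to a loop is multiplied by \<open>exp (\<plusminus> 2 \<pi> \<i> \<Phi>)\<close> after one turn, and one-dimensional inequalities for such
  functions, integrated over the family, give two lower bounds for the quotient: \<open>(2 \<pi> \<gamma>)\<^sup>2 m\<^sup>2 / (L\<^sup>2 B\<^sup>2)\<close>, by a twisted Wirtinger
  inequality, and \<open>(4 \<gamma>)\<^sup>2 4 m B / ((m + B)\<^sup>2 L\<^sup>2)\<close>, by a bound of the supremum together with the Kantorovich inequality.

  For one hole the cell is \<open>F\<close> and the first bound with \<open>m = \<beta>\<close> is the claim. For several holes only \<open>m = \<beta> / 2\<close> is
  available, but then \<open>B \<ge> 2 \<beta>\<close>: rays close to one that is tangent to another disk have at least that length, up to an
  arbitrarily small error. With this, the second bound implies the claim because \<open>\<pi>\<^sup>2 b (1 + b / 2)\<^sup>2 \<le> 8\<close> for \<open>b = \<beta> / B \<le> 1 / 2\<close>.\<close>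

subsection \<open>Quasiperiodic functions of one variable\<close>

text \<open>Leaves interpolating directly between the circle and the boundary of a Voronoi cell
  would only be Lipschitz, and their weights would contain the derivative of the radius function.
  With vertices on N fixed rays every leaf is affine on each side and the Jacobian is a polynomial
  there, so classical calculus suffices. The price is a thin layer at the disk and another at the
  boundary of the cell that the leaves miss; both vanish as N grows. For fixed N the leaves with 1/N
  \<le> s \<le> 1 - 1/N fill a compact set, on which mollification replaces a Sobolev function by a
  differentiable one; Fatou's lemma then recovers the cell. Both one-dimensional bounds are needed.
  The first is quadratic in m / B, so that m = \<beta> / 2 would cost a factor 4. The second has
  worse constants but is linear in m / B for small m / B, and this gain is what the estimate B \<ge>
  2 \<beta> turns into the sharp claim.\<close>

definition piecewise_cont :: "nat \<Rightarrow> (real \<Rightarrow> 'a::topological_space) \<Rightarrow> bool" where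
  "piecewise_cont N h \<longleftrightarrow> (\<forall>i<N. \<exists>k. continuous_on {real i..real (Suc i)} k \<and>
     (\<forall>t\<in>{real i<..<real (Suc i)}. h t = k t))"

lemma piecewise_cont_bin:
  assumes "piecewise_cont N f" "piecewise_cont N g" "continuous_on UNIV (\<lambda>z. F (fst z) (snd z))"
  shows "piecewise_cont N (\<lambda>t. F (f t) (g t))"
  unfolding piecewise_cont_def
proof (intro allI impI)
  fix i assume "i < N"
  then obtain k l where k: "continuous_on {real i..real (Suc i)} k" "\<forall>t\<in>{real i<..<real (Suc i)}. f t = k t"
    and l: "continuous_on {real i..real (Suc i)} l" "\<forall>t\<in>{real i<..<real (Suc i)}. g t = l t"
    using assms(1,2) unfolding piecewise_cont_def by meson
  have "continuous_on {real i..real (Suc i)} (\<lambda>t. F (k t) (l t))"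
    using continuous_on_compose2[OF assms(3) continuous_on_Pair[OF k(1) l(1)]] by simp
  then show "\<exists>k. continuous_on {real i..real (Suc i)} k \<and>
     (\<forall>t\<in>{real i<..<real (Suc i)}. F (f t) (g t) = k t)"
    using k l by (intro exI[of _ "\<lambda>t. F (k t) (l t)"]) simp
qed

lemma piecewise_cont_un:
  assumes "piecewise_cont N f" "continuous_on UNIV F"
  shows "piecewise_cont N (\<lambda>t. F (f t))"
  by (rule piecewise_cont_bin[OF assms(1) assms(1), of "\<lambda>x _. F x"])
    (rule continuous_on_compose2[OF assms(2) continuous_on_fst[OF continuous_on_id] subset_UNIV])

lemma piecewise_cont_continuous:
  assumes "continuous_on {0..real N} f"
  shows "piecewise_cont N f"
  unfolding piecewise_cont_def
proof (intro allI impI)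
  fix i assume "i < N"
  then have "{real i..real (Suc i)} \<subseteq> {0..real N}" by auto
  then show "\<exists>k. continuous_on {real i..real (Suc i)} k \<and> (\<forall>t\<in>{real i<..<real (Suc i)}. f t = k t)"
    using continuous_on_subset[OF assms] by blast
qed

lemma piecewise_cont_mult:
  fixes f g :: "real \<Rightarrow> 'a::real_normed_algebra"
  assumes "piecewise_cont N f" "piecewise_cont N g"
  shows "piecewise_cont N (\<lambda>t. f t * g t)"
  by (rule piecewise_cont_bin[OF assms]) (intro continuous_intros)

lemma piecewise_cont_add:
  fixes f g :: "real \<Rightarrow> 'a::real_normed_vector"
  assumes "piecewise_cont N f" "piecewise_cont N g"
  shows "piecewise_cont N (\<lambda>t. f t + g t)"
  by (rule piecewise_cont_bin[OF assms]) (intro continuous_intros)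

lemma piecewise_cont_const: "piecewise_cont N (\<lambda>t. c)"
  by (intro piecewise_cont_continuous continuous_intros)

lemma piecewise_cont_norm_sq:
  fixes f :: "real \<Rightarrow> 'a::real_normed_vector"
  assumes "piecewise_cont N f"
  shows "piecewise_cont N (\<lambda>t. (norm (f t))\<^sup>2)"
  by (rule piecewise_cont_un[OF assms]) (intro continuous_intros)

text \<open>The unit intervals are the sides of an N-gon traversed over [0, N]. On each closed one
  the function agrees with a continuous function except possibly at the two corners, and the values
  there do not affect integrals.\<close>

lemma piecewise_cont_integrable:
  fixes f :: "real \<Rightarrow> 'a::banach"
  assumes "piecewise_cont N f"
  shows "f integrable_on {0..real N}"
  using assms
proof (induction N)
  case 0
  show ?case using integrable_on_refl[of f "0::real"] by simp
next
  case (Suc N)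
  then have 1: "f integrable_on {0..real N}" unfolding piecewise_cont_def by simp
  obtain k where k: "continuous_on {real N..real (Suc N)} k" "\<forall>t\<in>{real N<..<real (Suc N)}. f t = k t"
    using Suc.prems unfolding piecewise_cont_def by blast
  have "f integrable_on {real N..real (Suc N)}"
    by (rule integrable_spike_finite[of "{real N, real (Suc N)}", OF _ _ integrable_continuous_interval[OF k(1)]])
       (use k(2) in auto)
  with 1 show ?case using Henstock_Kurzweil_Integration.integrable_combine[of 0 "real N" "real (Suc N)" f] by simp
qed

text \<open>Minimising the right-hand side over \<eta> gives 2 sqrt (T E). This is Cauchy-Schwarz in
  scalar form: an integral version follows from a pointwise AM-GM inequality.\<close>

lemma square_le_of_weighted_amgm:
  fixes c E T :: real
  assumes "\<And>\<eta>. \<eta> > 0 \<Longrightarrow> 2 * c \<le> \<eta> * E + T / \<eta>" "c \<ge> 0" "E \<ge> 0" "T \<ge> 0"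
  shows "c\<^sup>2 \<le> T * E"
proof (cases "c = 0")
  case False
  then have c: "c > 0" using assms by simp
  show ?thesis
  proof (cases "E = 0")
    case True
    \<comment> \<open>With \<open>E = 0\<close> this large \<eta> makes \<open>T / \<eta>\<close> at
      most c, which contradicts \<open>c > 0\<close>.\<close>
    have "2 * c \<le> T / (T / c + 1)" using assms(1)[of "T / c + 1"] True c assms(4)
      by (simp add: add_nonneg_pos)
    also have "\<dots> = T * c / (T + c)" using c by (simp add: field_simps)
    also have "\<dots> \<le> c" using c assms(4) by (simp add: field_simps)
    finally show ?thesis using c by simp
  next
    case False
    then have "2 * c \<le> c / E * E + T / (c / E)" using assms(1)[of "c / E"] c assms(3) by simp
    then have "c \<le> T * E / c" using False by simp
    then show ?thesis using c by (simp add: field_simps power2_eq_square)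
  qed
qed (use assms in simp)

text \<open>Following \<open>f\<close> from x to the end of the period and then from its start back
  to x multiplies the value by w. Hence \<open>(1 - w) * f x\<close> is a combination of two
  increments, together bounded by the integral of the norm of f', and Cauchy-Schwarz with the weight
  \<kappa> applies.\<close>

lemma quasiperiodic_sup_bound:
  fixes f f' :: "real \<Rightarrow> complex" and \<kappa> :: "real \<Rightarrow> real"
  assumes S: "finite S" and cont: "continuous_on {0..b} f" 
    and der: "\<And>t. t \<in> {0<..<b} - S \<Longrightarrow> (f has_vector_derivative f' t) (at t)"
    and pos: "\<And>t. \<kappa> t > 0"
    and i1: "(\<lambda>t. 1 / \<kappa> t) integrable_on {0..b}" and i2: "(\<lambda>t. \<kappa> t * (norm (f' t))\<^sup>2) integrable_on {0..b}"
    and per: "f b = w * f 0" "norm w = 1" and x: "x \<in> {0..b}"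
  shows "(norm (1 - w))\<^sup>2 * (norm (f x))\<^sup>2 \<le>
    integral {0..b} (\<lambda>t. 1 / \<kappa> t) * integral {0..b} (\<lambda>t. \<kappa> t * (norm (f' t))\<^sup>2)"
proof -
  have "(norm ((1 - w) * f x))\<^sup>2 \<le>
    integral {0..b} (\<lambda>t. 1 / \<kappa> t) * integral {0..b} (\<lambda>t. \<kappa> t * (norm (f' t))\<^sup>2)"
  proof (rule square_le_of_weighted_amgm)
    show "integral {0..b} (\<lambda>t. 1 / \<kappa> t) \<ge> 0" "integral {0..b} (\<lambda>t. \<kappa> t * (norm (f' t))\<^sup>2) \<ge> 0"
      using pos less_imp_le[OF pos] by (auto intro!: integral_nonneg i1 i2)
    fix \<eta> :: real assume \<eta>: "\<eta> > 0"
    define q where "q t = \<eta> / 2 * (\<kappa> t * (norm (f' t))\<^sup>2) + 1 / (2 * \<eta>) * (1 / \<kappa> t)" for t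
    have iq: "q integrable_on {0..b}" unfolding q_def by (intro integrable_add integrable_on_mult_right i1 i2)
    have le: "norm (f' t) \<le> q t" for t
    proof -
      have "0 \<le> (\<eta> * \<kappa> t * norm (f' t) - 1)\<^sup>2" by simp
      then have "2 * (\<eta> * \<kappa> t * norm (f' t)) \<le> (\<eta> * \<kappa> t * norm (f' t))\<^sup>2 + 1"
        by (simp add: power2_eq_square algebra_simps)
      then have "2 * (\<eta> * \<kappa> t * norm (f' t)) / (2 * \<eta> * \<kappa> t) \<le> ((\<eta> * \<kappa> t * norm (f' t))\<^sup>2 + 1) / (2 * \<eta> * \<kappa> t)"
        using \<eta> pos[of t] by (intro divide_right_mono) auto
      then show ?thesis using \<eta> pos[of t] unfolding q_def by (simp add: field_simps power2_eq_square)
    qed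
    have sub: "{0..x} \<subseteq> {0..b}" "{x..b} \<subseteq> {0..b}" using x by auto
    have h1: "(f' has_integral (f x - f 0)) {0..x}"
      by (rule fundamental_theorem_of_calculus_interior_strong[OF S])
         (use x der continuous_on_subset[OF cont sub(1)] in auto)
    have h2: "(f' has_integral (f b - f x)) {x..b}"
      by (rule fundamental_theorem_of_calculus_interior_strong[OF S])
         (use x der continuous_on_subset[OF cont sub(2)] in auto)
    have iq1: "q integrable_on {0..x}" and iq2: "q integrable_on {x..b}"
      using integrable_subinterval_real[OF iq] sub by auto
    have n1: "norm (f x - f 0) \<le> integral {0..x} q"
      using integral_norm_bound_integral[OF has_integral_integrable[OF h1] iq1] le integral_unique[OF h1] by simp
    have n2: "norm (f b - f x) \<le> integral {x..b} q"
      using integral_norm_bound_integral[OF has_integral_integrable[OF h2] iq2] le integral_unique[OF h2] by simp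
    have "(1 - w) * f x = - (f b - f x) - w * (f x - f 0)" by (simp add: per algebra_simps)
    then have "norm ((1 - w) * f x) \<le> norm (f b - f x) + norm (w * (f x - f 0))"
      by (metis norm_minus_cancel norm_triangle_ineq4)
    then have "norm ((1 - w) * f x) \<le> integral {0..x} q + integral {x..b} q"
      using n1 n2 per(2) by (simp add: norm_mult)
    also have "\<dots> = integral {0..b} q" using x by (intro Henstock_Kurzweil_Integration.integral_combine iq) auto
    also have "\<dots> = \<eta> / 2 * integral {0..b} (\<lambda>t. \<kappa> t * (norm (f' t))\<^sup>2) + 1 / (2 * \<eta>) * integral {0..b} (\<lambda>t. 1 / \<kappa> t)"
      unfolding q_def by (subst Henstock_Kurzweil_Integration.integral_add)
        (auto intro!: integrable_on_mult_right i1 i2 simp only: integral_mult_right)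
    finally show "2 * norm ((1 - w) * f x) \<le> \<eta> * integral {0..b} (\<lambda>t. \<kappa> t * (norm (f' t))\<^sup>2) + integral {0..b} (\<lambda>t. 1 / \<kappa> t) / \<eta>"
      using \<eta> by (simp add: field_simps)
  qed simp
  then show ?thesis by (simp add: norm_mult power_mult_distrib)
qed

text \<open>Jacobi's method. In the variable \<sigma>, with d\<sigma> = dt / \<kappa>, the function
  h = k tan (k (\<sigma> - m)) solves the Riccati equation h' = k^2 + h^2, so that adding the
  derivative of h g^2 to the difference of the two integrands gives a perfect square. The bound by
  pi / 2 keeps the tangent finite.\<close>

lemma weighted_riccati_inequality:
  fixes g g' \<sigma> \<kappa> :: "real \<Rightarrow> real"
  assumes "a \<le> b" and S: "finite S" and cg: "continuous_on {a..b} g" and c\<sigma>: "continuous_on {a..b} \<sigma>"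
    and der: "\<And>t. t \<in> {a<..<b} - S \<Longrightarrow> (g has_real_derivative g' t) (at t)"
    and der\<sigma>: "\<And>t. t \<in> {a<..<b} - S \<Longrightarrow> (\<sigma> has_real_derivative 1 / \<kappa> t) (at t)"
    and pos: "\<And>t. \<kappa> t > 0"
    and small: "\<And>t. t \<in> {a..b} \<Longrightarrow> \<bar>k * (\<sigma> t - m)\<bar> < pi / 2"
    and i1: "(\<lambda>t. (g t)\<^sup>2 / \<kappa> t) integrable_on {a..b}" and i2: "(\<lambda>t. \<kappa> t * (g' t)\<^sup>2) integrable_on {a..b}"
  shows "k\<^sup>2 * integral {a..b} (\<lambda>t. (g t)\<^sup>2 / \<kappa> t) + k * tan (k * (\<sigma> a - m)) * (g a)\<^sup>2 \<le>
    integral {a..b} (\<lambda>t. \<kappa> t * (g' t)\<^sup>2) + k * tan (k * (\<sigma> b - m)) * (g b)\<^sup>2"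
proof -
  define H where "H t = k * tan (k * (\<sigma> t - m)) * (g t)\<^sup>2" for t
  define H' where "H' t = 2 * g t * g' t * k * tan (k * (\<sigma> t - m)) + k\<^sup>2 * (1 + (tan (k * (\<sigma> t - m)))\<^sup>2) * (g t)\<^sup>2 / \<kappa> t" for t
  have cos0: "cos (k * (\<sigma> t - m)) \<noteq> 0" if "t \<in> {a..b}" for t
    using small[OF that] cos_gt_zero_pi[of "k * (\<sigma> t - m)"] by force
  have HI: "(H' has_integral (H b - H a)) {a..b}"
  proof (rule fundamental_theorem_of_calculus_interior_strong[OF S \<open>a \<le> b\<close>])
    show "continuous_on {a..b} H" unfolding H_def by (intro continuous_intros cg c\<sigma>) (use cos0 in auto)
    fix t assume t: "t \<in> {a<..<b} - S"
    then have c: "cos (k * (\<sigma> t - m)) \<noteq> 0" using cos0 by auto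
    have sec: "inverse ((cos (k * (\<sigma> t - m)))\<^sup>2) = 1 + (tan (k * (\<sigma> t - m)))\<^sup>2"
      using tan_sec[OF c] by (simp add: power_inverse)
    have "(H has_real_derivative H' t) (at t)"
      unfolding H_def H'_def
      by (rule derivative_eq_intros refl der der\<sigma> t c DERIV_tan[THEN DERIV_chain2] | simp)+
         (simp only: sec, simp add: algebra_simps power2_eq_square)
    then show "(H has_vector_derivative H' t) (at t)" by (simp add: has_real_derivative_iff_has_vector_derivative)
  qed
  have "((\<lambda>t. \<kappa> t * (g' t)\<^sup>2 - k\<^sup>2 * ((g t)\<^sup>2 / \<kappa> t) + H' t) has_integral
     (integral {a..b} (\<lambda>t. \<kappa> t * (g' t)\<^sup>2) - k\<^sup>2 * integral {a..b} (\<lambda>t. (g t)\<^sup>2 / \<kappa> t) + (H b - H a))) {a..b}"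
    by (intro has_integral_add has_integral_diff has_integral_mult_right HI integrable_integral i1 i2)
  moreover have "0 \<le> \<kappa> t * (g' t)\<^sup>2 - k\<^sup>2 * ((g t)\<^sup>2 / \<kappa> t) + H' t" for t
  proof -
    have "\<kappa> t * (g' t)\<^sup>2 - k\<^sup>2 * ((g t)\<^sup>2 / \<kappa> t) + H' t = \<kappa> t * (g' t + k * tan (k * (\<sigma> t - m)) * g t / \<kappa> t)\<^sup>2"
      using pos[of t] unfolding H'_def by (simp add: field_simps power2_eq_square)
    then show ?thesis using pos[of t] by simp
  qed
  ultimately have "0 \<le> integral {a..b} (\<lambda>t. \<kappa> t * (g' t)\<^sup>2) - k\<^sup>2 * integral {a..b} (\<lambda>t. (g t)\<^sup>2 / \<kappa> t) + (H b - H a)"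
    using has_integral_nonneg by blast
  then show ?thesis unfolding H_def by linarith
qed

text \<open>A periodic function takes the same value c at two points that halve the period T,
  measured in \<sigma>. Then \<open>g - c\<close> vanishes at the ends of both halves, and the
  Dirichlet constant of an interval of length T / 2 is (2 pi / T)^2, as wanted.\<close>

lemma wirtinger_real_periodic:
  fixes g g' \<sigma> \<kappa> :: "real \<Rightarrow> real"
  assumes N: "N > 0" and S: "finite S" and cg: "continuous_on {0..real N} g" and c\<sigma>: "continuous_on {0..real N} \<sigma>"
    and der: "\<And>t. t \<in> {0<..<real N} - S \<Longrightarrow> (g has_real_derivative g' t) (at t)"
    and der\<sigma>: "\<And>t. t \<in> {0<..<real N} - S \<Longrightarrow> (\<sigma> has_real_derivative 1 / \<kappa> t) (at t)"
    and mono: "\<And>s t. 0 \<le> s \<Longrightarrow> s < t \<Longrightarrow> t \<le> real N \<Longrightarrow> \<sigma> s < \<sigma> t"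
    and pos: "\<And>t. \<kappa> t > 0"
    and pc: "piecewise_cont N \<kappa>" "piecewise_cont N (\<lambda>t. 1 / \<kappa> t)" "piecewise_cont N g'"
    and \<sigma>0: "\<sigma> 0 = 0" and per: "g (real N) = g 0"
  shows "\<exists>c. (2 * pi / \<sigma> (real N))\<^sup>2 * integral {0..real N} (\<lambda>t. (g t - c)\<^sup>2 / \<kappa> t) \<le>
     integral {0..real N} (\<lambda>t. \<kappa> t * (g' t)\<^sup>2)"
proof -
  define b where "b = real N"
  define T where "T = \<sigma> b"
  have b: "0 < b" using N unfolding b_def by simp
  have T: "0 < T" using mono[of 0 b] b \<sigma>0 unfolding T_def b_def by simp
  have wmono: "\<sigma> s \<le> \<sigma> t" if "0 \<le> s" "s \<le> t" "t \<le> b" for s t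
    using mono[of s t] that unfolding b_def by (cases "s = t") auto
  have inj: "inj_on \<sigma> {0..b}"
    by (rule inj_onI) (metis (no_types, lifting) mono b_def atLeastAtMost_iff less_irrefl linorder_neqE_linordered_idom)
  define \<tau> where "\<tau> = inv_into {0..b} \<sigma>"
  have \<tau>\<sigma>: "\<tau> (\<sigma> t) = t" if "t \<in> {0..b}" for t unfolding \<tau>_def using inv_into_f_f[OF inj that] .
  have im: "\<sigma> ` {0..b} = {0..T}"
  proof
    show "\<sigma> ` {0..b} \<subseteq> {0..T}" using wmono \<sigma>0 unfolding T_def by force
    show "{0..T} \<subseteq> \<sigma> ` {0..b}"
    proof
      fix y assume "y \<in> {0..T}"
      then obtain x where "0 \<le> x" "x \<le> b" "\<sigma> x = y"
        using IVT'[of \<sigma> 0 y b] \<sigma>0 b c\<sigma> unfolding T_def b_def by auto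
      then show "y \<in> \<sigma> ` {0..b}" by auto
    qed
  qed
  have c\<tau>: "continuous_on {0..T} \<tau>"
    unfolding im[symmetric] by (rule continuous_on_inv) (use c\<sigma> \<tau>\<sigma> in \<open>auto simp: b_def\<close>)
  have \<tau>im: "\<tau> y \<in> {0..b}" "\<sigma> (\<tau> y) = y" if "y \<in> {0..T}" for y
    unfolding \<tau>_def using inv_into_into[of y \<sigma> "{0..b}"] f_inv_into_f[of y \<sigma> "{0..b}"] that im by blast+
  have cg\<tau>: "continuous_on {0..T} (\<lambda>y. g (\<tau> y))"
    by (rule continuous_on_compose2[OF cg c\<tau>]) (use \<tau>im in \<open>auto simp: b_def\<close>)
  \<comment> \<open>Compares values half a period apart in \<sigma>. Periodicity gives
    \<open>\<psi> (T/2) = - \<psi> 0\<close>, hence a zero.\<close>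
  define \<psi> where "\<psi> x = g (\<tau> (x + T/2)) - g (\<tau> x)" for x
  have "continuous_on {0..T/2} \<psi>"
    unfolding \<psi>_def using T
    by (intro continuous_on_diff continuous_on_compose2[OF cg\<tau>, of _ "\<lambda>x. x + T/2"] continuous_on_subset[OF cg\<tau>] continuous_intros) auto
  moreover have "\<psi> (T/2) = - \<psi> 0"
  proof -
    have "\<tau> T = b" "\<tau> 0 = 0" using \<tau>\<sigma>[of b] \<tau>\<sigma>[of 0] b \<sigma>0 unfolding T_def by auto
    then show ?thesis using per unfolding \<psi>_def b_def by simp
  qed
  ultimately have "\<exists>x\<in>{0..T/2}. \<psi> x = 0"
    using IVT'[of \<psi> 0 0 "T/2"] IVT2'[of \<psi> "T/2" 0 0] T by (cases "\<psi> 0 \<le> 0") force+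
  then obtain x where x: "0 \<le> x" "x \<le> T/2" "\<psi> x = 0" by auto
  define t1 where "t1 = \<tau> x"
  define t2 where "t2 = \<tau> (x + T/2)"
  have t1: "t1 \<in> {0..b}" "\<sigma> t1 = x" and t2: "t2 \<in> {0..b}" "\<sigma> t2 = x + T/2"
    using \<tau>im[of x] \<tau>im[of "x + T/2"] x T unfolding t1_def t2_def by auto
  have t12: "t1 < t2" using wmono[of t2 t1] t1 t2 T by (auto simp: not_less[symmetric])
  define c where "c = g t1"
  have gc: "g t1 - c = 0" "g t2 - c = 0" using x(3) unfolding c_def \<psi>_def t1_def t2_def by auto
  have pci: "piecewise_cont N (\<lambda>t. (g t - c)\<^sup>2 / \<kappa> t)"
    using piecewise_cont_mult[OF piecewise_cont_continuous pc(2), of "\<lambda>t. (g t - c)\<^sup>2"] cg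
    by (simp add: continuous_intros)
  have i1: "(\<lambda>t. (g t - c)\<^sup>2 / \<kappa> t) integrable_on {0..b}" 
    unfolding b_def by (rule piecewise_cont_integrable[OF pci])
  have "piecewise_cont N (\<lambda>t. \<kappa> t * (g' t)\<^sup>2)"
    unfolding power2_eq_square by (intro piecewise_cont_mult pc)
  then have i2: "(\<lambda>t. \<kappa> t * (g' t)\<^sup>2) integrable_on {0..b}" unfolding b_def by (rule piecewise_cont_integrable)
  \<comment> \<open>k stays strictly below 2 pi / T, so that k T / 4 < pi / 2 and the tangents are
    finite; the limit is taken at the end.\<close>
  have main: "k\<^sup>2 * integral {0..b} (\<lambda>t. (g t - c)\<^sup>2 / \<kappa> t) \<le> integral {0..b} (\<lambda>t. \<kappa> t * (g' t)\<^sup>2)"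
    if k: "0 < k" "k < 2 * pi / T" for k
  proof -
    have kT: "k * (T/4) < pi / 2" using k T by (simp add: field_simps)
    have piece: "k\<^sup>2 * integral {a..e} (\<lambda>t. (g t - c)\<^sup>2 / \<kappa> t) + k * tan (k * (\<sigma> a - m)) * (g a - c)\<^sup>2 \<le>
       integral {a..e} (\<lambda>t. \<kappa> t * (g' t)\<^sup>2) + k * tan (k * (\<sigma> e - m)) * (g e - c)\<^sup>2"
      if ae: "0 \<le> a" "a \<le> e" "e \<le> b" and sm: "\<sigma> a \<ge> m - T/4" "\<sigma> e \<le> m + T/4" for a e m
    proof (rule weighted_riccati_inequality[OF ae(2) S])
      have sub: "{a..e} \<subseteq> {0..b}" using ae by auto
      show "continuous_on {a..e} (\<lambda>t. g t - c)" "continuous_on {a..e} \<sigma>"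
        using sub unfolding b_def by (auto intro!: continuous_intros continuous_on_subset[OF cg] continuous_on_subset[OF c\<sigma>])
      show "((\<lambda>t. g t - c) has_real_derivative g' t) (at t)" "(\<sigma> has_real_derivative 1 / \<kappa> t) (at t)" if "t \<in> {a<..<e} - S" for t
        using that ae der[of t] der\<sigma>[of t] unfolding b_def by (auto intro!: derivative_eq_intros)
      show "(\<lambda>t. (g t - c)\<^sup>2 / \<kappa> t) integrable_on {a..e}" "(\<lambda>t. \<kappa> t * (g' t)\<^sup>2) integrable_on {a..e}"
        using integrable_subinterval_real[OF i1 sub] integrable_subinterval_real[OF i2 sub] by auto
      show "\<bar>k * (\<sigma> t - m)\<bar> < pi / 2" if "t \<in> {a..e}" for t
      proof -
        have "\<bar>\<sigma> t - m\<bar> \<le> T/4" 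
        proof -
          have "\<sigma> a \<le> \<sigma> t" "\<sigma> t \<le> \<sigma> e" using wmono[of a t] wmono[of t e] that ae by auto
          then show ?thesis using sm unfolding abs_le_iff by linarith
        qed
        then have "k * \<bar>\<sigma> t - m\<bar> \<le> k * (T/4)" using k by (intro mult_left_mono) auto
        moreover have "\<bar>k * (\<sigma> t - m)\<bar> = k * \<bar>\<sigma> t - m\<bar>" using k by (simp add: abs_mult)
        ultimately show ?thesis using kT by linarith
      qed
    qed (rule pos)
    \<comment> \<open>One half of the period is [t1, t2]. The other half wraps around the end of the
      interval and is split there, so that its centre appears both as x + 3 T / 4 and as x - T / 4.
      By periodicity the two boundary terms at the splitting point agree and cancel.\<close>
    have p1: "k\<^sup>2 * integral {t1..t2} (\<lambda>t. (g t - c)\<^sup>2 / \<kappa> t) \<le> integral {t1..t2} (\<lambda>t. \<kappa> t * (g' t)\<^sup>2)"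
      using piece[of t1 t2 "x + T/4"] t1 t2 t12 gc by simp
    have p2: "k\<^sup>2 * integral {t2..b} (\<lambda>t. (g t - c)\<^sup>2 / \<kappa> t) \<le> integral {t2..b} (\<lambda>t. \<kappa> t * (g' t)\<^sup>2)
        + k * tan (k * (T - (x + 3 * T/4))) * (g 0 - c)\<^sup>2"
      using piece[of t2 b "x + 3 * T/4"] t2 gc x per T unfolding T_def b_def by simp
    have p3: "k\<^sup>2 * integral {0..t1} (\<lambda>t. (g t - c)\<^sup>2 / \<kappa> t) + k * tan (k * (0 - (x - T/4))) * (g 0 - c)\<^sup>2
       \<le> integral {0..t1} (\<lambda>t. \<kappa> t * (g' t)\<^sup>2)"
      using piece[of 0 t1 "x - T/4"] t1 gc x \<sigma>0 T by simp
    have eq: "T - (x + 3 * T/4) = 0 - (x - T/4)" by simp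
    have comb: "integral {0..b} h = integral {0..t1} h + integral {t1..t2} h + integral {t2..b} h"
      if "h integrable_on {0..b}" for h :: "real \<Rightarrow> real"
    proof -
      have "h integrable_on {0..t2}" using integrable_subinterval_real[OF that, of 0 t2] t2 by auto
      then show ?thesis
        using Henstock_Kurzweil_Integration.integral_combine[of 0 t2 b h] that t1 t2 t12 
          Henstock_Kurzweil_Integration.integral_combine[of 0 t1 t2 h] by auto
    qed
    show ?thesis unfolding comb[OF i1] comb[OF i2] distrib_left
      using p1 p2 p3 unfolding eq by linarith
  qed
  have "(2 * pi / T)\<^sup>2 * integral {0..b} (\<lambda>t. (g t - c)\<^sup>2 / \<kappa> t) \<le> integral {0..b} (\<lambda>t. \<kappa> t * (g' t)\<^sup>2)"
  proof (rule tendsto_upperbound)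
    show "((\<lambda>k. k\<^sup>2 * integral {0..b} (\<lambda>t. (g t - c)\<^sup>2 / \<kappa> t)) \<longlongrightarrow> (2 * pi / T)\<^sup>2 * integral {0..b} (\<lambda>t. (g t - c)\<^sup>2 / \<kappa> t)) (at_left (2 * pi / T))"
      by (intro tendsto_intros)
    have "0 < 2 * pi / T" using T by simp
    then show "\<forall>\<^sub>F k in at_left (2 * pi / T). k\<^sup>2 * integral {0..b} (\<lambda>t. (g t - c)\<^sup>2 / \<kappa> t) \<le> integral {0..b} (\<lambda>t. \<kappa> t * (g' t)\<^sup>2)"
      using main eventually_at_left_real[of 0 "2 * pi / T"] by (auto elim!: eventually_mono)
  qed auto
  then show ?thesis unfolding T_def b_def by blast
qed

text \<open>The gauge v = cis (- q \<sigma>) f is periodic. The energy of f is the energy of v plus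
  q^2 times the weighted norm of f plus a cross term. In the cross term v may be replaced by v - c,
  and the periodic inequality then bounds it by |\<phi>| / pi times the energy of v; this is where
  |\<phi>| \<le> pi enters.\<close>

lemma wirtinger_quasiperiodic:
  fixes f f' :: "real \<Rightarrow> complex" and \<kappa> :: "real \<Rightarrow> real"
  assumes N: "N > 0" and S: "finite S" and cf: "continuous_on {0..real N} f" and c\<sigma>: "continuous_on {0..real N} \<sigma>"
    and der: "\<And>t. t \<in> {0<..<real N} - S \<Longrightarrow> (f has_vector_derivative f' t) (at t)"
    and der\<sigma>: "\<And>t. t \<in> {0<..<real N} - S \<Longrightarrow> (\<sigma> has_real_derivative 1 / \<kappa> t) (at t)"
    and mono: "\<And>s t. 0 \<le> s \<Longrightarrow> s < t \<Longrightarrow> t \<le> real N \<Longrightarrow> \<sigma> s < \<sigma> t"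
    and pos: "\<And>t. \<kappa> t > 0"
    and pc: "piecewise_cont N \<kappa>" "piecewise_cont N (\<lambda>t. 1 / \<kappa> t)" "piecewise_cont N f'"
    and \<sigma>0: "\<sigma> 0 = 0" and per: "f (real N) = cis \<phi> * f 0" and \<phi>: "\<bar>\<phi>\<bar> \<le> pi"
  shows "(\<phi> / \<sigma> (real N))\<^sup>2 * integral {0..real N} (\<lambda>t. (norm (f t))\<^sup>2 / \<kappa> t) \<le>
     integral {0..real N} (\<lambda>t. \<kappa> t * (norm (f' t))\<^sup>2)"
proof -
  define T where "T = \<sigma> (real N)"
  have T: "0 < T" using mono[of 0 "real N"] N \<sigma>0 unfolding T_def by simp
  define q where "q = \<phi> / T"
  define v where "v t = cis (- q * \<sigma> t) * f t" for t
  define v' where "v' t = cis (- q * \<sigma> t) * (f' t - \<i> * of_real (q / \<kappa> t) * f t)" for t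
  have cv: "continuous_on {0..real N} v"
    unfolding v_def cis_conv_exp by (intro continuous_intros cf c\<sigma>)
  have derv: "(v has_vector_derivative v' t) (at t)" if "t \<in> {0<..<real N} - S" for t
  proof -
    have "((\<lambda>t. cis (- q * \<sigma> t)) has_vector_derivative (- q * (1 / \<kappa> t)) *\<^sub>R (\<i> * cis (- q * \<sigma> t))) (at t)"
      using vector_derivative_diff_chain_within[of "\<lambda>t. - q * \<sigma> t" "- q * (1 / \<kappa> t)" t UNIV cis "\<lambda>x. x *\<^sub>R (\<i> * cis (- q * \<sigma> t))"]
        has_derivative_cis[of "\<lambda>x. x" "\<lambda>x. x" "- q * \<sigma> t" UNIV]
        DERIV_cmult[OF der\<sigma>[OF that], of "-q"]
      by (auto simp: comp_def has_real_derivative_iff_has_vector_derivative intro: has_derivative_at_withinI)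
    then have "((\<lambda>t. cis (- q * \<sigma> t) * f t) has_vector_derivative
        cis (- q * \<sigma> t) * f' t + (- q * (1 / \<kappa> t)) *\<^sub>R (\<i> * cis (- q * \<sigma> t)) * f t) (at t)"
      by (rule has_vector_derivative_mult[OF _ der[OF that]])
    then show ?thesis unfolding v_def v'_def by (simp add: algebra_simps scaleR_conv_of_real)
  qed
  have pccis: "piecewise_cont N (\<lambda>t. cis (- q * \<sigma> t))"
    unfolding cis_conv_exp by (intro piecewise_cont_continuous continuous_intros c\<sigma>)
  have pcv': "piecewise_cont N v'"
  proof -
    have "piecewise_cont N (\<lambda>t. complex_of_real (1 / \<kappa> t))"
      by (rule piecewise_cont_un[OF pc(2)]) (intro continuous_intros)
    then have "piecewise_cont N (\<lambda>t. cis (- q * \<sigma> t) * (f' t + (- \<i> * of_real q * f t) * complex_of_real (1 / \<kappa> t)))"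
      by (intro piecewise_cont_mult pccis piecewise_cont_add pc piecewise_cont_continuous[OF cf] piecewise_cont_const)
    then show ?thesis unfolding v'_def by (simp add: algebra_simps)
  qed
  have v_per: "v (real N) = v 0"
    unfolding v_def using per T \<sigma>0 by (simp add: q_def T_def[symmetric] cis_mult mult.assoc[symmetric])
  have pcRe: "piecewise_cont N (\<lambda>t. Re (v' t))" "piecewise_cont N (\<lambda>t. Im (v' t))"
    by (rule piecewise_cont_un[OF pcv'], intro continuous_intros)+
  have derRe: "((\<lambda>t. Re (v t)) has_real_derivative Re (v' t)) (at t)"
    "((\<lambda>t. Im (v t)) has_real_derivative Im (v' t)) (at t)" if "t \<in> {0<..<real N} - S" for t
    using derv[OF that] unfolding has_real_derivative_iff_has_vector_derivative
    by (auto intro: bounded_linear.has_vector_derivative[OF bounded_linear_Re] bounded_linear.has_vector_derivative[OF bounded_linear_Im])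
  obtain c1 where c1: "(2 * pi / T)\<^sup>2 * integral {0..real N} (\<lambda>t. (Re (v t) - c1)\<^sup>2 / \<kappa> t) \<le>
     integral {0..real N} (\<lambda>t. \<kappa> t * (Re (v' t))\<^sup>2)"
    using wirtinger_real_periodic[OF N S _ c\<sigma> derRe(1) der\<sigma> mono pos pc(1,2) pcRe(1) \<sigma>0] cv v_per
    unfolding T_def by (auto intro: continuous_intros)
  obtain c2 where c2: "(2 * pi / T)\<^sup>2 * integral {0..real N} (\<lambda>t. (Im (v t) - c2)\<^sup>2 / \<kappa> t) \<le>
     integral {0..real N} (\<lambda>t. \<kappa> t * (Im (v' t))\<^sup>2)"
    using wirtinger_real_periodic[OF N S _ c\<sigma> derRe(2) der\<sigma> mono pos pc(1,2) pcRe(2) \<sigma>0] cv v_per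
    unfolding T_def by (auto intro: continuous_intros)
  define c where "c = Complex c1 c2"
  define k where "k = 2 * pi / T"
  have pcd: "piecewise_cont N (\<lambda>t. h t / \<kappa> t)" if "continuous_on {0..real N} h" for h
    using piecewise_cont_mult[OF piecewise_cont_continuous[OF that] pc(2)] by simp
  have iI: "(\<lambda>t. (norm (v t - c))\<^sup>2 / \<kappa> t) integrable_on {0..real N}"
    "(\<lambda>t. (Re (v t) - c1)\<^sup>2 / \<kappa> t) integrable_on {0..real N}"
    "(\<lambda>t. (Im (v t) - c2)\<^sup>2 / \<kappa> t) integrable_on {0..real N}"
    "(\<lambda>t. (norm (f t))\<^sup>2 / \<kappa> t) integrable_on {0..real N}"
    by (intro piecewise_cont_integrable pcd continuous_intros cv cf)+
  have iV: "(\<lambda>t. \<kappa> t * (norm (v' t))\<^sup>2) integrable_on {0..real N}"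
    "(\<lambda>t. \<kappa> t * (Re (v' t))\<^sup>2) integrable_on {0..real N}"
    "(\<lambda>t. \<kappa> t * (Im (v' t))\<^sup>2) integrable_on {0..real N}"
    "(\<lambda>t. \<kappa> t * (norm (f' t))\<^sup>2) integrable_on {0..real N}"
    subgoal by (intro piecewise_cont_integrable piecewise_cont_mult piecewise_cont_norm_sq pc pcv')
    subgoal unfolding power2_eq_square by (intro piecewise_cont_integrable piecewise_cont_mult pc pcRe)
    subgoal unfolding power2_eq_square by (intro piecewise_cont_integrable piecewise_cont_mult pc pcRe)
    subgoal by (intro piecewise_cont_integrable piecewise_cont_mult piecewise_cont_norm_sq pc)
    done
  have W: "k\<^sup>2 * integral {0..real N} (\<lambda>t. (norm (v t - c))\<^sup>2 / \<kappa> t) \<le> integral {0..real N} (\<lambda>t. \<kappa> t * (norm (v' t))\<^sup>2)"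
  proof -
    have "integral {0..real N} (\<lambda>t. (norm (v t - c))\<^sup>2 / \<kappa> t) =
       integral {0..real N} (\<lambda>t. (Re (v t) - c1)\<^sup>2 / \<kappa> t) + integral {0..real N} (\<lambda>t. (Im (v t) - c2)\<^sup>2 / \<kappa> t)"
      by (subst Henstock_Kurzweil_Integration.integral_add[OF iI(2,3), symmetric])
         (simp add: c_def cmod_power2 add_divide_distrib)
    moreover have "integral {0..real N} (\<lambda>t. \<kappa> t * (norm (v' t))\<^sup>2) =
       integral {0..real N} (\<lambda>t. \<kappa> t * (Re (v' t))\<^sup>2) + integral {0..real N} (\<lambda>t. \<kappa> t * (Im (v' t))\<^sup>2)"
      by (subst Henstock_Kurzweil_Integration.integral_add[OF iV(2,3), symmetric])
         (simp add: cmod_power2 distrib_left)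
    ultimately show ?thesis using c1 c2 unfolding k_def by (simp add: distrib_left)
  qed
  \<comment> \<open>The share of the constant c in the cross term: it integrates to zero because v
    is periodic.\<close>
  define X where "X t = Re (\<i> * c * cnj (v' t))" for t
  have X0: "(X has_integral 0) {0..real N}"
  proof -
    have "(v' has_integral (v (real N) - v 0)) {0..real N}"
      by (rule fundamental_theorem_of_calculus_interior_strong[OF S _ _ cv]) (use derv in auto)
    then have "(v' has_integral 0) {0..real N}" by (simp add: v_per)
    moreover have "bounded_linear (\<lambda>z. Re (\<i> * c * cnj z))"
      by (intro bounded_linear_intros bounded_linear_compose[OF bounded_linear_Re] bounded_linear_compose[OF bounded_linear_mult_right] bounded_linear_cnj)
    ultimately show ?thesis using has_integral_linear[of v' 0 "{0..real N}" "\<lambda>z. Re (\<i> * c * cnj z)"]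
      unfolding X_def comp_def by simp
  qed
  \<comment> \<open>With k = 2 pi / T this means \<open>\<bar>q\<bar> = r * k / 2\<close>. Young's
    inequality splits the cross term evenly between the energy of v and k^2 times the weighted norm
    of v - c, each with the factor r / 2.\<close>
  define r where "r = \<bar>\<phi>\<bar> / pi"
  have r: "0 \<le> r" "r \<le> 1" using \<phi> unfolding r_def by auto
  have qk: "\<bar>q\<bar> = r * k / 2" unfolding q_def r_def k_def using T by simp
  have pw: "q\<^sup>2 * ((norm (f t))\<^sup>2 / \<kappa> t) \<le> \<kappa> t * (norm (f' t))\<^sup>2 - (1 - r) * (\<kappa> t * (norm (v' t))\<^sup>2) - 2 * q * X t
      - r / 2 * (\<kappa> t * (norm (v' t))\<^sup>2) + r / 2 * (k\<^sup>2 * ((norm (v t - c))\<^sup>2 / \<kappa> t))" for t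
  proof -
    have K: "\<kappa> t > 0" by (rule pos)
    have nf: "norm (f t) = norm (v t)" unfolding v_def by (simp add: norm_mult)
    have "f' t = cis (q * \<sigma> t) * (v' t + \<i> * of_real (q / \<kappa> t) * v t)"
    proof -
      have cc: "cis (q * \<sigma> t) * cis (- q * \<sigma> t) = 1" by (simp add: cis_mult)
      have "cis (q * \<sigma> t) * (v' t + \<i> * of_real (q / \<kappa> t) * v t) = (cis (q * \<sigma> t) * cis (- q * \<sigma> t)) * f' t"
        unfolding v_def v'_def by (simp only: algebra_simps)
      then show ?thesis unfolding cc by simp
    qed
    then have nf': "norm (f' t) = norm (v' t + \<i> * of_real (q / \<kappa> t) * v t)" by (simp add: norm_mult)
    have e0: "(norm (v' t + \<i> * of_real (q / \<kappa> t) * v t))\<^sup>2 =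
       (norm (v' t))\<^sup>2 + (q / \<kappa> t)\<^sup>2 * (norm (v t))\<^sup>2 + 2 * (q / \<kappa> t) * Re (\<i> * v t * cnj (v' t))"
      unfolding cmod_power2 by (simp add: power2_eq_square algebra_simps)
    have e1: "\<kappa> t * (norm (f' t))\<^sup>2 = \<kappa> t * (norm (v' t))\<^sup>2 + q\<^sup>2 * ((norm (f t))\<^sup>2 / \<kappa> t) + 2 * q * Re (\<i> * v t * cnj (v' t))"
      unfolding nf' nf e0 using K by (simp add: field_simps power2_eq_square)
    have e2: "Re (\<i> * v t * cnj (v' t)) = Re (\<i> * (v t - c) * cnj (v' t)) + X t"
      unfolding X_def by (simp add: algebra_simps)
    have "\<bar>2 * q * Re (\<i> * (v t - c) * cnj (v' t))\<bar> \<le> 2 * \<bar>q\<bar> * (norm (v t - c) * norm (v' t))"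
    proof -
      have "\<bar>Re (\<i> * (v t - c) * cnj (v' t))\<bar> \<le> norm (v t - c) * norm (v' t)"
        using abs_Re_le_cmod[of "\<i> * (v t - c) * cnj (v' t)"] by (simp add: norm_mult)
      then show ?thesis by (simp add: abs_mult mult_left_mono)
    qed
    also have "\<dots> = r * (k * norm (v t - c) * norm (v' t))" unfolding qk by simp
    also have "\<dots> \<le> r * ((\<kappa> t * (norm (v' t))\<^sup>2 + k\<^sup>2 * ((norm (v t - c))\<^sup>2 / \<kappa> t)) / 2)"
    proof (rule mult_left_mono[OF _ r(1)])
      have "0 \<le> (\<kappa> t * norm (v' t) - k * norm (v t - c))\<^sup>2 / \<kappa> t" using K by simp
      also have "\<dots> = \<kappa> t * (norm (v' t))\<^sup>2 + k\<^sup>2 * ((norm (v t - c))\<^sup>2 / \<kappa> t) - 2 * (k * norm (v t - c) * norm (v' t))"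
        using K by (simp add: field_simps power2_eq_square)
      finally show "k * norm (v t - c) * norm (v' t) \<le> (\<kappa> t * (norm (v' t))\<^sup>2 + k\<^sup>2 * ((norm (v t - c))\<^sup>2 / \<kappa> t)) / 2" by simp
    qed
    finally have e3: "2 * q * Re (\<i> * (v t - c) * cnj (v' t)) \<ge> - (r * ((\<kappa> t * (norm (v' t))\<^sup>2 + k\<^sup>2 * ((norm (v t - c))\<^sup>2 / \<kappa> t)) / 2))"
      by linarith
    have "B \<le> F' - (1 - r) * A' - 2 * q * Z - r / 2 * A' + r / 2 * W"
      if "F' = A' + B + 2 * q * (Y + Z)" "2 * q * Y \<ge> - (r * ((A' + W) / 2))" for F' A' B Y Z W :: real
    proof -
      have "2 * q * (Y + Z) = 2 * q * Y + 2 * q * Z" "(1 - r) * A' = A' - r * A'" "r * ((A' + W) / 2) = r / 2 * A' + r / 2 * W" "r / 2 * A' = r * A' / 2"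
        by (simp_all add: algebra_simps add_divide_distrib)
      then show ?thesis using that by linarith
    qed
    then show ?thesis using e1[unfolded e2] e3 by blast
  qed
  let ?V = "integral {0..real N} (\<lambda>t. \<kappa> t * (norm (v' t))\<^sup>2)"
  let ?F = "integral {0..real N} (\<lambda>t. \<kappa> t * (norm (f' t))\<^sup>2)"
  let ?W = "integral {0..real N} (\<lambda>t. (norm (v t - c))\<^sup>2 / \<kappa> t)"
  have "q\<^sup>2 * integral {0..real N} (\<lambda>t. (norm (f t))\<^sup>2 / \<kappa> t) \<le>
     ?F - (1 - r) * ?V - 2 * q * 0 - r / 2 * ?V + r / 2 * (k\<^sup>2 * ?W)"
  proof (rule has_integral_le)
    show "((\<lambda>t. q\<^sup>2 * ((norm (f t))\<^sup>2 / \<kappa> t)) has_integral q\<^sup>2 * integral {0..real N} (\<lambda>t. (norm (f t))\<^sup>2 / \<kappa> t)) {0..real N}"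
      by (intro has_integral_mult_right integrable_integral iI)
    show "((\<lambda>t. \<kappa> t * (norm (f' t))\<^sup>2 - (1 - r) * (\<kappa> t * (norm (v' t))\<^sup>2) - 2 * q * X t
      - r / 2 * (\<kappa> t * (norm (v' t))\<^sup>2) + r / 2 * (k\<^sup>2 * ((norm (v t - c))\<^sup>2 / \<kappa> t))) has_integral
      ?F - (1 - r) * ?V - 2 * q * 0 - r / 2 * ?V + r / 2 * (k\<^sup>2 * ?W)) {0..real N}"
      by (intro has_integral_add has_integral_diff has_integral_mult_right integrable_integral iI iV X0)
  qed (rule pw)
  moreover have "r / 2 * (k\<^sup>2 * ?W) \<le> r / 2 * ?V" using W r by (intro mult_left_mono) auto
  moreover have "(1 - r) * ?V \<ge> 0"
    using r less_imp_le[OF pos] by (intro mult_nonneg_nonneg integral_nonneg iV) auto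
  ultimately have "q\<^sup>2 * integral {0..real N} (\<lambda>t. (norm (f t))\<^sup>2 / \<kappa> t) \<le> ?F" by linarith
  then show ?thesis unfolding q_def T_def .
qed

subsection \<open>Exact and locally exact one-forms\<close>

text \<open>Exactness is pointwise, so that derivatives of merely differentiable functions, such as
  the cut-off potentials below, count as exact forms.\<close>

definition exact_on :: "('a::euclidean_space \<Rightarrow> 'a \<Rightarrow> real) \<Rightarrow> 'a set \<Rightarrow> bool" where
  "exact_on \<omega> S \<longleftrightarrow> (\<exists>f. \<forall>x\<in>S. (f has_derivative \<omega> x) (at x))"

text \<open>Plays the role of closedness: closed forms of class C^1 have this property by the
  Poincare lemma, and it passes to pullbacks by the chain rule alone.\<close>

definition locally_exact_on :: "('a::euclidean_space \<Rightarrow> 'a \<Rightarrow> real) \<Rightarrow> 'a set \<Rightarrow> bool" where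
  "locally_exact_on \<omega> S \<longleftrightarrow> (\<forall>x\<in>S. \<exists>e>0. exact_on \<omega> (ball x e))"

lemma exact_on_subset: "exact_on \<omega> S \<Longrightarrow> T \<subseteq> S \<Longrightarrow> exact_on \<omega> T"
  unfolding exact_on_def by blast

lemma exact_on_cong: "exact_on \<omega> S \<Longrightarrow> (\<And>x. x \<in> S \<Longrightarrow> \<omega> x = \<eta> x) \<Longrightarrow> exact_on \<eta> S"
  unfolding exact_on_def by metis

lemma exact_on_add:
  assumes "exact_on \<omega> S" "exact_on \<eta> S"
  shows "exact_on (\<lambda>x v. \<omega> x v + \<eta> x v) S"
proof -
  obtain f g where "\<forall>x\<in>S. (f has_derivative \<omega> x) (at x)" "\<forall>x\<in>S. (g has_derivative \<eta> x) (at x)"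
    using assms unfolding exact_on_def by blast
  then have "\<forall>x\<in>S. ((\<lambda>x. f x + g x) has_derivative (\<lambda>v. \<omega> x v + \<eta> x v)) (at x)"
    by (auto intro: has_derivative_add)
  then show ?thesis unfolding exact_on_def by blast
qed

lemma exact_on_cmult:
  assumes "exact_on \<omega> S"
  shows "exact_on (\<lambda>x v. c * \<omega> x v) S"
proof -
  obtain f where "\<forall>x\<in>S. (f has_derivative \<omega> x) (at x)"
    using assms unfolding exact_on_def by blast
  then have "\<forall>x\<in>S. ((\<lambda>x. c * f x) has_derivative (\<lambda>v. c * \<omega> x v)) (at x)"
    by (auto intro: has_derivative_mult_right)
  then show ?thesis unfolding exact_on_def by blast
qed

lemma exact_on_diff:
  assumes "exact_on \<omega> S" "exact_on \<eta> S"
  shows "exact_on (\<lambda>x v. \<omega> x v - \<eta> x v) S"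
  using exact_on_add[OF assms(1) exact_on_cmult[OF assms(2), of "-1"]] by simp

lemma exact_on_zero: "exact_on (\<lambda>x v. 0) S"
  unfolding exact_on_def by (intro exI[of _ "\<lambda>x. 0"]) simp

lemma exact_on_sum:
  assumes "finite K" "\<And>k. k \<in> K \<Longrightarrow> exact_on (\<omega> k) S"
  shows "exact_on (\<lambda>x v. \<Sum>k\<in>K. \<omega> k x v) S"
  using assms by (induction K rule: finite_induct) (auto intro: exact_on_add exact_on_zero)

text \<open>On the convex intersection the two potentials have the same derivative, hence differ by
  a constant, and shifting one of them makes them match.\<close>

lemma exact_on_Un:
  assumes "exact_on \<omega> U" "exact_on \<omega> V" and op: "open U" "open V" and cv: "convex U" "convex V"
  shows "exact_on \<omega> (U \<union> V)"
proof -
  obtain f g where f: "\<forall>x\<in>U. (f has_derivative \<omega> x) (at x)" and g: "\<forall>x\<in>V. (g has_derivative \<omega> x) (at x)"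
    using assms unfolding exact_on_def by blast
  have "((\<lambda>x. f x - g x) has_derivative (\<lambda>v. 0)) (at x within U \<inter> V)" if "x \<in> U \<inter> V" for x
    using has_derivative_diff[of f "\<omega> x" "at x" g "\<omega> x"] f g that by (auto intro: has_derivative_at_withinI)
  then obtain c where c: "\<forall>x\<in>U \<inter> V. f x - g x = c"
    using has_derivative_zero_constant[OF convex_Int[OF cv]] by blast
  define h where "h x = (if x \<in> U then f x else g x + c)" for x
  have "(h has_derivative \<omega> x) (at x)" if "x \<in> U \<union> V" for x
  proof (cases "x \<in> U")
    case True
    show ?thesis
      by (rule has_derivative_transform_within_open[of f _ _ UNIV U]) (use True op f in \<open>auto simp: h_def\<close>)
  next
    case False
    then have x: "x \<in> V" using that by auto
    show ?thesis
    proof (rule has_derivative_transform_within_open[of "\<lambda>x. g x + c" _ _ UNIV V])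
      show "((\<lambda>x. g x + c) has_derivative \<omega> x) (at x)"
        using has_derivative_add[of g "\<omega> x" "at x" "\<lambda>x. c" "\<lambda>x. 0"] g x by simp
      fix y assume "y \<in> V"
      then show "g y + c = h y" using c[rule_format, of y] by (auto simp: h_def)
    qed (use x op in auto)
  qed
  then show ?thesis unfolding exact_on_def by blast
qed

text \<open>The candidate potential is the integral along radii. Near a given x it is compared with
  a potential P on a tube around the segment from p to x, glued from local potentials over a chain
  of short convex tubes. The gauge integral integrates every derivative, and being one is all that
  is known of \<omega>.\<close>

lemma locally_exact_imp_exact_on_starlike:
  assumes le: "locally_exact_on \<omega> S" and p: "p \<in> S" and star: "\<And>x. x \<in> S \<Longrightarrow> closed_segment p x \<subseteq> S"
  shows "exact_on \<omega> S"
proof -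
  define f where "f y = integral {0..1} (\<lambda>t. \<omega> (p + t *\<^sub>R (y - p)) (y - p))" for y
  have "(f has_derivative \<omega> x) (at x)" if x: "x \<in> S" for x
  proof -
    define q where "q t = p + t *\<^sub>R (x - p)" for t
    have qseg: "q t \<in> closed_segment p x" if "0 \<le> t" "t \<le> 1" for t
      unfolding closed_segment_def q_def using that by (auto simp: algebra_simps intro!: exI[of _ t])
    have cov: "closed_segment p x \<subseteq> \<Union>{B. open B \<and> exact_on \<omega> B}"
    proof
      fix y assume "y \<in> closed_segment p x"
      then have "y \<in> S" using star[OF x] by blast
      then obtain e where "e > 0" "exact_on \<omega> (ball y e)" using le unfolding locally_exact_on_def by blast
      then show "y \<in> \<Union>{B. open B \<and> exact_on \<omega> B}" by (intro UnionI[of "ball y e"]) auto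
    qed
    \<comment> \<open>A Lebesgue number: every \<delta>-ball centred on the segment lies in a set
      with a potential.\<close>
    obtain \<delta> where \<delta>: "\<delta> > 0" "\<And>y. y \<in> closed_segment p x \<Longrightarrow> \<exists>G\<in>{B. open B \<and> exact_on \<omega> B}. ball y \<delta> \<subseteq> G"
      using Heine_Borel_lemma[OF compact_segment cov] by auto
    have exb: "exact_on \<omega> (ball (q t) \<delta>)" if "0 \<le> t" "t \<le> 1" for t
      using \<delta>(2)[OF qseg[OF that]] exact_on_subset by blast
    define \<rho> where "\<rho> = \<delta> / 2"
    have \<rho>: "\<rho> > 0" using \<delta>(1) unfolding \<rho>_def by simp
    define tube where "tube a b = (\<Union>t\<in>{a..b}. ball (q t) \<rho>)" for a b
    have tube_open: "open (tube a b)" for a b unfolding tube_def by auto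
    have tube_convex: "convex (tube a b)" for a b
    proof (rule convexI)
      fix y z u v :: real and y' z' assume y: "y' \<in> tube a b" "z' \<in> tube a b" and uv: "0 \<le> u" "0 \<le> v" "u + v = 1"
      obtain s t where st: "s \<in> {a..b}" "t \<in> {a..b}" "dist (q s) y' < \<rho>" "dist (q t) z' < \<rho>"
        using y unfolding tube_def by auto
      have mem: "u * s + v * t \<in> {a..b}" using st uv convexD[of "{a..b}" s t u v] by auto
      have "q (u * s + v * t) - (u *\<^sub>R y' + v *\<^sub>R z') = u *\<^sub>R (q s - y') + v *\<^sub>R (q t - z')"
      proof -
        have "p = (u + v) *\<^sub>R p" using uv by simp
        then have "p = u *\<^sub>R p + v *\<^sub>R p" by (simp add: scaleR_add_left)
        then show ?thesis unfolding q_def by (simp add: algebra_simps)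
      qed
      moreover have "norm (u *\<^sub>R (q s - y') + v *\<^sub>R (q t - z')) < \<rho>"
      proof -
        have "q s - y' \<in> ball 0 \<rho>" "q t - z' \<in> ball 0 \<rho>" using st unfolding mem_ball_0 dist_norm by auto
        from convexD[OF convex_ball this uv] show ?thesis unfolding mem_ball_0 .
      qed
      ultimately have "u *\<^sub>R y' + v *\<^sub>R z' \<in> ball (q (u * s + v * t)) \<rho>" by (simp add: dist_norm)
      with mem show "u *\<^sub>R y' + v *\<^sub>R z' \<in> tube a b" unfolding tube_def by (rule UN_I)
    qed
    \<comment> \<open>M pieces of length less than \<rho> = \<delta> / 2 each, so that every piece
      of the tube, which has radius \<rho>, stays within one \<delta>-ball.\<close>
    obtain M :: nat where M: "norm (x - p) / \<rho> < real M" using reals_Archimedean2 by blast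
    then have M0: "M > 0" using \<rho> by (cases "M = 0") (simp_all add: divide_less_0_iff not_less)
    have step: "norm (x - p) / real M < \<rho>" using M M0 \<rho> by (simp add: field_simps)
    have "exact_on \<omega> (tube 0 (real k / real M))" if "k \<le> M" for k
      using that
    proof (induction k)
      case 0
      have "tube 0 (real 0 / real M) \<subseteq> ball (q 0) \<delta>" unfolding tube_def \<rho>_def using \<delta>(1) by auto
      then show ?case using exb[of 0] exact_on_subset by auto
    next
      case (Suc k)
      define a where "a = real k / real M"
      define b where "b = real (Suc k) / real M"
      have ab: "0 \<le> a" "a \<le> b" "a \<le> 1" "b - a = 1 / real M" using Suc.prems M0 unfolding a_def b_def by (auto simp: field_simps)
      have sub: "tube a b \<subseteq> ball (q a) \<delta>"
      proof
        fix y assume "y \<in> tube a b"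
        then obtain t where t: "t \<in> {a..b}" "dist (q t) y < \<rho>" unfolding tube_def by auto
        have "dist (q a) (q t) = \<bar>t - a\<bar> * norm (x - p)"
        proof -
          have "q a - q t = (a - t) *\<^sub>R (x - p)" unfolding q_def by (simp add: algebra_simps)
          then show ?thesis unfolding dist_norm by (simp add: abs_minus_commute)
        qed
        also have "\<dots> \<le> 1 / real M * norm (x - p)" using t ab by (intro mult_right_mono) auto
        also have "\<dots> < \<rho>" using step by simp
        finally have "dist (q a) y < \<rho> + \<rho>" using t dist_triangle[of "q a" y "q t"] by linarith
        then show "y \<in> ball (q a) \<delta>" unfolding \<rho>_def by simp
      qed
      have "exact_on \<omega> (tube 0 a \<union> tube a b)"
      proof (rule exact_on_Un)
        show "exact_on \<omega> (tube 0 a)" using Suc unfolding a_def by simp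
        show "exact_on \<omega> (tube a b)" using exact_on_subset[OF exb[OF ab(1,3)] sub] .
      qed (auto simp: tube_open tube_convex)
      moreover have "tube 0 a \<union> tube a b = tube 0 b"
      proof -
        have "{0..a} \<union> {a..b} = {0..b}" using ab by auto
        then show ?thesis unfolding tube_def UN_Un[symmetric] by (simp only:)
      qed
      ultimately show ?case unfolding b_def by simp
    qed
    from this[of M] have "exact_on \<omega> (tube 0 1)" using M0 by simp
    then obtain P where P: "\<And>y. y \<in> tube 0 1 \<Longrightarrow> (P has_derivative \<omega> y) (at y)" unfolding exact_on_def by blast
    have fP: "f y = P y - P p" if y: "y \<in> ball x \<rho>" for y
    proof -
      have "((\<lambda>t. \<omega> (p + t *\<^sub>R (y - p)) (y - p)) has_integral (P (p + 1 *\<^sub>R (y - p)) - P (p + 0 *\<^sub>R (y - p)))) {0..1}"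
      proof (rule fundamental_theorem_of_calculus)
        fix t :: real assume t: "t \<in> {0..1}"
        have "dist (q t) (p + t *\<^sub>R (y - p)) = t * dist x y"
        proof -
          have "q t - (p + t *\<^sub>R (y - p)) = t *\<^sub>R (x - y)" unfolding q_def by (simp add: algebra_simps)
          then show ?thesis using t by (simp add: dist_norm)
        qed
        also have "\<dots> \<le> 1 * dist x y" using t by (intro mult_right_mono) auto
        also have "\<dots> < \<rho>" using y by simp
        finally have "p + t *\<^sub>R (y - p) \<in> tube 0 1" unfolding tube_def using t by auto
        from P[OF this] have "(P has_derivative \<omega> (p + t *\<^sub>R (y - p))) (at (p + t *\<^sub>R (y - p)))" .
        moreover have "((\<lambda>t. p + t *\<^sub>R (y - p)) has_vector_derivative (y - p)) (at t within {0..1})"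
          by (auto intro!: derivative_eq_intros simp: has_vector_derivative_def)
        ultimately show "((\<lambda>t. P (p + t *\<^sub>R (y - p))) has_vector_derivative \<omega> (p + t *\<^sub>R (y - p)) (y - p)) (at t within {0..1})"
          using vector_derivative_diff_chain_within[of "\<lambda>t. p + t *\<^sub>R (y - p)" "y - p" t "{0..1}" P "\<omega> (p + t *\<^sub>R (y - p))"]
          by (auto simp: comp_def intro: has_derivative_at_withinI)
      qed simp
      then show ?thesis unfolding f_def by (simp add: integral_unique)
    qed
    have "x \<in> tube 0 1" unfolding tube_def q_def using \<rho> by (auto intro!: bexI[of _ 1])
    from has_derivative_diff[OF P[OF this] has_derivative_const[of "P p"]]
    have "((\<lambda>y. P y - P p) has_derivative \<omega> x) (at x)" by simp
    then show ?thesis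
      by (rule has_derivative_transform_within_open[of _ _ _ UNIV "ball x \<rho>"]) (use fP \<rho> in auto)
  qed
  then show ?thesis unfolding exact_on_def by blast
qed

lemma locally_exact_imp_exact_on_convex:
  assumes "locally_exact_on \<omega> S" "convex S"
  shows "exact_on \<omega> S"
proof (cases "S = {}")
  case False
  then obtain p where "p \<in> S" by blast
  then show ?thesis using locally_exact_imp_exact_on_starlike[OF assms(1)] closed_segment_subset[OF _ _ assms(2)] by blast
qed (simp add: exact_on_def)

text \<open>The radial homotopy formula. Differentiate the integral of A (p + t (x - p)) \<bullet>
  (x - p) under the integral sign; the symmetry of D turns the result into the t-derivative of t
  times A (p + t (x - p)) \<bullet> v.\<close>

lemma poincare_C1:
  fixes A :: "'a::euclidean_space \<Rightarrow> 'a"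
  assumes U: "convex U" "open U" and D: "\<And>x. x \<in> U \<Longrightarrow> (A has_derivative D x) (at x)"
    and cD: "\<And>v. continuous_on U (\<lambda>x. D x v)" and sym: "\<And>x v w. x \<in> U \<Longrightarrow> D x v \<bullet> w = D x w \<bullet> v"
  shows "exact_on (\<lambda>x v. A x \<bullet> v) U"
proof (cases "U = {}")
  case False
  then obtain p where p: "p \<in> U" by blast
  define q where "q x t = p + t *\<^sub>R (x - p)" for x and t :: real
  have qU: "q x t \<in> U" if "x \<in> U" "t \<in> {0..1}" for x t
  proof -
    have "q x t = (1 - t) *\<^sub>R p + t *\<^sub>R x" unfolding q_def by (simp add: algebra_simps)
    then show ?thesis using convexD[OF U(1) p that(1), of "1 - t" t] that by simp
  qed
  have lin: "bounded_linear (D x)" if "x \<in> U" for x using D[OF that] has_derivative_bounded_linear by blast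
  have cA: "continuous_on U A"
    using D by (meson continuous_at_imp_continuous_on has_derivative_continuous)
  \<comment> \<open>The Leibniz rule takes the x-derivative of the integrand as a bounded linear
    map.\<close>
  define fx where "fx x t = Blinfun (\<lambda>h. D (q x t) (t *\<^sub>R h) \<bullet> (x - p) + A (q x t) \<bullet> h)" for x t
  have bl: "blinfun_apply (fx x t) = (\<lambda>h. D (q x t) (t *\<^sub>R h) \<bullet> (x - p) + A (q x t) \<bullet> h)" if "x \<in> U" "t \<in> {0..1}" for x t
    unfolding fx_def
    by (rule bounded_linear_Blinfun_apply)
       (intro bounded_linear_intros bounded_linear_compose[OF lin[OF qU[OF that]]] bounded_linear_inner_left_comp bounded_linear_inner_right)
  have qcont: "continuous_on (U \<times> {0..1}) (\<lambda>z. q (fst z) (snd z))" unfolding q_def by (intro continuous_intros)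
  have qim: "(\<lambda>z. q (fst z) (snd z)) ` (U \<times> {0..1}) \<subseteq> U" using qU by auto
  have main: "((\<lambda>x. integral (cbox 0 1) (\<lambda>t. A (q x t) \<bullet> (x - p))) has_derivative integral (cbox 0 1) (fx x0)) (at x0 within U)"
    if x0: "x0 \<in> U" for x0
  proof (rule leibniz_rule[OF _ _ _ x0 U(1)])
    fix x t assume x: "x \<in> U" and t: "t \<in> cbox 0 (1::real)"
    then have t': "t \<in> {0..1}" by simp
    have dq: "((\<lambda>x. q x t) has_derivative (\<lambda>h. t *\<^sub>R h)) (at x within U)"
      unfolding q_def by (auto intro!: derivative_eq_intros)
    have "((\<lambda>x. A (q x t)) has_derivative (\<lambda>h. D (q x t) (t *\<^sub>R h))) (at x within U)"
      using has_derivative_compose[OF dq D[OF qU[OF x t']]] .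
    then show "((\<lambda>x. A (q x t) \<bullet> (x - p)) has_derivative blinfun_apply (fx x t)) (at x within U)"
      unfolding bl[OF x t'] by (auto intro!: derivative_eq_intros)
  next
    fix x assume x: "x \<in> U"
    have "continuous_on {0..1} (\<lambda>t. A (q x t))"
      by (rule continuous_on_compose2[OF cA]) (use qU[OF x] in \<open>auto simp: q_def intro!: continuous_intros\<close>)
    then show "(\<lambda>t. A (q x t) \<bullet> (x - p)) integrable_on cbox 0 1"
      by (intro integrable_continuous) (auto intro!: continuous_intros)
  next
    show "continuous_on (U \<times> cbox 0 1) (\<lambda>(x, t). fx x t)"
    proof (rule continuous_on_blinfun_componentwise)
      fix i :: 'a assume "i \<in> Basis"
      have c1: "continuous_on (U \<times> {0..1}) (\<lambda>z. D (q (fst z) (snd z)) i)"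
        by (rule continuous_on_compose2[OF cD qcont qim])
      have c2: "continuous_on (U \<times> {0..1}) (\<lambda>z. A (q (fst z) (snd z)))"
        by (rule continuous_on_compose2[OF cA qcont qim])
      have "continuous_on (U \<times> {0..1}) (\<lambda>z. (snd z *\<^sub>R D (q (fst z) (snd z)) i) \<bullet> (fst z - p) + A (q (fst z) (snd z)) \<bullet> i)"
        by (intro continuous_intros c1 c2)
      moreover have "blinfun_apply (case z of (x, t) \<Rightarrow> fx x t) i = (snd z *\<^sub>R D (q (fst z) (snd z)) i) \<bullet> (fst z - p) + A (q (fst z) (snd z)) \<bullet> i"
        if "z \<in> U \<times> {0..1}" for z
        using that bl[of "fst z" "snd z"] lin[OF qU[of "fst z" "snd z"]] 
        by (auto simp: case_prod_unfold linear_cmul[OF bounded_linear.linear])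
      ultimately show "continuous_on (U \<times> cbox 0 1) (\<lambda>z. blinfun_apply (case z of (x, t) \<Rightarrow> fx x t) i)"
        by (simp cong: continuous_on_cong)
    qed
  qed
  have "((\<lambda>x. integral (cbox 0 1) (\<lambda>t. A (q x t) \<bullet> (x - p))) has_derivative (\<lambda>v. A x0 \<bullet> v)) (at x0)" if x0: "x0 \<in> U" for x0
  proof -
    have fxint: "fx x0 integrable_on cbox 0 1"
    proof (rule integrable_continuous, rule continuous_on_blinfun_componentwise)
      fix i :: 'a assume "i \<in> Basis"
      have qc: "continuous_on {0..1} (q x0)" unfolding q_def by (intro continuous_intros)
      have qi: "q x0 ` {0..1} \<subseteq> U" using qU[OF x0] by auto
      have "continuous_on {0..1} (\<lambda>t. (t *\<^sub>R D (q x0 t) i) \<bullet> (x0 - p) + A (q x0 t) \<bullet> i)"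
        by (intro continuous_intros continuous_on_compose2[OF cD qc qi] continuous_on_compose2[OF cA qc qi])
      moreover have "blinfun_apply (fx x0 t) i = (t *\<^sub>R D (q x0 t) i) \<bullet> (x0 - p) + A (q x0 t) \<bullet> i" if "t \<in> {0..1}" for t
        using bl[OF x0 that] lin[OF qU[OF x0 that]] by (simp add: linear_cmul[OF bounded_linear.linear])
      ultimately show "continuous_on (cbox 0 1) (\<lambda>t. blinfun_apply (fx x0 t) i)"
        unfolding cbox_interval using continuous_on_eq by (metis (no_types, lifting))
    qed
    have "blinfun_apply (integral (cbox 0 1) (fx x0)) v = A x0 \<bullet> v" for v
    proof -
      have "((\<lambda>t. blinfun_apply (fx x0 t) v) has_integral (1 * (A (q x0 1) \<bullet> v) - 0 * (A (q x0 0) \<bullet> v))) {0..1}"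
      proof (rule fundamental_theorem_of_calculus)
        fix t :: real assume t: "t \<in> {0..1}"
        have dq: "((\<lambda>t. q x0 t) has_vector_derivative (x0 - p)) (at t within {0..1})"
          unfolding q_def by (auto intro!: derivative_eq_intros simp: has_vector_derivative_def)
        have "((\<lambda>t. A (q x0 t)) has_vector_derivative D (q x0 t) (x0 - p)) (at t within {0..1})"
          using vector_derivative_diff_chain_within[OF dq has_derivative_at_withinI[OF D[OF qU[OF x0 t]]]] by (simp add: comp_def)
        then have "((\<lambda>t. A (q x0 t) \<bullet> v) has_real_derivative D (q x0 t) (x0 - p) \<bullet> v) (at t within {0..1})"
          using bounded_linear.has_vector_derivative[OF bounded_linear_inner_left] by (simp add: has_real_derivative_iff_has_vector_derivative)
        then have "((\<lambda>t. t * (A (q x0 t) \<bullet> v)) has_real_derivative 1 * (A (q x0 t) \<bullet> v) + D (q x0 t) (x0 - p) \<bullet> v * t) (at t within {0..1})"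
          by (intro DERIV_mult DERIV_ident)
        moreover have "1 * (A (q x0 t) \<bullet> v) + D (q x0 t) (x0 - p) \<bullet> v * t = blinfun_apply (fx x0 t) v"
          using bl[OF x0 t] lin[OF qU[OF x0 t]] sym[OF qU[OF x0 t], of "x0 - p" v] by (simp add: linear_cmul[OF bounded_linear.linear])
        ultimately show "((\<lambda>t. t * (A (q x0 t) \<bullet> v)) has_vector_derivative blinfun_apply (fx x0 t) v) (at t within {0..1})"
          by (simp add: has_real_derivative_iff_has_vector_derivative)
      qed simp
      then have "integral (cbox 0 1) (\<lambda>t. blinfun_apply (fx x0 t) v) = A x0 \<bullet> v" by (simp add: integral_unique q_def)
      then show ?thesis by (simp only: blinfun_apply_integral[OF fxint])
    qed
    then have "blinfun_apply (integral (cbox 0 1) (fx x0)) = (\<lambda>v. A x0 \<bullet> v)" by auto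
    then show ?thesis using main[OF x0] at_within_open[OF x0 U(2)] by simp
  qed
  then show ?thesis unfolding exact_on_def by blast
qed (simp add: exact_on_def)

subsection \<open>Angle forms and fluxes\<close>

lemma to_complex_sel [simp]: "Re (to_complex x) = x $ 1" "Im (to_complex x) = x $ 2"
  by (simp_all add: to_complex_def)

definition of_complex :: "complex \<Rightarrow> real^2" where
  "of_complex z = (\<chi> i. if i = 1 then Re z else Im z)"

lemma of_complex_nth [simp]: "of_complex z $ 1 = Re z" "of_complex z $ 2 = Im z"
  by (simp_all add: of_complex_def)

lemma of_complex_to_complex [simp]: "of_complex (to_complex x) = x"
  by (simp add: vec_eq_iff forall_2)

lemma to_complex_of_complex [simp]: "to_complex (of_complex x) = x"
  by (simp add: complex_eq_iff)

lemma bounded_linear_to_complex: "bounded_linear to_complex"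
  by (rule linear_conv_bounded_linear[THEN iffD1], rule linearI) (simp_all add: complex_eq_iff)

lemma bounded_linear_of_complex: "bounded_linear of_complex"
  by (rule linear_conv_bounded_linear[THEN iffD1], rule linearI) (simp_all add: vec_eq_iff forall_2)

lemma norm_to_complex [simp]: "norm (to_complex x) = norm x"
  by (simp add: norm_vec_def L2_set_def sum_2 cmod_def)

lemma norm_of_complex [simp]: "norm (of_complex x) = norm x"
  by (metis norm_to_complex to_complex_of_complex)

lemma to_complex_eq_0 [simp]: "to_complex x = 0 \<longleftrightarrow> x = 0"
  by (simp add: complex_eq_iff vec_eq_iff forall_2)

lemma to_complex_diff: "to_complex (x - y) = to_complex x - to_complex y"
  by (simp add: complex_eq_iff)

text \<open>The differential of the polar angle around p, written as the imaginary part of dz / (z -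
  p); its local potentials are imaginary parts of logarithms.\<close>

definition angle_form :: "real^2 \<Rightarrow> real^2 \<Rightarrow> real^2 \<Rightarrow> real" where
  "angle_form p x v = Im (to_complex v / to_complex (x - p))"

lemma has_derivative_to_complex_quotient:
  "((\<lambda>x. to_complex (x - p) / c) has_derivative (\<lambda>v. to_complex v / c)) F"
proof -
  have "((\<lambda>x. to_complex (x - p)) has_derivative to_complex) F"
    using bounded_linear.has_derivative[OF bounded_linear_to_complex has_derivative_diff[OF has_derivative_ident has_derivative_const]] by simp
  then have "((\<lambda>x. to_complex (x - p) * inverse c) has_derivative (\<lambda>v. to_complex v * inverse c)) F"
    by (rule has_derivative_mult_left)
  then show ?thesis by (simp add: divide_inverse)
qed

text \<open>Dividing by c rotates the half-plane around the direction of c into the right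
  half-plane, away from the branch cut; a constant factor does not change the logarithmic
  derivative.\<close>

lemma has_derivative_Im_Ln:
  assumes re: "0 < Re (to_complex (x - p) / c)"
  shows "((\<lambda>x. Im (Ln (to_complex (x - p) / c))) has_derivative angle_form p x) (at x)"
proof -
  have c: "c \<noteq> 0" using re by auto
  have nr: "to_complex (x - p) / c \<notin> \<real>\<^sub>\<le>\<^sub>0" using re complex_nonpos_Reals_iff by force
  have xp: "to_complex (x - p) \<noteq> 0" using nr by (cases "x = p") (auto simp: to_complex_def)
  have d1: "((\<lambda>x. to_complex (x - p) / c) has_derivative (\<lambda>v. to_complex v / c)) (at x)"
    by (rule has_derivative_to_complex_quotient)
  have "((\<lambda>x. Ln (to_complex (x - p) / c)) has_derivative (\<lambda>v. inverse (to_complex (x - p) / c) * (to_complex v / c))) (at x)"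
    using has_derivative_compose[OF d1 has_field_derivative_Ln[OF nr, unfolded has_field_derivative_def]] .
  then have "((\<lambda>x. Im (Ln (to_complex (x - p) / c))) has_derivative (\<lambda>v. Im (inverse (to_complex (x - p) / c) * (to_complex v / c)))) (at x)"
    by (rule bounded_linear.has_derivative[OF bounded_linear_Im])
  moreover have "(\<lambda>v. Im (inverse (to_complex (x - p) / c) * (to_complex v / c))) = angle_form p x"
    using c xp unfolding angle_form_def by (simp add: field_simps)
  ultimately show ?thesis by simp
qed

lemma locally_exact_angle_form:
  assumes "p \<notin> S"
  shows "locally_exact_on (angle_form p) S"
  unfolding locally_exact_on_def exact_on_def
proof
  fix x0 assume "x0 \<in> S"
  then have x0: "x0 \<noteq> p" using assms by auto
  define c where "c = to_complex (x0 - p)"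
  have c: "c \<noteq> 0" using x0 unfolding c_def by simp
  have "((\<lambda>x. Im (Ln (to_complex (x - p) / c))) has_derivative angle_form p x) (at x)" if x: "x \<in> ball x0 (dist x0 p)" for x
  proof (rule has_derivative_Im_Ln)
    have "to_complex (x - p) / c - 1 = to_complex (x - x0) / c"
      using c unfolding c_def by (simp add: field_simps to_complex_diff)
    then have "norm (to_complex (x - p) / c - 1) < 1"
      using x c x0 by (simp add: norm_divide c_def dist_norm norm_minus_commute)
    then show "0 < Re (to_complex (x - p) / c)"
      using abs_Re_le_cmod[of "to_complex (x - p) / c - 1"] by simp
  qed
  then have "\<exists>f. \<forall>x\<in>ball x0 (dist x0 p). (f has_derivative angle_form p x) (at x)" by blast
  then show "\<exists>e>0. \<exists>f. \<forall>x\<in>ball x0 e. (f has_derivative angle_form p x) (at x)"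
    using x0 by (intro exI[of _ "dist x0 p"]) simp
qed

lemma exact_on_angle_form: "p \<notin> S \<Longrightarrow> convex S \<Longrightarrow> exact_on (angle_form p) S"
  by (intro locally_exact_imp_exact_on_convex locally_exact_angle_form)

text \<open>The exponential map covers the ring by a vertical strip, which is convex, so the
  pulled-back form has a potential h there. Its increment P over one turn 2 pi \<i> is constant;
  subtracting the multiple of Im with the same increment leaves a periodic function, which descends
  to the ring.\<close>

lemma ring_potential:
  assumes le: "locally_exact_on \<omega> {x. r < dist p x \<and> dist p x < r'}" and r: "0 < r" and rr': "r < r'"
  shows "\<exists>a. exact_on (\<lambda>x v. \<omega> x v - a * angle_form p x v) {x. r < dist p x \<and> dist p x < r'}"
proof -
  define R where "R = {x. r < dist p x \<and> dist p x < r'}"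
  define E where "E z = p + of_complex (exp z)" for z
  define St where "St = {z. ln r < Re z \<and> Re z < ln r'}"
  define \<omega>' where "\<omega>' z w = \<omega> (E z) (of_complex (exp z * w))" for z w
  have dE: "(E has_derivative (\<lambda>w. of_complex (exp z * w))) (at z)" for z
  proof -
    have "(exp has_derivative (\<lambda>w. exp z * w)) (at z)" using DERIV_exp[of z] unfolding has_field_derivative_def .
    from has_derivative_add[OF has_derivative_const[of p] bounded_linear.has_derivative[OF bounded_linear_of_complex this]]
    show ?thesis unfolding E_def by simp
  qed
  have ER: "E z \<in> R" if "z \<in> St" for z
  proof -
    have "exp (ln r) < exp (Re z)" "exp (Re z) < exp (ln r')" using that unfolding St_def by auto
    then have "r < exp (Re z)" "exp (Re z) < r'" using r rr' by auto
    then show ?thesis unfolding R_def E_def by (simp add: dist_norm)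
  qed
  have "locally_exact_on \<omega>' St"
    unfolding locally_exact_on_def
  proof
    fix z assume z: "z \<in> St"
    obtain e F where e: "e > 0" and F: "\<And>x. x \<in> ball (E z) e \<Longrightarrow> (F has_derivative \<omega> x) (at x)"
      using le ER[OF z] unfolding locally_exact_on_def exact_on_def R_def by blast
    have "continuous (at z) E" using dE has_derivative_continuous by blast
    then obtain d where d: "d > 0" "\<And>y. dist y z < d \<Longrightarrow> dist (E y) (E z) < e"
      using e unfolding continuous_at_eps_delta by blast
    have "((\<lambda>y. F (E y)) has_derivative \<omega>' y) (at y)" if "y \<in> ball z d" for y
    proof -
      have "E y \<in> ball (E z) e" using d(2)[of y] that by (simp add: dist_commute)
      from has_derivative_compose[OF dE F[OF this]] show ?thesis unfolding \<omega>'_def .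
    qed
    then show "\<exists>e>0. exact_on \<omega>' (ball z e)" using d(1) unfolding exact_on_def by blast
  qed
  moreover have St: "convex St" 
  proof -
    have "St = {z. Re z > ln r} \<inter> {z. Re z < ln r'}" unfolding St_def by auto
    then show ?thesis by (simp add: convex_Int convex_halfspace_Re_gt convex_halfspace_Re_lt)
  qed
  ultimately obtain h where h: "\<And>z. z \<in> St \<Longrightarrow> (h has_derivative \<omega>' z) (at z)"
    using locally_exact_imp_exact_on_convex unfolding exact_on_def by blast
  define \<tau> where "\<tau> = 2 * of_real pi * \<i>"
  have exp\<tau>: "exp (z + \<tau>) = exp z" for z unfolding \<tau>_def by (simp add: exp_add)
  have St\<tau>: "z + \<tau> \<in> St \<longleftrightarrow> z \<in> St" for z unfolding St_def \<tau>_def by simp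
  have "((\<lambda>z. h (z + \<tau>) - h z) has_derivative (\<lambda>w. 0)) (at z within St)" if z: "z \<in> St" for z
  proof -
    have "((\<lambda>z. z + \<tau>) has_derivative (\<lambda>w. w)) (at z)"
      using has_derivative_add[OF has_derivative_ident has_derivative_const[of \<tau>]] by simp
    from has_derivative_compose[OF this h] have "((\<lambda>z. h (z + \<tau>)) has_derivative \<omega>' (z + \<tau>)) (at z)"
      using St\<tau> z by simp
    from has_derivative_diff[OF this h[OF z]] 
    have "((\<lambda>z. h (z + \<tau>) - h z) has_derivative (\<lambda>w. 0)) (at z)"
      unfolding \<omega>'_def E_def exp\<tau> by simp
    then show ?thesis by (rule has_derivative_at_withinI)
  qed
  from has_derivative_zero_constant[OF St this]
  obtain P where P: "\<And>z. z \<in> St \<Longrightarrow> h (z + \<tau>) - h z = P" by blast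
  define a where "a = P / (2 * pi)"
  define k where "k z = h z - a * Im z" for z
  have k1: "k (z + \<tau>) = k z" if "z \<in> St" for z
  proof -
    have "Im (z + \<tau>) = Im z + 2 * pi" "a * (2 * pi) = P" unfolding \<tau>_def a_def by auto
    then have "a * Im (z + \<tau>) = a * Im z + P" by (simp add: distrib_left)
    then show ?thesis using P[OF that] unfolding k_def by linarith
  qed
  have kn: "k (z + of_nat n * \<tau>) = k z \<and> z + of_nat n * \<tau> \<in> St" if "z \<in> St" for z n
  proof (induction n)
    case (Suc n)
    have eq: "z + of_nat (Suc n) * \<tau> = (z + of_nat n * \<tau>) + \<tau>" by (simp add: distrib_right)
    show ?case unfolding eq St\<tau> using Suc k1 by metis
  qed (use that in simp)
  have km: "k (z + of_int m * \<tau>) = k z" if z: "z \<in> St" for z m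
  proof (cases "m \<ge> 0")
    case True
    then show ?thesis using kn[OF z, of "nat m"] by (simp add: of_nat_nat)
  next
    case False
    have mem: "z + of_int m * \<tau> \<in> St" using z unfolding St_def \<tau>_def by simp
    have "z + of_int m * \<tau> + of_nat (nat (- m)) * \<tau> = z" using False by (simp add: of_nat_nat)
    then show ?thesis using kn[OF mem, of "nat (- m)"] by (simp only:)
  qed
  define f where "f x = k (Ln (to_complex (x - p)))" for x
  have "(f has_derivative (\<lambda>v. \<omega> x0 v - a * angle_form p x0 v)) (at x0)" if x0: "x0 \<in> R" for x0
  proof -
    have np: "x0 \<noteq> p" using x0 r unfolding R_def by auto
    define B where "B = ball x0 (dist x0 p) \<inter> R"
    have oR: "open R" unfolding R_def
      by (intro open_Collect_conj open_Collect_less continuous_intros)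
    define c where "c = to_complex (x0 - p)"
    have c: "c \<noteq> 0" using np unfolding c_def by simp
    \<comment> \<open>A branch of the logarithm that is differentiable at x0 even if x0 lies on the
      cut of \<open>Ln\<close>. It differs from \<open>Ln\<close> by multiples of 2 pi \<i>, under
      which k is invariant.\<close>
    define l where "l x = Ln (to_complex (x - p) / c) + Ln c" for x
    have lnR: "Ln (to_complex (x - p)) \<in> St" if "x \<in> R" for x
    proof -
      have "x \<noteq> p" using that r unfolding R_def by auto
      then have "Re (Ln (to_complex (x - p))) = ln (dist p x)" by (simp add: dist_norm norm_minus_commute)
      moreover have "ln r < ln (dist p x)" "ln (dist p x) < ln r'" 
        using that r \<open>x \<noteq> p\<close> unfolding R_def by auto
      ultimately show ?thesis unfolding St_def by simp
    qed
    have fl: "k (l x) = f x" if x: "x \<in> B" for x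
    proof -
      have xR: "x \<in> R" using x unfolding B_def by simp
      have xp: "to_complex (x - p) \<noteq> 0" using xR r unfolding R_def by auto
      have "exp (l x) = exp (Ln (to_complex (x - p)))"
        unfolding l_def using c xp by (simp add: exp_add)
      then obtain m :: int where "l x = Ln (to_complex (x - p)) + (of_int (2 * m) * pi) * \<i>"
        unfolding exp_eq by blast
      then have "l x = Ln (to_complex (x - p)) + of_int m * \<tau>" unfolding \<tau>_def by simp
      then show ?thesis using km[OF lnR[OF xR]] unfolding f_def by simp
    qed
    have l0: "l x0 = Ln c" unfolding l_def using c by (simp add: c_def)
    have d1: "((\<lambda>x. to_complex (x - p) / c) has_derivative (\<lambda>v. to_complex v / c)) (at x0)"
      by (rule has_derivative_to_complex_quotient)
    have one: "to_complex (x0 - p) / c = 1" using c unfolding c_def by simp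
    have "(Ln has_derivative (\<lambda>w. inverse 1 * w)) (at (to_complex (x0 - p) / c))"
      unfolding one using has_field_derivative_Ln[of 1, unfolded has_field_derivative_def] by (simp add: lambda_one)
    from has_derivative_compose[OF d1 this]
    have "((\<lambda>x. Ln (to_complex (x - p) / c)) has_derivative (\<lambda>v. to_complex v / c)) (at x0)" by simp
    then have dl: "(l has_derivative (\<lambda>v. to_complex v / c)) (at x0)"
      unfolding l_def using has_derivative_add[OF _ has_derivative_const[of "Ln c"], of _ "\<lambda>v. to_complex v / c" "at x0"] by simp
    have St0: "Ln c \<in> St" using lnR[OF x0] unfolding c_def .
    have dk: "(k has_derivative (\<lambda>w. \<omega>' (Ln c) w - a * Im w)) (at (l x0))"
      unfolding k_def l0
      using has_derivative_diff[OF h[OF St0] has_derivative_mult_right[OF bounded_linear.has_derivative[OF bounded_linear_Im has_derivative_ident], of a]] .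
    have "((\<lambda>x. k (l x)) has_derivative (\<lambda>v. \<omega>' (Ln c) (to_complex v / c) - a * Im (to_complex v / c))) (at x0)"
      using has_derivative_compose[OF dl dk] .
    moreover have "\<omega>' (Ln c) (to_complex v / c) - a * Im (to_complex v / c) = \<omega> x0 v - a * angle_form p x0 v" for v
    proof -
      have "exp (Ln c) = c" "c * (to_complex v / c) = to_complex v" "of_complex c = x0 - p"
        using c by (simp_all add: c_def)
      then show ?thesis unfolding \<omega>'_def angle_form_def E_def by (simp only: of_complex_to_complex) (simp add: c_def)
    qed
    ultimately have "((\<lambda>x. k (l x)) has_derivative (\<lambda>v. \<omega> x0 v - a * angle_form p x0 v)) (at x0)" by simp
    then show ?thesis
      by (rule has_derivative_transform_within_open[of _ _ _ UNIV B])
         (use fl oR x0 np in \<open>auto simp: B_def\<close>)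
  qed
  then show ?thesis unfolding exact_on_def R_def by blast
qed

text \<open>The square of \<open>max 0 x\<close> is already differentiable, which is the regularity
  used in gluing potentials. The cutoff is a quotient of two such functions of the squared
  distance.\<close>

lemma cutoff_exists:
  fixes p :: "'a::euclidean_space"
  assumes ab: "0 \<le> a" "a < b"
  shows "\<exists>\<psi> :: 'a \<Rightarrow> real. (\<forall>x. \<psi> differentiable (at x)) \<and> (\<forall>x. dist p x \<le> a \<longrightarrow> \<psi> x = 1) \<and> (\<forall>x. b \<le> dist p x \<longrightarrow> \<psi> x = 0)"
proof -
  define s where "s x = (max 0 x)\<^sup>2" for x :: real
  have s': "(s has_real_derivative 2 * max 0 x) (at x)" for x
  proof (cases x "0::real" rule: linorder_cases)
    case less
    have "((\<lambda>x. 0) has_real_derivative 0) (at x)" by simp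
    then show ?thesis
      using has_field_derivative_transform_within_open[of "\<lambda>x. 0" 0 x "{..<0}" s] less by (auto simp: s_def)
  next
    case greater
    have "((\<lambda>x. x\<^sup>2) has_real_derivative 2 * x) (at x)" by (auto intro!: derivative_eq_intros)
    then show ?thesis
      using has_field_derivative_transform_within_open[of "\<lambda>x. x\<^sup>2" "2 * x" x "{0<..}" s] greater by (auto simp: s_def)
  next
    case equal
    have "((\<lambda>y. (s y - s 0) / (y - 0)) \<longlongrightarrow> 0) (at 0)"
    proof (rule Lim_null_comparison)
      show "\<forall>\<^sub>F y in at 0. norm ((s y - s 0) / (y - 0)) \<le> \<bar>y\<bar>"
        by (rule always_eventually) (auto simp: s_def max_def power2_eq_square)
      show "((\<lambda>y. \<bar>y\<bar>) \<longlongrightarrow> 0) (at (0::real))" by (rule tendsto_eq_intros | simp)+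
    qed
    then show ?thesis unfolding equal by (simp add: has_field_derivative_iff)
  qed
  have sd: "s differentiable (at x)" for x using s'[of x] real_differentiable_def by blast
  have s0: "s x \<ge> 0" "s x = 0 \<longleftrightarrow> x \<le> 0" for x unfolding s_def by (auto simp: max_def)
  define d where "d x = (x - p) \<bullet> (x - p)" for x
  have dd: "d differentiable (at x)" for x 
    unfolding d_def using has_derivative_inner[OF has_derivative_diff[OF has_derivative_ident has_derivative_const[of p]] has_derivative_diff[OF has_derivative_ident has_derivative_const[of p]]]
    by (auto simp: differentiable_def)
  have d: "d x = (dist p x)\<^sup>2" for x unfolding d_def by (simp add: dist_norm norm_minus_commute[of p] power2_norm_eq_inner)
  define \<psi> where "\<psi> x = s (b\<^sup>2 - d x) / (s (b\<^sup>2 - d x) + s (d x - a\<^sup>2))" for x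
  have ab2: "a\<^sup>2 < b\<^sup>2" using ab by (simp add: power_strict_mono)
  have nz: "s (b\<^sup>2 - d x) + s (d x - a\<^sup>2) \<noteq> 0" for x
    using s0[of "b\<^sup>2 - d x"] s0[of "d x - a\<^sup>2"] ab2 by (auto simp: add_nonneg_eq_0_iff)
  have c1: "(\<lambda>x. s (b\<^sup>2 - d x)) differentiable (at x)" "(\<lambda>x. s (d x - a\<^sup>2)) differentiable (at x)" for x
    using differentiable_chain_at[of "\<lambda>x. b\<^sup>2 - d x" x s] differentiable_chain_at[of "\<lambda>x. d x - a\<^sup>2" x s] sd dd
    by (auto simp: comp_def intro: derivative_intros)
  have "\<psi> differentiable (at x)" for x
    unfolding \<psi>_def by (intro differentiable_divide differentiable_add c1 nz)
  moreover have "\<psi> x = 1" if "dist p x \<le> a" for x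
  proof -
    have "d x \<le> a\<^sup>2" unfolding d using that by (simp add: power_mono)
    then have "s (d x - a\<^sup>2) = 0" using s0 by simp
    then show ?thesis using nz[of x] unfolding \<psi>_def by simp
  qed
  moreover have "\<psi> x = 0" if "b \<le> dist p x" for x
  proof -
    have "b\<^sup>2 \<le> d x" unfolding d using that ab by (intro power_mono) auto
    then show ?thesis using s0 unfolding \<psi>_def by simp
  qed
  ultimately show ?thesis by blast
qed

text \<open>Cut off the potential known near each hole and subtract the derivatives of the resulting
  functions \<open>P k\<close>. The remaining form vanishes near the holes, extends by zero to the
  convex set F and is exact there. Disjointness of the enlarged balls ensures that only one cut-off
  potential is active near a given hole.\<close>

lemma exact_on_punctured_convex:
  fixes p :: "nat \<Rightarrow> 'a::euclidean_space"
  assumes F: "convex F" "open F" and K: "finite K" and r: "0 < r" and \<delta>: "0 < \<delta>"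
    and disj: "\<And>j k. j \<in> K \<Longrightarrow> k \<in> K \<Longrightarrow> j \<noteq> k \<Longrightarrow> ball (p j) (r + \<delta>) \<inter> ball (p k) (r + \<delta>) = {}"
    and S: "S = F - (\<Union>k\<in>K. cball (p k) r)"
    and le: "locally_exact_on \<eta> S"
    and ring: "\<And>k. k \<in> K \<Longrightarrow> exact_on \<eta> {x. r < dist (p k) x \<and> dist (p k) x < r + \<delta>}"
  shows "exact_on \<eta> S"
proof -
  define R where "R k = {x. r < dist (p k) x \<and> dist (p k) x < r + \<delta>}" for k
  have Ro: "open (R k)" for k unfolding R_def
    by (intro open_Collect_conj open_Collect_less continuous_intros)
  have So: "open S" unfolding S using F(2) K by (intro open_Diff closed_UN) auto
  have "\<forall>k\<in>K. \<exists>f. \<forall>x\<in>R k. (f has_derivative \<eta> x) (at x)" using ring unfolding exact_on_def R_def by blast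
  then obtain f where f: "\<And>k x. k \<in> K \<Longrightarrow> x \<in> R k \<Longrightarrow> (f k has_derivative \<eta> x) (at x)" by metis
  have "\<forall>k. \<exists>\<psi> :: 'a \<Rightarrow> real. (\<forall>x. \<psi> differentiable (at x)) \<and> (\<forall>x. dist (p k) x \<le> r + \<delta>/4 \<longrightarrow> \<psi> x = 1) \<and> (\<forall>x. r + \<delta>/2 \<le> dist (p k) x \<longrightarrow> \<psi> x = 0)"
    using r \<delta> by (intro allI cutoff_exists) auto
  then obtain \<psi> :: "nat \<Rightarrow> 'a \<Rightarrow> real" where \<psi>: "\<And>k x. \<psi> k differentiable (at x)" 
     "\<And>k x. dist (p k) x \<le> r + \<delta>/4 \<Longrightarrow> \<psi> k x = 1" "\<And>k x. r + \<delta>/2 \<le> dist (p k) x \<Longrightarrow> \<psi> k x = 0" by metis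
  define P where "P k x = (if x \<in> R k then \<psi> k x * f k x else 0)" for k x
  have P0: "(P k has_derivative (\<lambda>v. 0)) (at x)" if "r + \<delta>/2 < dist (p k) x" for k x
  proof (rule has_derivative_transform_within_open[of "\<lambda>x. 0" _ _ UNIV "- cball (p k) (r + \<delta>/2)"])
    fix y assume "y \<in> - cball (p k) (r + \<delta>/2)"
    then show "0 = P k y" using \<psi>(3)[of k y] unfolding P_def by auto
  qed (use that in auto)
  have Pd: "P k differentiable (at x)" if k: "k \<in> K" and x: "x \<in> S" for k x
  proof (cases "x \<in> R k")
    case True
    have "(\<lambda>x. \<psi> k x * f k x) differentiable (at x)"
      using \<psi>(1) f[OF k True] by (intro differentiable_mult) (auto simp: differentiable_def)
    then obtain D where "((\<lambda>x. \<psi> k x * f k x) has_derivative D) (at x)" unfolding differentiable_def by blast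
    then have "(P k has_derivative D) (at x)"
      by (rule has_derivative_transform_within_open[of _ _ _ UNIV "R k"]) (use Ro True in \<open>auto simp: P_def\<close>)
    then show ?thesis unfolding differentiable_def by blast
  next
    case False
    then have "r + \<delta> \<le> dist (p k) x" using x k unfolding R_def S by force
    then have "(P k has_derivative (\<lambda>v. 0)) (at x)" using \<delta> by (intro P0) auto
    then show ?thesis unfolding differentiable_def by blast
  qed
  define \<mu> where "\<mu> k x = frechet_derivative (P k) (at x)" for k x
  have \<mu>: "(P k has_derivative \<mu> k x) (at x)" if "k \<in> K" "x \<in> S" for k x
    using Pd[OF that] unfolding \<mu>_def frechet_derivative_works .
  have \<mu>ex: "exact_on (\<mu> k) S" if "k \<in> K" for k using \<mu>[OF that] unfolding exact_on_def by blast
  define \<zeta> where "\<zeta> x v = (if x \<in> S then \<eta> x v - (\<Sum>k\<in>K. \<mu> k x v) else 0)" for x v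
  have "locally_exact_on \<zeta> F" unfolding locally_exact_on_def
  proof
    fix x assume xF: "x \<in> F"
    show "\<exists>e>0. exact_on \<zeta> (ball x e)"
    proof (cases "x \<in> S")
      case True
      then obtain e1 where e1: "e1 > 0" "exact_on \<eta> (ball x e1)" using le unfolding locally_exact_on_def by blast
      obtain e2 where e2: "e2 > 0" "ball x e2 \<subseteq> S" using So True open_contains_ball by blast
      define e where "e = min e1 e2"
      have eS: "ball x e \<subseteq> S" using e2 unfolding e_def by auto
      have "exact_on \<eta> (ball x e)" by (rule exact_on_subset[OF e1(2)]) (auto simp: e_def)
      then have "exact_on (\<lambda>x v. \<eta> x v - (\<Sum>k\<in>K. \<mu> k x v)) (ball x e)"
        by (intro exact_on_diff exact_on_sum K exact_on_subset[OF \<mu>ex eS])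
      then have "exact_on \<zeta> (ball x e)"
        by (rule exact_on_cong) (use eS in \<open>auto simp: \<zeta>_def fun_eq_iff\<close>)
      then show ?thesis using e1(1) e2(1) unfolding e_def by (intro exI[of _ "min e1 e2"]) auto
    next
      case False
      then obtain j where j: "j \<in> K" "dist (p j) x \<le> r" using xF unfolding S by auto
      have "\<zeta> y = (\<lambda>v. 0)" if y: "y \<in> ball x (\<delta>/4)" for y
      proof (cases "y \<in> S")
        case True
        have yj: "dist (p j) y < r + \<delta>/4" using y j(2) dist_triangle[of "p j" y x] by simp
        then have yR: "y \<in> R j" using True j \<delta> unfolding R_def S by auto
        have "(P j has_derivative \<eta> y) (at y)"
        proof (rule has_derivative_transform_within_open[OF f[OF j(1) yR], of "R j \<inter> ball (p j) (r + \<delta>/4)"])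
          fix z assume "z \<in> R j \<inter> ball (p j) (r + \<delta>/4)"
          then show "f j z = P j z" using \<psi>(2)[of j z] unfolding P_def by simp
        qed (use Ro yR yj in auto)
        then have "\<mu> j y = \<eta> y" using \<mu>[OF j(1) True] has_derivative_unique by blast
        moreover have "\<mu> k y = (\<lambda>v. 0)" if k: "k \<in> K - {j}" for k
        proof -
          have "y \<in> ball (p j) (r + \<delta>)" using yj \<delta> by auto
          then have "y \<notin> ball (p k) (r + \<delta>)" using disj[of j k] j k by blast
          then have "(P k has_derivative (\<lambda>v. 0)) (at y)" using \<delta> by (intro P0) auto
          then show ?thesis using \<mu>[of k y] k True has_derivative_unique by blast
        qed
        ultimately have "(\<Sum>k\<in>K. \<mu> k y v) = \<eta> y v" for v
          using sum.remove[OF K j(1), of "\<lambda>k. \<mu> k y v"] by simp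
        then show ?thesis unfolding \<zeta>_def by (simp add: fun_eq_iff)
      qed (simp add: \<zeta>_def fun_eq_iff)
      then have "exact_on \<zeta> (ball x (\<delta>/4))" using exact_on_cong[OF exact_on_zero] by metis
      then show ?thesis using \<delta> by (intro exI[of _ "\<delta>/4"]) auto
    qed
  qed
  then have "exact_on \<zeta> F" using F(1) by (rule locally_exact_imp_exact_on_convex)
  then have "exact_on \<zeta> S" by (rule exact_on_subset) (auto simp: S)
  then have "exact_on (\<lambda>x v. \<zeta> x v + (\<Sum>k\<in>K. \<mu> k x v)) S" by (intro exact_on_add exact_on_sum K \<mu>ex)
  then show ?thesis by (rule exact_on_cong) (auto simp: \<zeta>_def fun_eq_iff)
qed

text \<open>Modulo exact forms, the angle forms of the centres span the closed forms on F minus the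
  disks. The coefficients come from thin rings around the disks: on the ring of one disk the other
  angle forms are exact, since the ring lies in a ball that misses the other centres.\<close>

lemma exact_on_minus_angle_forms:
  fixes p :: "nat \<Rightarrow> real^2"
  assumes F: "convex F" "open F" and K: "finite K" and r: "0 < r"
    and sub: "\<And>k. k \<in> K \<Longrightarrow> cball (p k) r \<subseteq> F"
    and disj: "\<And>j k. j \<in> K \<Longrightarrow> k \<in> K \<Longrightarrow> j \<noteq> k \<Longrightarrow> cball (p j) r \<inter> cball (p k) r = {}"
    and S: "S = F - (\<Union>k\<in>K. cball (p k) r)"
    and le: "locally_exact_on \<omega> S"
  shows "\<exists>a. exact_on (\<lambda>x v. \<omega> x v - (\<Sum>k\<in>K. a k * angle_form (p k) x v)) S"
proof -
  have So: "open S" unfolding S using F(2) K by (intro open_Diff closed_UN) auto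
  have ev1: "\<forall>\<^sub>F \<delta> in at_right 0. ball (p k) (r + \<delta>) \<subseteq> F" if k: "k \<in> K" for k
  proof -
    obtain e where e: "e > 0" "(\<Union>x\<in>cball (p k) r. ball x e) \<subseteq> F"
      using compact_subset_open_imp_ball_epsilon_subset[OF compact_cball F(2) sub[OF k]] by blast
    have "ball (p k) (r + \<delta>) \<subseteq> F" if "0 < \<delta>" "\<delta> < e" for \<delta>
    proof
      fix y assume y: "y \<in> ball (p k) (r + \<delta>)"
      show "y \<in> F"
      proof (cases "dist (p k) y \<le> r")
        case True
        then show ?thesis using e by (force intro!: UN_I[of y])
      next
        case False
        define d where "d = dist (p k) y"
        have d: "d > r" using False unfolding d_def by simp
        \<comment> \<open>Radial projection to the boundary circle of the disk; it moves y by d - r,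
          which is less than \<delta>.\<close>
        define x where "x = p k + (r / d) *\<^sub>R (y - p k)"
        have "dist (p k) x = r" 
        proof -
          have "dist (p k) x = \<bar>r / d\<bar> * d" unfolding x_def d_def by (simp add: dist_norm norm_minus_commute)
          then show ?thesis using d r by simp
        qed
        moreover have "dist x y < e"
        proof -
          have "y - x = (1 - r / d) *\<^sub>R (y - p k)" unfolding x_def by (simp add: algebra_simps)
          then have "dist x y = \<bar>1 - r / d\<bar> * d" unfolding dist_norm d_def by (metis norm_minus_commute norm_scaleR)
          also have "\<dots> = d - r" using d r by (simp add: field_simps)
          finally show ?thesis using y that unfolding d_def by simp
        qed
        ultimately show ?thesis using e by (force intro!: UN_I[of x])
      qed
    qed
    then show ?thesis using eventually_at_right[of 0 1] e(1) by (auto simp: eventually_at_right_field)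
  qed
  have ev2: "\<forall>\<^sub>F \<delta> in at_right 0. ball (p j) (r + \<delta>) \<inter> ball (p k) (r + \<delta>) = {}" if "j \<in> K" "k \<in> K" "j \<noteq> k" for j k
  proof -
    have "2 * r < dist (p j) (p k)"
    proof (rule ccontr)
      assume "\<not> ?thesis"
      then have "midpoint (p j) (p k) \<in> cball (p j) r \<inter> cball (p k) r" by (simp add: dist_midpoint)
      then show False using disj[OF that] by blast
    qed
    moreover have "ball (p j) (r + \<delta>) \<inter> ball (p k) (r + \<delta>) = {}" if "\<delta> < (dist (p j) (p k) - 2 * r) / 2" for \<delta>
    proof -
      have "\<not> (dist (p j) y < r + \<delta> \<and> dist (p k) y < r + \<delta>)" for y
        using dist_triangle2[of "p j" "p k" y] that by (auto simp: field_simps dist_commute)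
      then show ?thesis by auto
    qed
    ultimately show ?thesis unfolding eventually_at_right_field
      by (intro exI[of _ "(dist (p j) (p k) - 2 * r) / 2"]) auto
  qed
  have "\<forall>\<^sub>F \<delta> in at_right 0. (\<forall>k\<in>K. ball (p k) (r + \<delta>) \<subseteq> F) \<and>
      (\<forall>j\<in>K. \<forall>k\<in>K. j \<noteq> k \<longrightarrow> ball (p j) (r + \<delta>) \<inter> ball (p k) (r + \<delta>) = {}) \<and> \<delta> > 0"
    by (intro eventually_conj eventually_ball_finite K ballI ev1 eventually_at_right_less)
       (use ev2 in \<open>auto intro: eventually_mono\<close>)
  then obtain \<delta> :: real where d1: "\<And>k. k \<in> K \<Longrightarrow> ball (p k) (r + \<delta>) \<subseteq> F" 
     and d2: "\<And>j k. j \<in> K \<Longrightarrow> k \<in> K \<Longrightarrow> j \<noteq> k \<Longrightarrow> ball (p j) (r + \<delta>) \<inter> ball (p k) (r + \<delta>) = {}" and \<delta>: "\<delta> > 0"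
    using eventually_happens'[OF trivial_limit_at_right_real] by blast
  define R where "R k = {x. r < dist (p k) x \<and> dist (p k) x < r + \<delta>}" for k
  have RS: "R k \<subseteq> S" if k: "k \<in> K" for k
  proof
    fix x assume x: "x \<in> R k"
    then have xb: "x \<in> ball (p k) (r + \<delta>)" unfolding R_def by simp
    have "x \<notin> cball (p j) r" if j: "j \<in> K" for j
    proof (cases "j = k")
      case False
      then have "x \<notin> ball (p j) (r + \<delta>)" using d2[OF k j] xb by blast
      then show ?thesis using \<delta> by auto
    qed (use x in \<open>simp add: R_def\<close>)
    then show "x \<in> S" using xb d1[OF k] unfolding S by blast
  qed
  have "\<forall>k\<in>K. \<exists>a. exact_on (\<lambda>x v. \<omega> x v - a * angle_form (p k) x v) (R k)"
  proof
    fix k assume k: "k \<in> K"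
    have "locally_exact_on \<omega> (R k)" using le RS[OF k] unfolding locally_exact_on_def by blast
    then show "\<exists>a. exact_on (\<lambda>x v. \<omega> x v - a * angle_form (p k) x v) (R k)"
      unfolding R_def by (rule ring_potential) (use r \<delta> in auto)
  qed
  from bchoice[OF this]
  obtain a where a: "\<And>k. k \<in> K \<Longrightarrow> exact_on (\<lambda>x v. \<omega> x v - a k * angle_form (p k) x v) (R k)" by blast
  define \<eta> where "\<eta> x v = \<omega> x v - (\<Sum>k\<in>K. a k * angle_form (p k) x v)" for x v
  have "exact_on \<eta> S"
  proof (rule exact_on_punctured_convex[OF F K r \<delta> d2 S])
    fix k assume k: "k \<in> K"
    have "p j \<notin> ball (p k) (r + \<delta>)" if "j \<in> K - {k}" for j
      using d2[OF k, of j] that \<delta> r centre_in_ball[of "p j" "r + \<delta>"] by auto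
    then have "exact_on (\<lambda>x v. (\<omega> x v - a k * angle_form (p k) x v) - (\<Sum>j\<in>K - {k}. a j * angle_form (p j) x v)) (R k)"
      using K by (intro exact_on_diff a[OF k] exact_on_sum exact_on_cmult exact_on_subset[OF exact_on_angle_form[OF _ convex_ball[of "p k" "r + \<delta>"]]])
        (auto simp: R_def)
    then show "exact_on \<eta> {x. r < dist (p k) x \<and> dist (p k) x < r + \<delta>}"
      unfolding R_def[symmetric]
      by (rule exact_on_cong) (auto simp: \<eta>_def fun_eq_iff sum.remove[OF K k])
  next
    show "locally_exact_on \<eta> S" unfolding locally_exact_on_def
    proof
      fix x assume x: "x \<in> S"
      obtain e1 where e1: "e1 > 0" "exact_on \<omega> (ball x e1)" using le x unfolding locally_exact_on_def by blast
      obtain e2 where e2: "e2 > 0" "ball x e2 \<subseteq> S" using So x open_contains_ball by blast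
      define e where "e = min e1 e2"
      have pS: "p k \<notin> S" if "k \<in> K" for k using that r centre_in_cball[of "p k" r] unfolding S by force
      have "exact_on \<omega> (ball x e)" by (rule exact_on_subset[OF e1(2)]) (auto simp: e_def)
      moreover have "p k \<notin> ball x e" if "k \<in> K" for k using pS[OF that] e2(2) unfolding e_def by auto
      ultimately have "exact_on \<eta> (ball x e)"
        unfolding \<eta>_def by (intro exact_on_diff exact_on_sum K exact_on_cmult exact_on_angle_form convex_ball)
      then show "\<exists>e>0. exact_on \<eta> (ball x e)" using e1(1) e2(1) unfolding e_def by (intro exI[of _ "min e1 e2"]) auto
    qed
  qed
  then show ?thesis unfolding \<eta>_def by blast
qed

section \<open>Smooth closed forms and the coefficients of their angle forms\<close>

lemma smooth_on_derivative:
  assumes "smooth_on A S" "x \<in> S"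
  shows "(A has_derivative frechet_derivative A (at x)) (at x)"
proof -
  have "Ck_on (Suc 0) A S" using assms(1) unfolding smooth_on_def by blast
  then show ?thesis using assms(2) by (simp add: frechet_derivative_works)
qed

lemma smooth_on_continuous_derivative:
  assumes "smooth_on A S"
  shows "continuous_on S (\<lambda>x. frechet_derivative A (at x) v)"
proof -
  have "Ck_on (Suc 0) A S" using assms(1) unfolding smooth_on_def by blast
  then show ?thesis by simp
qed

lemma closed_form_on_symmetric:
  assumes "closed_form_on A S" "x \<in> S" "linear (frechet_derivative A (at x))"
  shows "frechet_derivative A (at x) v \<bullet> w = frechet_derivative A (at x) w \<bullet> v"
proof -
  define D where "D = frechet_derivative A (at x)"
  have D: "D u $ i = u $ 1 * D (axis 1 1) $ i + u $ 2 * D (axis 2 1) $ i" for u i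
  proof -
    have "u = u $ 1 *\<^sub>R axis 1 1 + u $ 2 *\<^sub>R axis 2 1" by (simp add: vec_eq_iff forall_2 axis_def)
    then have "D u = D (u $ 1 *\<^sub>R axis 1 1 + u $ 2 *\<^sub>R axis 2 1)" by simp
    also have "\<dots> = u $ 1 *\<^sub>R D (axis 1 1) + u $ 2 *\<^sub>R D (axis 2 1)"
      using assms(3) unfolding D_def by (simp add: linear_add linear_cmul)
    finally show ?thesis by simp
  qed
  have "D (axis 1 1) $ 2 = D (axis 2 1) $ 1" using assms(1,2) unfolding closed_form_on_def D_def by blast
  then show ?thesis unfolding D_def[symmetric] inner_vec_def sum_2 D[of v] D[of w] by (simp add: algebra_simps)
qed

lemma locally_exact_closed_form:
  assumes "open S" "smooth_on A S" "closed_form_on A S"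
  shows "locally_exact_on (\<lambda>x v. A x \<bullet> v) S"
  unfolding locally_exact_on_def
proof
  fix x assume "x \<in> S"
  then obtain e where e: "e > 0" "ball x e \<subseteq> S" using assms(1) open_contains_ball by blast
  have "exact_on (\<lambda>x v. A x \<bullet> v) (ball x e)"
  proof (rule poincare_C1)
    show "(A has_derivative frechet_derivative A (at y)) (at y)" if "y \<in> ball x e" for y
      using smooth_on_derivative[OF assms(2)] that e(2) by blast
    then show "frechet_derivative A (at y) v \<bullet> w = frechet_derivative A (at y) w \<bullet> v" if "y \<in> ball x e" for y v w
      using closed_form_on_symmetric[OF assms(3)] that e(2) has_derivative_linear by blast
    show "continuous_on (ball x e) (\<lambda>y. frechet_derivative A (at y) v)" for v
      using continuous_on_subset[OF smooth_on_continuous_derivative[OF assms(2)] e(2)] .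
  qed auto
  then show "\<exists>e>0. exact_on (\<lambda>x v. A x \<bullet> v) (ball x e)" using e(1) by blast
qed

text \<open>Along a closed curve the exact part integrates to zero, and the angle form of
  \<open>p k\<close> to 2 pi times the real part of the winding number.\<close>

lemma line_integral_of_angle_forms:
  fixes p :: "nat \<Rightarrow> real^2"
  assumes K: "finite K" and ex: "exact_on (\<lambda>x v. A x \<bullet> v - (\<Sum>k\<in>K. a k * angle_form (p k) x v)) S"
    and c: "valid_path c" "pathfinish c = pathstart c" "path_image c \<subseteq> S"
    and p: "\<And>k. k \<in> K \<Longrightarrow> p k \<notin> S"
  shows "line_integral A c = (\<Sum>k\<in>K. a k * (2 * pi * Re (plane_winding_number c (p k))))"
proof -
  obtain P where P: "\<And>x. x \<in> S \<Longrightarrow> (P has_derivative (\<lambda>v. A x \<bullet> v - (\<Sum>k\<in>K. a k * angle_form (p k) x v))) (at x)"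
    using ex unfolding exact_on_def by blast
  obtain E D where E: "finite E" and D: "\<And>t. t \<in> {0..1} - E \<Longrightarrow> (c has_vector_derivative D t) (at t)" "continuous_on ({0..1} - E) D"
     and cc: "continuous_on {0..1} c"
    using c(1) unfolding valid_path_def piecewise_C1_differentiable_on_def C1_differentiable_on_def by blast
  have cS: "c t \<in> S" if "t \<in> {0..1}" for t using c(3) that unfolding path_image_def by blast
  \<comment> \<open>The endpoints are exceptional as well: there the derivative within
    \<open>{0..1}\<close> is one-sided.\<close>
  define E' where "E' = E \<union> {0, 1}"
  have E': "finite E'" using E unfolding E'_def by simp
  have vd: "vector_derivative c (at t within {0..1}) = D t" if "t \<in> {0..1} - E'" for t
  proof (rule vector_derivative_within_cbox[of 0 1 _ c, unfolded cbox_interval])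
    show "(c has_vector_derivative D t) (at t within {0..1})"
      using D(1)[of t] that unfolding E'_def by (auto intro: has_vector_derivative_at_within)
  qed (use that in auto)
  define tc where "tc = to_complex \<circ> c"
  have tcD: "(tc has_vector_derivative to_complex (D t)) (at t)" if "t \<in> {0..1} - E" for t
    unfolding tc_def comp_def by (rule bounded_linear.has_vector_derivative[OF bounded_linear_to_complex D(1)[OF that]])
  have vp: "valid_path tc"
    unfolding valid_path_def piecewise_C1_differentiable_on_def C1_differentiable_on_def
  proof (intro conjI exI)
    show "continuous_on {0..1} tc" unfolding tc_def comp_def
      by (rule bounded_linear.continuous_on[OF bounded_linear_to_complex cc])
    show "finite E" by fact
    show "\<forall>x\<in>{0..1} - E. (tc has_vector_derivative to_complex (D x)) (at x)" using tcD by blast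
    show "continuous_on ({0..1} - E) (\<lambda>x. to_complex (D x))"
      by (rule bounded_linear.continuous_on[OF bounded_linear_to_complex D(2)])
  qed
  have vdt: "vector_derivative tc (at t within {0..1}) = to_complex (D t)" if "t \<in> {0..1} - E'" for t
  proof (rule vector_derivative_within_cbox[of 0 1 _ tc, unfolded cbox_interval])
    show "(tc has_vector_derivative to_complex (D t)) (at t within {0..1})"
      using tcD[of t] that unfolding E'_def by (auto intro: has_vector_derivative_at_within)
  qed (use that in auto)
  have angle: "((\<lambda>t. angle_form (p k) (c t) (D t)) has_integral 2 * pi * Re (plane_winding_number c (p k))) {0..1}" if k: "k \<in> K" for k
  proof -
    have "to_complex (p k) \<notin> path_image tc"
    proof
      assume "to_complex (p k) \<in> path_image tc"
      then obtain t where "t \<in> {0..1}" "to_complex (p k) = to_complex (c t)" unfolding path_image_def tc_def by auto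
      then have "p k = c t" by (metis of_complex_to_complex)
      then show False using cS[OF \<open>t \<in> {0..1}\<close>] p[OF k] by simp
    qed
    from has_contour_integral_winding_number[OF vp this]
    have "((\<lambda>t. 1 / (tc t - to_complex (p k)) * vector_derivative tc (at t within {0..1})) has_integral
        2 * of_real pi * \<i> * winding_number tc (to_complex (p k))) {0..1}"
      unfolding has_contour_integral_def by simp
    from has_integral_linear[OF this bounded_linear_Im]
    have "((\<lambda>t. Im (1 / (tc t - to_complex (p k)) * vector_derivative tc (at t within {0..1}))) has_integral
        2 * pi * Re (plane_winding_number c (p k))) {0..1}"
      unfolding comp_def plane_winding_number_def tc_def by simp
    then show ?thesis
      by (rule has_integral_spike_finite[OF E', rotated])
         (auto simp: vdt angle_form_def tc_def[THEN fun_cong, simplified comp_def] to_complex_diff)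
  qed
  have "((\<lambda>t. A (c t) \<bullet> D t - (\<Sum>k\<in>K. a k * angle_form (p k) (c t) (D t))) has_integral (P (c 1) - P (c 0))) {0..1}"
  proof (rule fundamental_theorem_of_calculus_interior_strong[OF E])
    have "continuous_on S P" using P by (meson continuous_at_imp_continuous_on has_derivative_continuous)
    then show "continuous_on {0..1} (\<lambda>t. P (c t))"
      by (rule continuous_on_compose2[OF _ cc]) (use cS in auto)
    fix t assume t: "t \<in> {0<..<1} - E"
    then have "(c has_vector_derivative D t) (at t)" "c t \<in> S" using D(1) cS by auto
    from vector_derivative_diff_chain_within[of c "D t" t UNIV P, OF this(1) has_derivative_at_withinI[OF P[OF this(2)]]]
    show "((\<lambda>t. P (c t)) has_vector_derivative A (c t) \<bullet> D t - (\<Sum>k\<in>K. a k * angle_form (p k) (c t) (D t))) (at t)"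
      by (simp add: comp_def)
  qed simp
  note int = has_integral_add[OF this has_integral_sum[OF K has_integral_mult_right[OF angle]], of "\<lambda>k. k" a]
  have "((\<lambda>t. A (c t) \<bullet> D t) has_integral (P (c 1) - P (c 0)) + (\<Sum>k\<in>K. a k * (2 * pi * Re (plane_winding_number c (p k))))) {0..1}"
    using int by (simp only: diff_add_cancel)
  then have "((\<lambda>t. A (c t) \<bullet> D t) has_integral (\<Sum>k\<in>K. a k * (2 * pi * Re (plane_winding_number c (p k))))) {0..1}"
    using c(2) unfolding pathfinish_def pathstart_def by simp
  then have "((\<lambda>t. A (c t) \<bullet> vector_derivative c (at t within {0..1})) has_integral (\<Sum>k\<in>K. a k * (2 * pi * Re (plane_winding_number c (p k))))) {0..1}"
    by (rule has_integral_spike_finite[OF E', rotated]) (simp add: vd)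
  then show ?thesis unfolding line_integral_def by (rule integral_unique)
qed

text \<open>The loop that defines the flux has winding number 1 or -1 around \<open>p j\<close> and
  0 around the other centres, which identifies the coefficient of the angle form at
  \<open>p j\<close> up to sign. On a convex C without the other centres the remaining angle forms
  are exact.\<close>

lemma flux_potential:
  fixes p :: "nat \<Rightarrow> real^2"
  assumes F: "convex F" "open F" and r: "0 < r"
    and G: "\<And>j. j \<in> {1..n} \<Longrightarrow> G j = ball (p j) r"
    and sub: "\<And>j. j \<in> {1..n} \<Longrightarrow> closure (G j) \<subseteq> F"
    and disj: "\<And>j k. j \<in> {1..n} \<Longrightarrow> k \<in> {1..n} \<Longrightarrow> j \<noteq> k \<Longrightarrow> closure (G j) \<inter> closure (G k) = {}"
    and \<Omega>: "\<Omega> = F - (\<Union>j\<in>{1..n}. closure (G j))"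
    and A: "smooth_on A \<Omega>" "closed_form_on A \<Omega>"
    and flux: "\<And>j. j \<in> {1..n} \<Longrightarrow> has_flux \<Omega> n G A j (\<Phi> j)"
    and j: "j \<in> {1..n}" and C: "convex C" "\<And>k. k \<in> {1..n} \<Longrightarrow> k \<noteq> j \<Longrightarrow> p k \<notin> C"
  shows "\<exists>a. (a = \<Phi> j \<or> a = - \<Phi> j) \<and> exact_on (\<lambda>x v. A x \<bullet> v - a * angle_form (p j) x v) (C \<inter> \<Omega>)"
proof -
  let ?K = "{1..n}"
  have cl: "closure (G k) = cball (p k) r" if "k \<in> ?K" for k using G[OF that] r by simp
  have \<Omega>': "\<Omega> = F - (\<Union>j\<in>?K. cball (p j) r)"
  proof -
    have "(\<Union>j\<in>?K. closure (G j)) = (\<Union>j\<in>?K. cball (p j) r)" by (intro SUP_cong refl cl)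
    then show ?thesis unfolding \<Omega> by (simp only:)
  qed
  have o: "open \<Omega>" unfolding \<Omega>' using F(2) by (intro open_Diff closed_UN) auto
  have sub': "cball (p k) r \<subseteq> F" if "k \<in> ?K" for k using sub[OF that] unfolding cl[OF that] .
  have disj': "cball (p k) r \<inter> cball (p l) r = {}" if "k \<in> ?K" "l \<in> ?K" "k \<noteq> l" for k l
    using disj[OF that] unfolding cl[OF that(1)] cl[OF that(2)] .
  from exact_on_minus_angle_forms[OF F finite_atLeastAtMost r sub' disj' \<Omega>' locally_exact_closed_form[OF o A]]
  obtain a where a: "exact_on (\<lambda>x v. A x \<bullet> v - (\<Sum>k\<in>?K. a k * angle_form (p k) x v)) \<Omega>" ..
  have p\<Omega>: "p k \<notin> \<Omega>" if "k \<in> ?K" for k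
  proof -
    have "p k \<in> cball (p k) r" using r by simp
    then show ?thesis unfolding \<Omega>' using that by blast
  qed
  obtain c where c: "loop_once_around \<Omega> n G j c" "\<Phi> j = line_integral A c / (2 * pi)"
    using flux[OF j] unfolding has_flux_def by blast
  have pG: "p k \<in> G k" if "k \<in> ?K" for k using G[OF that] r by simp
  have wj: "plane_winding_number c (p j) = 1 \<or> plane_winding_number c (p j) = -1"
    using c(1) pG[OF j] unfolding loop_once_around_def by blast
  have wk: "plane_winding_number c (p k) = 0" if "k \<in> ?K - {j}" for k
    using c(1) pG[of k] that unfolding loop_once_around_def by blast
  have "line_integral A c = (\<Sum>k\<in>?K. a k * (2 * pi * Re (plane_winding_number c (p k))))"
    by (rule line_integral_of_angle_forms[OF _ a]) (use c(1) p\<Omega> in \<open>auto simp: loop_once_around_def\<close>)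
  also have "\<dots> = a j * (2 * pi * Re (plane_winding_number c (p j)))"
    using wk j by (subst sum.remove[of _ j]) auto
  finally have "a j = \<Phi> j \<or> a j = - \<Phi> j" using c(2) wj by auto
  moreover have "exact_on (\<lambda>x v. A x \<bullet> v - a j * angle_form (p j) x v) (C \<inter> \<Omega>)"
  proof -
    have e1: "exact_on (angle_form (p k)) (C \<inter> \<Omega>)" if "k \<in> ?K - {j}" for k
      by (rule exact_on_subset[OF exact_on_angle_form[OF C(2) C(1)]]) (use that in auto)
    have "exact_on (\<lambda>x v. (A x \<bullet> v - (\<Sum>k\<in>?K. a k * angle_form (p k) x v)) + (\<Sum>k\<in>?K - {j}. a k * angle_form (p k) x v)) (C \<inter> \<Omega>)"
      by (intro exact_on_add exact_on_sum exact_on_cmult e1 exact_on_subset[OF a]) auto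
    moreover have "(\<Sum>k\<in>?K. a k * angle_form (p k) x v) = a j * angle_form (p j) x v + (\<Sum>k\<in>?K - {j}. a k * angle_form (p k) x v)" for x v
      using j by (intro sum.remove) auto
    ultimately show ?thesis by simp
  qed
  ultimately show ?thesis by blast
qed

subsection \<open>Mollification and smooth approximation in the Sobolev space\<close>

text \<open>The powers of t in the denominator make the linear span of the family closed under
  differentiation, so that smoothness of bump functions becomes an induction without estimates of
  higher derivatives.\<close>

definition flat_exp :: "nat \<Rightarrow> real \<Rightarrow> real" where
  "flat_exp k t = (if t \<le> 0 then 0 else exp (- 1 / t) / t ^ k)"

lemma flat_exp_tendsto_0: "(flat_exp k \<longlongrightarrow> 0) (at 0)"
proof -
  have "((\<lambda>t. inverse t ^ k / exp (inverse t)) \<longlongrightarrow> 0) (at_right (0::real))"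
    by (rule filterlim_compose[OF tendsto_power_div_exp_0 filterlim_inverse_at_top_right])
  moreover have "\<forall>\<^sub>F t in at_right 0. inverse t ^ k / exp (inverse t) = flat_exp k t"
    by (auto simp: eventually_at_right_field flat_exp_def exp_minus power_inverse divide_simps intro!: exI[of _ 1])
  ultimately have "(flat_exp k \<longlongrightarrow> 0) (at_right 0)" by (rule Lim_transform_eventually)
  moreover have "(flat_exp k \<longlongrightarrow> 0) (at_left 0)"
    by (rule Lim_transform_eventually[OF tendsto_const]) (auto simp: eventually_at_left_field flat_exp_def intro!: exI[of _ "-1"])
  ultimately show ?thesis by (simp add: filterlim_at_split)
qed

lemma DERIV_flat_exp:
  "(flat_exp k has_real_derivative flat_exp (k + 2) t - real k * flat_exp (k + 1) t) (at t)"
proof (cases t "0::real" rule: linorder_cases)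
  case less
  have "((\<lambda>x. 0) has_real_derivative 0) (at t)" by simp
  then show ?thesis
    using has_field_derivative_transform_within_open[of "\<lambda>x. 0" 0 t "{..<0}" "flat_exp k"] less by (auto simp: flat_exp_def)
next
  case equal
  have "((\<lambda>h. (flat_exp k h - flat_exp k 0) / (h - 0)) \<longlongrightarrow> 0) (at 0)"
  proof (rule Lim_transform_eventually[OF flat_exp_tendsto_0[of "k + 1"]])
    show "\<forall>\<^sub>F h in at 0. flat_exp (k + 1) h = (flat_exp k h - flat_exp k 0) / (h - 0)"
      by (rule always_eventually) (simp add: flat_exp_def)
  qed
  then show ?thesis unfolding equal by (simp add: has_field_derivative_iff flat_exp_def)
next
  case greater
  have e: "((\<lambda>x. exp (- 1 / x) / x ^ k) has_real_derivative exp (- 1 / t) / t ^ (k + 2) - real k * (exp (- 1 / t) / t ^ (k + 1))) (at t)"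
    using greater
    by (cases k) (auto intro!: derivative_eq_intros simp: field_simps power2_eq_square, metis One_nat_def Suc_pred neq0_conv power_Suc)
  show ?thesis
    by (rule has_field_derivative_transform_within_open[where f="\<lambda>x. exp (- 1 / x) / x ^ k" and S="{0<..}"])
       (use e greater in \<open>auto simp: flat_exp_def\<close>)
qed

text \<open>A class of functions closed under directional derivatives, hence consisting of smooth functions.\<close>

inductive bump_expr :: "('a::euclidean_space \<Rightarrow> real) \<Rightarrow> bool" where
  const: "bump_expr (\<lambda>x. c)"
| inner: "bump_expr (\<lambda>x. x \<bullet> v)"
| flat: "bump_expr (\<lambda>x. flat_exp k (c - (a - x) \<bullet> (a - x)))"
| add: "bump_expr f \<Longrightarrow> bump_expr g \<Longrightarrow> bump_expr (\<lambda>x. f x + g x)"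
| mult: "bump_expr f \<Longrightarrow> bump_expr g \<Longrightarrow> bump_expr (\<lambda>x. f x * g x)"

lemma has_derivative_flat_bump:
  fixes a :: "'a::euclidean_space"
  shows "((\<lambda>x. flat_exp k (c - (a - x) \<bullet> (a - x))) has_derivative
    (\<lambda>h. (flat_exp (k + 2) (c - (a - x) \<bullet> (a - x)) - real k * flat_exp (k + 1) (c - (a - x) \<bullet> (a - x))) * (2 * ((a - x) \<bullet> h)))) (at x)"
proof -
  have d1: "((\<lambda>x. a - x) has_derivative (\<lambda>h. - h)) (at x)"
    using has_derivative_diff[OF has_derivative_const[of a] has_derivative_ident] by simp
  have "((\<lambda>x. c - (a - x) \<bullet> (a - x)) has_derivative (\<lambda>h. 2 * ((a - x) \<bullet> h))) (at x)"
    using has_derivative_diff[OF has_derivative_const[of c] has_derivative_inner[OF d1 d1]] by (simp add: inner_commute)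
  from has_derivative_compose[OF this DERIV_flat_exp[unfolded has_field_derivative_def]]
  show ?thesis .
qed

lemma bump_expr_derivative:
  "bump_expr f \<Longrightarrow> \<exists>D. (\<forall>x. (f has_derivative D x) (at x)) \<and> (\<forall>v. bump_expr (\<lambda>x. D x v))"
proof (induction rule: bump_expr.induct)
  case (const c)
  show ?case by (intro exI[of _ "\<lambda>x v. 0"]) (simp add: bump_expr.const)
next
  case (inner v)
  show ?case
    by (intro exI[of _ "\<lambda>x w. w \<bullet> v"]) (auto intro: bump_expr.const bounded_linear_imp_has_derivative bounded_linear_inner_left)
next
  case (flat k c a)
  have e: "(\<lambda>x. (flat_exp (k + 2) (c - (a - x) \<bullet> (a - x)) - real k * flat_exp (k + 1) (c - (a - x) \<bullet> (a - x))) * (2 * ((a - x) \<bullet> v))) =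
    (\<lambda>x. (flat_exp (k + 2) (c - (a - x) \<bullet> (a - x)) + (- real k) * flat_exp (k + 1) (c - (a - x) \<bullet> (a - x))) * (2 * (a \<bullet> v) + (-2) * (x \<bullet> v)))" for v
    by (simp add: algebra_simps inner_diff_left)
  show ?case
    by (rule exI[of _ "\<lambda>x h. (flat_exp (k + 2) (c - (a - x) \<bullet> (a - x)) - real k * flat_exp (k + 1) (c - (a - x) \<bullet> (a - x))) * (2 * ((a - x) \<bullet> h))"],
        intro conjI allI has_derivative_flat_bump, unfold e, intro bump_expr.intros)
next
  case (add f g)
  then obtain D E where "\<forall>x. (f has_derivative D x) (at x)" "\<forall>v. bump_expr (\<lambda>x. D x v)"
    "\<forall>x. (g has_derivative E x) (at x)" "\<forall>v. bump_expr (\<lambda>x. E x v)" by blast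
  then show ?case by (intro exI[of _ "\<lambda>x v. D x v + E x v"]) (auto intro: bump_expr.add has_derivative_add)
next
  case (mult f g)
  then obtain D E where "\<forall>x. (f has_derivative D x) (at x)" "\<forall>v. bump_expr (\<lambda>x. D x v)"
    "\<forall>x. (g has_derivative E x) (at x)" "\<forall>v. bump_expr (\<lambda>x. E x v)" by blast
  with mult.hyps show ?case
    by (intro exI[of _ "\<lambda>x v. f x * E x v + D x v * g x"] conjI allI has_derivative_mult bump_expr.add bump_expr.mult) auto
qed

lemma bump_expr_smooth:
  assumes "bump_expr f"
  shows "smooth_on f UNIV"
proof -
  have "Ck_on k f UNIV" for k using assms
  proof (induction k arbitrary: f)
    case 0
    then obtain D where "\<forall>x. (f has_derivative D x) (at x)" using bump_expr_derivative by blast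
    then show ?case by (auto intro: continuous_at_imp_continuous_on has_derivative_continuous)
  next
    case (Suc k)
    then obtain D where D: "\<forall>x. (f has_derivative D x) (at x)" "\<forall>v. bump_expr (\<lambda>x. D x v)"
      using bump_expr_derivative by blast
    have "frechet_derivative f (at x) = D x" for x using D(1) frechet_derivative_at by metis
    then show ?case using D Suc.IH by (auto simp: differentiable_def)
  qed
  then show ?thesis unfolding smooth_on_def by blast
qed

lemma continuous_flat_exp: "continuous_on UNIV (flat_exp k)"
  using DERIV_flat_exp by (meson continuous_at_imp_continuous_on DERIV_isCont)

section \<open>Approximation of square-integrable functions by continuous ones with bounded
  support\<close>

lemma uniformly_continuous_compact_support:
  fixes g :: "'a::euclidean_space \<Rightarrow> 'b::real_normed_vector"
  assumes "continuous_on UNIV g" and z: "\<And>z. norm z > r \<Longrightarrow> g z = 0"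
  shows "uniformly_continuous_on UNIV g"
  unfolding uniformly_continuous_on_def
proof (intro allI impI)
  fix e :: real assume e: "e > 0"
  have "uniformly_continuous_on (cball 0 (r + 1)) g"
    by (intro compact_uniformly_continuous continuous_on_subset[OF assms(1)]) auto
  then obtain d where d: "d > 0" "\<And>x y. x \<in> cball 0 (r + 1) \<Longrightarrow> y \<in> cball 0 (r + 1) \<Longrightarrow> dist y x < d \<Longrightarrow> dist (g y) (g x) < e"
    using e unfolding uniformly_continuous_on_def by metis
  have "dist (g y) (g x) < e" if xy: "dist y x < min d 1" for x y
  proof (cases "norm x \<le> r + 1 \<and> norm y \<le> r + 1")
    case True
    then show ?thesis using d(2)[of x y] xy by simp
  next
    case False
    have "norm x \<le> norm y + dist y x" "norm y \<le> norm x + dist y x"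
      by (metis dist_commute dist_norm norm_triangle_sub add.commute norm_minus_commute)+
    then have "norm x > r" "norm y > r" using False xy by auto
    then show ?thesis using z e by simp
  qed
  then show "\<exists>d>0. \<forall>x\<in>UNIV. \<forall>x'\<in>UNIV. dist x' x < d \<longrightarrow> dist (g x') (g x) < e"
    using d(1) by (intro exI[of _ "min d 1"]) auto
qed

text \<open>Values are truncated radially to norm at most M + 1. At a given x nothing changes once M
  exceeds \<open>norm (f x)\<close>, and dominated convergence applies.\<close>

lemma L2_truncation_approx:
  fixes f :: "'a::euclidean_space \<Rightarrow> 'b::euclidean_space"
  assumes f[measurable]: "f \<in> borel_measurable borel" and fin: "(\<integral>\<^sup>+x. ennreal ((norm (f x))\<^sup>2) \<partial>lborel) < \<infinity>" and e: "e > 0"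
  shows "\<exists>M::nat. (\<integral>\<^sup>+x. ennreal ((norm (f x - f x /\<^sub>R max 1 (norm (f x) / (real M + 1))))\<^sup>2) \<partial>lborel) < e"
proof -
  define T where "T M x = f x /\<^sub>R max 1 (norm (f x) / (real M + 1))" for M :: nat and x
  have [measurable]: "T M \<in> borel_measurable borel" for M unfolding T_def by measurable
  have nT: "norm (f x - T M x) \<le> norm (f x)" for M x
  proof -
    have "f x - T M x = (1 - inverse (max 1 (norm (f x) / (real M + 1)))) *\<^sub>R f x" unfolding T_def by (simp add: algebra_simps)
    then have "norm (f x - T M x) = \<bar>1 - inverse (max 1 (norm (f x) / (real M + 1)))\<bar> * norm (f x)" by simp
    also have "\<dots> \<le> 1 * norm (f x)"
    proof (intro mult_right_mono)
      have "inverse (max 1 (norm (f x) / (real M + 1))) \<le> 1" "0 \<le> inverse (max 1 (norm (f x) / (real M + 1)))"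
        by (auto simp: inverse_le_1_iff)
      then show "\<bar>1 - inverse (max 1 (norm (f x) / (real M + 1)))\<bar> \<le> 1" by simp
    qed simp
    finally show ?thesis by simp
  qed
  have lim: "(\<lambda>M. ennreal ((norm (f x - T M x))\<^sup>2)) \<longlonglongrightarrow> 0" for x
  proof (rule tendsto_eventually)
    obtain M0 :: nat where "norm (f x) < real M0" using reals_Archimedean2 by blast
    then have "T M x = f x" if "M \<ge> M0" for M
      using that unfolding T_def by (simp add: max_def divide_le_eq)
    then show "\<forall>\<^sub>F M in sequentially. ennreal ((norm (f x - T M x))\<^sup>2) = 0"
      by (auto simp: eventually_sequentially intro!: exI[of _ M0])
  qed
  have "(\<lambda>M. \<integral>\<^sup>+x. ennreal ((norm (f x - T M x))\<^sup>2) \<partial>lborel) \<longlonglongrightarrow> (\<integral>\<^sup>+x. 0 \<partial>(lborel :: 'a measure))"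
    by (rule nn_integral_dominated_convergence[of _ _ _ "\<lambda>x. ennreal ((norm (f x))\<^sup>2)"])
       (use fin nT lim in \<open>auto intro!: ennreal_leI power_mono\<close>)
  then have "\<forall>\<^sub>F M in sequentially. (\<integral>\<^sup>+x. ennreal ((norm (f x - T M x))\<^sup>2) \<partial>lborel) < e"
    using e by (auto dest!: order_tendstoD(2)[of _ _ _ e])
  then show ?thesis unfolding T_def using eventually_happens'[OF sequentially_bot] by blast
qed

lemma nn_integral_norm_add_sq:
  fixes f g :: "'a \<Rightarrow> 'b::{real_normed_vector, second_countable_topology}"
  assumes [measurable]: "f \<in> borel_measurable M" "g \<in> borel_measurable M"
  shows "(\<integral>\<^sup>+x. ennreal ((norm (f x + g x))\<^sup>2) \<partial>M) \<le> 2 * (\<integral>\<^sup>+x. ennreal ((norm (f x))\<^sup>2) \<partial>M) + 2 * (\<integral>\<^sup>+x. ennreal ((norm (g x))\<^sup>2) \<partial>M)"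
proof -
  have "ennreal ((norm (f x + g x))\<^sup>2) \<le> 2 * ennreal ((norm (f x))\<^sup>2) + 2 * ennreal ((norm (g x))\<^sup>2)" for x
  proof -
    have "(norm (f x + g x))\<^sup>2 \<le> (norm (f x) + norm (g x))\<^sup>2" by (intro power_mono norm_triangle_ineq) auto
    also have "\<dots> \<le> 2 * (norm (f x))\<^sup>2 + 2 * (norm (g x))\<^sup>2"
      using sum_squares_bound[of "norm (f x)" "norm (g x)"] by (simp add: power2_sum)
    finally have "ennreal ((norm (f x + g x))\<^sup>2) \<le> ennreal (2 * (norm (f x))\<^sup>2 + 2 * (norm (g x))\<^sup>2)" by (rule ennreal_leI)
    then show ?thesis by (simp add: ennreal_plus ennreal_mult)
  qed
  then have "(\<integral>\<^sup>+x. ennreal ((norm (f x + g x))\<^sup>2) \<partial>M) \<le> (\<integral>\<^sup>+x. 2 * ennreal ((norm (f x))\<^sup>2) + 2 * ennreal ((norm (g x))\<^sup>2) \<partial>M)"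
    by (intro nn_integral_mono) auto
  also have "\<dots> = 2 * (\<integral>\<^sup>+x. ennreal ((norm (f x))\<^sup>2) \<partial>M) + 2 * (\<integral>\<^sup>+x. ennreal ((norm (g x))\<^sup>2) \<partial>M)"
    by (subst nn_integral_add) (auto simp: nn_integral_cmult)
  finally show ?thesis .
qed

text \<open>A measurable f is almost everywhere the limit of continuous functions
  \<open>g n\<close>. Truncating their values and cutting them off outside a ball supplies the
  integrable bound for dominated convergence.\<close>

lemma L2_continuous_approx:
  fixes f :: "'a::euclidean_space \<Rightarrow> 'b::euclidean_space"
  assumes f[measurable]: "f \<in> borel_measurable borel" and fin: "(\<integral>\<^sup>+x. ennreal ((norm (f x))\<^sup>2) \<partial>lborel) < \<infinity>"
    and supp: "\<And>x. norm x > R \<Longrightarrow> f x = 0" and e: "e > 0"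
  shows "\<exists>h. continuous_on UNIV h \<and> (\<forall>x. norm x > R + 1 \<longrightarrow> h x = 0) \<and>
    (\<integral>\<^sup>+x. ennreal ((norm (f x - h x))\<^sup>2) \<partial>lborel) < e"
proof -
  \<comment> \<open>\<open>e\<close> may be infinite; the minimum with 1 keeps the strict
    inequalities between finite quantities.\<close>
  define e' where "e' = min 1 (e / 4)"
  have e': "e' > 0" "4 * e' \<le> e" "e' \<le> 1" 
  proof -
    show "e' > 0" using e unfolding e'_def by (simp add: ennreal_zero_less_divide)
    have "4 * e' \<le> 4 * (e / 4)" unfolding e'_def by (intro mult_left_mono) auto
    also have "\<dots> = e" by (simp add: ennreal_times_divide mult.commute[of 4 e] mult_divide_eq_ennreal)
    finally show "4 * e' \<le> e" .
    show "e' \<le> 1" unfolding e'_def by simp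
  qed
  define tr where "tr M w = w /\<^sub>R max 1 (norm w / (real M + 1))" for M :: nat and w :: 'b
  obtain M where M: "(\<integral>\<^sup>+x. ennreal ((norm (f x - tr M (f x)))\<^sup>2) \<partial>lborel) < e'"
    using L2_truncation_approx[OF f fin e'(1)] unfolding tr_def by blast
  have tr_cont: "continuous_on UNIV (tr M)" unfolding tr_def by (intro continuous_intros) auto
  have tr_bound: "norm (tr M w) \<le> real M + 1" for w
  proof -
    have "norm w = (real M + 1) * (norm w / (real M + 1))" by simp
    also have "\<dots> \<le> (real M + 1) * max 1 (norm w / (real M + 1))" by (intro mult_left_mono) auto
    finally have "norm w \<le> (real M + 1) * max 1 (norm w / (real M + 1))" .
    then show ?thesis unfolding tr_def by (simp add: divide_simps)
  qed
  have [measurable]: "tr M \<in> borel_measurable borel" using tr_cont by (rule borel_measurable_continuous_onI)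
  have "f measurable_on UNIV"
    by (intro lebesgue_measurable_imp_measurable_on) (auto intro: measurable_completion simp: f)
  then obtain Z g where Z: "negligible Z" and gc: "\<And>n. continuous_on UNIV (g n)" and lim: "\<And>x. x \<notin> Z \<Longrightarrow> (\<lambda>n::nat. g n x) \<longlonglongrightarrow> f x"
    unfolding measurable_on_def by auto
  define \<psi> where "\<psi> x = min 1 (max 0 (R + 1 - norm x))" for x :: 'a
  have \<psi>: "continuous_on UNIV \<psi>" "0 \<le> \<psi> x" "\<psi> x \<le> 1" "norm x \<le> R \<Longrightarrow> \<psi> x = 1" "norm x > R + 1 \<Longrightarrow> \<psi> x = 0" for x
    unfolding \<psi>_def by (auto intro!: continuous_intros)
  define h where "h n x = \<psi> x *\<^sub>R tr M (g n x)" for n x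
  have hc: "continuous_on UNIV (h n)" for n
    unfolding h_def by (intro continuous_intros \<psi>(1) continuous_on_compose2[OF tr_cont gc]) auto
  have [measurable]: "h n \<in> borel_measurable borel" for n using hc by (rule borel_measurable_continuous_onI)
  have [measurable]: "cball (0::'a) (R + 1) \<in> sets borel" by simp
  have "(\<lambda>n. \<integral>\<^sup>+x. ennreal ((norm (tr M (f x) - h n x))\<^sup>2) \<partial>lborel) \<longlonglongrightarrow> (\<integral>\<^sup>+x. 0 \<partial>(lborel :: 'a measure))"
  proof (rule nn_integral_dominated_convergence[of _ _ _ "\<lambda>x. ennreal ((2 * (real M + 1))\<^sup>2) * indicator (cball 0 (R + 1)) x"])
    show "(\<integral>\<^sup>+x. ennreal ((2 * (real M + 1))\<^sup>2) * indicator (cball 0 (R + 1)) x \<partial>(lborel :: 'a measure)) < \<infinity>"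
      using emeasure_bounded_finite[of "cball (0::'a) (R + 1)"]
      by (subst nn_integral_cmult_indicator) (auto simp: ennreal_mult_less_top less_top)
    fix n
    show "AE x in lborel. ennreal ((norm (tr M (f x) - h n x))\<^sup>2) \<le> ennreal ((2 * (real M + 1))\<^sup>2) * indicator (cball 0 (R + 1)) x"
    proof (rule AE_I2)
      fix x :: 'a
      show "ennreal ((norm (tr M (f x) - h n x))\<^sup>2) \<le> ennreal ((2 * (real M + 1))\<^sup>2) * indicator (cball 0 (R + 1)) x"
      proof (cases "norm x > R + 1")
        case True
        then show ?thesis using supp[of x] \<psi>(5)[of x] by (simp add: h_def tr_def)
      next
        case False
        have "norm (h n x) \<le> 1 * (real M + 1)" unfolding h_def using \<psi>(2,3)[of x] tr_bound[of "g n x"] by (simp only: norm_scaleR) (intro mult_mono; simp)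
        then have "norm (tr M (f x)) + norm (h n x) \<le> (real M + 1) + 1 * (real M + 1)" by (intro add_mono tr_bound)
        then have "norm (tr M (f x) - h n x) \<le> 2 * (real M + 1)" using norm_triangle_ineq4[of "tr M (f x)" "h n x"] by simp
        then show ?thesis using False by (auto intro!: ennreal_leI power_mono)
      qed
    qed
  next
    have "AE x in lebesgue. x \<notin> Z" using Z by (auto simp: negligible_iff_null_sets intro: AE_not_in)
    then have "AE x in lborel. x \<notin> Z" by (simp add: AE_completion_iff)
    then show "AE x in lborel. (\<lambda>n. ennreal ((norm (tr M (f x) - h n x))\<^sup>2)) \<longlonglongrightarrow> 0"
    proof eventually_elim
      fix x assume "x \<notin> Z"
      then have "(\<lambda>n. tr M (g n x)) \<longlonglongrightarrow> tr M (f x)"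
        using continuous_on_tendsto_compose[OF tr_cont lim] by simp
      then have "(\<lambda>n. h n x) \<longlonglongrightarrow> \<psi> x *\<^sub>R tr M (f x)" unfolding h_def by (intro tendsto_intros)
      moreover have "\<psi> x *\<^sub>R tr M (f x) = tr M (f x)"
        using supp[of x] \<psi>(4)[of x] by (cases "norm x > R") (auto simp: tr_def)
      ultimately have "(\<lambda>n. (norm (tr M (f x) - h n x))\<^sup>2) \<longlonglongrightarrow> (norm (tr M (f x) - tr M (f x)))\<^sup>2"
        by (intro tendsto_power tendsto_norm tendsto_diff tendsto_const) simp
      from tendsto_ennrealI[OF this]
      show "(\<lambda>n. ennreal ((norm (tr M (f x) - h n x))\<^sup>2)) \<longlonglongrightarrow> 0" by simp
    qed
  qed measurable
  then have "\<forall>\<^sub>F n in sequentially. (\<integral>\<^sup>+x. ennreal ((norm (tr M (f x) - h n x))\<^sup>2) \<partial>lborel) < e'"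
    using e'(1) by (auto dest!: order_tendstoD(2)[of _ _ _ e'])
  then obtain n where n: "(\<integral>\<^sup>+x. ennreal ((norm (tr M (f x) - h n x))\<^sup>2) \<partial>lborel) < e'"
    using eventually_happens'[OF sequentially_bot] by blast
  have "(\<integral>\<^sup>+x. ennreal ((norm (f x - h n x))\<^sup>2) \<partial>lborel) = (\<integral>\<^sup>+x. ennreal ((norm ((f x - tr M (f x)) + (tr M (f x) - h n x)))\<^sup>2) \<partial>lborel)"
    by simp
  also have "\<dots> \<le> 2 * (\<integral>\<^sup>+x. ennreal ((norm (f x - tr M (f x)))\<^sup>2) \<partial>lborel) + 2 * (\<integral>\<^sup>+x. ennreal ((norm (tr M (f x) - h n x))\<^sup>2) \<partial>lborel)"
    by (rule nn_integral_norm_add_sq) auto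
  also have "\<dots> < 2 * e' + 2 * e'"
    using M n e' by (intro add_strict_mono ennreal_mult_strict_left_mono) (auto simp: less_top[symmetric])
  also have "2 * e' + 2 * e' = 4 * e'" by (simp flip: distrib_right)
  also have "\<dots> \<le> e" by (rule e'(2))
  finally have "(\<integral>\<^sup>+x. ennreal ((norm (f x - h n x))\<^sup>2) \<partial>lborel) < e" .
  moreover have "h n x = 0" if "norm x > R + 1" for x using \<psi>(5)[OF that] unfolding h_def by simp
  ultimately show ?thesis using hc by blast
qed

text \<open>\<open>g\<close> is the gradient of the kernel \<open>b\<close>. Smoothness is recorded
  for the reflected translates of \<open>b\<close>, because these are the test functions to which
  the weak gradient will be applied.\<close>

locale mollifier =
  fixes \<epsilon> :: real and b :: "'a::euclidean_space \<Rightarrow> real" and g :: "'a \<Rightarrow> 'a"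
  assumes \<epsilon>: "0 < \<epsilon>"
    and b_nonneg: "0 \<le> b z" and b_supp: "norm z \<ge> \<epsilon> \<Longrightarrow> b z = 0" and b_sym: "b (- z) = b z"
    and b_smooth: "bump_expr (\<lambda>y. b (x - y))"
    and b_deriv: "(b has_derivative (\<lambda>h. g z \<bullet> h)) (at z)"
    and g_cont: "continuous_on UNIV g" and g_supp: "norm z \<ge> \<epsilon> \<Longrightarrow> g z = 0"
    and b_int: "(\<integral>\<^sup>+z. ennreal (b z) \<partial>lborel) = 1"

lemma mollifier_exists:
  assumes \<epsilon>: "0 < \<epsilon>"
  shows "\<exists>b g. mollifier \<epsilon> (b :: 'a::euclidean_space \<Rightarrow> real) g"
proof -
  define B where "B z = flat_exp 0 (\<epsilon>\<^sup>2 - (z \<bullet> z))" for z :: 'a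
  have B0: "B z \<ge> 0" for z unfolding B_def flat_exp_def by simp
  have B1: "B z \<le> indicator (cball 0 \<epsilon>) z" for z
  proof (cases "norm z \<le> \<epsilon>")
    case False
    then have "\<epsilon>\<^sup>2 < z \<bullet> z" using \<epsilon> by (simp add: power2_norm_eq_inner[symmetric] power_strict_mono)
    then show ?thesis unfolding B_def flat_exp_def by simp
  qed (simp add: B_def flat_exp_def)
  have Bs: "B z = 0" if "norm z \<ge> \<epsilon>" for z
  proof -
    have "\<epsilon>\<^sup>2 \<le> z \<bullet> z" using \<epsilon> that by (simp add: power2_norm_eq_inner[symmetric] power_mono)
    then show ?thesis unfolding B_def flat_exp_def by simp
  qed
  have Bc: "continuous_on UNIV B" unfolding B_def
    by (intro continuous_on_compose2[OF continuous_flat_exp] continuous_intros) auto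
  then have [measurable]: "B \<in> borel_measurable borel" by (rule borel_measurable_continuous_onI)
  have fin: "(\<integral>\<^sup>+z. ennreal (B z) \<partial>lborel) < \<infinity>"
  proof -
    have "(\<integral>\<^sup>+z. ennreal (B z) \<partial>lborel) \<le> (\<integral>\<^sup>+z. indicator (cball (0::'a) \<epsilon>) z \<partial>lborel)"
      by (rule nn_integral_mono) (metis B1 ennreal_leI ennreal_indicator)
    also have "\<dots> = emeasure lborel (cball (0::'a) \<epsilon>)" by simp
    also have "\<dots> < \<infinity>" using emeasure_bounded_finite[of "cball (0::'a) \<epsilon>"] by (simp add: less_top)
    finally show ?thesis .
  qed
  have pos: "(\<integral>\<^sup>+z. ennreal (B z) \<partial>lborel) > 0"
  proof (rule ccontr)
    assume "\<not> ?thesis"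
    then have "(\<integral>\<^sup>+z. ennreal (B z) \<partial>lborel) = 0" by simp
    then have "AE z in lborel. ennreal (B z) = 0" by (subst (asm) nn_integral_0_iff_AE) auto
    then have "AE z in lborel. z \<notin> ball (0::'a) \<epsilon>"
    proof eventually_elim
      fix z :: 'a assume "ennreal (B z) = 0"
      then have "B z = 0" using B0[of z] by (simp add: ennreal_eq_0_iff)
      then have "\<epsilon>\<^sup>2 \<le> z \<bullet> z" unfolding B_def flat_exp_def by (auto split: if_splits)
      then show "z \<notin> ball 0 \<epsilon>" using \<epsilon> by (simp add: power2_norm_eq_inner[symmetric] abs_le_square_iff[symmetric])
    qed
    then have "emeasure lborel (ball (0::'a) \<epsilon>) = 0"
      by (subst (asm) AE_iff_null_sets[symmetric]) (auto dest: null_setsD1)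
    then show False using \<epsilon> unit_ball_vol_pos[of "real DIM('a)"] by (simp add: emeasure_ball)
  qed
  define c where "c = enn2real (\<integral>\<^sup>+z. ennreal (B z) \<partial>lborel)"
  have c: "c > 0" "ennreal c = (\<integral>\<^sup>+z. ennreal (B z) \<partial>lborel)"
    using fin pos unfolding c_def by (auto simp: enn2real_positive_iff)
  define G where "G z = (- 2 * flat_exp 2 (\<epsilon>\<^sup>2 - (z \<bullet> z)) / c) *\<^sub>R z" for z :: 'a
  have "mollifier \<epsilon> (\<lambda>z. B z / c) G"
  proof
    fix x z :: 'a
    show "0 < \<epsilon>" by fact
    show "0 \<le> B z / c" using B0 c by simp
    show "B z / c = 0" if "\<epsilon> \<le> norm z" using Bs[OF that] by simp
    show "B (- z) / c = B z / c" unfolding B_def by simp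
    have "bump_expr (\<lambda>y. (1 / c) * flat_exp 0 (\<epsilon>\<^sup>2 - (x - y) \<bullet> (x - y)))" by (intro bump_expr.intros)
    then show "bump_expr (\<lambda>y. B (x - y) / c)" unfolding B_def by simp
    have "(B has_derivative (\<lambda>h. (flat_exp 2 (\<epsilon>\<^sup>2 - (z \<bullet> z))) * (2 * (- z \<bullet> h)))) (at z)"
      unfolding B_def using has_derivative_flat_bump[of 0 "\<epsilon>\<^sup>2" 0 z] by (simp add: inner_minus_left numeral_2_eq_2)
    then have "((\<lambda>z. B z * (1 / c)) has_derivative (\<lambda>h. ((flat_exp 2 (\<epsilon>\<^sup>2 - (z \<bullet> z))) * (2 * (- z \<bullet> h))) * (1 / c))) (at z)"
      by (rule has_derivative_mult_left)
    then show "((\<lambda>z. B z / c) has_derivative (\<lambda>h. G z \<bullet> h)) (at z)" unfolding G_def by (simp add: algebra_simps)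
    show "continuous_on UNIV G" unfolding G_def
      using c by (intro continuous_intros continuous_on_compose2[OF continuous_flat_exp]) auto
    show "G z = 0" if "\<epsilon> \<le> norm z"
    proof -
      have "\<epsilon>\<^sup>2 \<le> z \<bullet> z" using \<epsilon> that by (simp add: power2_norm_eq_inner[symmetric] power_mono)
      then show ?thesis unfolding G_def flat_exp_def by simp
    qed
    have "(\<integral>\<^sup>+z. ennreal (B z / c) \<partial>lborel) = (\<integral>\<^sup>+z. ennreal (1 / c) * ennreal (B z) \<partial>lborel)"
      using c B0 by (intro nn_integral_cong) (simp flip: ennreal_mult)
    also have "\<dots> = ennreal (1 / c) * ennreal c" by (subst nn_integral_cmult) (auto simp: c)
    also have "\<dots> = 1" using c(1) by (simp flip: ennreal_mult)
    finally show "(\<integral>\<^sup>+z. ennreal (B z / c) \<partial>lborel) = 1" .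
  qed
  then show ?thesis by blast
qed

section \<open>Convolution with a mollifier\<close>

context mollifier
begin

lemma b_cont: "continuous_on UNIV b"
  using b_deriv by (meson continuous_at_imp_continuous_on has_derivative_continuous)

lemma b_measurable [measurable]: "b \<in> borel_measurable borel"
  using b_cont by (rule borel_measurable_continuous_onI)

lemma g_measurable [measurable]: "g \<in> borel_measurable borel"
  using g_cont by (rule borel_measurable_continuous_onI)

lemma bounded_compact_support:
  fixes k :: "'a \<Rightarrow> 'c::real_normed_vector"
  assumes "continuous_on UNIV k" "\<And>z. norm z \<ge> \<epsilon> \<Longrightarrow> k z = 0"
  shows "\<exists>C\<ge>0. \<forall>z. norm (k z) \<le> C"
proof -
  have "compact (k ` cball 0 \<epsilon>)" by (intro compact_continuous_image continuous_on_subset[OF assms(1)]) auto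
  then obtain C where C: "\<And>z. z \<in> cball 0 \<epsilon> \<Longrightarrow> norm (k z) \<le> C" using compact_imp_bounded bounded_iff by (metis imageI)
  have "norm (k z) \<le> max C 0" for z using C[of z] assms(2)[of z] by (cases "norm z \<le> \<epsilon>") auto
  then show ?thesis by (intro exI[of _ "max C 0"]) auto
qed

definition mol :: "('a \<Rightarrow> 'c::{banach,second_countable_topology}) \<Rightarrow> 'a \<Rightarrow> 'c" where
  "mol f x = (\<integral>y. b (x - y) *\<^sub>R f y \<partial>lborel)"

lemma integrable_kernel:
  fixes f :: "'a \<Rightarrow> 'c::{banach,second_countable_topology}"
  assumes f: "integrable lborel f" and k: "k \<in> borel_measurable borel" and C: "\<And>z. norm (k z) \<le> C"
  shows "integrable lborel (\<lambda>y. k (x - y) *\<^sub>R f y)"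
proof (rule Bochner_Integration.integrable_bound[of _ "\<lambda>y. C *\<^sub>R norm (f y)"])
  show "integrable lborel (\<lambda>y. C *\<^sub>R norm (f y))" using f by (intro integrable_scaleR_right integrable_norm)
  show "(\<lambda>y. k (x - y) *\<^sub>R f y) \<in> borel_measurable lborel" using k f by measurable
  have "0 \<le> C" using C[of 0] norm_ge_zero order_trans by blast
  then show "AE y in lborel. norm (k (x - y) *\<^sub>R f y) \<le> norm (C *\<^sub>R norm (f y))"
    using C by (intro AE_I2) (simp add: mult_right_mono)
qed

text \<open>The derivative falls on the kernel. Uniform continuity of \<open>g\<close> bounds the
  linearisation error of \<open>b\<close> uniformly in the base point, so that it can be integrated
  against \<open>f\<close>.\<close>

lemma mol_has_derivative:
  fixes f :: "'a \<Rightarrow> 'c::{banach,second_countable_topology}"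
  assumes f: "integrable lborel f"
  shows "(mol f has_derivative (\<lambda>h. \<integral>y. (g (x - y) \<bullet> h) *\<^sub>R f y \<partial>lborel)) (at x)"
proof -
  obtain Cg where Cg: "Cg \<ge> 0" "\<And>z. norm (g z) \<le> Cg" using bounded_compact_support[OF g_cont g_supp] by blast
  obtain Cb where Cb: "Cb \<ge> 0" "\<And>z. norm (b z) \<le> Cb" using bounded_compact_support[OF b_cont b_supp] by blast
  have ib: "integrable lborel (\<lambda>y. b (x - y) *\<^sub>R f y)" for x by (rule integrable_kernel[OF f _ Cb(2)]) measurable
  have ig: "integrable lborel (\<lambda>y. (g (x - y) \<bullet> h) *\<^sub>R f y)" for x h
  proof (rule integrable_kernel[OF f])
    show "norm (g z \<bullet> h) \<le> Cg * norm h" for z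
      using Cauchy_Schwarz_ineq2[of "g z" h] mult_right_mono[OF Cg(2)[of z], of "norm h"] by simp
  qed measurable
  define I where "I = (\<integral>y. norm (f y) \<partial>lborel)"
  have I: "I \<ge> 0" unfolding I_def by simp
  have uc: "uniformly_continuous_on UNIV g"
    by (rule uniformly_continuous_compact_support[OF g_cont, of \<epsilon>]) (use g_supp in auto)
  show ?thesis unfolding has_derivative_at_alt
  proof (intro conjI allI impI)
    show "bounded_linear (\<lambda>h. \<integral>y. (g (x - y) \<bullet> h) *\<^sub>R f y \<partial>lborel)"
    proof (rule linear_conv_bounded_linear[THEN iffD1], rule linearI)
      fix h k :: 'a and r :: real
      show "(\<integral>y. (g (x - y) \<bullet> (h + k)) *\<^sub>R f y \<partial>lborel) = (\<integral>y. (g (x - y) \<bullet> h) *\<^sub>R f y \<partial>lborel) + (\<integral>y. (g (x - y) \<bullet> k) *\<^sub>R f y \<partial>lborel)"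
        using Bochner_Integration.integral_add[OF ig[of x h] ig[of x k]] by (simp add: inner_add_right scaleR_add_left)
      show "(\<integral>y. (g (x - y) \<bullet> (r *\<^sub>R h)) *\<^sub>R f y \<partial>lborel) = r *\<^sub>R (\<integral>y. (g (x - y) \<bullet> h) *\<^sub>R f y \<partial>lborel)"
        unfolding inner_scaleR_right scaleR_scaleR[symmetric] by (rule Bochner_Integration.integral_scaleR_right)
    qed
    fix e :: real assume e: "0 < e"
    define e' where "e' = e / (I + 1)"
    have e': "e' > 0" "e' * I \<le> e" using e I unfolding e'_def by (auto simp: field_simps)
    obtain d where d: "d > 0" "\<And>z w. dist w z < d \<Longrightarrow> dist (g w) (g z) < e'"
      using uc e'(1) unfolding uniformly_continuous_on_def by (metis UNIV_I)
    have lin: "\<bar>b (z + h) - b z - g z \<bullet> h\<bar> \<le> e' * norm h" if h: "norm h < d" for z h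
    proof -
      have "\<exists>t\<in>{0<..<1}. b (z + 1 *\<^sub>R h) - b (z + 0 *\<^sub>R h) = (\<lambda>u. g (z + t *\<^sub>R h) \<bullet> (u *\<^sub>R h)) (1 - 0)"
      proof (rule mvt_simple)
        fix t :: real
        have "((\<lambda>t. z + t *\<^sub>R h) has_derivative (\<lambda>u. u *\<^sub>R h)) (at t within {0..1})"
          by (auto intro!: derivative_eq_intros)
        from has_derivative_compose[OF this b_deriv]
        show "((\<lambda>t. b (z + t *\<^sub>R h)) has_derivative (\<lambda>u. g (z + t *\<^sub>R h) \<bullet> (u *\<^sub>R h))) (at t within {0..1})" .
      qed simp
      then obtain t where t: "0 < t" "t < 1" "b (z + h) - b z = g (z + t *\<^sub>R h) \<bullet> h" by auto
      have "dist (z + t *\<^sub>R h) z < d"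
      proof -
        have "t * norm h \<le> 1 * norm h" using t by (intro mult_right_mono) auto
        then show ?thesis using t h by (simp add: dist_norm)
      qed
      then have "norm (g (z + t *\<^sub>R h) - g z) < e'" using d(2) by (simp add: dist_norm)
      then have "norm (g (z + t *\<^sub>R h) - g z) * norm h \<le> e' * norm h" by (intro mult_right_mono) auto
      then show ?thesis unfolding t(3) inner_diff_left[symmetric]
        using Cauchy_Schwarz_ineq2[of "g (z + t *\<^sub>R h) - g z" h] by linarith
    qed
    show "\<exists>d>0. \<forall>y. norm (y - x) < d \<longrightarrow> norm (mol f y - mol f x - (\<integral>z. (g (x - z) \<bullet> (y - x)) *\<^sub>R f z \<partial>lborel)) \<le> e * norm (y - x)"
    proof (intro exI conjI allI impI)
      show "d > 0" by fact
      fix y assume y: "norm (y - x) < d"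
      have "mol f y - mol f x - (\<integral>z. (g (x - z) \<bullet> (y - x)) *\<^sub>R f z \<partial>lborel) =
         (\<integral>z. b (y - z) *\<^sub>R f z - b (x - z) *\<^sub>R f z - (g (x - z) \<bullet> (y - x)) *\<^sub>R f z \<partial>lborel)"
        unfolding mol_def using ib ig by (simp add: Bochner_Integration.integral_diff)
      also have "\<dots> = (\<integral>z. (b (y - z) - b (x - z) - (g (x - z) \<bullet> (y - x))) *\<^sub>R f z \<partial>lborel)"
        by (simp add: scaleR_diff_left)
      also have "norm \<dots> \<le> (\<integral>z. norm ((b (y - z) - b (x - z) - (g (x - z) \<bullet> (y - x))) *\<^sub>R f z) \<partial>lborel)"
        by (rule Bochner_Integration.integral_norm_bound)
      also have "\<dots> \<le> (\<integral>z. (e' * norm (y - x)) * norm (f z) \<partial>lborel)"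
      proof (rule integral_mono)
        show "integrable lborel (\<lambda>z. norm ((b (y - z) - b (x - z) - (g (x - z) \<bullet> (y - x))) *\<^sub>R f z))"
          unfolding scaleR_diff_left by (intro integrable_norm Bochner_Integration.integrable_diff ib ig)
        show "integrable lborel (\<lambda>z. e' * norm (y - x) * norm (f z))" using f by (intro integrable_mult_right integrable_norm)
        fix z
        have "\<bar>b (y - z) - b (x - z) - g (x - z) \<bullet> (y - x)\<bar> \<le> e' * norm (y - x)"
          using lin[OF y, of "x - z"] by simp
        then show "norm ((b (y - z) - b (x - z) - (g (x - z) \<bullet> (y - x))) *\<^sub>R f z) \<le> e' * norm (y - x) * norm (f z)"
          by (simp add: mult_right_mono)
      qed
      also have "\<dots> = (e' * I) * norm (y - x)" unfolding I_def by simp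
      also have "\<dots> \<le> e * norm (y - x)" using e' by (intro mult_right_mono) auto
      finally show "norm (mol f y - mol f x - (\<integral>z. (g (x - z) \<bullet> (y - x)) *\<^sub>R f z \<partial>lborel)) \<le> e * norm (y - x)" .
    qed
  qed
qed

lemma mol_continuous:
  assumes "integrable lborel f"
  shows "continuous_on UNIV (mol f)"
  using mol_has_derivative[OF assms] by (meson continuous_at_imp_continuous_on has_derivative_continuous)

end

lemma nn_integral_lborel_translate:
  fixes f :: "'a::euclidean_space \<Rightarrow> ennreal"
  assumes [measurable]: "f \<in> borel_measurable borel"
  shows "(\<integral>\<^sup>+y. f (y - x) \<partial>lborel) = (\<integral>\<^sup>+y. f y \<partial>lborel)"
proof -
  have "(\<integral>\<^sup>+y. f y \<partial>lborel) = (\<integral>\<^sup>+y. f y \<partial>(distr lborel borel ((+) (- x))))" by (simp add: lborel_distr_plus)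
  also have "\<dots> = (\<integral>\<^sup>+y. f (- x + y) \<partial>lborel)" by (rule nn_integral_distr) auto
  finally show ?thesis by (simp add: add.commute)
qed

lemma L2_bounded_support_integrable:
  fixes f :: "'a::euclidean_space \<Rightarrow> 'b::{banach, second_countable_topology}"
  assumes f[measurable]: "f \<in> borel_measurable borel" and fin: "(\<integral>\<^sup>+x. ennreal ((norm (f x))\<^sup>2) \<partial>lborel) < \<infinity>"
    and supp: "\<And>x. norm x > R \<Longrightarrow> f x = 0"
  shows "integrable lborel f" "integrable lborel (\<lambda>x. (norm (f x))\<^sup>2)"
proof -
  show sq: "integrable lborel (\<lambda>x. (norm (f x))\<^sup>2)"
    by (rule integrableI_bounded) (use fin in auto)
  have "integrable lborel (\<lambda>x. indicator (cball (0::'a) R) x + (norm (f x))\<^sup>2)"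
  proof (intro Bochner_Integration.integrable_add sq)
    show "integrable lborel (indicator (cball (0::'a) R) :: 'a \<Rightarrow> real)"
      using emeasure_bounded_finite[of "cball (0::'a) R"] by (simp add: less_top)
  qed
  then show "integrable lborel f"
  proof (rule Bochner_Integration.integrable_bound)
    show "AE x in lborel. norm (f x) \<le> norm (indicator (cball 0 R) x + (norm (f x))\<^sup>2 :: real)"
    proof (rule AE_I2)
      fix x :: 'a
      have "norm (f x) \<le> 1 + (norm (f x))\<^sup>2" using zero_le_power2[of "norm (f x) - 1/2"] by (simp add: power2_eq_square algebra_simps)
      then show "norm (f x) \<le> norm (indicator (cball 0 R) x + (norm (f x))\<^sup>2 :: real)" using supp[of x] by (cases "norm x \<le> R") auto
    qed
  qed measurable
qed

context mollifier
begin

lemma b_translate_nn: "(\<integral>\<^sup>+y. ennreal (b (x - y)) \<partial>lborel) = 1" "(\<integral>\<^sup>+y. ennreal (b (y - x)) \<partial>lborel) = 1"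
proof -
  show "(\<integral>\<^sup>+y. ennreal (b (y - x)) \<partial>lborel) = 1"
    using nn_integral_lborel_translate[of "\<lambda>z. ennreal (b z)" x] b_int by simp
  moreover have "b (x - y) = b (y - x)" for y using b_sym[of "y - x"] by simp
  ultimately show "(\<integral>\<^sup>+y. ennreal (b (x - y)) \<partial>lborel) = 1" by simp
qed

lemma b_translate_integral: "integrable lborel (\<lambda>y. b (x - y))" "(\<integral>y. b (x - y) \<partial>lborel) = 1"
proof -
  show "integrable lborel (\<lambda>y. b (x - y))"
    by (rule integrableI_bounded) (use b_translate_nn(1) b_nonneg in \<open>auto\<close>)
  show "(\<integral>y. b (x - y) \<partial>lborel) = 1"
    by (subst integral_eq_nn_integral) (use b_translate_nn(1) b_nonneg in auto)
qed

lemma b_bound: "\<exists>C\<ge>0. \<forall>z. norm (b z) \<le> C"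
  using bounded_compact_support[OF b_cont b_supp] by blast

lemma integrable_b: 
  fixes f :: "'a \<Rightarrow> 'c::{banach,second_countable_topology}"
  assumes "integrable lborel f"
  shows "integrable lborel (\<lambda>y. b (x - y) *\<^sub>R f y)"
  using b_bound integrable_kernel[OF assms b_measurable] by blast

lemma mol_diff:
  assumes "integrable lborel f" "integrable lborel h"
  shows "mol (\<lambda>x. f x - h x) x = mol f x - mol h x"
  unfolding mol_def scaleR_diff_right
  by (rule Bochner_Integration.integral_diff[OF integrable_b[OF assms(1)] integrable_b[OF assms(2)]])

text \<open>Jensen's inequality for the probability density \<open>b (x - y)\<close>: expand the
  nonnegative integral of the squared distance of \<open>f\<close> from its mean c.\<close>

lemma mol_sq_le:
  fixes f :: "'a \<Rightarrow> 'c::euclidean_space"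
  assumes f: "integrable lborel f" and f2: "integrable lborel (\<lambda>x. (norm (f x))\<^sup>2)"
  shows "ennreal ((norm (mol f x))\<^sup>2) \<le> (\<integral>\<^sup>+y. ennreal (b (x - y)) * ennreal ((norm (f y))\<^sup>2) \<partial>lborel)"
proof -
  define c where "c = mol f x"
  have i1: "integrable lborel (\<lambda>y. b (x - y) * (norm (f y))\<^sup>2)" using integrable_b[OF f2] by simp
  have i2: "integrable lborel (\<lambda>y. (b (x - y) *\<^sub>R f y) \<bullet> c)" using integrable_inner_left[OF integrable_b[OF f]] by blast
  have i3: "integrable lborel (\<lambda>y. b (x - y) * (norm c)\<^sup>2)" by (intro integrable_mult_left b_translate_integral)
  have "0 \<le> (\<integral>y. b (x - y) * (norm (f y - c))\<^sup>2 \<partial>lborel)" using b_nonneg by (intro Bochner_Integration.integral_nonneg) auto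
  also have "\<dots> = (\<integral>y. b (x - y) * (norm (f y))\<^sup>2 - 2 * ((b (x - y) *\<^sub>R f y) \<bullet> c) + b (x - y) * (norm c)\<^sup>2 \<partial>lborel)"
    by (intro Bochner_Integration.integral_cong) (auto simp: power2_norm_eq_inner algebra_simps inner_commute)
  also have "\<dots> = (\<integral>y. b (x - y) * (norm (f y))\<^sup>2 \<partial>lborel) - 2 * (\<integral>y. (b (x - y) *\<^sub>R f y) \<bullet> c \<partial>lborel) + (\<integral>y. b (x - y) * (norm c)\<^sup>2 \<partial>lborel)"
    using i1 i2 i3 by (simp add: Bochner_Integration.integral_add Bochner_Integration.integral_diff)
  also have "(\<integral>y. (b (x - y) *\<^sub>R f y) \<bullet> c \<partial>lborel) = c \<bullet> c"
  proof -
    have "(\<integral>y. (b (x - y) *\<^sub>R f y) \<bullet> c \<partial>lborel) = (\<integral>y. b (x - y) *\<^sub>R f y \<partial>lborel) \<bullet> c"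
      by (rule integral_inner_left) (intro integrable_b f)
    then show ?thesis unfolding mol_def[symmetric] c_def[symmetric] .
  qed
  also have "(\<integral>y. b (x - y) * (norm c)\<^sup>2 \<partial>lborel) = c \<bullet> c"
    using b_translate_integral(2) by (simp add: power2_norm_eq_inner)
  finally have "(norm c)\<^sup>2 \<le> (\<integral>y. b (x - y) * (norm (f y))\<^sup>2 \<partial>lborel)" by (simp add: power2_norm_eq_inner)
  then have "ennreal ((norm c)\<^sup>2) \<le> ennreal (\<integral>y. b (x - y) * (norm (f y))\<^sup>2 \<partial>lborel)" by (rule ennreal_leI)
  also have "\<dots> = (\<integral>\<^sup>+y. ennreal (b (x - y) * (norm (f y))\<^sup>2) \<partial>lborel)"
    using b_nonneg by (intro nn_integral_eq_integral[symmetric] i1) auto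
  also have "\<dots> = (\<integral>\<^sup>+y. ennreal (b (x - y)) * ennreal ((norm (f y))\<^sup>2) \<partial>lborel)"
    using b_nonneg by (simp add: ennreal_mult)
  finally show ?thesis unfolding c_def .
qed

text \<open>Integrate Jensen's inequality and exchange the integrals; the kernel has total mass 1 in
  either variable.\<close>

lemma mol_L2:
  fixes f :: "'a \<Rightarrow> 'c::euclidean_space"
  assumes f: "integrable lborel f" and f2: "integrable lborel (\<lambda>x. (norm (f x))\<^sup>2)"
  shows "(\<integral>\<^sup>+x. ennreal ((norm (mol f x))\<^sup>2) \<partial>lborel) \<le> (\<integral>\<^sup>+x. ennreal ((norm (f x))\<^sup>2) \<partial>lborel)"
proof -
  have [measurable]: "f \<in> borel_measurable borel" using f by simp
  have "(\<integral>\<^sup>+x. ennreal ((norm (mol f x))\<^sup>2) \<partial>lborel) \<le> (\<integral>\<^sup>+x. (\<integral>\<^sup>+y. ennreal (b (x - y)) * ennreal ((norm (f y))\<^sup>2) \<partial>lborel) \<partial>lborel)"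
    by (intro nn_integral_mono mol_sq_le f f2)
  also have "\<dots> = (\<integral>\<^sup>+y. (\<integral>\<^sup>+x. ennreal (b (x - y)) * ennreal ((norm (f y))\<^sup>2) \<partial>lborel) \<partial>lborel)"
    by (rule lborel_pair.Fubini') measurable
  also have "\<dots> = (\<integral>\<^sup>+y. ennreal ((norm (f y))\<^sup>2) \<partial>lborel)"
    by (simp add: nn_integral_multc b_translate_nn)
  finally show ?thesis .
qed

lemma mol_uniform:
  fixes h :: "'a \<Rightarrow> 'c::{banach,second_countable_topology}"
  assumes h: "integrable lborel h" and w: "\<And>y. dist y x < \<epsilon> \<Longrightarrow> norm (h y - h x) \<le> w" "w \<ge> 0"
  shows "norm (mol h x - h x) \<le> w"
proof -
  have "h x = (\<integral>y. b (x - y) *\<^sub>R h x \<partial>lborel)" using b_translate_integral by simp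
  then have "mol h x - h x = (\<integral>y. b (x - y) *\<^sub>R h y \<partial>lborel) - (\<integral>y. b (x - y) *\<^sub>R h x \<partial>lborel)" unfolding mol_def by simp
  also have "\<dots> = (\<integral>y. b (x - y) *\<^sub>R h y - b (x - y) *\<^sub>R h x \<partial>lborel)"
    by (rule Bochner_Integration.integral_diff[symmetric]) (intro integrable_b h, intro integrable_scaleR_left b_translate_integral)
  also have "\<dots> = (\<integral>y. b (x - y) *\<^sub>R (h y - h x) \<partial>lborel)" by (simp add: scaleR_diff_right)
  also have "norm \<dots> \<le> (\<integral>y. norm (b (x - y) *\<^sub>R (h y - h x)) \<partial>lborel)" by (rule Bochner_Integration.integral_norm_bound)
  also have "\<dots> \<le> (\<integral>y. b (x - y) * w \<partial>lborel)"
  proof (rule integral_mono)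
    show "integrable lborel (\<lambda>y. norm (b (x - y) *\<^sub>R (h y - h x)))"
      unfolding scaleR_diff_right
      by (intro integrable_norm Bochner_Integration.integrable_diff integrable_b h integrable_scaleR_left b_translate_integral)
    show "integrable lborel (\<lambda>y. b (x - y) * w)" by (intro integrable_mult_left b_translate_integral)
    fix y
    show "norm (b (x - y) *\<^sub>R (h y - h x)) \<le> b (x - y) * w"
    proof (cases "dist y x < \<epsilon>")
      case True
      then show ?thesis using w(1)[OF True] b_nonneg[of "x - y"] by (simp add: mult_left_mono)
    next
      case False
      then have "b (x - y) = 0" using b_supp[of "x - y"] by (simp add: dist_norm norm_minus_commute)
      then show ?thesis by simp
    qed
  qed
  also have "\<dots> = w" using b_translate_integral by simp
  finally show ?thesis .
qed

end

text \<open>Compare with a continuous h of bounded support, for which convergence is uniform, and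
  use that mollification contracts the L2 norm. The threshold does not depend on the kernel, so that
  one kernel can later serve a function and all components of its gradient.\<close>

lemma mollifier_L2_convergence:
  fixes f :: "'a::euclidean_space \<Rightarrow> 'c::euclidean_space"
  assumes f[measurable]: "f \<in> borel_measurable borel" and fin: "(\<integral>\<^sup>+x. ennreal ((norm (f x))\<^sup>2) \<partial>lborel) < \<infinity>"
    and supp: "\<And>x. norm x > R \<Longrightarrow> f x = 0" and \<delta>: "\<delta> > 0"
  shows "\<exists>\<epsilon>0>0. \<forall>\<epsilon> b g. \<epsilon> < \<epsilon>0 \<longrightarrow> mollifier \<epsilon> (b :: 'a \<Rightarrow> real) g \<longrightarrow>
    (\<integral>\<^sup>+x. ennreal ((norm (mollifier.mol b f x - f x))\<^sup>2) \<partial>lborel) < ennreal \<delta>"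
proof -
  \<comment> \<open>The three error terms add up to 6 \<delta>1 + \<delta> / 4 = 3 \<delta> /
    4.\<close>
  define \<delta>1 where "\<delta>1 = \<delta> / 12"
  have \<delta>1: "\<delta>1 > 0" using \<delta> unfolding \<delta>1_def by simp
  obtain h where hc: "continuous_on UNIV h" and hs: "\<And>x. norm x > R + 1 \<Longrightarrow> h x = 0"
    and hf: "(\<integral>\<^sup>+x. ennreal ((norm (f x - h x))\<^sup>2) \<partial>lborel) < ennreal \<delta>1"
    using L2_continuous_approx[OF f fin supp, where e="ennreal \<delta>1"] \<delta>1 by auto
  have [measurable]: "h \<in> borel_measurable borel" using hc by (rule borel_measurable_continuous_onI)
  note fi = L2_bounded_support_integrable[OF f fin supp]
  have fhi: "integrable lborel (\<lambda>x. f x - h x)" "integrable lborel (\<lambda>x. (norm (f x - h x))\<^sup>2)"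
    by (rule L2_bounded_support_integrable[of _ "R + 1"], use hf supp hs in \<open>auto simp: less_top[symmetric]\<close>)+
  have hi: "integrable lborel h" using Bochner_Integration.integrable_diff[OF fi(1) fhi(1)] by simp
  define V where "V = measure lborel (cball (0::'a) (R + 2))"
  have V: "V \<ge> 0" "emeasure lborel (cball (0::'a) (R + 2)) = ennreal V"
    using emeasure_bounded_finite[of "cball (0::'a) (R + 2)"] unfolding V_def by (auto simp: emeasure_eq_ennreal_measure less_top)
  \<comment> \<open>Uniform error allowed for \<open>mol h - h\<close>, which vanishes outside the
    ball of volume V; V + 1 avoids a zero denominator.\<close>
  define w where "w = sqrt (\<delta> / (16 * (V + 1)))"
  have w: "w > 0" "w\<^sup>2 * V \<le> \<delta> / 16" using \<delta> V unfolding w_def by (auto simp: field_simps)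
  have "uniformly_continuous_on UNIV h" by (rule uniformly_continuous_compact_support[OF hc hs])
  then obtain d where d: "d > 0" "\<And>x y. dist y x < d \<Longrightarrow> dist (h y) (h x) < w"
    using w(1) unfolding uniformly_continuous_on_def by (metis UNIV_I)
  show ?thesis
  proof (intro exI[of _ "min d 1"] conjI allI impI)
    show "min d 1 > 0" using d by simp
    fix \<epsilon> and b :: "'a \<Rightarrow> real" and g
    assume eb: "\<epsilon> < min d 1" and m: "mollifier \<epsilon> b g"
    interpret mollifier \<epsilon> b g by fact
    have [measurable]: "mol f \<in> borel_measurable borel" "mol h \<in> borel_measurable borel"
      using mol_continuous[OF fi(1)] mol_continuous[OF hi] by (auto intro: borel_measurable_continuous_onI)
    have B: "(\<integral>\<^sup>+x. ennreal ((norm (mol h x - h x))\<^sup>2) \<partial>lborel) \<le> ennreal (\<delta> / 16)"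
    proof -
      have "ennreal ((norm (mol h x - h x))\<^sup>2) \<le> ennreal (w\<^sup>2) * indicator (cball 0 (R + 2)) x" for x
      proof (cases "norm x \<le> R + 2")
        case True
        have "norm (mol h x - h x) \<le> w"
        proof (rule mol_uniform[OF hi])
          fix y assume "dist y x < \<epsilon>"
          then show "norm (h y - h x) \<le> w" using d(2)[of y x] eb by (simp add: dist_norm)
        qed (use w in simp)
        then show ?thesis using True by (auto intro!: ennreal_leI power_mono)
      next
        case False
        have "norm (mol h x - h x) \<le> 0"
        proof (rule mol_uniform[OF hi])
          fix y assume "dist y x < \<epsilon>"
          then have "norm y > R + 1" using False eb norm_triangle_sub[of x y] by (simp add: dist_norm norm_minus_commute)
          then show "norm (h y - h x) \<le> 0" using hs[of y] hs[of x] False by simp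
        qed simp
        then show ?thesis by simp
      qed
      then have "(\<integral>\<^sup>+x. ennreal ((norm (mol h x - h x))\<^sup>2) \<partial>lborel) \<le> (\<integral>\<^sup>+x. ennreal (w\<^sup>2) * indicator (cball (0::'a) (R + 2)) x \<partial>lborel)"
        by (intro nn_integral_mono) auto
      also have "\<dots> = ennreal (w\<^sup>2) * ennreal V" by (subst nn_integral_cmult_indicator) (auto simp: V)
      also have "\<dots> = ennreal (w\<^sup>2 * V)" using V by (simp add: ennreal_mult)
      also have "\<dots> \<le> ennreal (\<delta> / 16)" using w by (intro ennreal_leI)
      finally show ?thesis .
    qed
    have A: "(\<integral>\<^sup>+x. ennreal ((norm (mol f x - mol h x))\<^sup>2) \<partial>lborel) \<le> ennreal \<delta>1"
      using mol_L2[OF fhi] hf by (simp add: mol_diff[OF fi(1) hi])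
    have "(\<integral>\<^sup>+x. ennreal ((norm (mol f x - f x))\<^sup>2) \<partial>lborel) =
        (\<integral>\<^sup>+x. ennreal ((norm (((mol f x - mol h x) + (mol h x - h x)) + (h x - f x)))\<^sup>2) \<partial>lborel)" by simp
    also have "\<dots> \<le> 2 * (\<integral>\<^sup>+x. ennreal ((norm ((mol f x - mol h x) + (mol h x - h x)))\<^sup>2) \<partial>lborel) + 2 * (\<integral>\<^sup>+x. ennreal ((norm (h x - f x))\<^sup>2) \<partial>lborel)"
      by (rule nn_integral_norm_add_sq) measurable
    also have "\<dots> \<le> 2 * (2 * (\<integral>\<^sup>+x. ennreal ((norm (mol f x - mol h x))\<^sup>2) \<partial>lborel) + 2 * (\<integral>\<^sup>+x. ennreal ((norm (mol h x - h x))\<^sup>2) \<partial>lborel))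
        + 2 * (\<integral>\<^sup>+x. ennreal ((norm (h x - f x))\<^sup>2) \<partial>lborel)"
    proof (intro add_mono mult_left_mono order_refl)
      show "(\<integral>\<^sup>+x. ennreal ((norm ((mol f x - mol h x) + (mol h x - h x)))\<^sup>2) \<partial>lborel) \<le>
        2 * (\<integral>\<^sup>+x. ennreal ((norm (mol f x - mol h x))\<^sup>2) \<partial>lborel) + 2 * (\<integral>\<^sup>+x. ennreal ((norm (mol h x - h x))\<^sup>2) \<partial>lborel)"
        by (rule nn_integral_norm_add_sq) measurable
    qed auto
    also have "\<dots> \<le> 2 * (2 * ennreal \<delta>1 + 2 * ennreal (\<delta> / 16)) + 2 * ennreal \<delta>1"
      using A B hf by (intro add_mono mult_left_mono) (auto simp: norm_minus_commute)
    also have "\<dots> = ennreal (2 * (2 * \<delta>1 + 2 * (\<delta> / 16)) + 2 * \<delta>1)"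
    proof -
      have t: "2 * ennreal z = ennreal (2 * z)" if "z \<ge> 0" for z using that by (simp add: ennreal_mult)
      have p: "ennreal y + ennreal z = ennreal (y + z)" if "y \<ge> 0" "z \<ge> 0" for y z using that by (simp add: ennreal_plus)
      show ?thesis using \<delta> \<delta>1 by (simp only: t p add_nonneg_nonneg mult_nonneg_nonneg less_imp_le divide_nonneg_nonneg zero_le_numeral)
    qed
    also have "\<dots> < ennreal \<delta>" using \<delta> unfolding \<delta>1_def by (intro ennreal_lessI) auto
    finally show "(\<integral>\<^sup>+x. ennreal ((norm (mol f x - f x))\<^sup>2) \<partial>lborel) < ennreal \<delta>" .
  qed
qed

text \<open>The test function is the kernel reflected and translated to x, supported in
  \<open>cball x \<epsilon>\<close>. Its derivative in y is minus the value of \<open>g\<close> at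
  \<open>x - y\<close>, which cancels the sign in the definition of the weak gradient.\<close>

lemma mollifier_weak_gradient:
  fixes u :: "real^2 \<Rightarrow> complex" and G :: "real^2 \<Rightarrow> complex^2"
  assumes m: "mollifier \<epsilon> b (g :: real^2 \<Rightarrow> real^2)" and w: "has_weak_gradient \<Omega> u G" and x: "cball x \<epsilon> \<subseteq> \<Omega>"
  shows "(\<integral>y. (g (x - y) $ i) *\<^sub>R (indicator \<Omega> y *\<^sub>R u y) \<partial>lborel) = mollifier.mol b (\<lambda>y. indicator \<Omega> y *\<^sub>R (G y $ i)) x"
proof -
  interpret mollifier \<epsilon> b g by fact
  have tf: "test_function_on \<Omega> (\<lambda>y. b (x - y))"
    unfolding test_function_on_def
  proof (intro conjI exI[of _ "cball x \<epsilon>"] allI impI)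
    show "smooth_on (\<lambda>y. b (x - y)) UNIV" by (rule bump_expr_smooth[OF b_smooth])
    show "b (x - y) = 0" if "y \<notin> cball x \<epsilon>" for y using that by (intro b_supp) (simp add: dist_norm)
  qed (use x in auto)
  have fd: "frechet_derivative (\<lambda>y. b (x - y)) (at y) (axis i 1) = - (g (x - y) $ i)" for y
  proof -
    have "((\<lambda>y. x - y) has_derivative (\<lambda>h. - h)) (at y)"
      using has_derivative_diff[OF has_derivative_const[of x] has_derivative_ident] by simp
    from has_derivative_compose[OF this b_deriv]
    have "((\<lambda>y. b (x - y)) has_derivative (\<lambda>h. g (x - y) \<bullet> - h)) (at y)" .
    from frechet_derivative_at[OF this, symmetric] show ?thesis by (simp add: inner_axis)
  qed
  have "(LINT y:\<Omega>|lborel. (- (g (x - y) $ i)) *\<^sub>R u y) = - (LINT y:\<Omega>|lborel. b (x - y) *\<^sub>R (G y $ i))"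
    using w[unfolded has_weak_gradient_def, rule_format, OF tf, of i] unfolding fd .
  then show ?thesis
    unfolding mol_def set_lebesgue_integral_def by (simp add: mult.commute)
qed

text \<open>Interior mollification: once the \<epsilon>-neighbourhood of K lies in the domain, the
  gradient of the mollified u on K is the mollified G. Approximation on compact subsets is enough
  because the leaves with s in a compact subinterval of (0, 1) fill a compact set.\<close>

lemma smooth_approximation:
  fixes u :: "real^2 \<Rightarrow> complex" and G :: "real^2 \<Rightarrow> complex^2"
  assumes \<Omega>: "open \<Omega>" "bounded \<Omega>" and H: "H1_with_gradient \<Omega> u G" and K: "compact K" "K \<subseteq> \<Omega>" and \<delta>: "\<delta> > 0"
  shows "\<exists>v w. (\<forall>x\<in>K. (v has_derivative (\<lambda>h. \<Sum>i\<in>UNIV. (h $ i) *\<^sub>R (w x $ i))) (at x)) \<and> continuous_on UNIV v \<and> continuous_on UNIV w \<and>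
    (\<integral>\<^sup>+x\<in>K. ennreal ((norm (v x - u x))\<^sup>2) \<partial>lborel) < ennreal \<delta> \<and> (\<integral>\<^sup>+x\<in>K. ennreal ((norm (w x - G x))\<^sup>2) \<partial>lborel) < ennreal \<delta>"
proof -
  define u0 where "u0 y = indicator \<Omega> y *\<^sub>R u y" for y
  define G0 where "G0 i y = indicator \<Omega> y *\<^sub>R (G y $ i)" for i y
  have \<Omega>m[measurable]: "\<Omega> \<in> sets borel" using \<Omega> by simp
  obtain R where R: "\<And>x. x \<in> \<Omega> \<Longrightarrow> norm x \<le> R" using \<Omega>(2) bounded_iff by metis
  have u: "set_borel_measurable lborel \<Omega> u" "(\<integral>\<^sup>+x\<in>\<Omega>. ennreal ((norm (u x))\<^sup>2) \<partial>lborel) < \<infinity>"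
    and G: "set_borel_measurable lborel \<Omega> G" "(\<integral>\<^sup>+x\<in>\<Omega>. ennreal ((norm (G x))\<^sup>2) \<partial>lborel) < \<infinity>"
    and wg: "has_weak_gradient \<Omega> u G"
    using H unfolding H1_with_gradient_def L2_on_def by auto
  have um[measurable]: "u0 \<in> borel_measurable borel" using u(1) unfolding set_borel_measurable_def u0_def by simp
  have Gm[measurable]: "(\<lambda>y. indicator \<Omega> y *\<^sub>R G y) \<in> borel_measurable borel" using G(1) unfolding set_borel_measurable_def by simp
  have "G0 i = (\<lambda>y. (indicator \<Omega> y *\<^sub>R G y) $ i)" for i unfolding G0_def by auto
  moreover have "(\<lambda>y. (indicator \<Omega> y *\<^sub>R G y) $ i) \<in> borel_measurable borel" for i
    by (rule measurable_compose[OF Gm]) (intro borel_measurable_continuous_onI continuous_intros)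
  ultimately have G0m[measurable]: "G0 i \<in> borel_measurable borel" for i by simp
  have u0f: "(\<integral>\<^sup>+x. ennreal ((norm (u0 x))\<^sup>2) \<partial>lborel) < \<infinity>"
  proof -
    have "(\<integral>\<^sup>+x. ennreal ((norm (u0 x))\<^sup>2) \<partial>lborel) = (\<integral>\<^sup>+x\<in>\<Omega>. ennreal ((norm (u x))\<^sup>2) \<partial>lborel)"
      by (intro nn_integral_cong) (auto simp: u0_def split: split_indicator)
    then show ?thesis using u(2) by simp
  qed
  have G0f: "(\<integral>\<^sup>+x. ennreal ((norm (G0 i x))\<^sup>2) \<partial>lborel) < \<infinity>" for i
  proof -
    have "(\<integral>\<^sup>+x. ennreal ((norm (G0 i x))\<^sup>2) \<partial>lborel) \<le> (\<integral>\<^sup>+x\<in>\<Omega>. ennreal ((norm (G x))\<^sup>2) \<partial>lborel)"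
      by (intro nn_integral_mono) (auto simp: G0_def intro!: ennreal_leI power_mono Finite_Cartesian_Product.norm_nth_le split: split_indicator)
    then show ?thesis using G(2) by (rule le_less_trans)
  qed
  have supp: "u0 x = 0" "G0 i x = 0" if "norm x > R" for x i using R[of x] that unfolding u0_def G0_def by (cases "x \<in> \<Omega>"; simp)+
  define \<delta>' where "\<delta>' = \<delta> / 4"
  have \<delta>': "\<delta>' > 0" using \<delta> unfolding \<delta>'_def by simp
  obtain e0 where e0: "e0 > 0" "\<And>\<epsilon> b g. \<epsilon> < e0 \<Longrightarrow> mollifier \<epsilon> (b :: real^2 \<Rightarrow> real) g \<Longrightarrow>
    (\<integral>\<^sup>+x. ennreal ((norm (mollifier.mol b u0 x - u0 x))\<^sup>2) \<partial>lborel) < ennreal \<delta>'"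
    using mollifier_L2_convergence[OF um u0f supp(1) \<delta>'] by blast
  have "\<forall>i. \<exists>e. e > 0 \<and> (\<forall>\<epsilon> b g. \<epsilon> < e \<longrightarrow> mollifier \<epsilon> (b :: real^2 \<Rightarrow> real) g \<longrightarrow>
    (\<integral>\<^sup>+x. ennreal ((norm (mollifier.mol b (G0 i) x - G0 i x))\<^sup>2) \<partial>lborel) < ennreal \<delta>')"
    using mollifier_L2_convergence[OF G0m G0f supp(2) \<delta>'] by blast
  then obtain ei where ei: "\<And>i. ei i > 0" "\<And>i \<epsilon> b g. \<epsilon> < ei i \<Longrightarrow> mollifier \<epsilon> (b :: real^2 \<Rightarrow> real) g \<Longrightarrow>
    (\<integral>\<^sup>+x. ennreal ((norm (mollifier.mol b (G0 i) x - G0 i x))\<^sup>2) \<partial>lborel) < ennreal \<delta>'"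
    by metis
  obtain eK where eK: "eK > 0" "(\<Union>x\<in>K. ball x eK) \<subseteq> \<Omega>"
    using compact_subset_open_imp_ball_epsilon_subset[OF K(1) \<Omega>(1) K(2)] by blast
  define \<epsilon> where "\<epsilon> = min (min e0 eK) (min (ei 1) (ei 2)) / 2"
  have eps: "\<epsilon> > 0" "\<epsilon> < e0" "\<epsilon> < eK" "\<epsilon> < ei i" for i :: 2
    using e0(1) eK(1) ei(1)[of 1] ei(1)[of 2] exhaust_2[of i] unfolding \<epsilon>_def by auto
  obtain b g where m: "mollifier \<epsilon> (b :: real^2 \<Rightarrow> real) g" using mollifier_exists[OF eps(1)] by blast
  interpret mollifier \<epsilon> b g by fact
  note u0i = L2_bounded_support_integrable[OF um u0f supp(1)]
  note G0i = L2_bounded_support_integrable[OF G0m G0f supp(2)]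
  define w where "w x = (\<chi> i. mol (G0 i) x)" for x
  have "(mol u0 has_derivative (\<lambda>h. \<Sum>i\<in>UNIV. (h $ i) *\<^sub>R (w x $ i))) (at x)" if x: "x \<in> K" for x
  proof -
    have "cball x \<epsilon> \<subseteq> ball x eK" using eps(3) by auto
    then have cb: "cball x \<epsilon> \<subseteq> \<Omega>" using eK(2) x by blast
    obtain Cg where Cg: "\<And>z. norm (g z) \<le> Cg" using bounded_compact_support[OF g_cont g_supp] by blast
    have ig: "integrable lborel (\<lambda>y. (g (x - y) $ i) *\<^sub>R u0 y)" for i
    proof (rule integrable_kernel[OF u0i(1)])
      show "norm (g z $ i) \<le> Cg" for z using Cg[of z] Finite_Cartesian_Product.norm_nth_le[of "g z" i] by linarith
      show "(\<lambda>z. g z $ i) \<in> borel_measurable borel"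
        by (intro borel_measurable_continuous_onI continuous_intros g_cont)
    qed
    have "(\<integral>y. (g (x - y) \<bullet> h) *\<^sub>R u0 y \<partial>lborel) = (\<Sum>i\<in>UNIV. (h $ i) *\<^sub>R (w x $ i))" for h
    proof -
      have "(\<integral>y. (g (x - y) \<bullet> h) *\<^sub>R u0 y \<partial>lborel) = (\<integral>y. (\<Sum>i\<in>UNIV. (h $ i) *\<^sub>R ((g (x - y) $ i) *\<^sub>R u0 y)) \<partial>lborel)"
        by (intro Bochner_Integration.integral_cong refl) (simp add: inner_vec_def scaleR_sum_left mult.commute)
      also have "\<dots> = (\<Sum>i\<in>UNIV. (\<integral>y. (h $ i) *\<^sub>R ((g (x - y) $ i) *\<^sub>R u0 y) \<partial>lborel))"
        by (intro Bochner_Integration.integral_sum integrable_scaleR_right ig)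
      also have "\<dots> = (\<Sum>i\<in>UNIV. (h $ i) *\<^sub>R (w x $ i))"
        using mollifier_weak_gradient[OF m wg cb] unfolding w_def u0_def G0_def
        by (intro sum.cong refl) (simp add: Bochner_Integration.integral_scaleR_right del: scaleR_scaleR)
      finally show ?thesis .
    qed
    then show ?thesis using mol_has_derivative[OF u0i(1), where x = x] by simp
  qed
  moreover have "continuous_on UNIV (mol u0)" by (rule mol_continuous[OF u0i(1)])
  moreover have wc: "continuous_on UNIV w" unfolding w_def
    by (intro continuous_on_vec_lambda mol_continuous[OF G0i(1)])
  moreover have "(\<integral>\<^sup>+x\<in>K. ennreal ((norm (mol u0 x - u x))\<^sup>2) \<partial>lborel) < ennreal \<delta>"
  proof -
    have "(\<integral>\<^sup>+x\<in>K. ennreal ((norm (mol u0 x - u x))\<^sup>2) \<partial>lborel) \<le> (\<integral>\<^sup>+x. ennreal ((norm (mol u0 x - u0 x))\<^sup>2) \<partial>lborel)"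
      using K(2) by (intro nn_integral_mono) (auto simp: u0_def split: split_indicator)
    also have "\<dots> < ennreal \<delta>'" by (rule e0(2)[OF eps(2) m])
    also have "\<dots> \<le> ennreal \<delta>" unfolding \<delta>'_def using \<delta> by (intro ennreal_leI) auto
    finally show ?thesis .
  qed
  moreover have "(\<integral>\<^sup>+x\<in>K. ennreal ((norm (w x - G x))\<^sup>2) \<partial>lborel) < ennreal \<delta>"
  proof -
    have mm[measurable]: "mol (G0 i) \<in> borel_measurable borel" for i
      using mol_continuous[OF G0i(1)] by (rule borel_measurable_continuous_onI)
    have "(\<integral>\<^sup>+x\<in>K. ennreal ((norm (w x - G x))\<^sup>2) \<partial>lborel) \<le>
       (\<integral>\<^sup>+x. ennreal ((norm (mol (G0 1) x - G0 1 x))\<^sup>2) + ennreal ((norm (mol (G0 2) x - G0 2 x))\<^sup>2) \<partial>lborel)"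
    proof (rule nn_integral_mono)
      fix x
      show "ennreal ((norm (w x - G x))\<^sup>2) * indicator K x \<le> ennreal ((norm (mol (G0 1) x - G0 1 x))\<^sup>2) + ennreal ((norm (mol (G0 2) x - G0 2 x))\<^sup>2)"
      proof (cases "x \<in> K")
        case True
        then have "x \<in> \<Omega>" using K by blast
        then have "(norm (w x - G x))\<^sup>2 = (norm (mol (G0 1) x - G0 1 x))\<^sup>2 + (norm (mol (G0 2) x - G0 2 x))\<^sup>2"
          by (simp add: norm_vec_def L2_set_def sum_2 w_def G0_def)
        then show ?thesis using True by (simp add: ennreal_plus)
      qed simp
    qed
    also have "\<dots> = (\<integral>\<^sup>+x. ennreal ((norm (mol (G0 1) x - G0 1 x))\<^sup>2) \<partial>lborel) + (\<integral>\<^sup>+x. ennreal ((norm (mol (G0 2) x - G0 2 x))\<^sup>2) \<partial>lborel)"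
      by (rule nn_integral_add) measurable
    also have "\<dots> \<le> ennreal \<delta>' + ennreal \<delta>'"
      using ei(2)[OF eps(4) m] by (intro add_mono less_imp_le) auto
    also have "\<dots> = ennreal (\<delta>' + \<delta>')" using \<delta>' by (intro ennreal_plus[symmetric]) auto
    also have "\<dots> < ennreal \<delta>" unfolding \<delta>'_def using \<delta> by (intro ennreal_lessI) auto
    finally show ?thesis .
  qed
  ultimately show ?thesis by blast
qed

subsection \<open>Convex regions in polar coordinates\<close>

definition dir :: "real \<Rightarrow> real^2" where
  "dir \<theta> = (\<chi> i. if i = 1 then cos \<theta> else sin \<theta>)"

lemma dir_nth [simp]: "dir \<theta> $ 1 = cos \<theta>" "dir \<theta> $ 2 = sin \<theta>"
  by (simp_all add: dir_def)

lemma inner_dir: "dir a \<bullet> dir b = cos (a - b)"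
  by (simp add: inner_vec_def sum_2 cos_diff)

lemma norm_dir [simp]: "norm (dir a) = 1"
  by (simp add: norm_eq_sqrt_inner inner_dir)

definition radius :: "(real^2) set \<Rightarrow> real^2 \<Rightarrow> real^2 \<Rightarrow> real" where
  "radius C p e = Sup {t. 0 \<le> t \<and> p + t *\<^sub>R e \<in> C}"

locale convex_region =
  fixes C :: "(real^2) set" and p :: "real^2"
  assumes convex: "convex C" and open_C: "open C" and bounded: "bounded C" and p: "p \<in> C"
begin

lemma radius_bdd: "norm e = 1 \<Longrightarrow> \<exists>M. \<forall>t. 0 \<le> t \<and> p + t *\<^sub>R e \<in> C \<longrightarrow> t \<le> M"
proof -
  assume e: "norm e = 1"
  obtain M where M: "\<And>x. x \<in> C \<Longrightarrow> norm x \<le> M" using bounded bounded_iff by metis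
  have "t \<le> M + norm p" if "0 \<le> t" "p + t *\<^sub>R e \<in> C" for t
    using M[OF that(2)] norm_triangle_ineq4[of "p + t *\<^sub>R e" p] e that(1) by simp
  then show ?thesis by blast
qed

lemma radius_le_iff:
  assumes e: "norm e = 1" and t: "0 \<le> t"
  shows "p + t *\<^sub>R e \<in> C \<longleftrightarrow> t < radius C p e"
proof
  obtain M where M: "\<forall>t. 0 \<le> t \<and> p + t *\<^sub>R e \<in> C \<longrightarrow> t \<le> M" using radius_bdd[OF e] by blast
  have bdd: "bdd_above {t. 0 \<le> t \<and> p + t *\<^sub>R e \<in> C}" using M by (intro bdd_aboveI[of _ M]) auto
  show "t < radius C p e" if tC: "p + t *\<^sub>R e \<in> C"
  proof -
    obtain d where d: "d > 0" "ball (p + t *\<^sub>R e) d \<subseteq> C" using open_C tC open_contains_ball by blast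
    have "p + (t + d / 2) *\<^sub>R e \<in> ball (p + t *\<^sub>R e) d" using d e by (simp add: dist_norm scaleR_add_left)
    then have "t + d / 2 \<in> {t. 0 \<le> t \<and> p + t *\<^sub>R e \<in> C}" using d t by auto
    then have "t + d / 2 \<le> radius C p e" unfolding radius_def by (intro cSup_upper bdd)
    then show ?thesis using d by simp
  qed
  show "p + t *\<^sub>R e \<in> C" if "t < radius C p e"
  proof -
    have "0 \<in> {t. 0 \<le> t \<and> p + t *\<^sub>R e \<in> C}" using p by simp
    then have ne: "{t. 0 \<le> t \<and> p + t *\<^sub>R e \<in> C} \<noteq> {}" by (metis empty_iff)
    from less_cSup_iff[OF ne bdd, of t] that[unfolded radius_def]
    obtain s where s: "0 \<le> s" "p + s *\<^sub>R e \<in> C" "t < s" by auto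
    have "(t / s) *\<^sub>R (s *\<^sub>R e) = t *\<^sub>R e" using s t by simp
    then have "p + t *\<^sub>R e = (1 - t / s) *\<^sub>R p + (t / s) *\<^sub>R (p + s *\<^sub>R e)"
      unfolding scaleR_add_right scaleR_diff_left by (simp del: scaleR_scaleR)
    moreover have "(1 - t / s) *\<^sub>R p + (t / s) *\<^sub>R (p + s *\<^sub>R e) \<in> C"
      by (rule convexD[OF convex p s(2)]) (use s t in auto)
    ultimately show ?thesis by simp
  qed
qed

lemma radius_pos: "norm e = 1 \<Longrightarrow> 0 < radius C p e"
  using radius_le_iff[of e 0] p by simp

lemma radius_not_in: "norm e = 1 \<Longrightarrow> p + radius C p e *\<^sub>R e \<notin> C"
  using radius_le_iff[of e "radius C p e"] radius_pos[of e] by simp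

lemma radius_in_closure:
  assumes e: "norm e = 1"
  shows "p + radius C p e *\<^sub>R e \<in> closure C"
  unfolding closure_approachable
proof (intro allI impI)
  fix d :: real assume d: "0 < d"
  define t where "t = max 0 (radius C p e - d / 2)"
  have t: "0 \<le> t" "t < radius C p e" "radius C p e - t < d" using d radius_pos[OF e] unfolding t_def by auto
  have "dist (p + t *\<^sub>R e) (p + radius C p e *\<^sub>R e) = \<bar>t - radius C p e\<bar>"
    using e by (simp add: dist_norm flip: scaleR_diff_left)
  then show "\<exists>y\<in>C. dist y (p + radius C p e *\<^sub>R e) < d"
    using radius_le_iff[OF e t(1)] t by (intro bexI[of _ "p + t *\<^sub>R e"]) auto
qed

lemma radius_frontier: "norm e = 1 \<Longrightarrow> p + radius C p e *\<^sub>R e \<in> frontier C"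
  using radius_in_closure radius_not_in open_C by (simp add: frontier_def interior_open)

lemma segment_to_closure_in:
  assumes y: "p + y \<in> closure C" and t: "0 \<le> t" "t < 1" and q: "q \<in> C"
  shows "q + t *\<^sub>R (p + y - q) \<in> C"
proof (cases "q = p + y \<or> t = 0")
  case False
  have "q + t *\<^sub>R (p + y - q) = (1 - t) *\<^sub>R q + t *\<^sub>R (p + y)" by (simp add: algebra_simps)
  then have "q + t *\<^sub>R (p + y - q) \<in> open_segment q (p + y)" using False t
    unfolding in_segment by (intro conjI exI[of _ t]) auto
  moreover have "open_segment q (p + y) \<subseteq> interior C"
    by (rule in_interior_closure_convex_segment[OF convex _ y]) (use q open_C in \<open>simp add: interior_open\<close>)
  ultimately show ?thesis using interior_subset by blast
qed (use q in auto)

lemma closure_radius_le: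
  assumes e: "norm e = 1" and t: "0 \<le> t" and c: "p + t *\<^sub>R e \<in> closure C"
  shows "t \<le> radius C p e"
proof (rule ccontr)
  assume "\<not> ?thesis"
  then have t: "radius C p e < t" by simp
  have "p + (radius C p e / t) *\<^sub>R (p + t *\<^sub>R e - p) \<in> C"
    by (rule segment_to_closure_in[OF c _ _ p]) (use t radius_pos[OF e] in auto)
  then show False using radius_not_in[OF e] t radius_pos[OF e] by simp
qed

lemma frontier_radius:
  assumes e: "norm e = 1" and t: "0 \<le> t" and c: "p + t *\<^sub>R e \<in> frontier C"
  shows "t = radius C p e"
proof -
  have "p + t *\<^sub>R e \<notin> C" "p + t *\<^sub>R e \<in> closure C" using c open_C by (auto simp: frontier_def interior_open)
  then show ?thesis using closure_radius_le[OF e t] radius_le_iff[OF e t] by simp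
qed

lemma ball_radius_le:
  assumes "ball p \<rho> \<subseteq> C" "norm e = 1"
  shows "\<rho> \<le> radius C p e"
proof (rule ccontr)
  assume "\<not> ?thesis"
  then have "p + radius C p e *\<^sub>R e \<in> ball p \<rho>" using radius_pos[OF assms(2)] assms(2) by (simp add: dist_norm)
  then show False using assms radius_not_in by blast
qed

text \<open>If the foot of the perpendicular from \<open>p\<close> to the chord lies outside the chord, then it cannot lie in
  the ball, as an endpoint of the chord would then be interior.\<close>

lemma chord_distance_outer:
  assumes b: "ball p \<rho> \<subseteq> C" "0 < \<rho>" and v: "p + v \<notin> C" and v': "p + v' \<in> closure C" and c: "v \<bullet> v < v \<bullet> v'"
  shows "\<rho>\<^sup>2 * ((v' - v) \<bullet> (v' - v)) \<le> (v \<bullet> v) * (v' \<bullet> v') - (v \<bullet> v')\<^sup>2"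
proof (rule ccontr)
  assume n: "\<not> ?thesis"
  define L where "L = (v' - v) \<bullet> (v' - v)"
  have "v' \<noteq> v" using c by auto
  then have L: "L > 0" unfolding L_def by simp
  define s where "s = (v \<bullet> v' - v \<bullet> v) / L"
  have s: "s > 0" using c L unfolding s_def by simp
  define q where "q = v - s *\<^sub>R (v' - v)"
  have sL: "s * L = v \<bullet> v' - v \<bullet> v" unfolding s_def using L by simp
  have "q \<bullet> q * L = (v \<bullet> v) * (v' \<bullet> v') - (v \<bullet> v')\<^sup>2"
  proof -
    have "q \<bullet> q = v \<bullet> v - 2 * s * (v \<bullet> v' - v \<bullet> v) + s * (s * L)"
      unfolding q_def L_def by (simp add: inner_diff_left inner_diff_right inner_commute algebra_simps)
    also have "\<dots> = v \<bullet> v - s * (v \<bullet> v' - v \<bullet> v)" unfolding sL by simp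
    finally have qq: "q \<bullet> q = v \<bullet> v - s * (v \<bullet> v' - v \<bullet> v)" .
    have "q \<bullet> q * L = v \<bullet> v * L - (s * L) * (v \<bullet> v' - v \<bullet> v)" unfolding qq by (simp add: algebra_simps)
    also have "\<dots> = (v \<bullet> v) * (v' \<bullet> v') - (v \<bullet> v')\<^sup>2"
      unfolding sL unfolding L_def by (simp add: inner_diff_left inner_diff_right inner_commute power2_eq_square algebra_simps)
    finally show ?thesis .
  qed
  then have "q \<bullet> q * L < \<rho>\<^sup>2 * L" using n unfolding L_def by simp
  then have "q \<bullet> q < \<rho>\<^sup>2" using L by simp
  then have "norm q < \<rho>" using b(2) by (simp add: norm_eq_sqrt_inner real_less_lsqrt)
  then have qC: "p + q \<in> C" using b(1) by (auto simp: dist_norm)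
  have "p + q + (s / (1 + s)) *\<^sub>R (p + v' - (p + q)) \<in> C"
    by (rule segment_to_closure_in[OF v' _ _ qC]) (use s in auto)
  moreover have "p + q + (s / (1 + s)) *\<^sub>R (p + v' - (p + q)) = p + v"
  proof -
    have "p + v' - (p + q) = (1 + s) *\<^sub>R (v' - v)" unfolding q_def by (simp add: algebra_simps)
    then have "(s / (1 + s)) *\<^sub>R (p + v' - (p + q)) = s *\<^sub>R (v' - v)" using s by simp
    then show ?thesis unfolding q_def by simp
  qed
  ultimately show False using v by (simp only:)
qed

end

text \<open>If c is the cosine of the angle between sides R and R' of a triangle, the bracket on the
  left is the squared chord by the law of cosines. The claim then says that the height over the
  chord is at least c times the shorter side R.\<close>

lemma chord_distance_inner:
  fixes c R R' :: real
  assumes c: "0 \<le> c" "c \<le> 1" and R: "c * R' \<le> R" "R \<le> R'" "0 \<le> R"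
  shows "c\<^sup>2 * (R\<^sup>2 + R'\<^sup>2 - 2 * R * R' * c) \<le> R'\<^sup>2 * (1 - c\<^sup>2)"
proof -
  have "0 \<le> c\<^sup>2 * ((R - c * R') * (R' - R))" using R by simp
  moreover have "0 \<le> c\<^sup>2 * (1 - c) * (R' * (R' - R))" using R c by simp
  moreover have "0 \<le> R'\<^sup>2 * ((1 - c)\<^sup>2 * (1 + 2 * c))" using c by simp
  moreover have "R'\<^sup>2 * (1 - c\<^sup>2) - c\<^sup>2 * (R\<^sup>2 + R'\<^sup>2 - 2 * R * R' * c) =
     c\<^sup>2 * ((R - c * R') * (R' - R)) + c\<^sup>2 * (1 - c) * (R' * (R' - R)) + R'\<^sup>2 * ((1 - c)\<^sup>2 * (1 + 2 * c))"
    by (simp add: power2_eq_square algebra_simps)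
  ultimately show ?thesis by linarith
qed

context convex_region
begin

text \<open>R R' sin \<Delta> is the length of the chord times the distance of p from its line, so
  the claim is that this distance is at least \<rho> cos \<Delta>. If the foot of the perpendicular
  lies beyond an endpoint, the distance is even at least \<rho>; if it lies on the chord, the
  distance is at least cos \<Delta> times the shorter radius.\<close>

lemma chord_bound:
  assumes b: "ball p \<rho> \<subseteq> C" "0 < \<rho>" and \<Delta>: "0 \<le> \<Delta>" "\<Delta> \<le> pi / 2"
    and R: "R = radius C p (dir \<theta>)" "R' = radius C p (dir (\<theta> + \<Delta>))"
  shows "\<rho> * cos \<Delta> * norm (R' *\<^sub>R dir (\<theta> + \<Delta>) - R *\<^sub>R dir \<theta>) \<le> R * R' * sin \<Delta>"
proof -
  define v where "v = R *\<^sub>R dir \<theta>"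
  define v' where "v' = R' *\<^sub>R dir (\<theta> + \<Delta>)"
  define c where "c = cos \<Delta>"
  have c: "0 \<le> c" "c \<le> 1" using \<Delta> unfolding c_def by (auto intro: cos_ge_zero)
  have s: "sin \<Delta> \<ge> 0" "(sin \<Delta>)\<^sup>2 = 1 - c\<^sup>2" using \<Delta> unfolding c_def by (auto intro!: sin_ge_zero simp: sin_squared_eq)
  have R0: "R \<ge> \<rho>" "R' \<ge> \<rho>" "R > 0" "R' > 0" unfolding R by (simp_all add: ball_radius_le[OF b(1)] radius_pos)
  have vv: "v \<bullet> v = R\<^sup>2" "v' \<bullet> v' = R'\<^sup>2" "v \<bullet> v' = R * R' * c"
    unfolding v_def v'_def c_def by (simp_all add: inner_dir power2_eq_square)
  have mem: "p + v \<notin> C" "p + v' \<notin> C" "p + v \<in> closure C" "p + v' \<in> closure C"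
    unfolding v_def v'_def R by (simp_all add: radius_not_in radius_in_closure)
  define L where "L = (v' - v) \<bullet> (v' - v)"
  have L: "L = R\<^sup>2 + R'\<^sup>2 - 2 * R * R' * c" unfolding L_def by (simp add: inner_diff_left inner_diff_right inner_commute[of v' v] vv)
  have L': "L = (v - v') \<bullet> (v - v')" unfolding L_def by (simp add: inner_diff_left inner_diff_right)
  have L0: "L \<ge> 0" unfolding L_def by simp
  have goal: "(\<rho> * c)\<^sup>2 * L \<le> R\<^sup>2 * R'\<^sup>2 * (1 - c\<^sup>2)"
  proof -
    consider "R < R' * c" | "R' < R * c" | "R' * c \<le> R" "R * c \<le> R'" by linarith
    then show ?thesis
    proof cases
      case 1
      then have "v \<bullet> v < v \<bullet> v'" using R0 unfolding vv by (simp add: power2_eq_square)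
      from chord_distance_outer[OF b mem(1,4) this]
      have "\<rho>\<^sup>2 * L \<le> R\<^sup>2 * R'\<^sup>2 * (1 - c\<^sup>2)" unfolding vv L_def[symmetric] by (simp add: power2_eq_square algebra_simps)
      moreover have "(\<rho> * c)\<^sup>2 * L \<le> \<rho>\<^sup>2 * L" using c b L0 by (intro mult_right_mono power_mono) (auto simp: mult_left_le)
      ultimately show ?thesis by linarith
    next
      case 2
      then have "v' \<bullet> v' < v' \<bullet> v" using R0 unfolding inner_commute[of v' v] vv by (simp add: power2_eq_square algebra_simps)
      from chord_distance_outer[OF b mem(2,3) this]
      have "\<rho>\<^sup>2 * L \<le> R\<^sup>2 * R'\<^sup>2 * (1 - c\<^sup>2)" unfolding inner_commute[of v' v] vv L'[symmetric] by (simp add: power2_eq_square algebra_simps)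
      moreover have "(\<rho> * c)\<^sup>2 * L \<le> \<rho>\<^sup>2 * L" using c b L0 by (intro mult_right_mono power_mono) (auto simp: mult_left_le)
      ultimately show ?thesis by linarith
    next
      case 3
      show ?thesis
      proof (cases "R \<le> R'")
        case True
        have "c\<^sup>2 * L \<le> R'\<^sup>2 * (1 - c\<^sup>2)" unfolding L using chord_distance_inner[of c R' R] c 3 True R0 by (simp add: mult.commute)
        then have "\<rho>\<^sup>2 * (c\<^sup>2 * L) \<le> R\<^sup>2 * (R'\<^sup>2 * (1 - c\<^sup>2))"
          using R0 b L0 by (intro mult_mono[of "\<rho>\<^sup>2"] power_mono[of \<rho>]) auto
        then show ?thesis by (simp add: power_mult_distrib mult.assoc)
      next
        case False
        have "c\<^sup>2 * L \<le> R\<^sup>2 * (1 - c\<^sup>2)" unfolding L using chord_distance_inner[of c R R'] c 3 False R0 by (simp add: algebra_simps)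
        then have "\<rho>\<^sup>2 * (c\<^sup>2 * L) \<le> R'\<^sup>2 * (R\<^sup>2 * (1 - c\<^sup>2))"
          using R0 b L0 by (intro mult_mono[of "\<rho>\<^sup>2"] power_mono[of \<rho>]) auto
        then show ?thesis by (simp add: power_mult_distrib algebra_simps)
      qed
    qed
  qed
  have "(\<rho> * c * norm (v' - v))\<^sup>2 \<le> (R * R' * sin \<Delta>)\<^sup>2"
    using goal by (simp add: power_mult_distrib power2_norm_eq_inner L_def[symmetric] s(2))
  then show ?thesis unfolding v_def v'_def c_def
    by (rule power2_le_imp_le) (use R0 s in auto)
qed

text \<open>The chord between the two outer points crosses the middle ray at distance 2 R1 R2 cos
  \<Delta> / (R1 + R2) from p, which by convexity does not exceed R.\<close>

lemma convex_vertex: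
  assumes "R1 = radius C p (dir (\<theta> - \<Delta>))" "R = radius C p (dir \<theta>)" "R2 = radius C p (dir (\<theta> + \<Delta>))" and c: "0 < cos \<Delta>"
  shows "R1 * R2 * (2 * cos \<Delta>) \<le> R * (R1 + R2)"
proof -
  have pos: "R1 > 0" "R > 0" "R2 > 0" unfolding assms(1-3) by (simp_all add: radius_pos)
  define k where "k = R1 * R2 / (R1 + R2)"
  have e: "dir (\<theta> - \<Delta>) + dir (\<theta> + \<Delta>) = (2 * cos \<Delta>) *\<^sub>R dir \<theta>"
    by (simp add: vec_eq_iff forall_2 cos_diff cos_add sin_diff sin_add)
  have "p + (k * (2 * cos \<Delta>)) *\<^sub>R dir \<theta> = (R2 / (R1 + R2)) *\<^sub>R (p + R1 *\<^sub>R dir (\<theta> - \<Delta>)) + (R1 / (R1 + R2)) *\<^sub>R (p + R2 *\<^sub>R dir (\<theta> + \<Delta>))"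
  proof -
    have "R2 / (R1 + R2) + R1 / (R1 + R2) = 1" using pos add_divide_distrib[of R2 R1 "R1 + R2"] by (simp add: add.commute)
    then have "p = (R2 / (R1 + R2) + R1 / (R1 + R2)) *\<^sub>R p" by simp
    then have pp: "p = (R2 / (R1 + R2)) *\<^sub>R p + (R1 / (R1 + R2)) *\<^sub>R p" by (simp add: scaleR_add_left)
    have "(k * (2 * cos \<Delta>)) *\<^sub>R dir \<theta> = k *\<^sub>R (dir (\<theta> - \<Delta>) + dir (\<theta> + \<Delta>))" unfolding e by simp
    also have "\<dots> = (R2 / (R1 + R2)) *\<^sub>R R1 *\<^sub>R dir (\<theta> - \<Delta>) + (R1 / (R1 + R2)) *\<^sub>R R2 *\<^sub>R dir (\<theta> + \<Delta>)"
      unfolding k_def by (simp add: scaleR_add_right mult.commute)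
    finally show ?thesis using pp by (simp add: scaleR_add_right)
  qed
  also have "\<dots> \<in> closure C"
    by (rule convexD[OF convex_closure[OF convex]])
       (use radius_in_closure pos assms in \<open>auto simp flip: add_divide_distrib\<close>)
  finally have "k * (2 * cos \<Delta>) \<le> R"
    unfolding assms(2) using pos c by (intro closure_radius_le) (auto simp: k_def)
  then show ?thesis using pos unfolding k_def by (simp add: field_simps)
qed

end

section \<open>Lengths of nested convex polygons\<close>

lemma sum_periodic_shift:
  fixes f :: "nat \<Rightarrow> real"
  assumes "f N = f 0"
  shows "(\<Sum>i<N. f (Suc i)) = (\<Sum>i<N. f i)"
  using sum.lessThan_Suc_shift[of f N] sum.lessThan_Suc[of f N] assms by simp

text \<open>The unit tangents \<open>t i\<close> of the inner polygon calibrate both lengths; after summation by parts the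
  difference is a sum of terms that are nonnegative by convexity at the vertices.\<close>

lemma convex_polygon_length_mono:
  fixes y z :: "nat \<Rightarrow> 'a::real_inner"
  assumes per: "y N = y 0" "y (Suc N) = y 1" "z N = z 0"
    and ne: "\<And>i. y (Suc i) \<noteq> y i"
    and out: "\<And>i. \<exists>l\<ge>1. z i = l *\<^sub>R y i"
    and vert: "\<And>i. i < N \<Longrightarrow> \<exists>a b \<mu>. a > 0 \<and> b > 0 \<and> \<mu> \<le> 1 \<and> a *\<^sub>R (y i - y (Suc i)) + b *\<^sub>R (y (Suc (Suc i)) - y (Suc i)) = (\<mu> - 1) *\<^sub>R y (Suc i)"
  shows "(\<Sum>i<N. norm (y (Suc i) - y i)) \<le> (\<Sum>i<N. norm (z (Suc i) - z i))"
proof -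
  define t where "t i = (y (Suc i) - y i) /\<^sub>R norm (y (Suc i) - y i)" for i
  have nt: "norm (t i) = 1" for i unfolding t_def using ne[of i] by simp
  have tN: "t N = t 0" unfolding t_def using per by simp
  have len: "norm (y (Suc i) - y i) = (y (Suc i) - y i) \<bullet> t i" for i
  proof -
    have "(y (Suc i) - y i) \<bullet> t i = (norm (y (Suc i) - y i))\<^sup>2 / norm (y (Suc i) - y i)"
      unfolding t_def by (simp add: dot_square_norm divide_inverse mult.commute)
    then show ?thesis using ne[of i] by (simp add: power2_eq_square)
  qed
  have vertex: "0 \<le> (z (Suc i) - y (Suc i)) \<bullet> (t i - t (Suc i))" if i: "i < N" for i
  proof -
    obtain a b \<mu> where ab: "a > 0" "b > 0" "\<mu> \<le> 1"
      "a *\<^sub>R (y i - y (Suc i)) + b *\<^sub>R (y (Suc (Suc i)) - y (Suc i)) = (\<mu> - 1) *\<^sub>R y (Suc i)" using vert[OF i] by blast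
    define A where "A = a * norm (y (Suc i) - y i)"
    define B where "B = b * norm (y (Suc (Suc i)) - y (Suc i))"
    have AB: "A > 0" "B > 0" using ab ne[of i] ne[of "Suc i"] unfolding A_def B_def by auto
    \<comment> \<open>The vertex condition in terms of unit tangents. Its inner product with
      \<open>t i - t (Suc i)\<close> is (A + B) (1 - d), which is nonnegative. For \<mu> = 1 the
      polygon is straight at the vertex and the tangents coincide.\<close>
    have eq: "(1 - \<mu>) *\<^sub>R y (Suc i) = A *\<^sub>R t i - B *\<^sub>R t (Suc i)"
    proof -
      have "(1 - \<mu>) *\<^sub>R y (Suc i) = a *\<^sub>R (y (Suc i) - y i) - b *\<^sub>R (y (Suc (Suc i)) - y (Suc i))"
        using arg_cong[OF ab(4), of uminus] by (simp add: algebra_simps)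
      moreover have "a *\<^sub>R (y (Suc i) - y i) = A *\<^sub>R t i" "b *\<^sub>R (y (Suc (Suc i)) - y (Suc i)) = B *\<^sub>R t (Suc i)"
        unfolding A_def B_def t_def using ne[of i] ne[of "Suc i"] by auto
      ultimately show ?thesis by simp
    qed
    define d where "d = t i \<bullet> t (Suc i)"
    have d: "d \<le> 1" unfolding d_def using norm_cauchy_schwarz[of "t i" "t (Suc i)"] nt by simp
    have "0 \<le> y (Suc i) \<bullet> (t i - t (Suc i))"
    proof (cases "\<mu> = 1")
      case False
      have "(1 - \<mu>) * (y (Suc i) \<bullet> (t i - t (Suc i))) = (A *\<^sub>R t i - B *\<^sub>R t (Suc i)) \<bullet> (t i - t (Suc i))"
        by (simp flip: eq)
      also have "\<dots> = (A + B) * (1 - d)"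
        using nt[of i] nt[of "Suc i"] unfolding d_def
        by (simp add: inner_diff_left inner_diff_right dot_square_norm inner_commute algebra_simps)
      also have "\<dots> \<ge> 0" using AB d by simp
      finally show ?thesis using False ab(3) by (simp add: zero_le_mult_iff)
    next
      case True
      then have AtB: "A *\<^sub>R t i = B *\<^sub>R t (Suc i)" using eq by simp
      then have "norm (A *\<^sub>R t i) = norm (B *\<^sub>R t (Suc i))" by simp
      then have "A = B" using AB nt by simp
      then have "t i = t (Suc i)" using AtB AB by simp
      then show ?thesis by simp
    qed
    moreover obtain l where l: "l \<ge> 1" "z (Suc i) = l *\<^sub>R y (Suc i)" using out by blast
    moreover have "z (Suc i) - y (Suc i) = (l - 1) *\<^sub>R y (Suc i)" using l by (simp add: algebra_simps)
    ultimately show ?thesis by simp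
  qed
  define w where "w i = z i - y i" for i
  have e1: "(\<Sum>i<N. norm (y (Suc i) - y i)) = (\<Sum>i<N. (z (Suc i) - z i) \<bullet> t i) - (\<Sum>i<N. w (Suc i) \<bullet> t i - w i \<bullet> t i)"
    unfolding len sum_subtractf[symmetric] w_def by (intro sum.cong refl) (simp add: inner_diff_left)
  have e2: "(\<Sum>i<N. w (Suc i) \<bullet> t i - w i \<bullet> t i) = (\<Sum>i<N. w (Suc i) \<bullet> (t i - t (Suc i)))"
    using sum_periodic_shift[of "\<lambda>i. w i \<bullet> t i" N] per tN
    by (simp add: sum_subtractf inner_diff_right w_def)
  have e3: "(\<Sum>i<N. w (Suc i) \<bullet> (t i - t (Suc i))) \<ge> 0" using vertex unfolding w_def by (intro sum_nonneg) auto
  have "(\<Sum>i<N. (z (Suc i) - z i) \<bullet> t i) \<le> (\<Sum>i<N. norm (z (Suc i) - z i))"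
  proof (intro sum_mono)
    fix i show "(z (Suc i) - z i) \<bullet> t i \<le> norm (z (Suc i) - z i)"
      using norm_cauchy_schwarz[of "z (Suc i) - z i" "t i"] nt[of i] by simp
  qed
  with e1 e2 e3 show ?thesis by linarith
qed

section \<open>The boundary curve in polar coordinates\<close>

lemma dir_2pi_int: "dir (\<theta> + 2 * pi * of_int m) = dir \<theta>"
proof -
  have "cos (\<theta> + 2 * pi * of_int m) = cos \<theta>" "sin (\<theta> + 2 * pi * of_int m) = sin \<theta>"
    by (simp_all add: cos_add sin_add cos_int_2pin sin_int_2pin)
  then show ?thesis by (simp add: vec_eq_iff forall_2)
qed

lemma dir_eq_imp:
  assumes "dir a = dir b"
  shows "\<exists>m::int. a = b + 2 * pi * of_int m"
proof -
  have "cos a = cos b" "sin a = sin b" using assms by (metis dir_nth)+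
  then have "cos (a - b) = 1" unfolding cos_diff by (simp flip: power2_eq_square)
  then obtain m :: int where "a - b = of_int m * 2 * pi" using cos_one_2pi_int by blast
  then have "a - b = 2 * pi * of_int m" by simp
  then have "a = b + 2 * pi * of_int m" by linarith
  then show ?thesis ..
qed

lemma continuous_dir: "continuous_on S dir"
proof -
  have "continuous_on S (\<lambda>x. if i = 1 then cos x else sin x)" for i :: 2
    by (cases "i = 1") (auto intro: continuous_intros)
  then show ?thesis unfolding dir_def by (rule continuous_on_vec_lambda)
qed

lemma polar_direction:
  assumes "x \<noteq> (0::real^2)"
  shows "\<exists>\<theta>. x = norm x *\<^sub>R dir \<theta>"
proof -
  define z where "z = to_complex x"
  have z: "of_real (norm x) * cis (Arg z) = z" using rcis_cmod_Arg[of z] by (simp add: rcis_def z_def)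
  have "norm x * cos (Arg z) = x $ 1" using arg_cong[OF z, of Re] by (simp add: z_def)
  moreover have "norm x * sin (Arg z) = x $ 2" using arg_cong[OF z, of Im] by (simp add: z_def)
  ultimately have "x = norm x *\<^sub>R dir (Arg z)" by (simp add: vec_eq_iff forall_2)
  then show ?thesis ..
qed

context convex_region
begin

text \<open>The boundary point in direction \<theta>, as a vector from p, so that points of
  different regions on the same ray are multiples of each other.\<close>

definition bpt :: "real \<Rightarrow> real^2" where
  "bpt \<theta> = radius C p (dir \<theta>) *\<^sub>R dir \<theta>"

lemma norm_bpt: "norm (bpt \<theta>) = radius C p (dir \<theta>)"
  unfolding bpt_def using radius_pos[of "dir \<theta>"] by simp

lemma bpt_frontier: "p + bpt \<theta> \<in> frontier C"
  unfolding bpt_def by (rule radius_frontier) simp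

lemma bpt_2pi_int: "bpt (\<theta> + 2 * pi * of_int m) = bpt \<theta>"
  unfolding bpt_def dir_2pi_int ..

lemma bpt_eq_imp:
  assumes "bpt a = bpt b"
  shows "\<exists>m::int. a = b + 2 * pi * of_int m"
proof -
  have "radius C p (dir a) = radius C p (dir b)" using norm_bpt assms by metis
  then have "dir a = dir b" using assms radius_pos[of "dir b"] unfolding bpt_def by simp
  then show ?thesis by (rule dir_eq_imp)
qed

lemma frontier_polar:
  assumes "x \<in> frontier C" "x = p + t *\<^sub>R dir \<theta>" "0 \<le> t"
  shows "x = p + bpt \<theta>"
  using frontier_radius[of "dir \<theta>" t] assms unfolding bpt_def by simp

lemma frontier_eq_bpt: "frontier C = range (\<lambda>\<theta>. p + bpt \<theta>)"
proof
  show "range (\<lambda>\<theta>. p + bpt \<theta>) \<subseteq> frontier C" using bpt_frontier by auto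
  show "frontier C \<subseteq> range (\<lambda>\<theta>. p + bpt \<theta>)"
  proof
    fix x assume x: "x \<in> frontier C"
    then have "x \<noteq> p" using p open_C by (auto simp: frontier_def interior_open)
    then obtain \<theta> where "x - p = norm (x - p) *\<^sub>R dir \<theta>" using polar_direction[of "x - p"] by auto
    then have "x = p + norm (x - p) *\<^sub>R dir \<theta>" by (metis add.commute diff_add_cancel)
    then have "x = p + bpt \<theta>" by (intro frontier_polar[OF x]) auto
    then show "x \<in> range (\<lambda>\<theta>. p + bpt \<theta>)" by blast
  qed
qed

lemma bpt_bounded: "\<exists>M>0. \<forall>\<theta>. norm (bpt \<theta>) \<le> M"
proof -
  have "Elementary_Metric_Spaces.bounded (closure C)" using bounded by (rule bounded_closure)
  then obtain M where M: "\<And>x. x \<in> closure C \<Longrightarrow> norm x \<le> M" using bounded_iff by metis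
  have "norm (bpt \<theta>) \<le> M + norm p" for \<theta>
  proof -
    have "norm (p + bpt \<theta>) \<le> M" using M bpt_frontier by (auto simp: frontier_def)
    then show ?thesis using norm_triangle_ineq4[of "p + bpt \<theta>" p] by simp
  qed
  moreover have "M + norm p > 0" using norm_bpt[of 0] radius_pos[of "dir 0"] calculation[of 0] by simp
  ultimately show ?thesis by blast
qed

text \<open>For angles up to 1, which is less than pi / 3, the cosine is at least 1 / 2 and
  \<open>chord_bound\<close> applies; for larger angles the trivial bound 2 M suffices. These are
  the two summands of K.\<close>

lemma bpt_lipschitz: "\<exists>K\<ge>0. \<forall>a b. norm (bpt a - bpt b) \<le> K * \<bar>a - b\<bar>"
proof -
  obtain M where M: "M > 0" "\<And>\<theta>. norm (bpt \<theta>) \<le> M" using bpt_bounded by blast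
  obtain \<rho> where \<rho>: "\<rho> > 0" "ball p \<rho> \<subseteq> C" using open_C p open_contains_ball by blast
  define K where "K = 2 * M\<^sup>2 / \<rho> + 2 * M"
  have K: "K \<ge> 0" "2 * M\<^sup>2 / \<rho> \<le> K" "2 * M \<le> K" using M(1) \<rho>(1) unfolding K_def by auto
  have main: "norm (bpt (a + d) - bpt a) \<le> K * d" if d: "0 \<le> d" for a d
  proof (cases "d \<le> 1")
    case True
    have d3: "d \<le> pi / 3" using True pi_gt3 by simp
    have cd: "cos d \<ge> 1 / 2" using cos_monotone_0_pi_le[of d "pi / 3"] d d3 pi_gt3 by (simp add: cos_60)
    have sd: "sin d \<le> d" "0 \<le> sin d" using sin_x_le_x[OF d] sin_ge_zero[of d] d d3 pi_gt3 by auto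
    have "\<rho> * (1/2) * norm (bpt (a + d) - bpt a) \<le> \<rho> * cos d * norm (bpt (a + d) - bpt a)"
      using cd \<rho> by (intro mult_right_mono mult_left_mono) auto
    also have "\<dots> \<le> radius C p (dir a) * radius C p (dir (a + d)) * sin d"
      unfolding bpt_def by (rule chord_bound[OF \<rho>(2,1) d _ refl refl]) (use d3 pi_gt3 in linarith)
    also have "\<dots> \<le> M * M * d"
      using M(2)[of a] M(2)[of "a + d"] sd M(1) radius_pos[of "dir a"] radius_pos[of "dir (a + d)"]
      unfolding norm_bpt by (intro mult_mono) auto
    finally have "norm (bpt (a + d) - bpt a) \<le> (2 * M\<^sup>2 / \<rho>) * d"
      using \<rho>(1) by (simp add: field_simps power2_eq_square)
    also have "\<dots> \<le> K * d" using K d by (intro mult_right_mono)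
    finally show ?thesis .
  next
    case False
    have "norm (bpt (a + d) - bpt a) \<le> 2 * M" using M(2)[of "a + d"] M(2)[of a] norm_triangle_ineq4[of "bpt (a + d)" "bpt a"] by linarith
    also have "\<dots> \<le> K * 1" using K by simp
    also have "\<dots> \<le> K * d" using K False by (intro mult_left_mono) auto
    finally show ?thesis .
  qed
  have "norm (bpt a - bpt b) \<le> K * \<bar>a - b\<bar>" for a b
    using main[of "a - b" b] main[of "b - a" a] by (cases "a \<ge> b") (auto simp: norm_minus_commute)
  then show ?thesis using K(1) by blast
qed

lemma bpt_continuous: "continuous_on UNIV bpt"
proof -
  obtain K where K: "K \<ge> 0" "\<And>a b. norm (bpt a - bpt b) \<le> K * \<bar>a - b\<bar>" using bpt_lipschitz by blast
  then have "K-lipschitz_on UNIV bpt" by (intro lipschitz_onI) (auto simp: dist_norm)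
  then show ?thesis by (rule lipschitz_on_continuous_on)
qed

lemma simple_closed_parametrization_exists:
  "\<exists>c. simple_path c \<and> pathfinish c = pathstart c \<and> path_image c = frontier C"
proof (intro exI conjI)
  define c where "c t = p + bpt (2 * pi * t)" for t
  have "continuous_on {0..1} c" unfolding c_def
    by (intro continuous_intros continuous_on_compose2[OF bpt_continuous]) auto
  moreover have "s = t \<or> s = 0 \<and> t = 1 \<or> s = 1 \<and> t = 0" if st: "s \<in> {0..1}" "t \<in> {0..1}" "c s = c t" for s t
  proof -
    obtain m :: int where "2 * pi * s = 2 * pi * t + 2 * pi * of_int m"
      using bpt_eq_imp[of "2 * pi * s" "2 * pi * t"] st unfolding c_def by auto
    then have "2 * pi * s = 2 * pi * (t + of_int m)" by (simp add: distrib_left)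
    then have m: "s = t + of_int m" by simp
    then have "\<bar>of_int m :: real\<bar> \<le> 1" using st by auto
    then have "m = -1 \<or> m = 0 \<or> m = 1" by linarith
    then show ?thesis using m st by auto
  qed
  ultimately show "simple_path c" unfolding simple_path_def path_def loop_free_def by blast
  show "pathfinish c = pathstart c"
    unfolding pathfinish_def pathstart_def c_def using bpt_2pi_int[of 0 1] by simp
  show "path_image c = frontier C"
  proof
    show "path_image c \<subseteq> frontier C" unfolding path_image_def c_def using bpt_frontier by auto
    show "frontier C \<subseteq> path_image c"
    proof
      fix x assume "x \<in> frontier C"
      then obtain \<theta> where x: "x = p + bpt \<theta>" unfolding frontier_eq_bpt by blast
      define t where "t = frac (\<theta> / (2 * pi))"
      have "2 * pi * t = \<theta> + 2 * pi * of_int (- \<lfloor>\<theta> / (2 * pi)\<rfloor>)" unfolding t_def frac_def by (simp add: algebra_simps)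
      then have "x = c t" unfolding c_def x using bpt_2pi_int by metis
      moreover have "t \<in> {0..1}" unfolding t_def using frac_ge_0 frac_lt_1 less_imp_le by auto
      ultimately show "x \<in> path_image c" unfolding path_image_def by blast
    qed
  qed
qed

text \<open>\<open>boundary_length\<close> refers to an arbitrary simple parametrization c, so its
  angle has to be recovered. A continuous logarithm of c - p lifts it to \<theta>; injectivity makes
  \<theta> strictly monotone, and the total increment is exactly one turn, because a second turn
  would repeat a point. \<sigma> records the orientation.\<close>

lemma angle_parametrization:
  assumes c: "simple_path c" "pathfinish c = pathstart c" "path_image c = frontier C"
  shows "\<exists>\<phi> \<theta>0 \<sigma>. (\<sigma> = 1 \<or> \<sigma> = -1) \<and> continuous_on {0..1} \<phi> \<and> \<phi> 0 = 0 \<and> \<phi> 1 = 2 * pi \<and>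
    (\<forall>s t. 0 \<le> s \<and> s < t \<and> t \<le> 1 \<longrightarrow> \<phi> s < \<phi> t) \<and> (\<forall>t\<in>{0..1}. c t = p + bpt (\<theta>0 + \<sigma> * \<phi> t))"
proof -
  have cc: "continuous_on {0..1} c" using c(1) unfolding simple_path_def path_def by blast
  have inj: "s = t \<or> s = 0 \<and> t = 1 \<or> s = 1 \<and> t = 0" if "s \<in> {0..1}" "t \<in> {0..1}" "c s = c t" for s t
    using c(1) that unfolding simple_path_def loop_free_def by blast
  have cf: "c t \<in> frontier C" if "t \<in> {0..1}" for t using c(3) that unfolding path_image_def by blast
  have cp: "c t \<noteq> p" if "t \<in> {0..1}" for t using cf[OF that] p open_C by (auto simp: frontier_def interior_open)
  define f where "f t = to_complex (c t - p)" for t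
  have "continuous_on {0..1} f" unfolding f_def to_complex_def
    by (intro continuous_intros continuous_on_Complex cc)
  moreover have "f t \<noteq> 0" if "t \<in> {0..1}" for t
  proof
    assume "f t = 0"
    then have "c t - p = 0" unfolding f_def to_complex_def by (simp add: complex_eq_iff vec_eq_iff forall_2)
    then show False using cp[OF that] by simp
  qed
  ultimately obtain h where h: "continuous_on {0..1} h" "\<And>t. t \<in> {0..1} \<Longrightarrow> f t = exp (h t)"
    using continuous_logarithm_on_contractible[of "{0..1}" f] convex_imp_contractible[of "{0..1::real}"] by auto
  define \<theta> where "\<theta> t = Im (h t)" for t
  have c\<theta>: "continuous_on {0..1} \<theta>" unfolding \<theta>_def by (intro continuous_intros h)
  have c\<theta>eq: "c t = p + bpt (\<theta> t)" if "t \<in> {0..1}" for t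
  proof (rule frontier_polar[OF cf[OF that]])
    have "Re (f t) = exp (Re (h t)) * cos (\<theta> t)" "Im (f t) = exp (Re (h t)) * sin (\<theta> t)"
      using h(2)[OF that] by (simp_all add: Re_exp Im_exp \<theta>_def)
    then have "(c t - p) $ 1 = exp (Re (h t)) * cos (\<theta> t)" "(c t - p) $ 2 = exp (Re (h t)) * sin (\<theta> t)"
      unfolding f_def to_complex_def by simp_all
    then have "c t - p = exp (Re (h t)) *\<^sub>R dir (\<theta> t)" by (simp add: vec_eq_iff forall_2)
    then show "c t = p + exp (Re (h t)) *\<^sub>R dir (\<theta> t)" by (metis add.commute diff_add_cancel)
  qed simp
  have per: "s = t \<or> s = 0 \<and> t = 1 \<or> s = 1 \<and> t = 0" if "s \<in> {0..1}" "t \<in> {0..1}" "\<theta> s = \<theta> t + 2 * pi * of_int m" for s t m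
    using inj[of s t] c\<theta>eq[of s] c\<theta>eq[of t] bpt_2pi_int[of "\<theta> t" m] that by simp
  have "inj_on \<theta> {0..<1}"
  proof (rule inj_onI)
    fix s t assume "s \<in> {0..<1::real}" "t \<in> {0..<1}" "\<theta> s = \<theta> t"
    then show "s = t" using per[of s t 0] by auto
  qed
  moreover have "continuous_on {0..<1} \<theta>" by (rule continuous_on_subset[OF c\<theta>]) auto
  ultimately have "strict_mono_on {0..<1} \<theta> \<or> strict_antimono_on {0..<1} \<theta>"
    using injective_eq_monotone_map[of "{0..<1}" \<theta>] is_interval_co by blast
  then obtain \<sigma> where \<sigma>: "\<sigma> = 1 \<or> \<sigma> = (-1::real)" "\<And>s t. 0 \<le> s \<Longrightarrow> s < t \<Longrightarrow> t < 1 \<Longrightarrow> \<sigma> * \<theta> s < \<sigma> * \<theta> t"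
  proof
    assume a: "strict_mono_on {0..<1} \<theta>"
    show thesis by (rule that[of 1]) (use a in \<open>auto simp: monotone_on_def\<close>)
  next
    assume a: "strict_antimono_on {0..<1} \<theta>"
    show thesis by (rule that[of "-1"]) (use a in \<open>auto simp: monotone_on_def\<close>)
  qed
  define \<phi> where "\<phi> t = \<sigma> * (\<theta> t - \<theta> 0)" for t
  have c\<phi>: "continuous_on {0..1} \<phi>" unfolding \<phi>_def by (intro continuous_intros c\<theta>)
  have \<phi>0: "\<phi> 0 = 0" unfolding \<phi>_def by simp
  have mono1: "\<phi> s < \<phi> t" if "0 \<le> s" "s < t" "t < 1" for s t
    using \<sigma>(2)[OF that] unfolding \<phi>_def by (simp add: algebra_simps)
  have le1: "\<phi> s \<le> \<phi> 1" if "0 \<le> s" "s < 1" for s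
  proof (rule tendsto_lowerbound)
    show "(\<phi> \<longlongrightarrow> \<phi> 1) (at_left 1)"
      using c\<phi> unfolding continuous_on_def by (auto simp: at_within_Icc_at_left dest!: bspec[of _ _ 1])
    show "\<forall>\<^sub>F t in at_left 1. \<phi> s \<le> \<phi> t"
      unfolding eventually_at_left_field using that mono1[of s] by (intro exI[of _ s]) (auto intro: less_imp_le)
  qed simp
  have mono: "\<phi> s < \<phi> t" if "0 \<le> s" "s < t" "t \<le> 1" for s t
  proof (cases "t = 1")
    case True
    then show ?thesis using mono1[of s "(s + 1) / 2"] le1[of "(s + 1) / 2"] that by auto
  qed (use mono1 that in auto)
  have \<theta>\<phi>: "\<theta> t = \<theta> 0 + \<sigma> * \<phi> t" for t
    unfolding \<phi>_def using \<sigma>(1) by auto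
  have "c 1 = c 0" using c(2) unfolding pathfinish_def pathstart_def .
  then have "bpt (\<theta> 1) = bpt (\<theta> 0)" using c\<theta>eq[of 0] c\<theta>eq[of 1] by simp
  then obtain m :: int where m: "\<theta> 1 = \<theta> 0 + 2 * pi * of_int m" using bpt_eq_imp by blast
  obtain k :: int where k: "\<phi> 1 = 2 * pi * of_int k"
  proof -
    have "\<phi> 1 = 2 * pi * of_int (if \<sigma> = 1 then m else - m)" using \<sigma>(1) m unfolding \<phi>_def by auto
    then show thesis by (rule that)
  qed
  have "0 < \<phi> 1" using mono[of 0 1] \<phi>0 by simp
  then have "k > 0" unfolding k by (simp add: zero_less_mult_iff)
  moreover have "\<not> k \<ge> 2"
  proof
    assume "k \<ge> 2"
    then have "real_of_int k \<ge> 2" by simp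
    then have k2: "2 * pi < \<phi> 1" unfolding k using pi_gt_zero by (simp add: mult_less_cancel_left)
    obtain t where t: "0 \<le> t" "t \<le> 1" "\<phi> t = 2 * pi"
      using IVT'[of \<phi> 0 "2 * pi" 1] k2 \<phi>0 c\<phi> by auto
    have "\<theta> t = \<theta> 0 + 2 * pi * of_int (if \<sigma> = 1 then 1 else -1)" unfolding \<theta>\<phi>[of t] t(3) using \<sigma>(1) by auto
    then have "t = 0 \<or> t = 1" using per[of t 0] t by auto
    then show False using t(3) k2 \<phi>0 by auto
  qed
  ultimately have "k = 1" by simp
  then have "\<phi> 1 = 2 * pi" using k by simp
  moreover have "\<forall>t\<in>{0..1}. c t = p + bpt (\<theta> 0 + \<sigma> * \<phi> t)" using c\<theta>eq unfolding \<theta>\<phi>[symmetric] by blast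
  moreover have "\<forall>s t. 0 \<le> s \<and> s < t \<and> t \<le> 1 \<longrightarrow> \<phi> s < \<phi> t" using mono by blast
  ultimately show ?thesis using \<sigma>(1) c\<phi> \<phi>0 by (intro exI[of _ \<phi>] exI[of _ "\<theta> 0"] exI[of _ \<sigma>] conjI)
qed

text \<open>The equally spaced angles are counted from \<theta>0, the angle of the initial point of
  the chosen parametrization, because the polygons in \<open>curve_length\<close> do not pass beyond
  the ends of the parameter interval. The parameters at which these angles occur come from the
  intermediate value theorem.\<close>

lemma inscribed_polygon_le_boundary_length:
  "\<exists>\<theta>0. \<forall>N>0. (\<Sum>i<N. norm (bpt (\<theta>0 + 2 * pi * real (Suc i) / real N) - bpt (\<theta>0 + 2 * pi * real i / real N))) \<le> boundary_length C"
proof -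
  define c where "c = (SOME c. simple_path c \<and> pathfinish c = pathstart c \<and> path_image c = frontier C)"
  have c: "simple_path c" "pathfinish c = pathstart c" "path_image c = frontier C"
    using someI_ex[OF simple_closed_parametrization_exists] unfolding c_def by auto
  obtain \<phi> \<theta>0 \<sigma> where \<sigma>: "\<sigma> = 1 \<or> \<sigma> = (-1::real)" and c\<phi>: "continuous_on {0..1} \<phi>" and \<phi>: "\<phi> 0 = 0" "\<phi> 1 = 2 * pi"
    and mono: "\<And>s t. 0 \<le> s \<Longrightarrow> s < t \<Longrightarrow> t \<le> 1 \<Longrightarrow> \<phi> s < \<phi> t" and c\<theta>: "\<And>t. t \<in> {0..1} \<Longrightarrow> c t = p + bpt (\<theta>0 + \<sigma> * \<phi> t)"
    using angle_parametrization[OF c] by blast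
  obtain K where K: "K \<ge> 0" "\<And>a b. norm (bpt a - bpt b) \<le> K * \<bar>a - b\<bar>" using bpt_lipschitz by blast
  have wmono: "\<phi> s \<le> \<phi> t" if "0 \<le> s" "s \<le> t" "t \<le> 1" for s t using mono[of s t] that by (cases "s = t") auto
  define P where "P = {\<Sum>i<N. dist (c (t i)) (c (t (Suc i))) | N t. mono (t :: nat \<Rightarrow> real) \<and> range t \<subseteq> {0..1}}"
  have bl: "boundary_length C = Sup P" unfolding boundary_length_def curve_length_def c_def[symmetric] P_def ..
  \<comment> \<open>The Lipschitz bound shows that the set is bounded, so that the supremum in
    \<open>curve_length\<close> is a genuine upper bound.\<close>
  have "x \<le> K * (2 * pi)" if xP: "x \<in> P" for x
  proof -
    obtain N t where x: "x = (\<Sum>i<N. dist (c (t i)) (c (t (Suc i))))" and t: "mono (t :: nat \<Rightarrow> real)" "range t \<subseteq> {0..1}"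
      using xP unfolding P_def by blast
    have ti: "0 \<le> t i" "t i \<le> 1" for i using t(2) by (auto simp: image_subset_iff)
    have "x \<le> (\<Sum>i<N. K * (\<phi> (t (Suc i)) - \<phi> (t i)))" unfolding x
    proof (rule sum_mono)
      fix i
      have "dist (c (t i)) (c (t (Suc i))) = norm (bpt (\<theta>0 + \<sigma> * \<phi> (t i)) - bpt (\<theta>0 + \<sigma> * \<phi> (t (Suc i))))"
        using c\<theta> ti by (simp add: dist_norm)
      also have "\<dots> \<le> K * \<bar>\<sigma> * \<phi> (t i) - \<sigma> * \<phi> (t (Suc i))\<bar>" using K(2)[of "\<theta>0 + \<sigma> * \<phi> (t i)" "\<theta>0 + \<sigma> * \<phi> (t (Suc i))"] by simp
      also have "\<bar>\<sigma> * \<phi> (t i) - \<sigma> * \<phi> (t (Suc i))\<bar> = \<phi> (t (Suc i)) - \<phi> (t i)"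
        using \<sigma> wmono[of "t i" "t (Suc i)"] ti monoD[OF t(1), of i "Suc i"] by auto
      finally show "dist (c (t i)) (c (t (Suc i))) \<le> K * (\<phi> (t (Suc i)) - \<phi> (t i))" .
    qed
    also have "\<dots> = K * (\<phi> (t N) - \<phi> (t 0))" 
      using sum_lessThan_telescope[of "\<lambda>i. \<phi> (t i)" N] by (simp flip: sum_distrib_left)
    also have "\<dots> \<le> K * (2 * pi)"
      using K wmono[of "t N" 1] wmono[of 0 "t 0"] ti \<phi> by (intro mult_left_mono) auto
    finally show ?thesis .
  qed
  then have bdd: "bdd_above P" by (intro bdd_aboveI)
  have "(\<Sum>i<N. norm (bpt (\<theta>0 + 2 * pi * real (Suc i) / real N) - bpt (\<theta>0 + 2 * pi * real i / real N))) \<le> boundary_length C" if N: "N > 0" for N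
  proof -
    have "\<exists>s. 0 \<le> s \<and> s \<le> 1 \<and> \<phi> s = 2 * pi * real i / real N" if "i \<le> N" for i
    proof -
      have "2 * pi * real i / real N \<le> 2 * pi" using that N by (simp add: field_simps)
      then show ?thesis using IVT'[of \<phi> 0 "2 * pi * real i / real N" 1] \<phi> c\<phi> by auto
    qed
    then obtain s where s: "\<And>i. i \<le> N \<Longrightarrow> 0 \<le> s i \<and> s i \<le> 1 \<and> \<phi> (s i) = 2 * pi * real i / real N" by metis
    \<comment> \<open>\<open>curve_length\<close> takes a monotone sequence over all naturals;
      beyond N it is continued as a constant.\<close>
    define t where "t i = s (min i N)" for i
    have t: "0 \<le> t i" "t i \<le> 1" "\<phi> (t i) = 2 * pi * real (min i N) / real N" for i using s[of "min i N"] unfolding t_def by auto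
    have tm: "mono t"
    proof (rule monoI)
      fix i j :: nat assume "i \<le> j"
      then have "\<phi> (t i) \<le> \<phi> (t j)" unfolding t(3) using N by (intro divide_right_mono mult_left_mono) auto
      then show "t i \<le> t j" using mono[of "t j" "t i"] t by force
    qed
    have ct: "c (t i) = p + bpt (\<theta>0 + \<sigma> * (2 * pi * real i / real N))" if "i \<le> N" for i
      using c\<theta>[of "t i"] t[of i] that by (simp add: min_def)
    have "(\<Sum>i<N. dist (c (t i)) (c (t (Suc i)))) \<in> P" unfolding P_def using tm t(1,2) by (intro CollectI exI[of _ N] exI[of _ t]) auto
    then have le: "(\<Sum>i<N. dist (c (t i)) (c (t (Suc i)))) \<le> boundary_length C" unfolding bl by (intro cSup_upper bdd)
    define a where "a k = norm (bpt (\<theta>0 + 2 * pi * real (Suc k) / real N) - bpt (\<theta>0 + 2 * pi * real k / real N))" for k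
    have "(\<Sum>i<N. dist (c (t i)) (c (t (Suc i)))) = (\<Sum>i<N. a i)"
      using \<sigma>
    proof
      assume "\<sigma> = 1"
      then show ?thesis using ct by (intro sum.cong refl) (simp add: dist_norm a_def norm_minus_commute)
    next
      \<comment> \<open>The curve then meets the vertices in the opposite order, and its side i is
        side N - 1 - i of the polygon.\<close>
      assume m: "\<sigma> = -1"
      have "dist (c (t i)) (c (t (Suc i))) = a (N - Suc i)" if "i < N" for i
      proof -
        have r: "bpt (\<theta>0 + \<sigma> * (2 * pi * real j / real N)) = bpt (\<theta>0 + 2 * pi * real (N - j) / real N)" if "j \<le> N" for j
        proof -
          have "\<theta>0 + 2 * pi * real (N - j) / real N = \<theta>0 + \<sigma> * (2 * pi * real j / real N) + 2 * pi * of_int 1"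
            using N that m by (simp add: of_nat_diff field_simps)
          then show ?thesis using bpt_2pi_int[of "\<theta>0 + \<sigma> * (2 * pi * real j / real N)" 1] by (simp only:)
        qed
        have "Suc (N - Suc i) = N - i" using that by simp
        then show ?thesis using ct[of i] ct[of "Suc i"] that r[of i] r[of "Suc i"] unfolding a_def by (simp add: dist_norm)
      qed
      then have "(\<Sum>i<N. dist (c (t i)) (c (t (Suc i)))) = (\<Sum>i<N. a (N - Suc i))" by (intro sum.cong) auto
      also have "\<dots> = (\<Sum>i<N. a i)" by (rule sum.nat_diff_reindex)
      finally show ?thesis .
    qed
    then show ?thesis using le unfolding a_def by simp
  qed
  then show ?thesis by blast
qed

end

subsection \<open>Widths and Voronoi cells\<close>

text \<open>Both polygons have their vertices on the same rays, those for F farther out. The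
  condition at the vertices of the inner polygon is \<open>convex_vertex\<close>; N > 4 makes
  \<Delta> less than pi / 2, so that cos \<Delta> is positive.\<close>

lemma inscribed_polygon_mono:
  assumes "convex_region C p" "convex_region F p" and sub: "C \<subseteq> F" and N: "N > 4"
  shows "(\<Sum>i<N. norm (convex_region.bpt C p (\<theta> + 2 * pi * real (Suc i) / real N) - convex_region.bpt C p (\<theta> + 2 * pi * real i / real N)))
    \<le> (\<Sum>i<N. norm (convex_region.bpt F p (\<theta> + 2 * pi * real (Suc i) / real N) - convex_region.bpt F p (\<theta> + 2 * pi * real i / real N)))"
proof -
  interpret C: convex_region C p by fact
  interpret F: convex_region F p by fact
  define a where "a i = \<theta> + 2 * pi * real i / real N" for i
  define \<Delta> where "\<Delta> = 2 * pi / real N"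
  have \<Delta>: "0 < \<Delta>" "\<Delta> < pi / 2" using N unfolding \<Delta>_def by (auto simp: field_simps)
  have step: "a (Suc i) = a i + \<Delta>" for i unfolding a_def \<Delta>_def by (simp add: add_divide_distrib distrib_left)
  have aN: "a (i + N) = a i + 2 * pi * of_int 1" for i unfolding a_def using N by (simp add: field_simps)
  have "(\<Sum>i<N. norm (C.bpt (a (Suc i)) - C.bpt (a i))) \<le> (\<Sum>i<N. norm (F.bpt (a (Suc i)) - F.bpt (a i)))"
  proof (rule convex_polygon_length_mono)
    show "C.bpt (a N) = C.bpt (a 0)" using aN[of 0] C.bpt_2pi_int by (metis add_0)
    show "F.bpt (a N) = F.bpt (a 0)" using aN[of 0] F.bpt_2pi_int by (metis add_0)
    show "C.bpt (a (Suc N)) = C.bpt (a 1)" using aN[of 1] C.bpt_2pi_int by (metis plus_1_eq_Suc)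
    show "C.bpt (a (Suc i)) \<noteq> C.bpt (a i)" for i
    proof
      assume "C.bpt (a (Suc i)) = C.bpt (a i)"
      then obtain m :: int where "a (Suc i) = a i + 2 * pi * of_int m" using C.bpt_eq_imp by blast
      then have m: "\<Delta> = 2 * pi * of_int m" unfolding step by simp
      then have "0 < 2 * pi * (of_int m :: real)" "2 * pi * (of_int m :: real) < 2 * pi * 1" using \<Delta> pi_gt_zero by auto
      then have "0 < (of_int m :: real)" "(of_int m :: real) < 1" using pi_gt_zero by (simp_all add: zero_less_mult_iff)
      then show False by simp
    qed
    show "\<exists>l\<ge>1. F.bpt (a i) = l *\<^sub>R C.bpt (a i)" for i
    proof -
      let ?e = "dir (a i)"
      have pos: "radius C p ?e > 0" "radius F p ?e > 0" using C.radius_pos F.radius_pos by auto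
      have "radius C p ?e \<le> radius F p ?e"
      proof (rule ccontr)
        assume "\<not> ?thesis"
        then have "p + radius F p ?e *\<^sub>R ?e \<in> C" using C.radius_le_iff[of ?e "radius F p ?e"] pos by simp
        then show False using sub F.radius_not_in[of ?e] by auto
      qed
      then show ?thesis using pos unfolding C.bpt_def F.bpt_def
        by (intro exI[of _ "radius F p ?e / radius C p ?e"]) auto
    qed
    fix i assume "i < N"
    define R1 where "R1 = radius C p (dir (a i))"
    define R where "R = radius C p (dir (a (Suc i)))"
    define R2 where "R2 = radius C p (dir (a (Suc (Suc i))))"
    have pos: "R1 > 0" "R > 0" "R2 > 0" unfolding R1_def R_def R2_def by (simp_all add: C.radius_pos)
    have ai: "a i = a (Suc i) - \<Delta>" "a (Suc (Suc i)) = a (Suc i) + \<Delta>" using step[of i] step[of "Suc i"] by auto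
    have cv: "R1 * R2 * (2 * cos \<Delta>) \<le> R * (R1 + R2)"
      by (rule C.convex_vertex[of R1 "a (Suc i)" \<Delta> R R2]) (use \<Delta> ai in \<open>auto simp: R1_def R_def R2_def intro!: cos_gt_zero\<close>)
    \<comment> \<open>The chord between the two neighbours of a vertex crosses the ray of the vertex
      at the fraction \<mu> of its radius.\<close>
    define \<mu> where "\<mu> = R1 * R2 * (2 * cos \<Delta>) / (R * (R1 + R2))"
    have \<mu>: "\<mu> \<le> 1" using cv pos unfolding \<mu>_def by simp
    have e: "dir (a i) + dir (a (Suc (Suc i))) = (2 * cos \<Delta>) *\<^sub>R dir (a (Suc i))"
      unfolding ai by (simp add: vec_eq_iff forall_2 cos_diff cos_add sin_diff sin_add)
    have sum1: "R2 / (R1 + R2) + R1 / (R1 + R2) = 1" using pos add_divide_distrib[of R2 R1 "R1 + R2"] by (simp add: add.commute)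
    have "(R2 / (R1 + R2)) *\<^sub>R (C.bpt (a i) - C.bpt (a (Suc i))) + (R1 / (R1 + R2)) *\<^sub>R (C.bpt (a (Suc (Suc i))) - C.bpt (a (Suc i)))
      = (R1 * R2 / (R1 + R2)) *\<^sub>R (dir (a i) + dir (a (Suc (Suc i)))) - (R2 / (R1 + R2) + R1 / (R1 + R2)) *\<^sub>R C.bpt (a (Suc i))"
      unfolding C.bpt_def R1_def[symmetric] R_def[symmetric] R2_def[symmetric]
      by (simp add: algebra_simps)
    also have "\<dots> = (R1 * R2 / (R1 + R2) * (2 * cos \<Delta>)) *\<^sub>R dir (a (Suc i)) - C.bpt (a (Suc i))" unfolding sum1 e by simp
    also have "(R1 * R2 / (R1 + R2) * (2 * cos \<Delta>)) = \<mu> * R"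
    proof -
      have "\<mu> * R = R1 * R2 * (2 * cos \<Delta>) / (R1 + R2)" unfolding \<mu>_def using pos by simp
      then show ?thesis by simp
    qed
    also have "(\<mu> * R) *\<^sub>R dir (a (Suc i)) - C.bpt (a (Suc i)) = (\<mu> - 1) *\<^sub>R C.bpt (a (Suc i))"
      unfolding C.bpt_def R_def[symmetric] by (simp add: algebra_simps)
    finally have "(R2 / (R1 + R2)) *\<^sub>R (C.bpt (a i) - C.bpt (a (Suc i))) + (R1 / (R1 + R2)) *\<^sub>R (C.bpt (a (Suc (Suc i))) - C.bpt (a (Suc i)))
      = (\<mu> - 1) *\<^sub>R C.bpt (a (Suc i))" .
    moreover have "R2 / (R1 + R2) > 0" "R1 / (R1 + R2) > 0" using pos by auto
    ultimately show "\<exists>a' b \<mu>. a' > 0 \<and> b > 0 \<and> \<mu> \<le> 1 \<and> a' *\<^sub>R (C.bpt (a i) - C.bpt (a (Suc i))) + b *\<^sub>R (C.bpt (a (Suc (Suc i))) - C.bpt (a (Suc i))) = (\<mu> - 1) *\<^sub>R C.bpt (a (Suc i))"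
      using \<mu> by blast
  qed
  then show ?thesis unfolding a_def .
qed

text \<open>Radial projection to the ball of radius r does not increase distances.\<close>

lemma dist_scaled_unit_vectors_ge:
  fixes e e' :: "'a::real_inner"
  assumes "norm e = 1" "norm e' = 1" "0 \<le> r" "r \<le> a" "r \<le> b"
  shows "r * norm (e' - e) \<le> norm (b *\<^sub>R e' - a *\<^sub>R e)"
proof -
  have n: "e \<bullet> e = 1" "e' \<bullet> e' = 1" using assms by (simp_all add: dot_square_norm)
  have c: "e' \<bullet> e \<le> 1" using norm_cauchy_schwarz[of e' e] assms by simp
  have "(r * norm (e' - e))\<^sup>2 = r * r * (2 * (1 - e' \<bullet> e))"
  proof -
    have "(norm (e' - e))\<^sup>2 = 2 * (1 - e' \<bullet> e)"
      by (simp add: power2_norm_eq_inner inner_diff_left inner_diff_right n inner_commute[of e e'])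
    then show ?thesis by (simp add: power_mult_distrib power2_eq_square[of r])
  qed
  also have "\<dots> \<le> a * b * (2 * (1 - e' \<bullet> e))" using assms c by (intro mult_right_mono mult_mono) auto
  also have "\<dots> \<le> (a - b)\<^sup>2 + a * b * (2 * (1 - e' \<bullet> e))" by simp
  also have "\<dots> = (norm (b *\<^sub>R e' - a *\<^sub>R e))\<^sup>2"
  proof -
    have "(norm (b *\<^sub>R e' - a *\<^sub>R e))\<^sup>2 = b * b - 2 * (a * b * (e' \<bullet> e)) + a * a"
      unfolding power2_norm_eq_inner by (simp add: inner_diff_left inner_diff_right n inner_commute[of e e'] algebra_simps)
    then show ?thesis by (simp add: power2_diff power2_eq_square algebra_simps)
  qed
  finally show ?thesis by (rule power2_le_imp_le) simp
qed

lemma ball_subset_of_radius: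
  assumes "convex_region C p" and "\<And>\<theta>. \<rho> \<le> radius C p (dir \<theta>)"
  shows "ball p \<rho> \<subseteq> C"
proof
  interpret convex_region C p by fact
  fix x assume x: "x \<in> ball p \<rho>"
  show "x \<in> C"
  proof (cases "x = p")
    case False
    then obtain \<theta> where \<theta>: "x - p = norm (x - p) *\<^sub>R dir \<theta>" using polar_direction[of "x - p"] by auto
    then have "x = p + norm (x - p) *\<^sub>R dir \<theta>" by (metis add.commute diff_add_cancel)
    moreover have "p + norm (x - p) *\<^sub>R dir \<theta> \<in> C"
      using radius_le_iff[of "dir \<theta>" "norm (x - p)"] assms(2)[of \<theta>] x by (simp add: dist_norm norm_minus_commute)
    ultimately show ?thesis by simp
  qed (use p in simp)
qed

section \<open>Rays, widths and cells of the perforated domain\<close>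

locale perforated_domain =
  fixes F \<Omega> :: "(real^2) set" and n :: nat and p :: "nat \<Rightarrow> real^2" and r :: real
  assumes F: "bounded F" "open F" "convex F" and n: "n \<ge> 1" and r: "r > 0"
    and disk_F: "\<And>j. j \<in> {1..n} \<Longrightarrow> cball (p j) r \<subseteq> F"
    and disks: "\<And>j k. j \<in> {1..n} \<Longrightarrow> k \<in> {1..n} \<Longrightarrow> j \<noteq> k \<Longrightarrow> cball (p j) r \<inter> cball (p k) r = {}"
    and \<Omega>: "\<Omega> = F - (\<Union>j\<in>{1..n}. cball (p j) r)"
begin

lemma region: "j \<in> {1..n} \<Longrightarrow> convex_region F (p j)"
  using F disk_F[of j] r by unfold_locales (auto intro: subsetD[of "cball (p j) r"])

lemma open_\<Omega>: "open \<Omega>"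
  unfolding \<Omega> using F(2) by (intro open_Diff closed_UN) auto

lemma frontier_\<Omega>I: "x \<in> closure \<Omega> \<Longrightarrow> x \<notin> \<Omega> \<Longrightarrow> x \<in> frontier \<Omega>"
  using open_\<Omega> by (simp add: frontier_def interior_open)

lemma not_frontier: "x \<in> \<Omega> \<Longrightarrow> x \<notin> frontier \<Omega>"
  using open_\<Omega> by (simp add: frontier_def interior_open)

lemma center_dist: "j \<in> {1..n} \<Longrightarrow> k \<in> {1..n} \<Longrightarrow> j \<noteq> k \<Longrightarrow> 2 * r < dist (p j) (p k)"
proof (rule ccontr)
  assume jk: "j \<in> {1..n}" "k \<in> {1..n}" "j \<noteq> k" and "\<not> ?thesis"
  then have "midpoint (p j) (p k) \<in> cball (p j) r \<inter> cball (p k) r" by (simp add: dist_midpoint)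
  then show False using disks[OF jk] by blast
qed

lemma outer_in_frontier:
  assumes j: "j \<in> {1..n}"
  shows "p j + radius F (p j) (dir \<theta>) *\<^sub>R dir \<theta> \<in> frontier \<Omega>"
proof -
  interpret convex_region F "p j" using region[OF j] .
  let ?y = "p j + radius F (p j) (dir \<theta>) *\<^sub>R dir \<theta>"
  let ?D = "\<Union>j\<in>{1..n}. cball (p j) r"
  have nF: "?y \<notin> F" and cF: "?y \<in> closure F" using radius_not_in radius_in_closure by auto
  have "?D \<subseteq> F" using disk_F by blast
  then have nD: "?y \<in> - ?D" using nF by blast
  have "open (- ?D)" by (intro open_Compl closed_UN) auto
  from subsetD[OF open_Int_closure_subset[OF this, of F]] nD cF
  have "?y \<in> closure (- ?D \<inter> F)" by blast
  moreover have "- ?D \<inter> F = \<Omega>" unfolding \<Omega> by blast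
  ultimately show ?thesis using nF by (intro frontier_\<Omega>I) (auto simp: \<Omega>)
qed

lemma sphere_in_frontier:
  assumes k: "k \<in> {1..n}" and y: "dist (p k) y = r"
  shows "y \<in> frontier \<Omega>"
proof -
  let ?W = "F \<inter> - (\<Union>l\<in>{1..n} - {k}. cball (p l) r)"
  have oW: "open ?W" using F(2) by (intro open_Int open_Compl closed_UN) auto
  have yk: "y \<in> cball (p k) r" using y by simp
  have "y \<notin> cball (p l) r" if "l \<in> {1..n} - {k}" for l using disks[of l k] that k yk by blast
  then have yW: "y \<in> ?W" using disk_F[OF k] yk by blast
  have yc: "y \<in> closure (- cball (p k) r)" using y by (simp add: closure_complement)
  have "y \<in> closure (?W \<inter> - cball (p k) r)" using subsetD[OF open_Int_closure_subset[OF oW]] yW yc by blast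
  moreover have "?W \<inter> - cball (p k) r = \<Omega>" unfolding \<Omega> using k by blast
  ultimately show ?thesis using k y by (intro frontier_\<Omega>I) (auto simp: \<Omega>)
qed

abbreviation "ray j \<theta> \<equiv> ray_length \<Omega> (p j + r *\<^sub>R dir \<theta>) (dir \<theta>)"
abbreviation "\<beta> \<equiv> min_width \<Omega> n p r"
abbreviation "B \<equiv> max_width \<Omega> n p r"

lemma ray_le:
  assumes "0 < t" "p j + (r + t) *\<^sub>R dir \<theta> \<in> frontier \<Omega>"
  shows "ray j \<theta> \<le> t"
  unfolding ray_length_def
  by (rule cInf_lower) (use assms in \<open>auto simp: scaleR_add_left add.assoc intro!: bdd_belowI[of _ 0]\<close>)

lemma disk_radius_less:
  assumes "j \<in> {1..n}"
  shows "r < radius F (p j) (dir \<theta>)"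
proof -
  interpret convex_region F "p j" using region[OF assms] .
  have "p j + r *\<^sub>R dir \<theta> \<in> cball (p j) r" using r by (simp add: dist_norm)
  then have "p j + r *\<^sub>R dir \<theta> \<in> F" using disk_F[OF assms] by blast
  then show ?thesis using radius_le_iff[of "dir \<theta>" r] r by simp
qed

lemma ray_le_radius:
  assumes "j \<in> {1..n}"
  shows "ray j \<theta> \<le> radius F (p j) (dir \<theta>) - r"
  by (rule ray_le) (use outer_in_frontier[OF assms] disk_radius_less[OF assms] in auto)

lemma ray_ge:
  assumes j: "j \<in> {1..n}" and "\<And>t. 0 < t \<Longrightarrow> t < T \<Longrightarrow> p j + (r + t) *\<^sub>R dir \<theta> \<in> \<Omega>"
  shows "T \<le> ray j \<theta>"
  unfolding ray_length_def
proof (rule cInf_greatest)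
  \<comment> \<open>The outer boundary is met at this parameter, so the infimum is over a nonempty
    set.\<close>
  have "radius F (p j) (dir \<theta>) - r \<in> {t. 0 < t \<and> p j + r *\<^sub>R dir \<theta> + t *\<^sub>R dir \<theta> \<in> frontier \<Omega>}"
    using outer_in_frontier[OF j, of \<theta>] disk_radius_less[OF j, of \<theta>] by (simp add: scaleR_diff_left)
  then show "{t. 0 < t \<and> p j + r *\<^sub>R dir \<theta> + t *\<^sub>R dir \<theta> \<in> frontier \<Omega>} \<noteq> {}" by blast
  fix t assume "t \<in> {t. 0 < t \<and> p j + r *\<^sub>R dir \<theta> + t *\<^sub>R dir \<theta> \<in> frontier \<Omega>}"
  then have t: "0 < t" "p j + (r + t) *\<^sub>R dir \<theta> \<in> frontier \<Omega>" by (auto simp: scaleR_add_left add.assoc)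
  then show "T \<le> t" using assms(2)[OF t(1)] not_frontier by force
qed

lemma ray_nonneg: "j \<in> {1..n} \<Longrightarrow> 0 \<le> ray j \<theta>"
  by (rule ray_ge) auto

lemma ray_lengths: "orthogonal_ray_lengths \<Omega> n p r = {ray j \<theta> | j \<theta>. j \<in> {1..n}}"
proof -
  have *: "\<exists>\<theta>. x = p j + r *\<^sub>R dir \<theta>" if "x \<in> sphere (p j) r" for x j
  proof -
    have "x - p j \<noteq> 0" "norm (x - p j) = r" using that r by (auto simp: dist_norm norm_minus_commute)
    then obtain \<theta> where "x - p j = r *\<^sub>R dir \<theta>" using polar_direction[of "x - p j"] by auto
    then have "x = p j + r *\<^sub>R dir \<theta>" by (metis add.commute diff_add_cancel)
    then show ?thesis ..
  qed
  have **: "p j + r *\<^sub>R dir \<theta> \<in> sphere (p j) r" for j \<theta> using r by (simp add: dist_norm)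
  have ***: "(p j + r *\<^sub>R dir \<theta> - p j) /\<^sub>R r = dir \<theta>" for j \<theta> using r by simp
  show ?thesis unfolding orthogonal_ray_lengths_def 
  proof (intro equalityI subsetI)
    fix l assume "l \<in> {ray_length \<Omega> x ((x - p j) /\<^sub>R r) |j x. j \<in> {1..n} \<and> x \<in> sphere (p j) r}"
    then obtain j x where l: "j \<in> {1..n}" "x \<in> sphere (p j) r" "l = ray_length \<Omega> x ((x - p j) /\<^sub>R r)" by blast
    then obtain \<theta> where x: "x = p j + r *\<^sub>R dir \<theta>" using * by blast
    show "l \<in> {ray j \<theta> |j \<theta>. j \<in> {1..n}}" unfolding l(3) x *** using l(1) by blast
  next
    fix l assume "l \<in> {ray j \<theta> |j \<theta>. j \<in> {1..n}}"
    then obtain j \<theta> where l: "j \<in> {1..n}" "l = ray j \<theta>" by blast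
    show "l \<in> {ray_length \<Omega> x ((x - p j) /\<^sub>R r) |j x. j \<in> {1..n} \<and> x \<in> sphere (p j) r}"
      unfolding l(2) using l(1) **[of j \<theta>] ***[of j \<theta>] by (intro CollectI exI[of _ j] exI[of _ "p j + r *\<^sub>R dir \<theta>"] conjI) auto
  qed
qed

lemma ray_bounded: "\<exists>M. \<forall>j\<in>{1..n}. \<forall>\<theta>. ray j \<theta> \<le> M"
proof -
  have "\<exists>M. \<forall>\<theta>. ray j \<theta> \<le> M" if j: "j \<in> {1..n}" for j
  proof -
    interpret convex_region F "p j" using region[OF j] .
    obtain M where M: "\<And>\<theta>. norm (bpt \<theta>) \<le> M" using bpt_bounded by blast
    have "ray j \<theta> \<le> M" for \<theta> using ray_le_radius[OF j, of \<theta>] M[of \<theta>] r unfolding norm_bpt by linarith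
    then show ?thesis by blast
  qed
  then obtain M where M: "\<And>j \<theta>. j \<in> {1..n} \<Longrightarrow> ray j \<theta> \<le> M j" by metis
  have "ray j \<theta> \<le> Max (M ` {1..n})" if j: "j \<in> {1..n}" for j \<theta>
  proof -
    have "M j \<le> Max (M ` {1..n})" using j by (intro Max_ge) auto
    then show ?thesis using M[OF j, of \<theta>] by simp
  qed
  then show ?thesis by blast
qed

lemma \<beta>_le: "j \<in> {1..n} \<Longrightarrow> \<beta> \<le> ray j \<theta>"
  unfolding min_width_def ray_lengths by (rule cInf_lower) (auto intro!: bdd_belowI[of _ 0] ray_nonneg)

lemma B_ge: 
  assumes j: "j \<in> {1..n}"
  shows "ray j \<theta> \<le> B"
proof -
  obtain M where M: "\<forall>j\<in>{1..n}. \<forall>\<theta>. ray j \<theta> \<le> M" using ray_bounded by blast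
  show ?thesis unfolding max_width_def ray_lengths by (rule cSup_upper) (use M j in \<open>auto intro!: bdd_aboveI[of _ M]\<close>)
qed

lemma \<beta>_nonneg: "0 \<le> \<beta>"
proof -
  have "1 \<in> {1..n}" using n by simp
  then have "{ray j \<theta> | j \<theta>. j \<in> {1..n}} \<noteq> {}" by blast
  then show ?thesis unfolding min_width_def ray_lengths by (rule cInf_greatest) (use ray_nonneg in auto)
qed

lemma ball_in_F: 
  assumes j: "j \<in> {1..n}"
  shows "ball (p j) (r + \<beta>) \<subseteq> F"
proof (rule ball_subset_of_radius[OF region[OF j]])
  show "r + \<beta> \<le> radius F (p j) (dir \<theta>)" for \<theta> using \<beta>_le[OF j, of \<theta>] ray_le_radius[OF j, of \<theta>] by linarith
qed

text \<open>The ray from disk j along the line of centres meets disk k after length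
  \<open>dist (p j) (p k) - 2 * r\<close> at the latest.\<close>

lemma gap_ge:
  assumes jk: "j \<in> {1..n}" "k \<in> {1..n}" "j \<noteq> k"
  shows "2 * r + \<beta> \<le> dist (p j) (p k)"
proof -
  define d where "d = dist (p j) (p k)"
  have d: "2 * r < d" using center_dist[OF jk] unfolding d_def .
  then have "p k - p j \<noteq> 0" using r unfolding d_def by auto
  then obtain \<theta> where \<theta>: "p k - p j = d *\<^sub>R dir \<theta>"
    using polar_direction[of "p k - p j"] unfolding d_def dist_norm by (auto simp: norm_minus_commute)
  have "p j + (r + (d - 2 * r)) *\<^sub>R dir \<theta> = p k - r *\<^sub>R dir \<theta>"
  proof -
    have "p k = p j + d *\<^sub>R dir \<theta>" using \<theta> by (metis add.commute diff_add_cancel)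
    then show ?thesis by (simp add: algebra_simps)
  qed
  then have "p j + (r + (d - 2 * r)) *\<^sub>R dir \<theta> \<in> frontier \<Omega>"
    using sphere_in_frontier[OF jk(2), of "p k - r *\<^sub>R dir \<theta>"] r by (simp add: dist_norm)
  then have "ray j \<theta> \<le> d - 2 * r" using d by (intro ray_le) auto
  then show ?thesis using \<beta>_le[OF jk(1), of \<theta>] unfolding d_def by linarith
qed

text \<open>Rotate a ray issuing from an extreme disk from a free direction until it first meets another
  disk: rays just before that position pass the other disk and are longer than \<open>2 * \<beta>\<close>, up to an arbitrarily small error.\<close>

lemma two_widths_le:
  assumes n2: "n \<ge> 2"
  shows "2 * \<beta> \<le> B"
proof -
  \<comment> \<open>The rightmost centre: from it the ray in direction \<open>dir 0\<close> misses
    all other disks, so the rotation can start at angle 0.\<close>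
  define j where "j = arg_min_on (\<lambda>j. - (p j $ 1)) {1..n}"
  have j: "j \<in> {1..n}" and jmax: "\<And>k. k \<in> {1..n} \<Longrightarrow> p k $ 1 \<le> p j $ 1"
  proof -
    have fin: "finite {1..n}" "{1..n} \<noteq> {}" using n by auto
    show "j \<in> {1..n}" unfolding j_def by (rule arg_min_if_finite(1)[OF fin])
    show "p k $ 1 \<le> p j $ 1" if "k \<in> {1..n}" for k
      using arg_min_if_finite(2)[OF fin, of "\<lambda>j. - (p j $ 1)"] that unfolding j_def[symmetric] by force
  qed
  interpret convex_region F "p j" using region[OF j] .
  obtain k0 where k0: "k0 \<in> {1..n}" "k0 \<noteq> j"
  proof (cases "j = 1")
    case True
    then show thesis using n2 that[of 2] by auto
  qed (use n that[of 1] in auto)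
  define K where "K = {1..n} - {j}"
  have K: "finite K" "k0 \<in> K" using k0 unfolding K_def by auto
  have "p k0 - p j \<noteq> 0" using center_dist[OF j k0(1)] k0(2) r by auto
  then obtain \<theta>k where \<theta>k: "p k0 - p j = norm (p k0 - p j) *\<^sub>R dir \<theta>k" using polar_direction by blast
  \<comment> \<open>Full turns are added to make the angle of another centre nonnegative; the
    rotation runs over [0, \<theta>1] and hits a disk at \<theta>1.\<close>
  define \<theta>1 where "\<theta>1 = \<theta>k + 2 * pi * of_int \<lceil>\<bar>\<theta>k\<bar>\<rceil>"
  have \<theta>1: "0 \<le> \<theta>1" "dir \<theta>1 = dir \<theta>k"
  proof -
    have "\<bar>\<theta>k\<bar> \<le> of_int \<lceil>\<bar>\<theta>k\<bar>\<rceil>" by (rule le_of_int_ceiling)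
    moreover have "1 * of_int \<lceil>\<bar>\<theta>k\<bar>\<rceil> \<le> 2 * pi * (of_int \<lceil>\<bar>\<theta>k\<bar>\<rceil> :: real)" using pi_gt3 by (intro mult_right_mono) auto
    ultimately show "0 \<le> \<theta>1" unfolding \<theta>1_def by linarith
    show "dir \<theta>1 = dir \<theta>k" unfolding \<theta>1_def by (rule dir_2pi_int)
  qed
  \<comment> \<open>A point within r of another centre has distance at most D from
    \<open>p j\<close>. Restricting the rays to length D therefore loses no hit and makes the set of
    hitting angles compact.\<close>
  define D where "D = Max ((\<lambda>k. dist (p j) (p k)) ` K) + r"
  define Z where "Z = (\<Union>k\<in>K. ({0..\<theta>1} \<times> {0..D}) \<inter> {z. dist (p j + snd z *\<^sub>R dir (fst z)) (p k) \<le> r})"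
  define Hs where "Hs = fst ` Z"
  have hit: "\<theta> \<in> Hs" if \<theta>: "0 \<le> \<theta>" "\<theta> \<le> \<theta>1" and k: "k \<in> K" and t: "0 \<le> t" "dist (p j + t *\<^sub>R dir \<theta>) (p k) \<le> r" for \<theta> k t
  proof -
    have "t = dist (p j + t *\<^sub>R dir \<theta>) (p j)" using t by (simp add: dist_norm)
    also have "\<dots> \<le> dist (p j + t *\<^sub>R dir \<theta>) (p k) + dist (p j) (p k)" by (rule dist_triangle2)
    also have "\<dots> \<le> D"
    proof -
      have "dist (p j) (p k) \<le> Max ((\<lambda>k. dist (p j) (p k)) ` K)" using K k by (intro Max_ge) auto
      then show ?thesis using t(2) unfolding D_def by linarith
    qed
    finally have "(\<theta>, t) \<in> Z" using \<theta> k t unfolding Z_def by (intro UN_I[of k]) auto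
    then have "fst (\<theta>, t) \<in> fst ` Z" by (rule imageI)
    then show ?thesis unfolding Hs_def by simp
  qed
  have "compact Z" unfolding Z_def
  proof (intro compact_UN K ballI)
    fix k
    have "closed {z. dist (p j + snd z *\<^sub>R dir (fst z)) (p k) \<le> r}"
      by (intro closed_Collect_le continuous_intros continuous_on_compose2[OF continuous_dir[of UNIV]]) auto
    moreover have "compact ({0..\<theta>1} \<times> {0..D})" by (intro compact_Times) auto
    ultimately show "compact (({0..\<theta>1} \<times> {0..D}) \<inter> {z. dist (p j + snd z *\<^sub>R dir (fst z)) (p k) \<le> r})"
      by (rule compact_Int_closed[rotated])
  qed
  then have cH: "compact Hs" unfolding Hs_def by (intro compact_continuous_image continuous_intros)
  have "\<theta>1 \<in> Hs"
  proof (rule hit[OF \<theta>1(1) order_refl K(2)])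
    have "p j + norm (p k0 - p j) *\<^sub>R dir \<theta>1 = p k0" unfolding \<theta>1(2) using \<theta>k by (metis add.commute diff_add_cancel)
    then show "dist (p j + norm (p k0 - p j) *\<^sub>R dir \<theta>1) (p k0) \<le> r" using r by simp
  qed simp
  then have "Hs \<noteq> {}" by blast
  from compact_attains_inf[OF cH this]
  obtain \<theta>' where \<theta>': "\<theta>' \<in> Hs" "\<And>\<theta>. \<theta> \<in> Hs \<Longrightarrow> \<theta>' \<le> \<theta>" by blast
  from \<theta>'(1) obtain k t where kt: "k \<in> K" "0 \<le> \<theta>'" "\<theta>' \<le> \<theta>1" "0 \<le> t" "dist (p j + t *\<^sub>R dir \<theta>') (p k) \<le> r"
    unfolding Hs_def Z_def by auto
  have kn: "k \<in> {1..n}" "k \<noteq> j" using kt(1) unfolding K_def by auto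
  have "\<theta>' \<noteq> 0"
  proof
    assume "\<theta>' = 0"
    define w where "w = p j - p k"
    have w1: "0 \<le> w \<bullet> dir 0" using jmax[OF kn(1)] by (simp add: w_def inner_vec_def sum_2)
    have "2 * r \<le> norm w" using center_dist[OF j kn(1)] kn(2) unfolding w_def dist_norm by simp
    then have "(2 * r)\<^sup>2 \<le> (norm w)\<^sup>2" using r by (intro power_mono) auto
    then have "(2 * r)\<^sup>2 \<le> w \<bullet> w" unfolding power2_norm_eq_inner .
    also have "\<dots> \<le> w \<bullet> w + 2 * t * (w \<bullet> dir 0) + t\<^sup>2" using w1 kt(4) by simp
    also have "\<dots> = (dist (p j + t *\<^sub>R dir \<theta>') (p k))\<^sup>2"
    proof -
      have "p j + t *\<^sub>R dir \<theta>' - p k = w + t *\<^sub>R dir 0" unfolding w_def \<open>\<theta>' = 0\<close> by simp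
      moreover have "(norm (w + t *\<^sub>R dir 0))\<^sup>2 = w \<bullet> w + 2 * t * (w \<bullet> dir 0) + t\<^sup>2"
        unfolding power2_norm_eq_inner
        by (simp add: inner_add_left inner_add_right inner_commute[of "dir 0" w] inner_dir power2_eq_square algebra_simps)
      ultimately show ?thesis unfolding dist_norm by (simp only:)
    qed
    also have "\<dots> \<le> r\<^sup>2" using kt(5) by (intro power_mono) auto
    finally show False using r by (simp add: power_mult_distrib)
  qed
  then have \<theta>'0: "0 < \<theta>'" using kt(2) by simp
  have t_ge: "r + \<beta> \<le> t"
    using gap_ge[OF j kn(1)] kn(2) kt(4,5) dist_triangle[of "p j" "p k" "p j + t *\<^sub>R dir \<theta>'"] by (simp add: dist_norm)
  \<comment> \<open>At angle \<theta>' the point at distance t + b from \<open>p j\<close> is within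
    r + b of \<open>p k\<close>, hence still in F, which contains the ball of radius r + \<beta>
    there. By openness this persists for a slightly smaller angle, whose ray meets no other disk;
    its length is at least t + b - r \<ge> \<beta> + b.\<close>
  have "\<beta> + b \<le> B" if b: "0 \<le> b" "b < \<beta>" for b
  proof -
    let ?q = "\<lambda>\<theta>. p j + (t + b) *\<^sub>R dir \<theta>"
    have "dist (p k) (?q \<theta>') \<le> r + b"
    proof -
      have "dist (p j + t *\<^sub>R dir \<theta>') (?q \<theta>') = b" using b by (simp add: dist_norm scaleR_add_left)
      then show ?thesis using kt(5) dist_triangle[of "p k" "?q \<theta>'" "p j + t *\<^sub>R dir \<theta>'"] by (simp add: dist_commute)
    qed
    then have "?q \<theta>' \<in> F" using ball_in_F[OF kn(1)] b by auto
    moreover have "continuous_on UNIV ?q" by (intro continuous_intros continuous_dir)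
    ultimately have "open (?q -` F)" "\<theta>' \<in> ?q -` F" using F(2) by (auto intro: open_vimage)
    then obtain \<delta> where \<delta>: "\<delta> > 0" "ball \<theta>' \<delta> \<subseteq> ?q -` F" using open_contains_ball by blast
    define \<theta> where "\<theta> = max 0 (\<theta>' - \<delta> / 2)"
    have \<theta>: "0 \<le> \<theta>" "\<theta> < \<theta>'" "\<theta> \<in> ball \<theta>' \<delta>" using \<theta>'0 \<delta>(1) unfolding \<theta>_def by (auto simp: dist_real_def)
    have qF: "?q \<theta> \<in> F" using \<delta>(2) \<theta>(3) by blast
    have tb: "t + b < radius F (p j) (dir \<theta>)" using radius_le_iff[of "dir \<theta>" "t + b"] qF kt(4) b by simp
    have "t + b - r \<le> ray j \<theta>"
    proof (rule ray_ge[OF j])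
      fix s assume s: "0 < s" "s < t + b - r"
      have "p j + (r + s) *\<^sub>R dir \<theta> \<in> F" using radius_le_iff[of "dir \<theta>" "r + s"] s tb r by simp
      moreover have "p j + (r + s) *\<^sub>R dir \<theta> \<notin> cball (p l) r" if l: "l \<in> {1..n}" for l
      proof (cases "l = j")
        case True
        then show ?thesis using s r by (simp add: dist_norm)
      next
        case False
        then have "l \<in> K" using l unfolding K_def by simp
        then show ?thesis using hit[of \<theta> l "r + s"] \<theta>'(2)[of \<theta>] \<theta> kt(3) s r by (auto simp: dist_commute)
      qed
      ultimately show "p j + (r + s) *\<^sub>R dir \<theta> \<in> \<Omega>" unfolding \<Omega> by blast
    qed
    then show ?thesis using B_ge[OF j, of \<theta>] t_ge by linarith
  qed
  note main = this
  show ?thesis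
  proof (cases "\<beta> = 0")
    case True
    then show ?thesis using B_ge[OF j, of 0] ray_nonneg[OF j, of 0] by linarith
  next
    case False
    then have b0: "\<beta> > 0" using \<beta>_nonneg by simp
    show ?thesis
    proof (rule ccontr)
      assume "\<not> ?thesis"
      then have "B - \<beta> < \<beta>" by simp
      then have "max 0 (B - \<beta>) < \<beta>" using b0 by simp
      then obtain b where "max 0 (B - \<beta>) < b" "b < \<beta>" using dense by blast
      then show False using main[of b] by simp
    qed
  qed
qed

definition cell :: "nat \<Rightarrow> (real^2) set" where
  "cell j = F \<inter> (\<Inter>k\<in>{1..n} - {j}. {x. dist x (p j) < dist x (p k)})"

lemma cell_halfplane: "{x. dist x (p j) < dist x (p k)} = {x. (2 *\<^sub>R (p k - p j)) \<bullet> x < p k \<bullet> p k - p j \<bullet> p j}"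
proof -
  have "dist x (p j) < dist x (p k) \<longleftrightarrow> (dist x (p j))\<^sup>2 < (dist x (p k))\<^sup>2" for x
    by (simp add: not_le[symmetric])
  moreover have "(dist x (p j))\<^sup>2 < (dist x (p k))\<^sup>2 \<longleftrightarrow> (2 *\<^sub>R (p k - p j)) \<bullet> x < p k \<bullet> p k - p j \<bullet> p j" for x
    unfolding dist_norm power2_norm_eq_inner by (auto simp: inner_diff_left inner_diff_right inner_commute algebra_simps)
  ultimately show ?thesis by simp
qed

text \<open>A lower bound for the distance from a disk to the boundary of its cell: neighbouring
  cells share the gap between their disks, while a single cell is all of F.\<close>

definition cell_width :: real where
  "cell_width = (if n = 1 then \<beta> else \<beta> / 2)"

lemma cell_width: "0 \<le> cell_width" "cell_width \<le> \<beta>" "2 * cell_width \<ge> \<beta>"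
  using \<beta>_nonneg unfolding cell_width_def by auto

lemma cell_sub_F: "cell j \<subseteq> F"
  unfolding cell_def by blast

lemma ball_in_cell:
  assumes j: "j \<in> {1..n}"
  shows "ball (p j) (r + cell_width) \<subseteq> cell j"
proof
  fix x assume x: "x \<in> ball (p j) (r + cell_width)"
  then have "x \<in> F" using ball_in_F[OF j] cell_width by auto
  moreover have "dist x (p j) < dist x (p k)" if k: "k \<in> {1..n} - {j}" for k
  proof -
    have "n \<noteq> 1" using j k by auto
    then have w: "cell_width = \<beta> / 2" unfolding cell_width_def by simp
    have "2 * r + \<beta> \<le> dist (p j) (p k)" using gap_ge[OF j] k by auto
    then show ?thesis using x w dist_triangle3[of "p j" "p k" x] by (simp add: dist_commute)
  qed
  ultimately show "x \<in> cell j" unfolding cell_def by blast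
qed

lemma disk_in_cell:
  assumes j: "j \<in> {1..n}"
  shows "cball (p j) r \<subseteq> cell j"
proof
  fix x assume x: "x \<in> cball (p j) r"
  then have "x \<in> F" using disk_F[OF j] by blast
  moreover have "dist x (p j) < dist x (p k)" if k: "k \<in> {1..n} - {j}" for k
    using center_dist[OF j, of k] k x dist_triangle3[of "p j" "p k" x] by (simp add: dist_commute)
  ultimately show "x \<in> cell j" unfolding cell_def by blast
qed

lemma cell_region:
  assumes j: "j \<in> {1..n}"
  shows "convex_region (cell j) (p j)"
proof
  show "convex (cell j)" unfolding cell_def cell_halfplane
    by (intro convex_Int F convex_INT ballI convex_halfspace_lt)
  show "open (cell j)" unfolding cell_def cell_halfplane
    by (intro open_Int F open_INT ballI open_halfspace_lt) auto
  show "bounded (cell j)" using F(1) cell_sub_F by (rule bounded_subset)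
  show "p j \<in> cell j" using disk_in_cell[OF j] r by auto
qed

lemma cell_minus_disk:
  assumes j: "j \<in> {1..n}"
  shows "cell j \<inter> \<Omega> = cell j - cball (p j) r"
proof -
  have "x \<notin> cball (p k) r" if x: "x \<in> cell j" and k: "k \<in> {1..n} - {j}" for x k
  proof
    assume "x \<in> cball (p k) r"
    moreover have "dist x (p j) < dist x (p k)" using x k unfolding cell_def by blast
    ultimately show False using center_dist[OF j, of k] k dist_triangle[of "p j" "p k" x] by (simp add: dist_commute)
  qed
  then show ?thesis unfolding \<Omega> using cell_sub_F[of j] j by blast
qed

lemma other_center_not_in_cell: "k \<in> {1..n} \<Longrightarrow> k \<noteq> j \<Longrightarrow> p k \<notin> cell j"
proof
  assume "k \<in> {1..n}" "k \<noteq> j" "p k \<in> cell j"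
  then have "dist (p k) (p j) < dist (p k) (p k)" unfolding cell_def by blast
  then show False by simp
qed

text \<open>Within its cell a radial segment from disk j meets none of the other disks, so it is
  part of an orthogonal ray.\<close>

lemma cell_radius_le:
  assumes j: "j \<in> {1..n}"
  shows "radius (cell j) (p j) (dir \<theta>) - r \<le> B"
proof -
  interpret convex_region "cell j" "p j" using cell_region[OF j] .
  have "radius (cell j) (p j) (dir \<theta>) - r \<le> ray j \<theta>"
  proof (rule ray_ge[OF j])
    fix t assume t: "0 < t" "t < radius (cell j) (p j) (dir \<theta>) - r"
    then have "p j + (r + t) *\<^sub>R dir \<theta> \<in> cell j" using radius_le_iff[of "dir \<theta>" "r + t"] r by simp
    moreover have "p j + (r + t) *\<^sub>R dir \<theta> \<notin> cball (p j) r" using t r by (simp add: dist_norm)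
    ultimately show "p j + (r + t) *\<^sub>R dir \<theta> \<in> \<Omega>" using cell_minus_disk[OF j] by blast
  qed
  then show ?thesis using B_ge[OF j, of \<theta>] by linarith
qed

lemma cells_disjoint: "j \<in> {1..n} \<Longrightarrow> k \<in> {1..n} \<Longrightarrow> j \<noteq> k \<Longrightarrow> cell j \<inter> cell k = {}"
proof (rule equals0I)
  fix x assume "j \<in> {1..n}" "k \<in> {1..n}" "j \<noteq> k" "x \<in> cell j \<inter> cell k"
  then have "dist x (p j) < dist x (p k)" "dist x (p k) < dist x (p j)" unfolding cell_def by blast+
  then show False by simp
qed

text \<open>An uncovered point is equidistant from its nearest centre j and from some k that keeps
  it out of the cell of j; such points lie on finitely many lines.\<close>

lemma cells_cover: "negligible (F - (\<Union>j\<in>{1..n}. cell j))"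
proof -
  have hp: "{x. dist x (p j) = dist x (p k)} = {x. (2 *\<^sub>R (p k - p j)) \<bullet> x = p k \<bullet> p k - p j \<bullet> p j}" for j k
  proof -
    have "dist x (p j) = dist x (p k) \<longleftrightarrow> (dist x (p j))\<^sup>2 = (dist x (p k))\<^sup>2" for x by simp
    moreover have "(dist x (p j))\<^sup>2 = (dist x (p k))\<^sup>2 \<longleftrightarrow> (2 *\<^sub>R (p k - p j)) \<bullet> x = p k \<bullet> p k - p j \<bullet> p j" for x
      unfolding dist_norm power2_norm_eq_inner by (auto simp: inner_diff_left inner_diff_right inner_commute algebra_simps)
    ultimately show ?thesis by simp
  qed
  have "F - (\<Union>j\<in>{1..n}. cell j) \<subseteq> (\<Union>j\<in>{1..n}. \<Union>k\<in>{1..n} - {j}. {x. dist x (p j) = dist x (p k)})"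
  proof
    fix x assume x: "x \<in> F - (\<Union>j\<in>{1..n}. cell j)"
    have fin: "finite {1..n}" "{1..n} \<noteq> {}" using n by auto
    define j where "j = arg_min_on (\<lambda>j. dist x (p j)) {1..n}"
    have j: "j \<in> {1..n}" unfolding j_def by (rule arg_min_if_finite(1)[OF fin])
    have jmin: "dist x (p j) \<le> dist x (p k)" if "k \<in> {1..n}" for k
      using arg_min_if_finite(2)[OF fin, of "\<lambda>j. dist x (p j)"] that unfolding j_def[symmetric] by force
    have "x \<notin> cell j" using x j by blast
    then obtain k where k: "k \<in> {1..n} - {j}" "\<not> dist x (p j) < dist x (p k)" using x unfolding cell_def by blast
    then have "dist x (p j) = dist x (p k)" using jmin[of k] by auto
    then show "x \<in> (\<Union>j\<in>{1..n}. \<Union>k\<in>{1..n} - {j}. {x. dist x (p j) = dist x (p k)})" using j k by blast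
  qed
  moreover have "negligible (\<Union>j\<in>{1..n}. \<Union>k\<in>{1..n} - {j}. {x. dist x (p j) = dist x (p k)})"
  proof -
    have "negligible {x. dist x (p j) = dist x (p k)}" if j: "j \<in> {1..n}" and k: "k \<in> {1..n} - {j}" for j k
    proof -
      have "p k - p j \<noteq> 0" using center_dist[OF j, of k] k r by auto
      then show ?thesis unfolding hp by (intro negligible_hyperplane) auto
    qed
    then have "negligible (\<Union>k\<in>{1..n} - {j}. {x. dist x (p j) = dist x (p k)})" if "j \<in> {1..n}" for j
      by (intro negligible_Union) (use that in blast)+
    then show ?thesis by (intro negligible_Union) blast+
  qed
  ultimately show ?thesis using negligible_subset by blast
qed

end

subsection \<open>The inequality on a single loop\<close>

lemma continuous_on_unit_intervals:
  assumes "\<And>i. i < N \<Longrightarrow> continuous_on {real i..real (Suc i)} f"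
  shows "continuous_on {0..real N} f"
  using assms
proof (induction N)
  case (Suc N)
  have "{0..real (Suc N)} = {0..real N} \<union> {real N..real (Suc N)}" by auto
  then show ?case using Suc continuous_on_closed_Un[of "{0..real N}" "{real N..real (Suc N)}" f] by auto
qed simp

lemma integral_unit_intervals:
  fixes f :: "real \<Rightarrow> real"
  assumes "\<And>i. i < N \<Longrightarrow> continuous_on {0..1} (h i)"
    and "\<And>i \<tau>. i < N \<Longrightarrow> 0 < \<tau> \<Longrightarrow> \<tau> < 1 \<Longrightarrow> f (real i + \<tau>) = h i \<tau>"
  shows "piecewise_cont N f" "integral {0..real N} f = (\<Sum>i<N. integral {0..1} (h i))"
proof -
  have k: "continuous_on {real i..real (Suc i)} (\<lambda>t. h i (t - real i))" if "i < N" for i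
    by (rule continuous_on_compose2[OF assms(1)[OF that]]) (auto intro!: continuous_intros)
  have eq: "f t = h i (t - real i)" if "i < N" "t \<in> {real i<..<real (Suc i)}" for i t
    using assms(2)[of i "t - real i"] that by auto
  show pc: "piecewise_cont N f"
    unfolding piecewise_cont_def using k eq by blast
  have piece: "integral {real i..real (Suc i)} f = integral {0..1} (h i)" if i: "i < N" for i
  proof -
    have "integral {real i..real (Suc i)} f = integral {real i..real (Suc i)} (\<lambda>t. h i (t - real i))"
      by (rule integral_spike[of "{real i, real (Suc i)}"]) (use eq[OF i] in auto)
    also have "\<dots> = integral {0..1} (\<lambda>t. h i (t + real i - real i))"
      using integral_shift[of 0 "real i" 1 "\<lambda>t. h i (t - real i)"] k[OF i] by (simp add: comp_def add.commute)
    finally show ?thesis by simp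
  qed
  have "integral {0..real M} f = (\<Sum>i<M. integral {0..1} (h i))" if "M \<le> N" for M
    using that
  proof (induction M)
    case (Suc M)
    have "f integrable_on {0..real (Suc M)}"
      by (rule piecewise_cont_integrable) (use pc Suc.prems in \<open>auto simp: piecewise_cont_def\<close>)
    then have "integral {0..real (Suc M)} f = integral {0..real M} f + integral {real M..real (Suc M)} f"
      by (intro Henstock_Kurzweil_Integration.integral_combine[symmetric]) auto
    then show ?case using Suc piece[of M] by simp
  qed simp
  then show "integral {0..real N} f = (\<Sum>i<N. integral {0..1} (h i))" by simp
qed

lemma piecewise_cont_primitive:
  fixes h :: "real \<Rightarrow> real"
  assumes pc: "piecewise_cont N h" and t: "t \<in> {0<..<real N} - real ` {0..N}"
  shows "((\<lambda>t. integral {0..t} h) has_real_derivative h t) (at t)"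
proof -
  define i where "i = nat \<lfloor>t\<rfloor>"
  have ri: "real i = of_int \<lfloor>t\<rfloor>" using t unfolding i_def by simp
  have "real i \<le> t" unfolding ri by simp
  moreover have "t < real (Suc i)" using ri real_of_int_floor_add_one_gt[of t] by linarith
  moreover have iN: "i < N" using calculation(1) t by simp
  moreover have "real i \<noteq> t" using t iN by (metis DiffE atLeastAtMost_iff image_eqI less_imp_le_nat zero_le)
  ultimately have ti: "t \<in> {real i<..<real (Suc i)}" by simp
  obtain k where k: "continuous_on {real i..real (Suc i)} k" "\<And>t. t \<in> {real i<..<real (Suc i)} \<Longrightarrow> h t = k t"
    using pc iN unfolding piecewise_cont_def by blast
  have hi: "h integrable_on {0..real N}" by (rule piecewise_cont_integrable[OF pc])
  have eq: "integral {0..real i} h + integral {real i..s} k = integral {0..s} h" if s: "s \<in> {real i<..<real (Suc i)}" for s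
  proof -
    have "h integrable_on {0..s}" by (rule integrable_subinterval_real[OF hi]) (use s iN in auto)
    then have "integral {0..s} h = integral {0..real i} h + integral {real i..s} h"
      using s by (intro Henstock_Kurzweil_Integration.integral_combine[symmetric]) auto
    moreover have "integral {real i..s} h = integral {real i..s} k"
      by (rule integral_spike[of "{real i}"]) (use k(2) s in auto)
    ultimately show ?thesis by simp
  qed
  have "((\<lambda>s. integral {real i..s} k) has_real_derivative k t) (at t within {real i..real (Suc i)})"
    by (rule integral_has_real_derivative[OF k(1)]) (use ti in auto)
  then have "((\<lambda>s. integral {real i..s} k) has_real_derivative k t) (at t)"
    using ti by (simp add: at_within_Icc_at)
  then have "((\<lambda>s. integral {0..real i} h + integral {real i..s} k) has_real_derivative k t) (at t)"
    using DERIV_add[OF DERIV_const] by fastforce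
  then show ?thesis
    using has_field_derivative_transform_within_open[of _ "k t" t "{real i<..<real (Suc i)}" "\<lambda>t. integral {0..t} h"] eq ti k(2)[OF ti] by simp
qed

text \<open>Here \<open>l\<close> is the speed of a closed curve and \<open>j / l\<close> is the weight, squeezed between \<open>m\<close> and \<open>B\<close>.\<close>

lemma weighted_loop_inequality:
  fixes z z' :: "real \<Rightarrow> complex" and j l :: "real \<Rightarrow> real"
  assumes N: "N > 0" and cz: "continuous_on {0..real N} z"
    and der: "\<And>t. t \<in> {0<..<real N} - real ` {0..N} \<Longrightarrow> (z has_vector_derivative z' t) (at t)"
    and pc: "piecewise_cont N j" "piecewise_cont N l" "piecewise_cont N (\<lambda>t. 1 / j t)" "piecewise_cont N (\<lambda>t. 1 / l t)" "piecewise_cont N z'"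
    and m: "0 < m" and B: "0 < B" and l0: "0 < l0" "\<And>t. l0 \<le> l t" and ml: "\<And>t. m * l t \<le> j t" and Bl: "\<And>t. j t \<le> B * l t"
    and L: "integral {0..real N} l \<le> L"
    and per: "z (real N) = cis \<phi> * z 0" and \<phi>: "\<bar>\<phi>\<bar> \<le> pi"
  shows "\<phi>\<^sup>2 * m\<^sup>2 * integral {0..real N} (\<lambda>t. j t * (norm (z t))\<^sup>2) \<le> L\<^sup>2 * B\<^sup>2 * integral {0..real N} (\<lambda>t. j t / (l t)\<^sup>2 * (norm (z' t))\<^sup>2)"
    and "(norm (1 - cis \<phi>))\<^sup>2 * (4 * m * B) * integral {0..real N} (\<lambda>t. j t * (norm (z t))\<^sup>2) \<le>
       (m + B)\<^sup>2 * L\<^sup>2 * integral {0..real N} (\<lambda>t. j t / (l t)\<^sup>2 * (norm (z' t))\<^sup>2)"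
proof -
  have l: "l t > 0" for t using l0(1) l0(2)[of t] by linarith
  \<comment> \<open>Dividing the derivative by the speed l, squaring it and multiplying by the area
    density j leaves this weight in front of the squared derivative.\<close>
  define \<kappa> where "\<kappa> t = j t / (l t)\<^sup>2" for t
  have j: "j t > 0" for t using ml[of t] m l[of t] by (meson less_le_trans mult_pos_pos)
  have \<kappa>: "\<kappa> t > 0" for t unfolding \<kappa>_def by (intro divide_pos_pos zero_less_power j l)
  have pc\<kappa>: "piecewise_cont N \<kappa>"
    using piecewise_cont_mult[OF pc(1) piecewise_cont_mult[OF pc(4) pc(4)]] unfolding \<kappa>_def by (simp add: power2_eq_square)
  have pci\<kappa>: "piecewise_cont N (\<lambda>t. 1 / \<kappa> t)"
    using piecewise_cont_mult[OF piecewise_cont_mult[OF pc(2) pc(2)] pc(3)] unfolding \<kappa>_def by (simp add: power2_eq_square)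
  have pcz: "piecewise_cont N z" by (rule piecewise_cont_continuous[OF cz])
  have i\<kappa>: "(\<lambda>t. 1 / \<kappa> t) integrable_on {0..real N}" by (rule piecewise_cont_integrable[OF pci\<kappa>])
  have iE: "(\<lambda>t. \<kappa> t * (norm (z' t))\<^sup>2) integrable_on {0..real N}"
    by (intro piecewise_cont_integrable piecewise_cont_mult pc\<kappa> piecewise_cont_norm_sq pc)
  have iU: "(\<lambda>t. j t * (norm (z t))\<^sup>2) integrable_on {0..real N}"
    by (intro piecewise_cont_integrable piecewise_cont_mult piecewise_cont_norm_sq pc pcz)
  have iV: "(\<lambda>t. (norm (z t))\<^sup>2 / \<kappa> t) integrable_on {0..real N}"
    using piecewise_cont_integrable[OF piecewise_cont_mult[OF piecewise_cont_norm_sq[OF pcz] pci\<kappa>]] by simp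
  have il: "l integrable_on {0..real N}" and ij: "j integrable_on {0..real N}"
    by (intro piecewise_cont_integrable pc)+
  define T where "T = integral {0..real N} (\<lambda>t. 1 / \<kappa> t)"
  define E where "E = integral {0..real N} (\<lambda>t. \<kappa> t * (norm (z' t))\<^sup>2)"
  define U where "U = integral {0..real N} (\<lambda>t. j t * (norm (z t))\<^sup>2)"
  define V where "V = integral {0..real N} (\<lambda>t. (norm (z t))\<^sup>2 / \<kappa> t)"
  define M where "M = integral {0..real N} j"
  have nonneg: "T \<ge> 0" "E \<ge> 0" "U \<ge> 0" "M \<ge> 0"
    unfolding T_def E_def U_def M_def using \<kappa> j less_imp_le[OF \<kappa>] less_imp_le[OF j]
    by (auto intro!: integral_nonneg i\<kappa> iE iU ij)
  show "\<phi>\<^sup>2 * m\<^sup>2 * integral {0..real N} (\<lambda>t. j t * (norm (z t))\<^sup>2) \<le> L\<^sup>2 * B\<^sup>2 * integral {0..real N} (\<lambda>t. j t / (l t)\<^sup>2 * (norm (z' t))\<^sup>2)"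
  proof -
    define \<sigma> where "\<sigma> t = integral {0..t} (\<lambda>t. 1 / \<kappa> t)" for t
    have c\<sigma>: "continuous_on {0..real N} \<sigma>" unfolding \<sigma>_def by (rule indefinite_integral_continuous_1[OF i\<kappa>])
    have der\<sigma>: "(\<sigma> has_real_derivative 1 / \<kappa> t) (at t)" if "t \<in> {0<..<real N} - real ` {0..N}" for t
      unfolding \<sigma>_def by (rule piecewise_cont_primitive[OF pci\<kappa> that])
    \<comment> \<open>1 / \<kappa> is bounded below by l0 / B, which makes its primitive strictly
      increasing.\<close>
    have \<sigma>_mono: "\<sigma> s < \<sigma> t" if st: "0 \<le> s" "s < t" "t \<le> real N" for s t
    proof -
      have "(\<lambda>t. 1 / \<kappa> t) integrable_on {0..t}" by (rule integrable_subinterval_real[OF i\<kappa>]) (use st in auto)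
      then have "\<sigma> t = \<sigma> s + integral {s..t} (\<lambda>t. 1 / \<kappa> t)" unfolding \<sigma>_def
        using st by (intro Henstock_Kurzweil_Integration.integral_combine[symmetric]) auto
      moreover have "integral {s..t} (\<lambda>t. 1 / \<kappa> t) > 0"
      proof -
        have i: "(\<lambda>t. 1 / \<kappa> t) integrable_on {s..t}" by (rule integrable_subinterval_real[OF i\<kappa>]) (use st in auto)
        have "integral {s..t} (\<lambda>t. l0 / B) \<le> integral {s..t} (\<lambda>t. 1 / \<kappa> t)"
        proof (rule integral_le[OF _ i])
          fix u
          have "l0 * j u \<le> l u * (B * l u)" using l0 Bl j less_imp_le[OF j] less_imp_le[OF l] by (intro mult_mono) auto
          then show "l0 / B \<le> 1 / \<kappa> u" unfolding \<kappa>_def using j[of u] B by (simp add: field_simps power2_eq_square)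
        qed (simp add: integrable_const_ivl)
        moreover have "integral {s..t} (\<lambda>t. l0 / B) > 0" using st l0 B by simp
        ultimately show ?thesis by linarith
      qed
      ultimately show ?thesis by simp
    qed
    have \<sigma>N: "\<sigma> (real N) = T" unfolding \<sigma>_def T_def ..
    have T0: "T > 0" using \<sigma>_mono[of 0 "real N"] N unfolding \<sigma>N by (simp add: \<sigma>_def)
    have "(\<phi> / T)\<^sup>2 * V \<le> E"
      using wirtinger_quasiperiodic[OF N finite_imageI[OF finite_atLeastAtMost] cz c\<sigma> der der\<sigma> \<sigma>_mono \<kappa> pc\<kappa> pci\<kappa> pc(5) _ per \<phi>]
      unfolding V_def E_def \<sigma>N by (simp add: \<sigma>_def)
    then have 1: "\<phi>\<^sup>2 * V \<le> T\<^sup>2 * E" using T0 by (simp add: power_divide field_simps)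
    \<comment> \<open>The normal speed j / l enters twice: j \<kappa> is its square, at most B^2,
      which compares U with V; and m / \<kappa> = m l^2 / j is at most l, which bounds the period T
      by L / m.\<close>
    have 2: "U \<le> B\<^sup>2 * V" unfolding U_def V_def integral_mult_right[symmetric]
    proof (rule integral_le[OF iU])
      show "(\<lambda>t. B\<^sup>2 * ((norm (z t))\<^sup>2 / \<kappa> t)) integrable_on {0..real N}" by (intro integrable_on_mult_right iV)
      fix t
      have "j t * \<kappa> t = (j t / l t)\<^sup>2" unfolding \<kappa>_def by (simp add: power2_eq_square)
      also have "\<dots> \<le> B\<^sup>2" using Bl[of t] l[of t] j[of t] by (intro power_mono) (auto simp: divide_le_eq)
      finally have "j t \<le> B\<^sup>2 / \<kappa> t" using \<kappa>[of t] by (simp add: field_simps)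
      then have "j t * (norm (z t))\<^sup>2 \<le> B\<^sup>2 / \<kappa> t * (norm (z t))\<^sup>2" by (intro mult_right_mono) auto
      then show "j t * (norm (z t))\<^sup>2 \<le> B\<^sup>2 * ((norm (z t))\<^sup>2 / \<kappa> t)" by simp
    qed
    have 3: "m * T \<le> L"
    proof -
      have "m * T = integral {0..real N} (\<lambda>t. m * (1 / \<kappa> t))" unfolding T_def by (rule integral_mult_right[symmetric])
      also have "\<dots> \<le> integral {0..real N} l"
      proof (rule integral_le[OF _ il])
        show "(\<lambda>t. m * (1 / \<kappa> t)) integrable_on {0..real N}" by (intro integrable_on_mult_right i\<kappa>)
        fix t show "m * (1 / \<kappa> t) \<le> l t" unfolding \<kappa>_def using ml[of t] l[of t] j[of t] by (simp add: field_simps power2_eq_square)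
      qed
      finally show ?thesis using L by linarith
    qed
    have "\<phi>\<^sup>2 * m\<^sup>2 * U \<le> \<phi>\<^sup>2 * m\<^sup>2 * (B\<^sup>2 * V)" using 2 by (intro mult_left_mono) auto
    also have "\<dots> = (m\<^sup>2 * B\<^sup>2) * (\<phi>\<^sup>2 * V)" by simp
    also have "\<dots> \<le> (m\<^sup>2 * B\<^sup>2) * (T\<^sup>2 * E)" using 1 by (intro mult_left_mono) auto
    also have "\<dots> = (m * T)\<^sup>2 * (B\<^sup>2 * E)" by (simp add: power_mult_distrib)
    also have "\<dots> \<le> L\<^sup>2 * (B\<^sup>2 * E)" using 3 m nonneg by (intro mult_right_mono power_mono) auto
    finally show ?thesis unfolding U_def E_def \<kappa>_def by simp
  qed
  show "(norm (1 - cis \<phi>))\<^sup>2 * (4 * m * B) * integral {0..real N} (\<lambda>t. j t * (norm (z t))\<^sup>2) \<le>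
       (m + B)\<^sup>2 * L\<^sup>2 * integral {0..real N} (\<lambda>t. j t / (l t)\<^sup>2 * (norm (z' t))\<^sup>2)"
  proof -
    define w where "w = (norm (1 - cis \<phi>))\<^sup>2"
    have 1: "w * U \<le> M * (T * E)"
    proof -
      have "w * U = integral {0..real N} (\<lambda>t. w * (j t * (norm (z t))\<^sup>2))" unfolding U_def by simp
      also have "\<dots> \<le> integral {0..real N} (\<lambda>t. j t * (T * E))"
      proof (rule integral_le)
        show "(\<lambda>t. w * (j t * (norm (z t))\<^sup>2)) integrable_on {0..real N}" by (intro integrable_on_mult_right iU)
        show "(\<lambda>t. j t * (T * E)) integrable_on {0..real N}" by (intro integrable_on_mult_left ij)
        fix t assume t: "t \<in> {0..real N}"
        have "w * (norm (z t))\<^sup>2 \<le> T * E" unfolding w_def T_def E_def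
          by (rule quasiperiodic_sup_bound[OF _ cz der \<kappa> i\<kappa> iE per _ t]) auto
        then show "w * (j t * (norm (z t))\<^sup>2) \<le> j t * (T * E)" using j[of t] by (simp add: mult.left_commute)
      qed
      also have "\<dots> = M * (T * E)" unfolding M_def by simp
      finally show ?thesis .
    qed
    \<comment> \<open>The Kantorovich step: the product of \<open>j - m l\<close> and
      \<open>B l - j\<close> is nonnegative, and dividing by j gives the pointwise bound. With AM-GM
      this controls M T by (m + B)^2 L^2 / (4 m B).\<close>
    have 2: "M + m * B * T \<le> (m + B) * L"
    proof -
      have "M + m * B * T = integral {0..real N} (\<lambda>t. j t + m * B * (1 / \<kappa> t))"
        unfolding M_def T_def by (subst Henstock_Kurzweil_Integration.integral_add) (auto intro!: ij integrable_on_mult_right i\<kappa> simp del: mult_1_right times_divide_eq_right)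
      also have "\<dots> \<le> integral {0..real N} (\<lambda>t. (m + B) * l t)"
      proof (rule integral_le)
        show "(\<lambda>t. j t + m * B * (1 / \<kappa> t)) integrable_on {0..real N}" by (intro integrable_add ij integrable_on_mult_right i\<kappa>)
        show "(\<lambda>t. (m + B) * l t) integrable_on {0..real N}" by (intro integrable_on_mult_right il)
        fix t
        have "0 \<le> (j t - m * l t) * (B * l t - j t)" using ml Bl by simp
        then have "j t * j t + m * B * (l t)\<^sup>2 \<le> (m + B) * l t * j t" by (simp add: algebra_simps power2_eq_square)
        then show "j t + m * B * (1 / \<kappa> t) \<le> (m + B) * l t" unfolding \<kappa>_def using j[of t] by (simp add: field_simps)
      qed
      also have "\<dots> = (m + B) * integral {0..real N} l" by simp
      also have "\<dots> \<le> (m + B) * L" using L m B by (intro mult_left_mono) auto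
      finally show ?thesis .
    qed
    have "4 * m * B * (M * T) \<le> (M + m * B * T)\<^sup>2"
      using zero_le_power2[of "M - m * B * T"] by (simp add: power2_eq_square algebra_simps)
    also have "\<dots> \<le> ((m + B) * L)\<^sup>2" using 2 nonneg m B by (intro power_mono) auto
    finally have 3: "4 * m * B * (M * T) \<le> (m + B)\<^sup>2 * L\<^sup>2" by (simp add: power_mult_distrib)
    have "w * (4 * m * B) * U = 4 * m * B * (w * U)" by simp
    also have "\<dots> \<le> 4 * m * B * (M * (T * E))" using 1 m B by (intro mult_left_mono) auto
    also have "\<dots> = 4 * m * B * (M * T) * E" by simp
    also have "\<dots> \<le> (m + B)\<^sup>2 * L\<^sup>2 * E" using 3 nonneg by (intro mult_right_mono) auto
    finally show ?thesis unfolding w_def U_def E_def \<kappa>_def .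
  qed
qed

subsection \<open>Change of variables on a quadrilateral\<close>

text \<open>Iterated integrals live on \<open>real \<times> real\<close> and Jacobian determinants
  on \<open>real^2\<close>; this measure-preserving map connects them.\<close>

definition pair_vec :: "real \<times> real \<Rightarrow> real^2" where
  "pair_vec z = (\<chi> i. if i = 1 then fst z else snd z)"

lemma pair_vec_nth [simp]: "pair_vec z $ 1 = fst z" "pair_vec z $ 2 = snd z"
  by (simp_all add: pair_vec_def)

lemma continuous_pair_vec: "continuous_on S pair_vec"
proof -
  have "continuous_on S (\<lambda>z. if i = 1 then fst z else snd z)" for i :: 2
    by (cases "i = 1") (auto intro: continuous_intros)
  then show ?thesis unfolding pair_vec_def by (rule continuous_on_vec_lambda)
qed

lemma pair_vec_measurable [measurable]: "pair_vec \<in> borel_measurable borel"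
  by (rule borel_measurable_continuous_onI[OF continuous_pair_vec])

lemma lborel_pair_vec: "lborel = distr lborel borel pair_vec"
proof (rule lborel_eqI)
  fix l u :: "real^2"
  assume lu: "\<And>b. b \<in> Basis \<Longrightarrow> l \<bullet> b \<le> u \<bullet> b"
  have l1: "l $ i \<le> u $ i" for i using lu[of "axis i 1"] by (simp add: inner_axis axis_in_Basis_iff)
  have "pair_vec -` box l u = {l $ 1<..<u $ 1} \<times> {l $ 2<..<u $ 2}"
    by (auto simp: mem_box_cart forall_2)
  then have "emeasure (distr lborel borel pair_vec) (box l u) = emeasure (lborel \<Otimes>\<^sub>M lborel) ({l $ 1<..<u $ 1} \<times> {l $ 2<..<u $ 2})"
    by (subst emeasure_distr) (auto simp: lborel_prod)
  also have "\<dots> = ennreal (u $ 1 - l $ 1) * ennreal (u $ 2 - l $ 2)"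
    using l1 by (subst lborel.emeasure_pair_measure_Times) auto
  also have "\<dots> = ennreal (\<Prod>i\<in>UNIV. (u - l) $ i)" using l1 by (simp add: ennreal_mult UNIV_2)
  also have "(\<Prod>i\<in>UNIV. (u - l) $ i) = (\<Prod>b\<in>Basis. (u - l) \<bullet> b)"
  proof -
    have B: "(Basis :: (real^2) set) = (\<lambda>i. axis i 1) ` UNIV" unfolding Basis_vec_def by auto
    have "inj (\<lambda>i::2. axis i (1::real))" by (auto intro!: injI simp: axis_eq_axis)
    then show ?thesis unfolding B by (subst prod.reindex) (auto simp: inner_axis)
  qed
  finally show "emeasure (distr lborel borel pair_vec) (box l u) = ennreal (\<Prod>b\<in>Basis. (u - l) \<bullet> b)" .
qed simp

lemma integral_cbox_pair_vec:
  fixes h :: "real^2 \<Rightarrow> real"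
  assumes h: "continuous_on (cbox (pair_vec (a, c)) (pair_vec (b, d))) h"
  shows "integral (cbox (pair_vec (a, c)) (pair_vec (b, d))) h = integral {a..b} (\<lambda>s. integral {c..d} (\<lambda>\<tau>. h (pair_vec (s, \<tau>))))"
proof -
  let ?S = "cbox (pair_vec (a, c)) (pair_vec (b, d))"
  have mem: "pair_vec z \<in> ?S \<longleftrightarrow> z \<in> cbox (a, c) (b, d)" for z
    by (cases z) (auto simp: mem_box_cart forall_2 cbox_Pair_eq)
  have i1: "set_integrable lborel ?S h"
    unfolding set_integrable_def by (rule borel_integrable_compact) (use h in auto)
  have ch: "continuous_on (cbox (a, c) (b, d)) (\<lambda>z. h (pair_vec z))"
    by (rule continuous_on_compose2[OF h continuous_pair_vec]) (use mem in auto)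
  have i2: "set_integrable lborel (cbox (a, c) (b, d)) (\<lambda>z. h (pair_vec z))"
    unfolding set_integrable_def by (rule borel_integrable_compact) (use ch in auto)
  have "integral ?S h = (LINT x:?S|lborel. h x)" using set_borel_integral_eq_integral(2)[OF i1] by simp
  also have "\<dots> = (\<integral>x. indicator ?S x *\<^sub>R h x \<partial>(distr lborel borel pair_vec))"
    unfolding set_lebesgue_integral_def by (subst lborel_pair_vec) simp
  also have "\<dots> = (\<integral>z. indicator ?S (pair_vec z) *\<^sub>R h (pair_vec z) \<partial>lborel)"
    using i1 unfolding set_integrable_def by (intro integral_distr) auto
  also have "\<dots> = (LINT z:cbox (a, c) (b, d)|lborel. h (pair_vec z))"
    unfolding set_lebesgue_integral_def by (intro Bochner_Integration.integral_cong refl) (auto simp: mem split: split_indicator)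
  also have "\<dots> = integral (cbox (a, c) (b, d)) (\<lambda>z. h (pair_vec z))" by (rule set_borel_integral_eq_integral(2)[OF i2])
  also have "\<dots> = integral (cbox a b) (\<lambda>s. integral (cbox c d) (\<lambda>\<tau>. h (pair_vec (s, \<tau>))))"
    by (rule integral_prod_continuous[OF ch])
  finally show ?thesis by simp
qed

text \<open>The function is read as \<open>real^1\<close>-valued, the vector formula is applied, and
  the single component is extracted.\<close>

lemma integral_change_of_variables_real:
  fixes f :: "real^2 \<Rightarrow> real" and g :: "real^2 \<Rightarrow> real^2"
  assumes S: "compact S" and der: "\<And>x. x \<in> S \<Longrightarrow> (g has_derivative g' x) (at x)"
    and inj: "inj_on g S" and f: "continuous_on (g ` S) f"
  shows "integral (g ` S) f = integral S (\<lambda>x. \<bar>det (matrix (g' x))\<bar> * f (g x))"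
proof -
  define F where "F x = (vec (f x) :: real^1)" for x
  have cg: "continuous_on S g" using der by (meson continuous_at_imp_continuous_on has_derivative_continuous)
  have cgS: "compact (g ` S)" by (rule compact_continuous_image[OF cg S])
  have cF: "continuous_on (g ` S) F" unfolding F_def vec_def by (rule continuous_on_vec_lambda) (rule f)
  have "set_integrable lborel (g ` S) F"
    unfolding set_integrable_def by (rule borel_integrable_compact[OF cgS cF])
  then have Fa: "F absolutely_integrable_on (g ` S)"
    unfolding set_integrable_def by (simp add: integrable_completion)
  have "(\<lambda>x. \<bar>det (matrix (g' x))\<bar> *\<^sub>R F (g x)) absolutely_integrable_on S \<and>
      integral S (\<lambda>x. \<bar>det (matrix (g' x))\<bar> *\<^sub>R F (g x)) = integral (g ` S) F"
    using has_absolute_integral_change_of_variables_compact[OF S has_derivative_at_withinI[OF der] inj, of F "integral (g ` S) F"] Fa by blast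
  then have Fi: "(\<lambda>x. \<bar>det (matrix (g' x))\<bar> *\<^sub>R F (g x)) integrable_on S"
    and eq: "integral S (\<lambda>x. \<bar>det (matrix (g' x))\<bar> *\<^sub>R F (g x)) = integral (g ` S) F"
    using absolutely_integrable_on_def by blast+
  have bl: "bounded_linear (\<lambda>v::real^1. v $ 1)" by (rule bounded_linear_vec_nth)
  have "F integrable_on (g ` S)" using Fa absolutely_integrable_on_def by blast
  then have "integral (g ` S) (\<lambda>x. F x $ 1) = integral (g ` S) F $ 1"
    using integral_linear[OF _ bl, of F "g ` S"] by (simp add: comp_def)
  also have "\<dots> = integral S (\<lambda>x. (\<bar>det (matrix (g' x))\<bar> *\<^sub>R F (g x)) $ 1)"
    using integral_linear[OF Fi bl] eq by (simp add: comp_def)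
  finally show ?thesis unfolding F_def by simp
qed

text \<open>X sweeps the region between two rays by segments with endpoints on them, and J is its
  Jacobian, \<delta> being the determinant of the two directions. X is injective because both
  endpoints move strictly outwards with s, so that different segments do not meet.\<close>

lemma integral_quadrilateral:
  fixes d d' q :: "real^2" and f :: "real^2 \<Rightarrow> real"
  assumes \<delta>: "d $ 1 * d' $ 2 - d $ 2 * d' $ 1 = \<delta>" "\<delta> > 0" and a: "a > 0" "a' > 0"
    and pos: "\<And>s. s \<in> {s0..s1} \<Longrightarrow> 0 < \<alpha> + s * a" "\<And>s. s \<in> {s0..s1} \<Longrightarrow> 0 < \<alpha>' + s * a'"
    and X: "\<And>s \<tau>. X s \<tau> = q + ((1 - \<tau>) * (\<alpha> + s * a)) *\<^sub>R d + (\<tau> * (\<alpha>' + s * a')) *\<^sub>R d'"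
    and Q: "Q = (\<lambda>(s, \<tau>). X s \<tau>) ` ({s0..s1} \<times> {0..1})"
    and f: "continuous_on Q f"
    and J: "\<And>s \<tau>. J s \<tau> = \<delta> * ((1 - \<tau>) * a * (\<alpha>' + s * a') + \<tau> * a' * (\<alpha> + s * a))"
  shows "compact Q" "integral Q f = integral {s0..s1} (\<lambda>s. integral {0..1} (\<lambda>\<tau>. J s \<tau> * f (X s \<tau>)))"
    "continuous_on {s0..s1} (\<lambda>s. integral {0..1} (\<lambda>\<tau>. J s \<tau> * f (X s \<tau>)))"
proof -
  have Xc: "continuous_on UNIV (\<lambda>z. X (fst z) (snd z))" unfolding X by (intro continuous_intros)
  have QS: "Q = (\<lambda>z. X (fst z) (snd z)) ` ({s0..s1} \<times> {0..1})" unfolding Q by (simp add: case_prod_beta')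
  show "compact Q" unfolding QS
    by (intro compact_continuous_image continuous_on_subset[OF Xc] compact_Times) auto
  define g where "g x = X (x $ 1) (x $ 2)" for x :: "real^2"
  define S where "S = cbox (pair_vec (s0, 0)) (pair_vec (s1, 1))"
  have S: "x \<in> S \<longleftrightarrow> x $ 1 \<in> {s0..s1} \<and> x $ 2 \<in> {0..1}" for x
    unfolding S_def by (auto simp: mem_box_cart forall_2)
  have gS: "g ` S = Q"
  proof
    show "g ` S \<subseteq> Q"
    proof
      fix y assume "y \<in> g ` S"
      then obtain x :: "real^2" where "x \<in> S" "y = X (x $ (1::2)) (x $ (2::2))" unfolding g_def by blast
      then show "y \<in> Q" unfolding Q S by blast
    qed
    show "Q \<subseteq> g ` S"
    proof
      fix y assume "y \<in> Q"
      then obtain s \<tau> where st: "s \<in> {s0..s1}" "\<tau> \<in> {0..1}" "y = X s \<tau>" unfolding Q by auto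
      then have "y = g (pair_vec (s, \<tau>))" "pair_vec (s, \<tau>) \<in> S" unfolding g_def S by auto
      then show "y \<in> g ` S" by blast
    qed
  qed
  define g' where "g' x h = (h $ 1) *\<^sub>R (((1 - x $ 2) * a) *\<^sub>R d + (x $ 2 * a') *\<^sub>R d') + (h $ 2) *\<^sub>R ((\<alpha>' + x $ 1 * a') *\<^sub>R d' - (\<alpha> + x $ 1 * a) *\<^sub>R d)" for x h :: "real^2"
  have der: "(g has_derivative g' x) (at x)" for x
  proof -
    have n: "((\<lambda>x::real^2. x $ i) has_derivative (\<lambda>h. h $ i)) (at x)" for i
      by (rule bounded_linear_imp_has_derivative[OF bounded_linear_vec_nth])
    show ?thesis unfolding g_def X g'_def
      by (rule derivative_eq_intros n refl | simp)+ (simp add: algebra_simps)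
  qed
  have detg: "det (matrix (g' x)) = J (x $ 1) (x $ 2)" for x
  proof -
    have "det (matrix (g' x)) = (d $ 1 * d' $ 2 - d $ 2 * d' $ 1) * ((1 - x $ 2) * a * (\<alpha>' + x $ 1 * a') + x $ 2 * a' * (\<alpha> + x $ 1 * a))"
      unfolding det_2 matrix_def g'_def by (simp add: axis_def algebra_simps)
    then show ?thesis unfolding J \<delta>(1) .
  qed
  have J0: "J s \<tau> \<ge> 0" if "s \<in> {s0..s1}" "\<tau> \<in> {0..1}" for s \<tau>
    unfolding J using that(2) a \<delta>(2)
    by (intro mult_nonneg_nonneg add_nonneg_nonneg pos[OF that(1), THEN less_imp_le]) auto
  have indep: "x = 0 \<and> y = 0" if "x *\<^sub>R d + y *\<^sub>R d' = 0" for x y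
  proof -
    have "x * d $ 1 + y * d' $ 1 = 0" "x * d $ 2 + y * d' $ 2 = 0"
      using that by (simp_all add: vec_eq_iff forall_2)
    then have "x * (d $ 1 * d' $ 2 - d $ 2 * d' $ 1) = 0" "y * (d $ 1 * d' $ 2 - d $ 2 * d' $ 1) = 0" by algebra+
    then show ?thesis using \<delta> by simp
  qed
  have inj_le: "s \<ge> s'" if st: "s \<in> {s0..s1}" "s' \<in> {s0..s1}" "\<tau> \<in> {0..1}" "\<tau>' \<in> {0..1}" "X s \<tau> = X s' \<tau>'" for s \<tau> s' \<tau>'
  proof (rule ccontr)
    assume n: "\<not> s \<ge> s'"
    have "((1 - \<tau>) * (\<alpha> + s * a) - (1 - \<tau>') * (\<alpha> + s' * a)) *\<^sub>R d + (\<tau> * (\<alpha>' + s * a') - \<tau>' * (\<alpha>' + s' * a')) *\<^sub>R d' = X s \<tau> - X s' \<tau>'"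
      unfolding X by (simp add: algebra_simps)
    \<comment> \<open>Compare coefficients along d and d'. With s < s' and \<tau>' < 1 the first
      equation forces \<tau> < \<tau>', the second \<tau>' \<le> \<tau>.\<close>
    then have e: "(1 - \<tau>) * (\<alpha> + s * a) = (1 - \<tau>') * (\<alpha> + s' * a)" "\<tau> * (\<alpha>' + s * a') = \<tau>' * (\<alpha>' + s' * a')"
      using indep st(5) by force+
    have lt: "\<alpha> + s * a < \<alpha> + s' * a" "\<alpha>' + s * a' < \<alpha>' + s' * a'" using n a by auto
    show False
    proof (cases "\<tau>' = 1")
      case True
      then have "\<tau> * (\<alpha>' + s * a') = \<alpha>' + s' * a'" using e by simp
      moreover have "\<tau> * (\<alpha>' + s * a') \<le> 1 * (\<alpha>' + s * a')" using st pos(2)[OF st(1)] by (intro mult_right_mono) auto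
      ultimately show False using lt by simp
    next
      case False
      then have t: "0 < 1 - \<tau>'" using st by simp
      have "(1 - \<tau>') * (\<alpha> + s * a) < (1 - \<tau>') * (\<alpha> + s' * a)" using lt t by simp
      then have "(1 - \<tau>') * (\<alpha> + s * a) < (1 - \<tau>) * (\<alpha> + s * a)" using e by simp
      then have t1: "\<tau> < \<tau>'" using pos(1)[OF st(1)] by simp
      have "\<tau>' * (\<alpha>' + s * a') \<le> \<tau>' * (\<alpha>' + s' * a')" using lt st by (intro mult_left_mono) auto
      then have "\<tau>' * (\<alpha>' + s * a') \<le> \<tau> * (\<alpha>' + s * a')" using e by simp
      then show False using t1 pos(2)[OF st(1)] by simp
    qed
  qed
  have inj: "inj_on g S"
  proof (rule inj_onI)
    fix x y assume xy: "x \<in> S" "y \<in> S" "g x = g y"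
    have s: "x $ 1 = y $ 1" using inj_le[of "x $ 1" "y $ 1" "x $ 2" "y $ 2"] inj_le[of "y $ 1" "x $ 1" "y $ 2" "x $ 2"] xy S unfolding g_def by force
    have "(((1 - x $ 2) - (1 - y $ 2)) * (\<alpha> + x $ 1 * a)) *\<^sub>R d + ((x $ 2 - y $ 2) * (\<alpha>' + x $ 1 * a')) *\<^sub>R d' = g x - g y"
      unfolding g_def X s by (simp add: algebra_simps)
    then have "(x $ 2 - y $ 2) * (\<alpha>' + x $ 1 * a') = 0" using indep xy(3) by force
    then have "x $ 2 = y $ 2" using pos(2)[of "x $ 1"] xy(1) S by force
    with s show "x = y" by (simp add: vec_eq_iff forall_2)
  qed
  have fX: "continuous_on ({s0..s1} \<times> {0..1}) (\<lambda>z. f (X (fst z) (snd z)))"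
    by (rule continuous_on_compose2[OF f continuous_on_subset[OF Xc subset_UNIV]]) (simp add: QS)
  have cJf: "continuous_on ({s0..s1} \<times> {0..1}) (\<lambda>(s, \<tau>). J s \<tau> * f (X s \<tau>))"
    unfolding case_prod_beta' J by (intro continuous_intros fX)
  have cS: "continuous_on S (\<lambda>x. J (x $ 1) (x $ 2) * f (g x))"
  proof -
    have c: "continuous_on S (\<lambda>x::real^2. (x $ (1::2), x $ (2::2)))" by (intro continuous_intros)
    have "(\<lambda>x::real^2. (x $ (1::2), x $ (2::2))) ` S \<subseteq> {s0..s1} \<times> {0..1}" using S by blast
    from continuous_on_compose2[OF cJf c this] show ?thesis unfolding g_def by (simp only: case_prod_conv)
  qed
  have "integral Q f = integral S (\<lambda>x. \<bar>det (matrix (g' x))\<bar> * f (g x))"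
    unfolding gS[symmetric] by (rule integral_change_of_variables_real[OF _ der inj]) (use f gS in \<open>auto simp: S_def\<close>)
  also have "\<dots> = integral S (\<lambda>x. J (x $ 1) (x $ 2) * f (g x))"
    using J0 S by (intro Henstock_Kurzweil_Integration.integral_cong) (simp add: detg)
  also have "\<dots> = integral {s0..s1} (\<lambda>s. integral {0..1} (\<lambda>\<tau>. J s \<tau> * f (X s \<tau>)))"
    unfolding S_def by (subst integral_cbox_pair_vec) (use cS in \<open>auto simp: S_def g_def\<close>)
  finally show "integral Q f = integral {s0..s1} (\<lambda>s. integral {0..1} (\<lambda>\<tau>. J s \<tau> * f (X s \<tau>)))" .
  show "continuous_on {s0..s1} (\<lambda>s. integral {0..1} (\<lambda>\<tau>. J s \<tau> * f (X s \<tau>)))"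
    using integral_continuous_on_param[of "{s0..s1}" 0 1 "\<lambda>s \<tau>. J s \<tau> * f (X s \<tau>)"] cJf by simp
qed

subsection \<open>The polygonal foliation of a punctured convex region\<close>

text \<open>The heights of the triangle over its two rays: project on the unit normals of
  \<open>dir \<theta>\<close> and of \<open>dir (\<theta> + \<Delta>)\<close>.\<close>

lemma norm_dir_combination_ge:
  shows "\<bar>b * sin \<Delta>\<bar> \<le> norm (b *\<^sub>R dir (\<theta> + \<Delta>) - a *\<^sub>R dir \<theta>)"
    and "\<bar>a * sin \<Delta>\<bar> \<le> norm (b *\<^sub>R dir (\<theta> + \<Delta>) - a *\<^sub>R dir \<theta>)"
proof -
  let ?x = "b *\<^sub>R dir (\<theta> + \<Delta>) - a *\<^sub>R dir \<theta>"
  have "?x \<bullet> dir (\<theta> + pi / 2) = b * sin \<Delta>"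
    by (simp add: inner_diff_left inner_dir cos_diff)
  then show "\<bar>b * sin \<Delta>\<bar> \<le> norm ?x" using Cauchy_Schwarz_ineq2[of ?x "dir (\<theta> + pi / 2)"] by simp
  have "?x \<bullet> dir (\<theta> + \<Delta> + pi / 2) = a * sin \<Delta>"
    by (simp add: inner_diff_left inner_dir cos_diff cos_add sin_add)
  then show "\<bar>a * sin \<Delta>\<bar> \<le> norm ?x" using Cauchy_Schwarz_ineq2[of ?x "dir (\<theta> + \<Delta> + pi / 2)"] by simp
qed

lemma norm_dir_diff:
  assumes "0 \<le> \<Delta>" "\<Delta> \<le> 2 * pi"
  shows "norm (dir (\<theta> + \<Delta>) - dir \<theta>) = 2 * sin (\<Delta> / 2)"
proof -
  have "(norm (dir (\<theta> + \<Delta>) - dir \<theta>))\<^sup>2 = 2 - 2 * cos (2 * (\<Delta> / 2))"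
    unfolding power2_norm_eq_inner by (simp add: inner_diff_left inner_diff_right inner_dir)
  also have "\<dots> = (2 * sin (\<Delta> / 2))\<^sup>2" unfolding cos_double_sin by (simp add: power_mult_distrib)
  finally show ?thesis by (rule power2_eq_imp_eq) (use assms in \<open>auto intro!: sin_ge_zero\<close>)
qed

text \<open>The curves \<open>s = const\<close> interpolate between the regular polygon circumscribed about the disk of radius
  \<open>r\<close> and the polygon inscribed in \<open>C\<close> with vertices on the same rays. With \<open>J\<close> the Jacobian of \<open>X\<close> and \<open>e\<close> the
  derivative of \<open>X\<close> along such a curve, \<open>J / norm e\<close> is the normal speed of the family.\<close>

locale polygonal_foliation = convex_region C p for C p +
  fixes r \<rho> m B \<theta>0 L :: real and N :: nat
  assumes r: "0 < r" and ball_C: "ball p \<rho> \<subseteq> C" and N: "4 < N"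
    and m: "0 < m" "m \<le> \<rho> * cos (2 * pi / real N) - r / cos (pi / real N)"
    and B: "\<And>\<theta>. radius C p (dir \<theta>) - r \<le> B"
    and L: "(\<Sum>i<N. norm (bpt (\<theta>0 + 2 * pi * real (Suc i) / real N) - bpt (\<theta>0 + 2 * pi * real i / real N))) \<le> L"
begin

definition \<Delta> where "\<Delta> = 2 * pi / real N"
text \<open>The circumradius of the regular N-gon whose sides touch the disk of radius r.\<close>

definition r' where "r' = r / cos (\<Delta> / 2)"
definition ang where "ang i = \<theta>0 + 2 * pi * real i / real N" for i :: nat
definition a where "a i = radius C p (dir (ang i)) - r'" for i
definition rad where "rad s i = r' + s * a i" for s i
definition X where "X s i \<tau> = p + ((1 - \<tau>) * (r' + s * a i)) *\<^sub>R dir (ang i) + (\<tau> * (r' + s * a (Suc i))) *\<^sub>R dir (ang (Suc i))" for s i \<tau>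
definition e where "e s i = rad s (Suc i) *\<^sub>R dir (ang (Suc i)) - rad s i *\<^sub>R dir (ang i)" for s i
definition J where "J s i \<tau> = sin \<Delta> * ((1 - \<tau>) * a i * (r' + s * a (Suc i)) + \<tau> * a (Suc i) * (r' + s * a i))" for s i \<tau>

lemma X_rad: "X s i \<tau> = p + ((1 - \<tau>) * rad s i) *\<^sub>R dir (ang i) + (\<tau> * rad s (Suc i)) *\<^sub>R dir (ang (Suc i))"
  unfolding X_def rad_def ..

lemma J_rad: "J s i \<tau> = sin \<Delta> * ((1 - \<tau>) * a i * rad s (Suc i) + \<tau> * a (Suc i) * rad s i)"
  unfolding J_def rad_def ..

lemma ang_Suc: "ang (Suc i) = ang i + \<Delta>"
  unfolding ang_def \<Delta>_def by (simp add: add_divide_distrib distrib_left)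

lemma \<Delta>: "0 < \<Delta>" "\<Delta> < pi / 2"
  using N unfolding \<Delta>_def by (auto simp: field_simps)

lemma trig: "0 < sin \<Delta>" "0 < cos \<Delta>" "0 < cos (\<Delta> / 2)" "0 < sin (\<Delta> / 2)" "cos \<Delta> \<le> cos (\<Delta> / 2)" "cos (\<Delta> / 2) \<le> 1"
  "sin \<Delta> = 2 * sin (\<Delta> / 2) * cos (\<Delta> / 2)" "sin \<Delta> \<le> 1"
proof -
  show "sin \<Delta> = 2 * sin (\<Delta> / 2) * cos (\<Delta> / 2)" using sin_double[of "\<Delta> / 2"] by simp
  show "cos \<Delta> \<le> cos (\<Delta> / 2)" using \<Delta> pi_gt_zero by (intro cos_monotone_0_pi_le) auto
qed (use \<Delta> pi_gt_zero in \<open>auto intro!: sin_gt_zero cos_gt_zero\<close>)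

lemma r': "0 < r'" "r \<le> r'" "r' * cos (\<Delta> / 2) = r"
proof -
  show "r' * cos (\<Delta> / 2) = r" unfolding r'_def using trig by simp
  show "0 < r'" unfolding r'_def using trig r by simp
  then show "r \<le> r'" using trig \<open>r' * cos (\<Delta> / 2) = r\<close> mult_left_le[of "cos (\<Delta> / 2)" r'] by simp
qed

lemma m_le: "m \<le> \<rho> * cos \<Delta> - r'"
  using m(2) unfolding r'_def \<Delta>_def by simp

lemma \<rho>: "0 < \<rho>" "m \<le> \<rho> - r'" "m \<le> (\<rho> - r') * cos (\<Delta> / 2)"
proof -
  have "0 < \<rho> * cos \<Delta>" using m_le m(1) r'(1) by linarith
  then show \<rho>: "0 < \<rho>" using trig by (simp add: zero_less_mult_iff)
  have "\<rho> * cos \<Delta> \<le> \<rho> * cos (\<Delta> / 2)" using \<rho> trig by simp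
  then show "m \<le> (\<rho> - r') * cos (\<Delta> / 2)" using m_le r' by (simp add: left_diff_distrib)
  have "\<rho> * cos (\<Delta> / 2) \<le> \<rho>" using \<rho> trig by (simp add: mult_left_le)
  then show "m \<le> \<rho> - r'" using \<open>\<rho> * cos \<Delta> \<le> \<rho> * cos (\<Delta> / 2)\<close> m_le by linarith
qed

lemma a_bounds: "\<rho> - r' \<le> a i" "0 < a i" "a i \<le> B"
proof -
  show "\<rho> - r' \<le> a i" unfolding a_def using ball_radius_le[OF ball_C] by simp
  then show "0 < a i" using \<rho> m by linarith
  show "a i \<le> B" unfolding a_def using B[of "ang i"] r' by linarith
qed

lemma B_pos: "0 < B" using a_bounds[of 0] by linarith

lemma rad_ge: "0 \<le> s \<Longrightarrow> r' \<le> rad s i"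
  unfolding rad_def using a_bounds(2)[of i] by simp

lemma rad_pos: "0 \<le> s \<Longrightarrow> 0 < rad s i"
  using rad_ge[of s i] r' by linarith

lemma bpt_ang: "bpt (ang i) = rad 1 i *\<^sub>R dir (ang i)"
  unfolding bpt_def rad_def a_def by simp

lemma norm_e_ge:
  assumes "0 \<le> s"
  shows "rad s (Suc i) * sin \<Delta> \<le> norm (e s i)" "rad s i * sin \<Delta> \<le> norm (e s i)" "r' * sin \<Delta> \<le> norm (e s i)" "0 < norm (e s i)"
proof -
  show 1: "rad s (Suc i) * sin \<Delta> \<le> norm (e s i)" "rad s i * sin \<Delta> \<le> norm (e s i)"
    unfolding e_def ang_Suc by (rule order_trans[OF abs_ge_self norm_dir_combination_ge(1)], rule order_trans[OF abs_ge_self norm_dir_combination_ge(2)])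
  have "r' * sin \<Delta> \<le> rad s i * sin \<Delta>" using rad_ge[OF assms] trig by simp
  then show "r' * sin \<Delta> \<le> norm (e s i)" using 1 by linarith
  moreover have "0 < r' * sin \<Delta>" using r' trig by simp
  ultimately show "0 < norm (e s i)" by linarith
qed

lemma e_affine: "e s i = (1 - s) *\<^sub>R e 0 i + s *\<^sub>R e 1 i"
  unfolding e_def rad_def by (simp add: algebra_simps)

lemma J_affine: "J s i \<tau> = (1 - s) * J 0 i \<tau> + s * J 1 i \<tau>"
  unfolding J_def by (simp add: algebra_simps)

lemma norm_e_le:
  assumes "0 \<le> s" "s \<le> 1"
  shows "norm (e s i) \<le> (1 - s) * norm (e 0 i) + s * norm (e 1 i)"
  unfolding e_affine[of s] using assms norm_triangle_ineq[of "(1 - s) *\<^sub>R e 0 i" "s *\<^sub>R e 1 i"] by simp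

text \<open>\<open>e\<close> and \<open>J\<close> are affine in s and the norm is convex, so only s
  = 0 and s = 1 matter. At s = 0 the normal speed is a mean of \<open>a i\<close> and
  \<open>a (Suc i)\<close> times cos (\<Delta> / 2). At s = 1 \<open>chord_bound\<close> puts the
  side at distance at least \<rho> cos \<Delta> from p, and the speed is at least \<rho> cos
  \<Delta> - r'. The bound on \<open>m\<close> in the locale is the latter, which is the smaller
  one.\<close>

lemma J_ge:
  assumes s: "0 \<le> s" "s \<le> 1" and \<tau>: "0 \<le> \<tau>" "\<tau> \<le> 1"
  shows "m * norm (e s i) \<le> J s i \<tau>"
proof -
  have 0: "m * norm (e 0 i) \<le> J 0 i \<tau>"
  proof -
    have "e 0 i = r' *\<^sub>R (dir (ang i + \<Delta>) - dir (ang i))" unfolding e_def rad_def ang_Suc by (simp add: algebra_simps)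
    then have n: "norm (e 0 i) = r' * (2 * sin (\<Delta> / 2))" using r' \<Delta> norm_dir_diff[of \<Delta> "ang i"] by simp
    have "(1 - \<tau>) * (\<rho> - r') + \<tau> * (\<rho> - r') \<le> (1 - \<tau>) * a i + \<tau> * a (Suc i)"
      using \<tau> a_bounds by (intro add_mono mult_left_mono) auto
    then have "(\<rho> - r') * cos (\<Delta> / 2) \<le> ((1 - \<tau>) * a i + \<tau> * a (Suc i)) * cos (\<Delta> / 2)"
      using trig by (intro mult_right_mono) (auto simp: algebra_simps)
    then have "m \<le> ((1 - \<tau>) * a i + \<tau> * a (Suc i)) * cos (\<Delta> / 2)" using \<rho> by linarith
    then have "m * (r' * (2 * sin (\<Delta> / 2))) \<le> ((1 - \<tau>) * a i + \<tau> * a (Suc i)) * cos (\<Delta> / 2) * (r' * (2 * sin (\<Delta> / 2)))"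
      using r' trig by (intro mult_right_mono) auto
    also have "\<dots> = J 0 i \<tau>" unfolding J_def trig(7) by (simp add: algebra_simps)
    finally show ?thesis unfolding n .
  qed
  have 1: "m * norm (e 1 i) \<le> J 1 i \<tau>"
  proof -
    let ?R = "radius C p (dir (ang i))" and ?R' = "radius C p (dir (ang i + \<Delta>))"
    have R: "rad 1 i = ?R" "rad 1 (Suc i) = ?R'" unfolding rad_def a_def ang_Suc by simp_all
    have "\<rho> * cos \<Delta> * norm (e 1 i) \<le> ?R * ?R' * sin \<Delta>"
      unfolding e_def R ang_Suc by (rule chord_bound[OF ball_C \<rho>(1)]) (use \<Delta> in auto)
    moreover have "r' * ((1 - \<tau>) * (rad 1 (Suc i) * sin \<Delta>) + \<tau> * (rad 1 i * sin \<Delta>)) \<le> r' * ((1 - \<tau>) * norm (e 1 i) + \<tau> * norm (e 1 i))"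
      using \<tau> r' norm_e_ge[of 1 i] by (intro mult_left_mono add_mono) auto
    moreover have "J 1 i \<tau> = ?R * ?R' * sin \<Delta> - r' * ((1 - \<tau>) * (rad 1 (Suc i) * sin \<Delta>) + \<tau> * (rad 1 i * sin \<Delta>))"
      unfolding J_rad R unfolding a_def ang_Suc by (simp add: algebra_simps)
    moreover have "r' * ((1 - \<tau>) * norm (e 1 i) + \<tau> * norm (e 1 i)) = r' * norm (e 1 i)" by (simp add: algebra_simps)
    ultimately have "\<rho> * cos \<Delta> * norm (e 1 i) - r' * norm (e 1 i) \<le> J 1 i \<tau>" by linarith
    moreover have "m * norm (e 1 i) \<le> (\<rho> * cos \<Delta> - r') * norm (e 1 i)" using m_le by (intro mult_right_mono) auto
    ultimately show ?thesis by (simp add: left_diff_distrib)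
  qed
  have "m * norm (e s i) \<le> m * ((1 - s) * norm (e 0 i) + s * norm (e 1 i))"
    using m norm_e_le[OF s] by (intro mult_left_mono) auto
  also have "\<dots> = (1 - s) * (m * norm (e 0 i)) + s * (m * norm (e 1 i))" by (simp add: algebra_simps)
  also have "\<dots> \<le> J s i \<tau>" unfolding J_affine[of s] using s 0 1 by (intro add_mono mult_left_mono) auto
  finally show ?thesis .
qed

lemma J_le:
  assumes s: "0 \<le> s" and \<tau>: "0 \<le> \<tau>" "\<tau> \<le> 1"
  shows "J s i \<tau> \<le> B * norm (e s i)"
proof -
  have "J s i \<tau> = (1 - \<tau>) * (a i * (rad s (Suc i) * sin \<Delta>)) + \<tau> * (a (Suc i) * (rad s i * sin \<Delta>))"
    unfolding J_rad by (simp add: algebra_simps)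
  also have "\<dots> \<le> (1 - \<tau>) * (B * norm (e s i)) + \<tau> * (B * norm (e s i))"
    using \<tau> B_pos a_bounds less_imp_le[OF a_bounds(2)] norm_e_ge[OF s, of i] less_imp_le[OF rad_pos[OF s]] trig
    by (intro add_mono mult_left_mono mult_mono) auto
  also have "\<dots> = B * norm (e s i)" by (simp add: algebra_simps)
  finally show ?thesis .
qed

text \<open>Convexity in s again reduces to the two ends, and each side at s = 0 is the radial
  projection of its counterpart at s = 1, hence not longer.\<close>

lemma length_le:
  assumes s: "0 \<le> s" "s \<le> 1"
  shows "(\<Sum>i<N. norm (e s i)) \<le> L"
proof -
  have "norm (e s i) \<le> norm (bpt (ang (Suc i)) - bpt (ang i))" for i
  proof -
    have e1: "norm (e 1 i) = norm (bpt (ang (Suc i)) - bpt (ang i))" unfolding e_def bpt_ang ..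
    have "e 0 i = r' *\<^sub>R (dir (ang (Suc i)) - dir (ang i))" unfolding e_def rad_def by (simp add: algebra_simps)
    then have "norm (e 0 i) = r' * norm (dir (ang (Suc i)) - dir (ang i))" using r' by simp
    also have "\<dots> \<le> norm (e 1 i)" unfolding e_def
      by (rule dist_scaled_unit_vectors_ge) (use r' rad_ge[of 1] in auto)
    finally have "(1 - s) * norm (e 0 i) + s * norm (e 1 i) \<le> (1 - s) * norm (e 1 i) + s * norm (e 1 i)"
      using s by (intro add_mono mult_left_mono) auto
    also have "\<dots> = norm (e 1 i)" by (simp add: algebra_simps)
    finally show ?thesis using norm_e_le[OF s, of i] e1 by linarith
  qed
  then have "(\<Sum>i<N. norm (e s i)) \<le> (\<Sum>i<N. norm (bpt (ang (Suc i)) - bpt (ang i)))" by (rule sum_mono)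
  also have "\<dots> \<le> L" using L unfolding ang_def .
  finally show ?thesis .
qed

text \<open>The point lies outside the disk because its component along the bisector of the two rays
  exceeds r' cos (\<Delta> / 2) = r, and in C by convexity.\<close>

lemma X_in:
  assumes s: "0 < s" "s < 1" and \<tau>: "0 \<le> \<tau>" "\<tau> \<le> 1"
  shows "X s i \<tau> \<in> C - cball p r"
proof -
  have v: "p + rad s i *\<^sub>R dir (ang i) \<in> C" for i
  proof -
    have "rad s i < radius C p (dir (ang i))"
    proof -
      have "s * a i < 1 * a i" using s a_bounds[of i] by (intro mult_strict_right_mono) auto
      then show ?thesis unfolding rad_def by (simp add: a_def)
    qed
    then show ?thesis using radius_le_iff[of "dir (ang i)" "rad s i"] rad_pos[of s i] s by simp
  qed
  have "X s i \<tau> = (1 - \<tau>) *\<^sub>R (p + rad s i *\<^sub>R dir (ang i)) + \<tau> *\<^sub>R (p + rad s (Suc i) *\<^sub>R dir (ang (Suc i)))"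
    unfolding X_rad by (simp add: algebra_simps)
  then have 1: "X s i \<tau> \<in> C" using convexD[OF convex v v, of "1 - \<tau>" \<tau> i "Suc i"] \<tau> by simp
  have "r' < rad s i" for i unfolding rad_def using s a_bounds[of i] by simp
  then have "(1 - \<tau>) * r' + \<tau> * r' < (1 - \<tau>) * rad s i + \<tau> * rad s (Suc i)"
    using \<tau> by (cases "\<tau> = 0") (auto intro!: add_le_less_mono mult_left_mono mult_strict_left_mono simp: less_imp_le)
  then have "r' < (1 - \<tau>) * rad s i + \<tau> * rad s (Suc i)" by (simp add: algebra_simps)
  then have "r' * cos (\<Delta> / 2) < ((1 - \<tau>) * rad s i + \<tau> * rad s (Suc i)) * cos (\<Delta> / 2)" using trig by simp
  also have "\<dots> = (X s i \<tau> - p) \<bullet> dir (ang i + \<Delta> / 2)"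
    unfolding X_rad ang_Suc by (simp add: inner_add_left inner_dir algebra_simps)
  also have "\<dots> \<le> norm (X s i \<tau> - p)" using norm_cauchy_schwarz[of "X s i \<tau> - p" "dir (ang i + \<Delta> / 2)"] by simp
  finally have "r < dist p (X s i \<tau>)" unfolding r' by (simp add: dist_norm norm_minus_commute)
  with 1 show ?thesis by simp
qed

text \<open>Keeps side i in the half-plane around ray i, where the principal logarithm relative to
  that ray measures the angle without meeting its cut.\<close>

lemma X_positive:
  assumes s: "0 \<le> s" and \<tau>: "0 \<le> \<tau>" "\<tau> \<le> 1"
  shows "0 < (X s i \<tau> - p) \<bullet> dir (ang i)"
proof -
  have "(X s i \<tau> - p) \<bullet> dir (ang i) = (1 - \<tau>) * rad s i + \<tau> * (rad s (Suc i) * cos \<Delta>)"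
    unfolding X_rad ang_Suc by (simp add: inner_add_left inner_dir)
  also have "\<dots> > 0"
  proof (cases "\<tau> = 0")
    case False
    have "0 \<le> (1 - \<tau>) * rad s i" using \<tau> less_imp_le[OF rad_pos[OF s]] by simp
    moreover have "0 < \<tau> * (rad s (Suc i) * cos \<Delta>)" using False \<tau> rad_pos[OF s] trig by simp
    ultimately show ?thesis by simp
  qed (use rad_pos[OF s] in simp)
  finally show ?thesis .
qed

lemma X_1: "X s i 1 = X s (Suc i) 0" unfolding X_def by simp

lemma X_derivative: "(X s i has_vector_derivative e s i) (at \<tau> within S)"
proof -
  have "X s i = (\<lambda>\<tau>. p + rad s i *\<^sub>R dir (ang i) + \<tau> *\<^sub>R e s i)" unfolding X_rad e_def by (auto simp: algebra_simps)
  moreover have "((\<lambda>\<tau>. p + rad s i *\<^sub>R dir (ang i) + \<tau> *\<^sub>R e s i) has_vector_derivative e s i) (at \<tau> within S)"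
    by (auto intro!: derivative_eq_intros)
  ultimately show ?thesis by simp
qed

lemma dir_N: "dir (ang (i + N)) = dir (ang i)"
  using dir_2pi_int[of "ang i" 1] N unfolding ang_def by (simp add: field_simps)

lemma X_N: "X s N 0 = X s 0 0"
proof -
  have "dir (ang N) = dir (ang 0)" using dir_N[of 0] by simp
  then show ?thesis unfolding X_def a_def by simp
qed

end

text \<open>Jordan's inequality, from concavity: the mean value theorem on both sides of x compares
  the slopes.\<close>

lemma sin_ge_chord:
  fixes x :: real
  assumes "0 \<le> x" "x \<le> pi / 2"
  shows "2 * x \<le> pi * sin x"
proof (cases "x = 0 \<or> x = pi / 2")
  case False
  then have x: "0 < x" "x < pi / 2" using assms by auto
  obtain \<xi> where \<xi>: "0 < \<xi>" "\<xi> < x" "sin x - sin 0 = (x - 0) * cos \<xi>"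
    using MVT2[OF x(1), of sin cos] DERIV_sin by blast
  obtain \<eta> where \<eta>: "x < \<eta>" "\<eta> < pi / 2" "sin (pi / 2) - sin x = (pi / 2 - x) * cos \<eta>"
    using MVT2[OF x(2), of sin cos] DERIV_sin by blast
  have "cos \<eta> \<le> cos \<xi>" using \<xi> \<eta> by (intro cos_monotone_0_pi_le) auto
  then have "1 - sin x \<le> (pi / 2 - x) * cos \<xi>" using \<eta> x by (auto intro: mult_left_mono)
  then have "x * (1 - sin x) \<le> x * ((pi / 2 - x) * cos \<xi>)" using x by (intro mult_left_mono) auto
  also have "\<dots> = (pi / 2 - x) * sin x" using \<xi> by simp
  finally show ?thesis by (simp add: algebra_simps)
next
  case True
  then show ?thesis
  proof
    assume "x = pi / 2"
    then show ?thesis unfolding \<open>x = pi / 2\<close> sin_pi_half by simp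
  qed simp
qed

text \<open>Subtract the integer k nearest to a: then |\<phi>| = 2 pi |a - k| lies between 2 pi
  \<gamma> and pi, and |1 - cis \<phi>| = 2 |sin (\<phi> / 2)| is at least 2 |\<phi>| / pi by
  Jordan's inequality.\<close>

lemma holonomy_lower_bounds:
  assumes "\<gamma> \<le> infdist a (\<int> :: real set)" "0 \<le> \<gamma>"
  shows "\<exists>\<phi>. cis \<phi> = cis (- 2 * pi * a) \<and> \<bar>\<phi>\<bar> \<le> pi \<and> 2 * pi * \<gamma> \<le> \<bar>\<phi>\<bar> \<and> 4 * \<gamma> \<le> norm (1 - cis \<phi>)"
proof -
  define k where "k = round a"
  define \<phi> where "\<phi> = - 2 * pi * (a - of_int k)"
  have h: "\<bar>a - of_int k\<bar> \<le> 1 / 2" using of_int_round_abs_le[of a] unfolding k_def by (simp add: abs_minus_commute)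
  have "infdist a \<int> \<le> dist a (of_int k)" by (rule infdist_le) simp
  then have g: "\<gamma> \<le> \<bar>a - of_int k\<bar>" using assms by (simp add: dist_real_def)
  have ab: "\<bar>\<phi>\<bar> = 2 * pi * \<bar>a - of_int k\<bar>" unfolding \<phi>_def by (simp add: abs_mult)
  have p: "\<bar>\<phi>\<bar> \<le> pi" using h pi_gt_zero unfolding ab by simp
  have q: "2 * pi * \<gamma> \<le> \<bar>\<phi>\<bar>" using g unfolding ab by simp
  have "cis \<phi> = cis (- 2 * pi * a) * cis (2 * pi * of_int k)" unfolding cis_mult \<phi>_def by (simp add: algebra_simps)
  also have "cis (2 * pi * of_int k) = 1" by (simp add: cis.ctr cos_int_2pin sin_int_2pin complex_eq_iff)
  finally have c: "cis \<phi> = cis (- 2 * pi * a)" by simp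
  have "(norm (1 - cis \<phi>))\<^sup>2 = (1 - cos \<phi>)\<^sup>2 + (sin \<phi>)\<^sup>2" unfolding cmod_power2 by simp
  also have "\<dots> = 2 - 2 * cos (2 * (\<phi> / 2))" using sin_cos_squared_add[of \<phi>] by (simp add: power2_eq_square algebra_simps)
  also have "\<dots> = (2 * sin (\<phi> / 2))\<^sup>2" unfolding cos_double_sin by (simp add: power_mult_distrib)
  finally have n: "norm (1 - cis \<phi>) = \<bar>2 * sin (\<phi> / 2)\<bar>" by (metis abs_norm_cancel power2_eq_iff_nonneg abs_ge_zero norm_ge_zero power2_abs)
  have "2 * (\<bar>\<phi>\<bar> / 2) \<le> pi * sin (\<bar>\<phi>\<bar> / 2)" using p by (intro sin_ge_chord) auto
  also have "sin (\<bar>\<phi>\<bar> / 2) \<le> \<bar>sin (\<phi> / 2)\<bar>" by (cases "\<phi> \<ge> 0") auto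
  finally have "\<bar>\<phi>\<bar> \<le> pi * \<bar>sin (\<phi> / 2)\<bar>" by simp
  then have "2 * pi * \<gamma> \<le> pi * \<bar>sin (\<phi> / 2)\<bar>" using q by linarith
  then have "2 * \<gamma> \<le> \<bar>sin (\<phi> / 2)\<bar>" using pi_gt_zero by (simp add: mult.assoc mult.left_commute)
  then have "4 * \<gamma> \<le> norm (1 - cis \<phi>)" unfolding n abs_mult by simp
  then show ?thesis using c p q by blast
qed

text \<open>Passes from the magnetic derivative along a leaf to the full magnetic gradient by
  Cauchy-Schwarz.\<close>

lemma norm_magnetic_directional_le:
  fixes h :: "real^2" and w :: "complex^2"
  shows "norm ((\<Sum>k\<in>UNIV. (h $ k) *\<^sub>R w $ k) - \<i> * of_real (b \<bullet> h) * z) \<le> norm h * norm (\<chi> k. w $ k - \<i> * of_real (b $ k) * z)"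
proof -
  let ?g = "\<chi> k. w $ k - \<i> * of_real (b $ k) * z"
  have "(\<Sum>k\<in>UNIV. (h $ k) *\<^sub>R w $ k) - \<i> * of_real (b \<bullet> h) * z = (\<Sum>k\<in>UNIV. (h $ k) *\<^sub>R ?g $ k)"
    by (simp add: sum_2 inner_vec_def scaleR_conv_of_real algebra_simps)
  also have "norm \<dots> \<le> (\<Sum>k\<in>UNIV. \<bar>h $ k\<bar> * \<bar>norm (?g $ k)\<bar>)"
    by (rule order_trans[OF norm_sum]) simp
  also have "\<dots> \<le> norm h * norm ?g"
    unfolding norm_vec_def by (rule order_trans[OF L2_set_mult_ineq]) (simp add: norm_vec_def L2_set_def)
  finally show ?thesis .
qed


section \<open>The Rayleigh estimate along one leaf\<close>

context polygonal_foliation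
begin

lemma J_pos: "0 \<le> s \<Longrightarrow> s \<le> 1 \<Longrightarrow> 0 \<le> \<tau> \<Longrightarrow> \<tau> \<le> 1 \<Longrightarrow> 0 < J s i \<tau>"
  using J_ge[of s \<tau> i] norm_e_ge(4)[of s i] m by (meson less_le_trans mult_pos_pos)

lemma continuous_X: "continuous_on S (\<lambda>\<tau>. X s i \<tau>)"
  unfolding X_def by (intro continuous_intros)

lemma continuous_J: "continuous_on S (\<lambda>\<tau>. J s i \<tau>)"
  unfolding J_def by (intro continuous_intros)

text \<open>Near side i the form A has the potential \<open>h i\<close>, its exact part plus
  \<alpha> times the polar angle, and multiplication by \<open>cis (- h i)\<close> turns the
  magnetic derivative of v into an ordinary one. The potentials match at the vertices, and after N
  sides the angle has grown by 2 pi, so the result on [0, N] is quasiperiodic with factor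
  \<open>cis (- 2 * pi * \<alpha>)\<close> and \<open>weighted_loop_inequality\<close>
  applies.\<close>

lemma loop_estimate:
  assumes s: "0 < s" "s < 1"
    and \<Psi>: "\<And>x. x \<in> C - cball p r \<Longrightarrow> (\<Psi> has_derivative (\<lambda>h. A x \<bullet> h - \<alpha> * angle_form p x h)) (at x)"
    and A: "continuous_on (C - cball p r) A" and \<gamma>: "\<gamma> \<le> infdist \<alpha> \<int>" "0 \<le> \<gamma>"
    and dv: "\<And>i \<tau>. i < N \<Longrightarrow> \<tau> \<in> {0..1} \<Longrightarrow> (v has_derivative (\<lambda>h. \<Sum>k\<in>UNIV. (h $ k) *\<^sub>R (w (X s i \<tau>) $ k))) (at (X s i \<tau>))"
    and cv: "continuous_on UNIV v" and cw: "continuous_on UNIV w"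
    and \<mu>: "0 \<le> \<mu>" "\<mu> * (L\<^sup>2 * B\<^sup>2) \<le> (2 * pi * \<gamma>)\<^sup>2 * m\<^sup>2 \<or> \<mu> * ((m + B)\<^sup>2 * L\<^sup>2) \<le> (4 * \<gamma>)\<^sup>2 * (4 * m * B)"
  shows "\<mu> * (\<Sum>i<N. integral {0..1} (\<lambda>\<tau>. J s i \<tau> * (norm (v (X s i \<tau>)))\<^sup>2)) \<le>
    (\<Sum>i<N. integral {0..1} (\<lambda>\<tau>. J s i \<tau> * (norm (magnetic_gradient A v w (X s i \<tau>)))\<^sup>2))"
proof -
  define c where "c i = to_complex (dir (ang i))" for i
  \<comment> \<open>The angle relative to ray i is the principal one; \<open>ang i\<close>, which is
    not reduced modulo 2 pi, continues it from side to side.\<close>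
  define h where "h i x = \<Psi> x + \<alpha> * (ang i + Im (Ln (to_complex (x - p) / c i)))" for i x
  define y where "y i \<tau> = cis (- h i (X s i \<tau>)) * v (X s i \<tau>)" for i \<tau>
  define y' where "y' i \<tau> = cis (- h i (X s i \<tau>)) * ((\<Sum>k\<in>UNIV. (e s i $ k) *\<^sub>R w (X s i \<tau>) $ k) - \<i> * of_real (A (X s i \<tau>) \<bullet> e s i) * v (X s i \<tau>))" for i \<tau>
  have cc: "c i = cis (ang i)" for i unfolding c_def by (simp add: complex_eq_iff)
  have c0: "c i \<noteq> 0" for i unfolding cc by simp
  have dh: "(h i has_derivative (\<lambda>k. A (X s i \<tau>) \<bullet> k)) (at (X s i \<tau>))" if \<tau>: "\<tau> \<in> {0..1}" for i \<tau>
  proof -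
    have re: "0 < Re (to_complex (X s i \<tau> - p) / c i)"
    proof -
      have "Re (to_complex (X s i \<tau> - p) / c i) = Re (to_complex (X s i \<tau> - p) * cis (- ang i))"
        unfolding cc by (simp add: divide_inverse cis_inverse)
      also have "\<dots> = (X s i \<tau> - p) \<bullet> dir (ang i)" by (simp add: inner_vec_def sum_2)
      finally show ?thesis using X_positive[of s \<tau> i] s \<tau> by simp
    qed
    have "(h i has_derivative (\<lambda>k. (A (X s i \<tau>) \<bullet> k - \<alpha> * angle_form p (X s i \<tau>) k) + \<alpha> * (0 + angle_form p (X s i \<tau>) k))) (at (X s i \<tau>))"
      unfolding h_def
      by (intro has_derivative_add has_derivative_mult_right has_derivative_const has_derivative_Im_Ln re \<Psi> X_in s) (use \<tau> in auto)
    then show ?thesis by simp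
  qed
  have ds: "((\<lambda>\<tau>. h i (X s i \<tau>)) has_real_derivative (A (X s i \<tau>) \<bullet> e s i)) (at \<tau>)" if \<tau>: "\<tau> \<in> {0..1}" for i \<tau>
    using has_derivative_compose[OF X_derivative[unfolded has_vector_derivative_def] dh[OF \<tau>]]
    unfolding has_field_derivative_def by (simp add: mult.commute[of _ "A _ \<bullet> _"])
  have dc: "((\<lambda>\<tau>. cis (- h i (X s i \<tau>))) has_vector_derivative cis (- h i (X s i \<tau>)) * (- \<i> * of_real (A (X s i \<tau>) \<bullet> e s i))) (at \<tau>)" if \<tau>: "\<tau> \<in> {0..1}" for i \<tau>
  proof -
    have "((\<lambda>\<tau>. of_real (h i (X s i \<tau>))) has_vector_derivative (of_real (A (X s i \<tau>) \<bullet> e s i) :: complex)) (at \<tau>)"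
      by (rule has_vector_derivative_of_real) (use ds[OF \<tau>] in \<open>simp add: has_real_derivative_iff_has_vector_derivative\<close>)
    then have "((\<lambda>\<tau>. - \<i> * of_real (h i (X s i \<tau>))) has_vector_derivative (- \<i> * of_real (A (X s i \<tau>) \<bullet> e s i))) (at \<tau>)"
      by (rule has_vector_derivative_mult_right)
    from field_vector_diff_chain_at[OF this DERIV_exp]
    show ?thesis by (simp add: comp_def cis_conv_exp mult.commute)
  qed
  have dy: "(y i has_vector_derivative y' i \<tau>) (at \<tau>)" if i: "i < N" and \<tau>: "\<tau> \<in> {0..1}" for i \<tau>
  proof -
    have "((\<lambda>\<tau>. v (X s i \<tau>)) has_vector_derivative (\<Sum>k\<in>UNIV. (e s i $ k) *\<^sub>R w (X s i \<tau>) $ k)) (at \<tau>)"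
      using has_derivative_compose[OF X_derivative[unfolded has_vector_derivative_def] dv[OF i \<tau>]]
      unfolding has_vector_derivative_def by (simp add: scaleR_sum_right)
    from has_vector_derivative_mult[OF dc[OF \<tau>] this]
    show ?thesis unfolding y_def y'_def by (simp add: algebra_simps)
  qed
  have Xin: "X s i ` {0..1} \<subseteq> C - cball p r" for i using X_in[OF s] by auto
  have cAX: "continuous_on {0..1} (\<lambda>\<tau>. A (X s i \<tau>))" for i
    by (rule continuous_on_compose2[OF A continuous_X Xin])
  have cwX: "continuous_on {0..1} (\<lambda>\<tau>. w (X s i \<tau>))" and cvX: "continuous_on {0..1} (\<lambda>\<tau>. v (X s i \<tau>))" for i
    by (rule continuous_on_compose2[OF cw continuous_X subset_UNIV], rule continuous_on_compose2[OF cv continuous_X subset_UNIV])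
  have ccis: "continuous_on {0..1} (\<lambda>\<tau>. cis (- h i (X s i \<tau>)))" for i
    using dc by (intro continuous_at_imp_continuous_on ballI has_vector_derivative_continuous) blast
  have cy: "continuous_on {0..1} (y i)" for i unfolding y_def by (intro continuous_on_mult ccis cvX)
  have cy': "continuous_on {0..1} (y' i)" for i unfolding y'_def by (intro continuous_intros ccis cvX cwX cAX)
  have y'_le: "norm (y' i \<tau>) \<le> norm (e s i) * norm (magnetic_gradient A v w (X s i \<tau>))" for i \<tau>
    unfolding y'_def norm_mult norm_cis magnetic_gradient_def using norm_magnetic_directional_le by simp
  have start: "h i (X s i 0) = \<Psi> (X s i 0) + \<alpha> * ang i" for i
  proof -
    have "to_complex (X s i 0 - p) = of_real (rad s i) * c i" unfolding X_rad cc by (simp add: complex_eq_iff)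
    then have "to_complex (X s i 0 - p) / c i = of_real (rad s i)" using c0 by simp
    then show ?thesis unfolding h_def using rad_pos[of s i] s by (simp add: Ln_of_real)
  qed
  have stop: "h i (X s i 1) = \<Psi> (X s i 1) + \<alpha> * ang (Suc i)" for i
  proof -
    have "to_complex (X s i 1 - p) = of_real (rad s (Suc i)) * (c i * cis \<Delta>)" unfolding X_rad cc cis_mult ang_Suc[symmetric] by (simp add: complex_eq_iff)
    then have "to_complex (X s i 1 - p) / c i = of_real (rad s (Suc i)) * cis \<Delta>" using c0 by simp
    moreover have "Ln (of_real (rad s (Suc i)) * cis \<Delta>) = of_real (ln (rad s (Suc i))) + \<i> * of_real \<Delta>"
    proof (rule Ln_unique)
      show "exp (of_real (ln (rad s (Suc i))) + \<i> * of_real \<Delta>) = of_real (rad s (Suc i)) * cis \<Delta>"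
        using rad_pos[of s "Suc i"] s by (simp add: exp_add cis_conv_exp exp_of_real)
    qed (use \<Delta> pi_gt_zero in auto)
    ultimately show ?thesis unfolding h_def ang_Suc by simp
  qed
  have glue: "y i 1 = y (Suc i) 0" for i
    unfolding y_def stop[of i] start[of "Suc i"] unfolding X_1 ..
  have per: "y N 0 = cis (- 2 * pi * \<alpha>) * y 0 0"
  proof -
    have "ang N = ang 0 + 2 * pi" unfolding ang_def using N by (simp add: field_simps)
    then have "- h N (X s N 0) = - 2 * pi * \<alpha> + (- h 0 (X s 0 0))" using start[of N] start[of 0] X_N[of s] by (simp add: algebra_simps)
    then have "cis (- h N (X s N 0)) = cis (- 2 * pi * \<alpha>) * cis (- h 0 (X s 0 0))" by (simp only: cis_mult)
    then show ?thesis unfolding y_def X_N by simp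
  qed
  \<comment> \<open>Concatenation: [i, i + 1] carries side i. At an integer \<open>frac\<close>
    selects the start of the next side, which by \<open>glue\<close> agrees with the end of the
    previous one.\<close>
  define z where "z t = y (nat \<lfloor>t\<rfloor>) (frac t)" for t
  define z' where "z' t = y' (nat \<lfloor>t\<rfloor>) (frac t)" for t
  define j where "j t = J s (nat \<lfloor>t\<rfloor>) (frac t)" for t
  define l where "l t = norm (e s (nat \<lfloor>t\<rfloor>))" for t :: real
  have fl: "nat \<lfloor>real i + \<tau>\<rfloor> = i" "frac (real i + \<tau>) = \<tau>" if "0 \<le> \<tau>" "\<tau> < 1" for i :: nat and \<tau>
  proof -
    have "\<lfloor>real i + \<tau>\<rfloor> = int i" using that by (simp add: floor_eq_iff)
    then show "nat \<lfloor>real i + \<tau>\<rfloor> = i" "frac (real i + \<tau>) = \<tau>" unfolding frac_def by simp_all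
  qed
  have zf: "z (real i + \<tau>) = y i \<tau>" and z'f: "z' (real i + \<tau>) = y' i \<tau>" and jf: "j (real i + \<tau>) = J s i \<tau>"
    and lf: "l (real i + \<tau>) = norm (e s i)" if "0 \<le> \<tau>" "\<tau> < 1" for i \<tau>
    unfolding z_def z'_def j_def l_def by (simp_all only: fl[OF that])
  have fr: "0 \<le> frac t" "frac t \<le> 1" for t :: real using frac_lt_1[of t] by auto
  have zi: "z t = y i (t - real i)" if t: "t \<in> {real i..real (Suc i)}" for t i
  proof (cases "t = real (Suc i)")
    case True
    then show ?thesis using zf[of 0 "Suc i"] glue[of i] by simp
  next
    case False
    then show ?thesis using zf[of "t - real i" i] t by simp
  qed
  have cz: "continuous_on {0..real N} z"
  proof (rule continuous_on_unit_intervals)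
    fix i
    have "continuous_on {real i..real (Suc i)} (\<lambda>t. y i (t - real i))"
      by (rule continuous_on_compose2[OF cy]) (auto intro!: continuous_intros)
    then show "continuous_on {real i..real (Suc i)} z" by (rule continuous_on_eq) (use zi in simp)
  qed
  have der: "(z has_vector_derivative z' t) (at t)" if t: "t \<in> {0<..<real N} - real ` {0..N}" for t
  proof -
    define i where "i = nat \<lfloor>t\<rfloor>"
    have ri: "real i = of_int \<lfloor>t\<rfloor>" using t unfolding i_def by simp
    have ti: "real i \<le> t" unfolding ri by simp
    have tS: "t < real (Suc i)" using ri real_of_int_floor_add_one_gt[of t] by linarith
    have iN: "i < N" using ti t by simp
    have "real i \<noteq> t" using t iN by (metis DiffE atLeastAtMost_iff image_eqI less_imp_le_nat zero_le)
    with ti have ti: "real i < t" by simp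
    have f: "t - real i = frac t" unfolding ri frac_def by simp
    have "((\<lambda>t. t - real i) has_real_derivative 1) (at t)" by (auto intro!: derivative_eq_intros)
    then have "((\<lambda>t. y i (t - real i)) has_vector_derivative y' i (t - real i)) (at t)"
      using vector_diff_chain_at[of "\<lambda>t. t - real i" 1 t "y i" "y' i (t - real i)"] dy[OF iN, of "t - real i"] ti tS
      by (simp add: comp_def has_real_derivative_iff_has_vector_derivative)
    moreover have "y' i (t - real i) = z' t" unfolding z'_def f[symmetric] i_def[symmetric] ..
    ultimately have "((\<lambda>t. y i (t - real i)) has_vector_derivative z' t) (at t)" by simp
    then show ?thesis
      by (rule has_vector_derivative_transform_within_open[of _ _ _ "{real i<..<real (Suc i)}"]) (use ti tS zi[symmetric] in auto)
  qed
  have s': "0 \<le> s" "s \<le> 1" using s by auto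
  have cJ: "continuous_on {0..1} (J s i)" for i by (rule continuous_J)
  have J0: "0 < J s i \<tau>" if "\<tau> \<in> {0..1}" for i \<tau> using J_pos[OF s', of \<tau> i] that by simp
  have pcj: "piecewise_cont N j"
    by (rule integral_unit_intervals(1)[OF cJ]) (simp add: jf)
  have pcl: "piecewise_cont N l"
    by (rule integral_unit_intervals(1)[OF continuous_on_const]) (simp add: lf)
  have pcij: "piecewise_cont N (\<lambda>t. 1 / j t)"
  proof (rule integral_unit_intervals(1)[of N "\<lambda>i \<tau>. 1 / J s i \<tau>"])
    show "continuous_on {0..1} (\<lambda>\<tau>. 1 / J s i \<tau>)" for i
      by (intro continuous_intros cJ ballI less_imp_neq[OF J0, symmetric])
  qed (simp add: jf)
  have pcil: "piecewise_cont N (\<lambda>t. 1 / l t)"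
    by (rule integral_unit_intervals(1)[OF continuous_on_const]) (simp add: lf)
  have pcz': "piecewise_cont N z'"
  proof -
    have "\<exists>k. continuous_on {real i..real (Suc i)} k \<and> (\<forall>t\<in>{real i<..<real (Suc i)}. z' t = k t)" for i
    proof (intro exI conjI ballI)
      show "continuous_on {real i..real (Suc i)} (\<lambda>t. y' i (t - real i))"
        by (rule continuous_on_compose2[OF cy']) (auto intro!: continuous_intros)
      fix t assume "t \<in> {real i<..<real (Suc i)}"
      then show "z' t = y' i (t - real i)" using z'f[of "t - real i" i] by simp
    qed
    then show ?thesis unfolding piecewise_cont_def by blast
  qed
  have ml: "m * l t \<le> j t" and Bl: "j t \<le> B * l t" for t
    unfolding l_def j_def by (rule J_ge[OF s' fr], rule J_le[OF s'(1) fr])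
  have Ll: "integral {0..real N} l \<le> L"
  proof -
    have "integral {0..real N} l = (\<Sum>i<N. integral {0..1::real} (\<lambda>_. norm (e s i)))"
      by (rule integral_unit_intervals(2)[of N "\<lambda>i _. norm (e s i)"]) (simp_all add: lf)
    then show ?thesis using length_le[OF s'] by simp
  qed
  obtain \<phi> where \<phi>: "cis \<phi> = cis (- 2 * pi * \<alpha>)" "\<bar>\<phi>\<bar> \<le> pi" "2 * pi * \<gamma> \<le> \<bar>\<phi>\<bar>" "4 * \<gamma> \<le> norm (1 - cis \<phi>)"
    using holonomy_lower_bounds[OF \<gamma>] by blast
  have perz: "z (real N) = cis \<phi> * z 0"
    using per zf[of 0 N] zf[of 0 0] unfolding \<phi>(1) by simp
  have N0: "N > 0" using N by simp
  have l0: "0 < r' * sin \<Delta>" using r' trig by simp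
  have l0l: "r' * sin \<Delta> \<le> l t" for t unfolding l_def by (rule norm_e_ge(3)[OF s'(1)])
  note loop = weighted_loop_inequality[OF N0 cz der pcj pcl pcij pcil pcz' m(1) B_pos l0 l0l ml Bl Ll perz \<phi>(2)]
  define U where "U = (\<Sum>i<N. integral {0..1} (\<lambda>\<tau>. J s i \<tau> * (norm (v (X s i \<tau>)))\<^sup>2))"
  define E where "E = (\<Sum>i<N. integral {0..1} (\<lambda>\<tau>. J s i \<tau> / (norm (e s i))\<^sup>2 * (norm (y' i \<tau>))\<^sup>2))"
  have U: "integral {0..real N} (\<lambda>t. j t * (norm (z t))\<^sup>2) = U"
    unfolding U_def
    by (rule integral_unit_intervals(2)) (auto intro!: continuous_intros cJ cvX simp: jf zf y_def norm_mult)
  have en: "norm (e s i) \<noteq> 0" for i using norm_e_ge(4)[OF s'(1), of i] by simp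
  have E: "integral {0..real N} (\<lambda>t. j t / (l t)\<^sup>2 * (norm (z' t))\<^sup>2) = E"
    unfolding E_def
    by (rule integral_unit_intervals(2)) (use en in \<open>auto intro!: continuous_intros cJ cy' simp: jf z'f lf\<close>)
  have U0: "0 \<le> U" unfolding U_def
    by (intro sum_nonneg integral_nonneg integrable_continuous_real continuous_intros cJ cvX mult_nonneg_nonneg less_imp_le[OF J0]) auto
  have L0: "0 < L"
  proof -
    have "0 < norm (e s 0)" using norm_e_ge(4)[OF s'(1)] .
    also have "\<dots> \<le> (\<Sum>i<N. norm (e s i))" by (rule member_le_sum) (use N0 in auto)
    finally show ?thesis using length_le[OF s'] by linarith
  qed
  have "\<mu> * U \<le> E"
    using \<mu>(2)
  proof
    assume a: "\<mu> * (L\<^sup>2 * B\<^sup>2) \<le> (2 * pi * \<gamma>)\<^sup>2 * m\<^sup>2"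
    have "(2 * pi * \<gamma>)\<^sup>2 \<le> \<phi>\<^sup>2" using power_mono[OF \<phi>(3), of 2] \<gamma>(2) by simp
    then have "(2 * pi * \<gamma>)\<^sup>2 * m\<^sup>2 \<le> \<phi>\<^sup>2 * m\<^sup>2" by (rule mult_right_mono) simp
    then have "\<mu> * (L\<^sup>2 * B\<^sup>2) * U \<le> \<phi>\<^sup>2 * m\<^sup>2 * U" by (rule mult_right_mono[OF order_trans[OF a] U0])
    also have "\<dots> \<le> L\<^sup>2 * B\<^sup>2 * E" using loop(1) unfolding U E .
    finally have "(L\<^sup>2 * B\<^sup>2) * (\<mu> * U) \<le> (L\<^sup>2 * B\<^sup>2) * E" by (simp add: mult_ac)
    then show ?thesis by (rule mult_left_le_imp_le) (use L0 B_pos in simp)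
  next
    assume a: "\<mu> * ((m + B)\<^sup>2 * L\<^sup>2) \<le> (4 * \<gamma>)\<^sup>2 * (4 * m * B)"
    have "(4 * \<gamma>)\<^sup>2 \<le> (norm (1 - cis \<phi>))\<^sup>2" using power_mono[OF \<phi>(4), of 2] \<gamma>(2) by simp
    then have "(4 * \<gamma>)\<^sup>2 * (4 * m * B) \<le> (norm (1 - cis \<phi>))\<^sup>2 * (4 * m * B)" using m B_pos by (intro mult_right_mono) auto
    then have "\<mu> * ((m + B)\<^sup>2 * L\<^sup>2) * U \<le> (norm (1 - cis \<phi>))\<^sup>2 * (4 * m * B) * U" by (rule mult_right_mono[OF order_trans[OF a] U0])
    also have "\<dots> \<le> (m + B)\<^sup>2 * L\<^sup>2 * E" using loop(2) unfolding U E .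
    finally have "((m + B)\<^sup>2 * L\<^sup>2) * (\<mu> * U) \<le> ((m + B)\<^sup>2 * L\<^sup>2) * E" by (simp add: mult_ac)
    then show ?thesis by (rule mult_left_le_imp_le) (use L0 B_pos m in simp)
  qed
  also have "E \<le> (\<Sum>i<N. integral {0..1} (\<lambda>\<tau>. J s i \<tau> * (norm (magnetic_gradient A v w (X s i \<tau>)))\<^sup>2))"
    unfolding E_def
  proof (intro sum_mono integral_le integrable_continuous_real)
    fix i
    show "continuous_on {0..1} (\<lambda>\<tau>. J s i \<tau> / (norm (e s i))\<^sup>2 * (norm (y' i \<tau>))\<^sup>2)"
      using en by (intro continuous_intros cJ cy') auto
    show "continuous_on {0..1} (\<lambda>\<tau>. J s i \<tau> * (norm (magnetic_gradient A v w (X s i \<tau>)))\<^sup>2)"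
      unfolding magnetic_gradient_def by (intro continuous_intros cJ cvX cwX cAX)
    fix \<tau> :: real assume \<tau>: "\<tau> \<in> {0..1}"
    \<comment> \<open>The derivative along a side is at most \<open>norm (e s i)\<close> times the
      magnetic gradient, and the squared speed in the denominator of the weight cancels this
      factor.\<close>
    have "(norm (y' i \<tau>))\<^sup>2 \<le> (norm (e s i) * norm (magnetic_gradient A v w (X s i \<tau>)))\<^sup>2"
      using y'_le by (intro power_mono) auto
    then have "J s i \<tau> / (norm (e s i))\<^sup>2 * (norm (y' i \<tau>))\<^sup>2 \<le> J s i \<tau> / (norm (e s i))\<^sup>2 * (norm (e s i) * norm (magnetic_gradient A v w (X s i \<tau>)))\<^sup>2"
      using J0[OF \<tau>, of i] by (intro mult_left_mono) auto
    then show "J s i \<tau> / (norm (e s i))\<^sup>2 * (norm (y' i \<tau>))\<^sup>2 \<le> J s i \<tau> * (norm (magnetic_gradient A v w (X s i \<tau>)))\<^sup>2"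
      using en[of i] by (simp add: power_mult_distrib)
  qed
  finally show ?thesis unfolding U_def .
qed

end

section \<open>Integration over the leaves\<close>

lemma AE_not_in_negligible:
  assumes "negligible S"
  shows "AE x in lborel. x \<notin> S"
proof -
  have "S \<in> null_sets lebesgue" using assms negligible_iff_null_sets by blast
  then have "AE x in lebesgue. x \<notin> S" by (rule AE_not_in)
  then show ?thesis by (simp add: AE_completion_iff)
qed

text \<open>The sets \<open>S i\<close> may overlap, but only in null sets: up to null sets each of
  them lies in \<open>T i\<close>, and the \<open>T i\<close> are disjoint.\<close>

lemma sum_nn_integral_almost_disjoint_le:
  fixes f :: "'a::euclidean_space \<Rightarrow> ennreal"
  assumes I: "finite I" and S: "\<And>i. i \<in> I \<Longrightarrow> S i \<in> sets borel" "\<And>i. i \<in> I \<Longrightarrow> S i \<subseteq> K"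
    and T: "\<And>i. i \<in> I \<Longrightarrow> T i \<in> sets borel" "\<And>i j x. i \<in> I \<Longrightarrow> j \<in> I \<Longrightarrow> x \<in> T i \<Longrightarrow> x \<in> T j \<Longrightarrow> i = j"
    and n: "\<And>i. i \<in> I \<Longrightarrow> negligible (S i - T i)"
    and f: "(\<lambda>x. f x * indicator K x) \<in> borel_measurable borel"
  shows "(\<Sum>i\<in>I. \<integral>\<^sup>+x\<in>S i. f x \<partial>lborel) \<le> (\<integral>\<^sup>+x\<in>K. f x \<partial>lborel)"
proof -
  have "(\<integral>\<^sup>+x\<in>S i. f x \<partial>lborel) = (\<integral>\<^sup>+x. (f x * indicator K x) * indicator (S i \<inter> T i) x \<partial>lborel)" if i: "i \<in> I" for i
    by (rule nn_integral_cong_AE) (use AE_not_in_negligible[OF n[OF i]] S(2)[OF i] in \<open>auto elim!: eventually_mono split: split_indicator\<close>)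
  then have "(\<Sum>i\<in>I. \<integral>\<^sup>+x\<in>S i. f x \<partial>lborel) = (\<Sum>i\<in>I. \<integral>\<^sup>+x. (f x * indicator K x) * indicator (S i \<inter> T i) x \<partial>lborel)" by simp
  also have "\<dots> = (\<integral>\<^sup>+x. (\<Sum>i\<in>I. (f x * indicator K x) * indicator (S i \<inter> T i) x) \<partial>lborel)"
    by (rule nn_integral_sum[symmetric]) (use S T f in auto)
  also have "\<dots> \<le> (\<integral>\<^sup>+x\<in>K. f x \<partial>lborel)"
  proof (rule nn_integral_mono)
    fix x
    show "(\<Sum>i\<in>I. (f x * indicator K x) * indicator (S i \<inter> T i) x) \<le> f x * indicator K x"
    proof (cases "\<exists>j\<in>I. x \<in> T j")
      case True
      then obtain j where j: "j \<in> I" "x \<in> T j" by blast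
      have "(\<Sum>i\<in>I. (f x * indicator K x) * indicator (S i \<inter> T i) x) = (\<Sum>i\<in>I. if i = j then (f x * indicator K x) * indicator (S i \<inter> T i) x else 0)"
        by (rule sum.cong) (use T(2) j in \<open>auto split: split_indicator\<close>)
      also have "\<dots> = (f x * indicator K x) * indicator (S j \<inter> T j) x" using I j by simp
      also have "\<dots> \<le> f x * indicator K x" by (auto split: split_indicator)
      finally show ?thesis .
    next
      case False
      then have "(\<Sum>i\<in>I. (f x * indicator K x) * indicator (S i \<inter> T i) x) = 0" by (intro sum.neutral) (auto split: split_indicator)
      then show ?thesis by simp
    qed
  qed
  finally show ?thesis .
qed

lemma set_nn_integral_compact:
  fixes f :: "'a::euclidean_space \<Rightarrow> real"
  assumes "compact K" "continuous_on K f" "\<And>x. 0 \<le> f x"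
  shows "(\<integral>\<^sup>+x\<in>K. ennreal (f x) \<partial>lborel) = ennreal (integral K f)"
proof -
  have i: "set_integrable lborel K f"
    unfolding set_integrable_def by (rule borel_integrable_compact[OF assms(1,2)])
  have "(\<integral>\<^sup>+x\<in>K. ennreal (f x) \<partial>lborel) = (\<integral>\<^sup>+x. ennreal (indicator K x *\<^sub>R f x) \<partial>lborel)"
    by (rule nn_integral_cong) (auto split: split_indicator)
  also have "\<dots> = ennreal (\<integral>x. indicator K x *\<^sub>R f x \<partial>lborel)"
    by (rule nn_integral_eq_integral) (use i assms(3) in \<open>auto simp: set_integrable_def\<close>)
  also have "(\<integral>x. indicator K x *\<^sub>R f x \<partial>lborel) = integral K f"
    using set_borel_integral_eq_integral(2)[OF i] unfolding set_lebesgue_integral_def .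
  finally show ?thesis .
qed

text \<open>Translates the two half-plane conditions of an angular sector of opening \<Delta> into
  an interval of angles; k counts full turns.\<close>

lemma positive_sines_imp_between:
  assumes "sin y > 0" "sin (\<Delta> - y) > 0" "0 < \<Delta>" "\<Delta> < pi"
  shows "\<exists>k::int. 2 * pi * of_int k < y \<and> y < 2 * pi * of_int k + \<Delta>"
proof -
  define k where "k = \<lfloor>y / (2 * pi)\<rfloor>"
  define x where "x = y - 2 * pi * of_int k"
  have "of_int k \<le> y / (2 * pi)" "y / (2 * pi) < of_int k + 1" unfolding k_def by linarith+
  then have x: "0 \<le> x" "x < 2 * pi" unfolding x_def using pi_gt_zero by (auto simp: field_simps)
  have s: "sin x = sin y" "sin (\<Delta> - x) = sin (\<Delta> - y)"
    using sin_int_2pin[of k] cos_int_2pin[of k] unfolding x_def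
    by (simp_all add: sin_diff sin_add cos_diff cos_add)
  have "x \<noteq> 0" using s assms by auto
  moreover have "x < pi" using sin_le_zero[of x] x s assms by force
  moreover have "x < \<Delta>"
  proof (rule ccontr)
    assume n: "\<not> x < \<Delta>"
    have "0 \<le> sin (x - \<Delta>)" by (rule sin_ge_zero) (use n \<open>x < pi\<close> assms in auto)
    then have "sin (\<Delta> - x) \<le> 0" by (metis minus_diff_eq neg_0_le_iff_le sin_minus minus_minus)
    then show False using s assms by simp
  qed
  ultimately show ?thesis using x unfolding x_def by (intro exI[of _ k]) auto
qed

context polygonal_foliation
begin

definition quad where "quad s0 s1 i = (\<lambda>(s, \<tau>). X s i \<tau>) ` ({s0..s1} \<times> {0..1})" for s0 s1 i
text \<open>The open angle between rays i and i + 1 as an intersection of two half-planes.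
  Neighbouring quadrilaterals share sides, and these disjoint sets confine the overlap to the
  rays.\<close>

definition sector where "sector i = {x. 0 < (x - p) \<bullet> dir (ang i + pi / 2) \<and> 0 < (x - p) \<bullet> dir (ang (Suc i) - pi / 2)}" for i

lemma sector_sine:
  assumes "x - p = t *\<^sub>R dir \<theta>"
  shows "(x - p) \<bullet> dir (ang i + pi / 2) = t * sin (\<theta> - ang i)" "(x - p) \<bullet> dir (ang (Suc i) - pi / 2) = t * sin (\<Delta> - (\<theta> - ang i))"
proof -
  have "cos (\<theta> - (ang i + pi / 2)) = sin (\<theta> - ang i)"
    using sin_cos_eq[of "\<theta> - ang i"] cos_minus[of "\<theta> - (ang i + pi / 2)"] by (simp add: algebra_simps)
  then show "(x - p) \<bullet> dir (ang i + pi / 2) = t * sin (\<theta> - ang i)" unfolding assms by (simp add: inner_dir)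
  have "cos (\<theta> - (ang (Suc i) - pi / 2)) = sin (\<Delta> - (\<theta> - ang i))"
    using sin_cos_eq[of "\<Delta> - (\<theta> - ang i)"] unfolding ang_Suc by (simp add: algebra_simps)
  then show "(x - p) \<bullet> dir (ang (Suc i) - pi / 2) = t * sin (\<Delta> - (\<theta> - ang i))" unfolding assms by (simp add: inner_dir)
qed

text \<open>The floor of the polar angle, counted from \<theta>0 in units of \<Delta>, determines i
  modulo N.\<close>

lemma sectors_disjoint:
  assumes "i < N" "j < N" "x \<in> sector i" "x \<in> sector j"
  shows "i = j"
proof -
  have "x - p \<noteq> 0" using assms unfolding sector_def by auto
  then obtain \<theta> where \<theta>: "x - p = norm (x - p) *\<^sub>R dir \<theta>" using polar_direction by blast
  have n: "norm (x - p) > 0" using \<open>x - p \<noteq> 0\<close> by simp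
  define q where "q = (\<theta> - \<theta>0) / \<Delta>"
  have fl: "\<exists>k::int. \<lfloor>q\<rfloor> = int i + k * int N" if "i < N" "x \<in> sector i" for i
  proof -
    have "sin (\<theta> - ang i) > 0" "sin (\<Delta> - (\<theta> - ang i)) > 0"
      using that(2) n unfolding sector_def mem_Collect_eq sector_sine[OF \<theta>] by (auto simp: zero_less_mult_iff)
    then obtain k :: int where k: "2 * pi * of_int k < \<theta> - ang i" "\<theta> - ang i < 2 * pi * of_int k + \<Delta>"
      using positive_sines_imp_between[OF _ _ \<Delta>(1)] \<Delta>(2) pi_gt_zero by (metis field_sum_of_halves less_add_same_cancel1 half_gt_zero less_trans)
    have N\<Delta>: "2 * pi = real N * \<Delta>" unfolding \<Delta>_def using N by simp
    have "ang i = \<theta>0 + real i * \<Delta>" unfolding ang_def \<Delta>_def by simp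
    then have "\<theta> - ang i = (q - real i) * \<Delta>" unfolding q_def left_diff_distrib using \<Delta> by simp
    then have "of_int k * real N * \<Delta> < (q - real i) * \<Delta>" "(q - real i) * \<Delta> < (of_int k * real N + 1) * \<Delta>"
      using k unfolding N\<Delta> by (simp_all add: algebra_simps)
    then have "of_int k * real N < q - real i" "q - real i < of_int k * real N + 1" using \<Delta> by auto
    then have "\<lfloor>q\<rfloor> = int i + k * int N" by (simp add: floor_eq_iff)
    then show ?thesis ..
  qed
  obtain k l where "\<lfloor>q\<rfloor> = int i + k * int N" "\<lfloor>q\<rfloor> = int j + l * int N" using fl assms by metis
  then have "(int i + k * int N) mod int N = (int j + l * int N) mod int N" by simp
  then show ?thesis using assms by simp
qed

lemma quad_in: "0 < s0 \<Longrightarrow> s1 < 1 \<Longrightarrow> quad s0 s1 i \<subseteq> C - cball p r"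
  unfolding quad_def using X_in by force

lemma quad_minus_sector:
  assumes "0 < s0"
  shows "negligible (quad s0 s1 i - sector i)"
proof -
  let ?a = "dir (ang i + pi / 2)" and ?b = "dir (ang (Suc i) - pi / 2)"
  have "quad s0 s1 i - sector i \<subseteq> {x. ?a \<bullet> x = ?a \<bullet> p} \<union> {x. ?b \<bullet> x = ?b \<bullet> p}"
  proof
    fix x assume x: "x \<in> quad s0 s1 i - sector i"
    then obtain s \<tau> where st: "s \<in> {s0..s1}" "\<tau> \<in> {0..1}" and xX: "x = X s i \<tau>" unfolding quad_def by auto
    have s: "0 \<le> s" using st assms by simp
    have a: "(x - p) \<bullet> ?a = \<tau> * rad s (Suc i) * sin \<Delta>"
      unfolding xX X_rad ang_Suc by (simp add: inner_add_left inner_dir cos_diff)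
    have b: "(x - p) \<bullet> ?b = (1 - \<tau>) * rad s i * sin \<Delta>"
      unfolding xX X_rad ang_Suc by (simp add: inner_add_left inner_dir cos_diff sin_add cos_add)
    have "\<tau> = 0 \<or> \<tau> = 1"
    proof (rule ccontr)
      assume "\<not> ?thesis"
      then have "0 < (x - p) \<bullet> ?a" "0 < (x - p) \<bullet> ?b" unfolding a b using st rad_pos[OF s] trig by auto
      then show False using x unfolding sector_def by simp
    qed
    then have "(x - p) \<bullet> ?a = 0 \<or> (x - p) \<bullet> ?b = 0" unfolding a b by auto
    then show "x \<in> {x. ?a \<bullet> x = ?a \<bullet> p} \<union> {x. ?b \<bullet> x = ?b \<bullet> p}"
      by (auto simp: inner_diff_left inner_commute)
  qed
  moreover have "negligible {x. ?a \<bullet> x = ?a \<bullet> p}" "negligible {x. ?b \<bullet> x = ?b \<bullet> p}"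
  proof -
    have "?a \<noteq> 0" "?b \<noteq> 0" using norm_dir norm_zero zero_neq_one by metis+
    then show "negligible {x. ?a \<bullet> x = ?a \<bullet> p}" "negligible {x. ?b \<bullet> x = ?b \<bullet> p}" by (simp_all add: negligible_hyperplane)
  qed
  ultimately show ?thesis using negligible_subset negligible_Un by blast
qed

lemma quad_integral:
  fixes f :: "real^2 \<Rightarrow> real"
  assumes s0: "0 < s0" and f: "continuous_on (quad s0 s1 i) f"
  shows "compact (quad s0 s1 i)" "integral (quad s0 s1 i) f = integral {s0..s1} (\<lambda>s. integral {0..1} (\<lambda>\<tau>. J s i \<tau> * f (X s i \<tau>)))"
    "continuous_on {s0..s1} (\<lambda>s. integral {0..1} (\<lambda>\<tau>. J s i \<tau> * f (X s i \<tau>)))"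
proof -
  have d: "dir (ang i) $ 1 * dir (ang (Suc i)) $ 2 - dir (ang i) $ 2 * dir (ang (Suc i)) $ 1 = sin \<Delta>"
  proof -
    have "sin \<Delta> = sin (ang (Suc i) - ang i)" unfolding ang_Suc by simp
    then show ?thesis unfolding sin_diff by (simp add: mult.commute)
  qed
  have pos: "0 < r' + s * a i" "0 < r' + s * a (Suc i)" if "s \<in> {s0..s1}" for s
    using rad_pos[of s] that s0 unfolding rad_def by auto
  note q = integral_quadrilateral[OF d trig(1) a_bounds(2) a_bounds(2) pos, of s0 s1 "\<lambda>s. X s i" p "quad s0 s1 i" f "\<lambda>s. J s i"]
  show "compact (quad s0 s1 i)" "integral (quad s0 s1 i) f = integral {s0..s1} (\<lambda>s. integral {0..1} (\<lambda>\<tau>. J s i \<tau> * f (X s i \<tau>)))"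
    "continuous_on {s0..s1} (\<lambda>s. integral {0..1} (\<lambda>\<tau>. J s i \<tau> * f (X s i \<tau>)))"
    using q[OF _ _ X_def quad_def f J_def] by auto
qed

lemma compact_quad: "0 < s0 \<Longrightarrow> compact (quad s0 s1 i)"
  by (rule quad_integral(1)[OF _ continuous_on_const])

text \<open>\<open>loop_estimate\<close> is integrated over s by the change of variables on each
  quadrilateral. On the left, subadditivity passes from K to the quadrilaterals; on the right,
  passing back to K requires that overlaps are null, which is what the sectors provide.\<close>

lemma area_estimate:
  assumes s: "0 < s0" "s1 < 1"
    and \<Psi>: "\<And>x. x \<in> C - cball p r \<Longrightarrow> (\<Psi> has_derivative (\<lambda>h. A x \<bullet> h - \<alpha> * angle_form p x h)) (at x)"
    and A: "continuous_on (C - cball p r) A" and \<gamma>: "\<gamma> \<le> infdist \<alpha> \<int>" "0 \<le> \<gamma>"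
    and K: "K = (\<Union>i<N. quad s0 s1 i)"
    and dv: "\<And>x. x \<in> K \<Longrightarrow> (v has_derivative (\<lambda>h. \<Sum>k\<in>UNIV. (h $ k) *\<^sub>R (w x $ k))) (at x)"
    and cv: "continuous_on UNIV v" and cw: "continuous_on UNIV w"
    and \<mu>: "0 \<le> \<mu>" "\<mu> * (L\<^sup>2 * B\<^sup>2) \<le> (2 * pi * \<gamma>)\<^sup>2 * m\<^sup>2 \<or> \<mu> * ((m + B)\<^sup>2 * L\<^sup>2) \<le> (4 * \<gamma>)\<^sup>2 * (4 * m * B)"
  shows "ennreal \<mu> * (\<integral>\<^sup>+x\<in>K. ennreal ((norm (v x))\<^sup>2) \<partial>lborel) \<le> (\<integral>\<^sup>+x\<in>K. ennreal ((norm (magnetic_gradient A v w x))\<^sup>2) \<partial>lborel)"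
proof -
  let ?f = "\<lambda>x. (norm (v x))\<^sup>2" and ?g = "\<lambda>x. (norm (magnetic_gradient A v w x))\<^sup>2"
  have cf: "continuous_on S ?f" for S by (intro continuous_intros continuous_on_subset[OF cv subset_UNIV])
  have cg: "continuous_on (C - cball p r) ?g"
    unfolding magnetic_gradient_def
    by (intro continuous_intros A continuous_on_subset[OF cv subset_UNIV] continuous_on_subset[OF cw subset_UNIV])
  have cgq: "continuous_on (quad s0 s1 i) ?g" for i by (rule continuous_on_subset[OF cg quad_in[OF s]])
  have KC: "K \<subseteq> C - cball p r" unfolding K using quad_in[OF s] by blast
  have cK: "compact K" unfolding K by (intro compact_UN compact_quad s) auto
  have nn: "0 \<le> integral S f" if "\<And>x. 0 \<le> f x" for S and f :: "real^2 \<Rightarrow> real"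
    by (cases "f integrable_on S") (auto intro!: integral_nonneg that simp: not_integrable_integral)
  have 1: "\<mu> * (\<Sum>i<N. integral (quad s0 s1 i) ?f) \<le> (\<Sum>i<N. integral (quad s0 s1 i) ?g)"
  proof -
    have i: "(\<lambda>s. integral {0..1} (\<lambda>\<tau>. J s i \<tau> * ?f (X s i \<tau>))) integrable_on {s0..s1}" "(\<lambda>s. integral {0..1} (\<lambda>\<tau>. J s i \<tau> * ?g (X s i \<tau>))) integrable_on {s0..s1}" for i
      by (intro integrable_continuous_real quad_integral(3) s cf, intro integrable_continuous_real quad_integral(3) s cgq)
    have "\<mu> * (\<Sum>i<N. integral (quad s0 s1 i) ?f) = integral {s0..s1} (\<lambda>s. \<mu> * (\<Sum>i<N. integral {0..1} (\<lambda>\<tau>. J s i \<tau> * ?f (X s i \<tau>))))"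
      using i by (simp add: quad_integral(2)[OF s(1) cf] integral_sum)
    also have "\<dots> \<le> integral {s0..s1} (\<lambda>s. \<Sum>i<N. integral {0..1} (\<lambda>\<tau>. J s i \<tau> * ?g (X s i \<tau>)))"
    proof (rule integral_le)
      show "(\<lambda>s. \<mu> * (\<Sum>i<N. integral {0..1} (\<lambda>\<tau>. J s i \<tau> * ?f (X s i \<tau>)))) integrable_on {s0..s1}"
        by (intro integrable_on_mult_right integrable_sum i) auto
      show "(\<lambda>s. \<Sum>i<N. integral {0..1} (\<lambda>\<tau>. J s i \<tau> * ?g (X s i \<tau>))) integrable_on {s0..s1}"
        by (intro integrable_sum i) auto
      fix s assume ss: "s \<in> {s0..s1}"
      show "\<mu> * (\<Sum>i<N. integral {0..1} (\<lambda>\<tau>. J s i \<tau> * ?f (X s i \<tau>))) \<le> (\<Sum>i<N. integral {0..1} (\<lambda>\<tau>. J s i \<tau> * ?g (X s i \<tau>)))"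
      proof (rule loop_estimate[OF _ _ \<Psi> A \<gamma> _ cv cw \<mu>])
        show "0 < s" "s < 1" using ss s by auto
        fix i \<tau> assume "i < N" "\<tau> \<in> {0..1::real}"
        then have "X s i \<tau> \<in> quad s0 s1 i" unfolding quad_def using ss by (force intro: image_eqI[of _ _ "(s, \<tau>)"])
        then have "X s i \<tau> \<in> K" unfolding K using \<open>i < N\<close> by blast
        then show "(v has_derivative (\<lambda>h. \<Sum>k\<in>UNIV. (h $ k) *\<^sub>R (w (X s i \<tau>) $ k))) (at (X s i \<tau>))" by (rule dv)
      qed
    qed
    also have "\<dots> = (\<Sum>i<N. integral (quad s0 s1 i) ?g)"
      using i by (simp add: quad_integral(2)[OF s(1) cgq] integral_sum)
    finally show ?thesis .
  qed
  have bq: "quad s0 s1 i \<in> sets borel" for i using compact_quad[OF s(1)] by (simp add: borel_compact)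
  have "(\<integral>\<^sup>+x\<in>K. ennreal (?f x) \<partial>lborel) \<le> (\<integral>\<^sup>+x. (\<Sum>i<N. ennreal (?f x) * indicator (quad s0 s1 i) x) \<partial>lborel)"
  proof (rule nn_integral_mono)
    fix x
    show "ennreal (?f x) * indicator K x \<le> (\<Sum>i<N. ennreal (?f x) * indicator (quad s0 s1 i) x)"
    proof (cases "x \<in> K")
      case True
      then obtain j where j: "j < N" "x \<in> quad s0 s1 j" unfolding K by blast
      have "ennreal (?f x) * indicator K x = ennreal (?f x) * indicator (quad s0 s1 j) x" using True j by simp
      also have "\<dots> \<le> (\<Sum>i<N. ennreal (?f x) * indicator (quad s0 s1 i) x)"
        by (rule member_le_sum) (use j in auto)
      finally show ?thesis .
    qed simp
  qed
  also have "\<dots> = (\<Sum>i<N. \<integral>\<^sup>+x\<in>quad s0 s1 i. ennreal (?f x) \<partial>lborel)"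
    by (rule nn_integral_sum) (use bq borel_measurable_continuous_onI[OF cf] in auto)
  also have "\<dots> = ennreal (\<Sum>i<N. integral (quad s0 s1 i) ?f)"
    using nn by (simp add: set_nn_integral_compact[OF compact_quad[OF s(1)] cf])
  finally have "ennreal \<mu> * (\<integral>\<^sup>+x\<in>K. ennreal (?f x) \<partial>lborel) \<le> ennreal \<mu> * ennreal (\<Sum>i<N. integral (quad s0 s1 i) ?f)"
    by (rule mult_left_mono) simp
  also have "\<dots> \<le> ennreal (\<Sum>i<N. integral (quad s0 s1 i) ?g)" 
    using 1 \<mu>(1) by (simp add: ennreal_leI flip: ennreal_mult')
  also have "\<dots> \<le> (\<Sum>i<N. ennreal (integral (quad s0 s1 i) ?g))"
    by (rule order_eq_refl) (rule sum_ennreal[symmetric], rule nn, simp)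
  also have "\<dots> = (\<Sum>i<N. \<integral>\<^sup>+x\<in>quad s0 s1 i. ennreal (?g x) \<partial>lborel)"
    by (subst set_nn_integral_compact[OF compact_quad[OF s(1)] cgq]) auto
  also have "\<dots> \<le> (\<integral>\<^sup>+x\<in>K. ennreal (?g x) \<partial>lborel)"
  proof (rule sum_nn_integral_almost_disjoint_le)
    show "quad s0 s1 i \<subseteq> K" if "i \<in> {..<N}" for i using that unfolding K by blast
    show "sector i \<in> sets borel" for i
      unfolding sector_def by (intro borel_open open_Collect_conj open_Collect_less continuous_intros)
    show "(\<lambda>x. ennreal (?g x) * indicator K x) \<in> borel_measurable borel"
    proof -
      have "(\<lambda>x. indicator K x *\<^sub>R ?g x) \<in> borel_measurable borel"
        by (rule borel_measurable_continuous_on_indicator[OF _ continuous_on_subset[OF cg KC]]) (use cK in \<open>simp add: borel_compact\<close>)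
      then have "(\<lambda>x. ennreal (indicator K x *\<^sub>R ?g x)) \<in> borel_measurable borel" by simp
      then show ?thesis by (rule subst[of _ _ "\<lambda>f. f \<in> borel_measurable borel", rotated]) (auto split: split_indicator)
    qed
  qed (use bq sectors_disjoint quad_minus_sector[OF s(1)] in auto)
  finally show ?thesis .
qed

end

subsection \<open>From smooth to Sobolev functions\<close>

text \<open>Young's inequality with a parameter, so that the factor of the main term can be brought
  close to 1.\<close>

lemma nn_integral_norm_add_weighted:
  fixes f g :: "'a \<Rightarrow> 'b::{real_normed_vector, second_countable_topology}"
  assumes [measurable]: "f \<in> borel_measurable M" "g \<in> borel_measurable M" and \<eta>: "0 < \<eta>"
  shows "(\<integral>\<^sup>+x. ennreal ((norm (f x + g x))\<^sup>2) \<partial>M) \<le>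
    ennreal (1 + \<eta>) * (\<integral>\<^sup>+x. ennreal ((norm (f x))\<^sup>2) \<partial>M) + ennreal (1 + 1 / \<eta>) * (\<integral>\<^sup>+x. ennreal ((norm (g x))\<^sup>2) \<partial>M)"
proof -
  have "ennreal ((norm (f x + g x))\<^sup>2) \<le> ennreal (1 + \<eta>) * ennreal ((norm (f x))\<^sup>2) + ennreal (1 + 1 / \<eta>) * ennreal ((norm (g x))\<^sup>2)" for x
  proof -
    let ?a = "norm (f x)" and ?b = "norm (g x)"
    have "(norm (f x + g x))\<^sup>2 \<le> (?a + ?b)\<^sup>2" by (intro power_mono norm_triangle_ineq) auto
    also have "\<dots> \<le> (1 + \<eta>) * ?a\<^sup>2 + (1 + 1 / \<eta>) * ?b\<^sup>2"
    proof -
      have "0 \<le> (\<eta> * ?a - ?b)\<^sup>2 / \<eta>" using \<eta> by simp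
      also have "\<dots> = \<eta> * ?a\<^sup>2 - 2 * ?a * ?b + ?b\<^sup>2 / \<eta>" using \<eta> by (simp add: power2_eq_square field_simps)
      finally show ?thesis by (simp add: power2_sum algebra_simps)
    qed
    finally have "ennreal ((norm (f x + g x))\<^sup>2) \<le> ennreal ((1 + \<eta>) * ?a\<^sup>2 + (1 + 1 / \<eta>) * ?b\<^sup>2)" by (rule ennreal_leI)
    then show ?thesis using \<eta> by (simp add: ennreal_plus ennreal_mult)
  qed
  then have "(\<integral>\<^sup>+x. ennreal ((norm (f x + g x))\<^sup>2) \<partial>M) \<le> (\<integral>\<^sup>+x. ennreal (1 + \<eta>) * ennreal ((norm (f x))\<^sup>2) + ennreal (1 + 1 / \<eta>) * ennreal ((norm (g x))\<^sup>2) \<partial>M)"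
    by (intro nn_integral_mono) auto
  also have "\<dots> = ennreal (1 + \<eta>) * (\<integral>\<^sup>+x. ennreal ((norm (f x))\<^sup>2) \<partial>M) + ennreal (1 + 1 / \<eta>) * (\<integral>\<^sup>+x. ennreal ((norm (g x))\<^sup>2) \<partial>M)"
    by (subst nn_integral_add) (auto simp: nn_integral_cmult)
  finally show ?thesis .
qed

lemma magnetic_gradient_add:
  "magnetic_gradient A (\<lambda>x. u x + v x) (\<lambda>x. g x + w x) x = magnetic_gradient A u g x + magnetic_gradient A v w x"
  by (simp add: magnetic_gradient_def vec_eq_iff algebra_simps)

lemma norm_magnetic_gradient_le:
  "norm (magnetic_gradient A u g x) \<le> norm (g x) + norm (A x) * norm (u x)"
proof -
  have "magnetic_gradient A u g x = g x + (\<chi> i. - \<i> * of_real (A x $ i) * u x)"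
    by (simp add: magnetic_gradient_def vec_eq_iff)
  moreover have "norm (\<chi> i. - \<i> * of_real (A x $ i) * u x) = norm (A x) * norm (u x)"
  proof -
    have "(\<lambda>i. norm ((\<chi> i. - \<i> * of_real (A x $ i) * u x) $ i)) = (\<lambda>i. norm (u x) * norm (A x $ i))"
      by (simp add: fun_eq_iff norm_mult)
    then show ?thesis unfolding norm_vec_def by (simp add: L2_set_right_distrib mult.commute)
  qed
  ultimately show ?thesis using norm_triangle_ineq[of "g x" "\<chi> i. - \<i> * of_real (A x $ i) * u x"] by simp
qed

lemma measurable_magnetic_gradient:
  assumes [measurable]: "A \<in> borel_measurable M" "u \<in> borel_measurable M" "g \<in> borel_measurable M"
  shows "magnetic_gradient A u g \<in> borel_measurable M"
proof -
  have c: "continuous_on UNIV (\<lambda>z :: ((real^2) \<times> complex) \<times> (complex^2). \<chi> i. snd z $ i - \<i> * of_real (fst (fst z) $ i) * snd (fst z))"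
    by (intro continuous_intros)
  have "(\<lambda>x. (A x, u x)) \<in> borel_measurable M" by (rule borel_measurable_Pair) measurable
  from borel_measurable_continuous_Pair[OF this assms(3), of "\<lambda>y z. \<chi> i. z $ i - \<i> * of_real (fst y $ i) * snd y"] c
  show ?thesis unfolding magnetic_gradient_def by simp
qed

text \<open>As A is bounded, both sides depend continuously on function and gradient in L2. The
  errors are split off with the parameter \<eta>; \<delta> tends to zero first, since it comes with
  a factor 1 / \<eta>, and \<eta> afterwards.\<close>

lemma magnetic_inequality_closure:
  fixes u :: "real^2 \<Rightarrow> complex" and g :: "real^2 \<Rightarrow> complex^2"
  assumes [measurable]: "A \<in> borel_measurable borel" "u \<in> borel_measurable borel" "g \<in> borel_measurable borel"
    and bound: "\<And>x. norm (A x) \<le> K" and fin: "(\<integral>\<^sup>+x. ennreal ((norm (u x))\<^sup>2) \<partial>lborel) < \<infinity>"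
    and approx: "\<And>\<delta>. 0 < \<delta> \<Longrightarrow> \<exists>v w. v \<in> borel_measurable borel \<and> w \<in> borel_measurable borel \<and>
      (\<integral>\<^sup>+x. ennreal ((norm (v x - u x))\<^sup>2) \<partial>lborel) < ennreal \<delta> \<and> (\<integral>\<^sup>+x. ennreal ((norm (w x - g x))\<^sup>2) \<partial>lborel) < ennreal \<delta> \<and>
      ennreal \<mu> * (\<integral>\<^sup>+x. ennreal ((norm (v x))\<^sup>2) \<partial>lborel) \<le> (\<integral>\<^sup>+x. ennreal ((norm (magnetic_gradient A v w x))\<^sup>2) \<partial>lborel)"
    and \<mu>: "0 \<le> \<mu>"
  shows "ennreal \<mu> * (\<integral>\<^sup>+x. ennreal ((norm (u x))\<^sup>2) \<partial>lborel) \<le> (\<integral>\<^sup>+x. ennreal ((norm (magnetic_gradient A u g x))\<^sup>2) \<partial>lborel)"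
proof (cases "(\<integral>\<^sup>+x. ennreal ((norm (magnetic_gradient A u g x))\<^sup>2) \<partial>lborel)" rule: ennreal_cases)
  case (real E)
  obtain a where a: "0 \<le> a" "(\<integral>\<^sup>+x. ennreal ((norm (u x))\<^sup>2) \<partial>lborel) = ennreal a"
    using fin by (cases "(\<integral>\<^sup>+x. ennreal ((norm (u x))\<^sup>2) \<partial>lborel)" rule: ennreal_cases) auto
  have K: "0 \<le> K" using bound[of 0] norm_ge_zero order_trans by blast
  have step: "\<mu> * a \<le> (1 + \<eta>) * ((1 + \<eta>) * E + (1 + 1 / \<eta>) * (2 * \<delta> + 2 * K\<^sup>2 * \<delta>)) + \<mu> * (1 + 1 / \<eta>) * \<delta>"
    if \<eta>: "0 < \<eta>" and \<delta>: "0 < \<delta>" for \<eta> \<delta>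
  proof -
    obtain v w where [measurable]: "v \<in> borel_measurable borel" "w \<in> borel_measurable borel"
      and v: "(\<integral>\<^sup>+x. ennreal ((norm (v x - u x))\<^sup>2) \<partial>lborel) < ennreal \<delta>" and w: "(\<integral>\<^sup>+x. ennreal ((norm (w x - g x))\<^sup>2) \<partial>lborel) < ennreal \<delta>"
      and vw: "ennreal \<mu> * (\<integral>\<^sup>+x. ennreal ((norm (v x))\<^sup>2) \<partial>lborel) \<le> (\<integral>\<^sup>+x. ennreal ((norm (magnetic_gradient A v w x))\<^sup>2) \<partial>lborel)"
      using approx[OF \<delta>] by blast
    let ?d = "\<lambda>x. magnetic_gradient A (\<lambda>x. v x - u x) (\<lambda>x. w x - g x) x"
    have [measurable]: "magnetic_gradient A u g \<in> borel_measurable borel" "?d \<in> borel_measurable borel"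
      by (rule measurable_magnetic_gradient; measurable)+
    have d: "(\<integral>\<^sup>+x. ennreal ((norm (?d x))\<^sup>2) \<partial>lborel) \<le> ennreal (2 * \<delta> + 2 * K\<^sup>2 * \<delta>)"
    proof -
      have "ennreal ((norm (?d x))\<^sup>2) \<le> 2 * ennreal ((norm (w x - g x))\<^sup>2) + ennreal (2 * K\<^sup>2) * ennreal ((norm (v x - u x))\<^sup>2)" for x
      proof -
        let ?a = "norm (w x - g x)" and ?b = "norm (v x - u x)"
        have "norm (?d x) \<le> ?a + norm (A x) * ?b" by (rule norm_magnetic_gradient_le)
        also have "\<dots> \<le> ?a + K * ?b" using bound by (intro add_mono mult_right_mono) auto
        finally have "(norm (?d x))\<^sup>2 \<le> (?a + K * ?b)\<^sup>2" by (intro power_mono) auto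
        also have "\<dots> \<le> 2 * ?a\<^sup>2 + 2 * K\<^sup>2 * ?b\<^sup>2"
          using sum_squares_bound[of ?a "K * ?b"] by (simp add: power2_sum power_mult_distrib)
        finally have "ennreal ((norm (?d x))\<^sup>2) \<le> ennreal (2 * ?a\<^sup>2 + 2 * K\<^sup>2 * ?b\<^sup>2)" by (rule ennreal_leI)
        then show ?thesis by (simp add: ennreal_plus ennreal_mult)
      qed
      then have "(\<integral>\<^sup>+x. ennreal ((norm (?d x))\<^sup>2) \<partial>lborel) \<le> (\<integral>\<^sup>+x. 2 * ennreal ((norm (w x - g x))\<^sup>2) + ennreal (2 * K\<^sup>2) * ennreal ((norm (v x - u x))\<^sup>2) \<partial>lborel)"
        by (rule nn_integral_mono)
      also have "\<dots> = 2 * (\<integral>\<^sup>+x. ennreal ((norm (w x - g x))\<^sup>2) \<partial>lborel) + ennreal (2 * K\<^sup>2) * (\<integral>\<^sup>+x. ennreal ((norm (v x - u x))\<^sup>2) \<partial>lborel)"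
        by (subst nn_integral_add) (auto simp: nn_integral_cmult)
      also have "\<dots> \<le> 2 * ennreal \<delta> + ennreal (2 * K\<^sup>2) * ennreal \<delta>"
        using v w by (intro add_mono mult_left_mono) auto
      also have "\<dots> = ennreal (2 * \<delta> + 2 * K\<^sup>2 * \<delta>)" using \<delta> by (simp add: ennreal_plus ennreal_mult)
      finally show ?thesis .
    qed
    have 1: "(\<integral>\<^sup>+x. ennreal ((norm (magnetic_gradient A v w x))\<^sup>2) \<partial>lborel) \<le> ennreal ((1 + \<eta>) * E + (1 + 1 / \<eta>) * (2 * \<delta> + 2 * K\<^sup>2 * \<delta>))"
    proof -
      have eq: "magnetic_gradient A v w x = magnetic_gradient A u g x + ?d x" for x
        using magnetic_gradient_add[of A u "\<lambda>x. v x - u x" g "\<lambda>x. w x - g x" x] by simp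
      have "(\<integral>\<^sup>+x. ennreal ((norm (magnetic_gradient A v w x))\<^sup>2) \<partial>lborel) \<le> ennreal (1 + \<eta>) * ennreal E + ennreal (1 + 1 / \<eta>) * (\<integral>\<^sup>+x. ennreal ((norm (?d x))\<^sup>2) \<partial>lborel)"
        unfolding eq real(2)[symmetric] by (rule nn_integral_norm_add_weighted) (use \<eta> in auto)
      also have "\<dots> \<le> ennreal (1 + \<eta>) * ennreal E + ennreal (1 + 1 / \<eta>) * ennreal (2 * \<delta> + 2 * K\<^sup>2 * \<delta>)"
        by (intro add_mono mult_left_mono d) auto
      also have "\<dots> = ennreal ((1 + \<eta>) * E + (1 + 1 / \<eta>) * (2 * \<delta> + 2 * K\<^sup>2 * \<delta>))"
        using \<eta> \<delta> real(1) by (simp add: ennreal_plus ennreal_mult)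
      finally show ?thesis .
    qed
    have "ennreal a \<le> ennreal (1 + \<eta>) * (\<integral>\<^sup>+x. ennreal ((norm (v x))\<^sup>2) \<partial>lborel) + ennreal (1 + 1 / \<eta>) * (\<integral>\<^sup>+x. ennreal ((norm (u x - v x))\<^sup>2) \<partial>lborel)"
      using nn_integral_norm_add_weighted[of v lborel "\<lambda>x. u x - v x" \<eta>] \<eta> unfolding a(2)[symmetric] by simp
    also have "\<dots> \<le> ennreal (1 + \<eta>) * (\<integral>\<^sup>+x. ennreal ((norm (v x))\<^sup>2) \<partial>lborel) + ennreal (1 + 1 / \<eta>) * ennreal \<delta>"
      using v by (intro add_mono mult_left_mono) (auto simp: norm_minus_commute)
    finally have "ennreal \<mu> * ennreal a \<le> ennreal \<mu> * (ennreal (1 + \<eta>) * (\<integral>\<^sup>+x. ennreal ((norm (v x))\<^sup>2) \<partial>lborel) + ennreal (1 + 1 / \<eta>) * ennreal \<delta>)"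
      by (rule mult_left_mono) simp
    also have "\<dots> = ennreal (1 + \<eta>) * (ennreal \<mu> * (\<integral>\<^sup>+x. ennreal ((norm (v x))\<^sup>2) \<partial>lborel)) + ennreal \<mu> * (ennreal (1 + 1 / \<eta>) * ennreal \<delta>)"
      by (simp add: distrib_left mult_ac)
    also have "\<dots> \<le> ennreal (1 + \<eta>) * ennreal ((1 + \<eta>) * E + (1 + 1 / \<eta>) * (2 * \<delta> + 2 * K\<^sup>2 * \<delta>)) + ennreal \<mu> * (ennreal (1 + 1 / \<eta>) * ennreal \<delta>)"
      by (intro add_mono mult_left_mono order_trans[OF vw 1]) auto
    also have "\<dots> = ennreal ((1 + \<eta>) * ((1 + \<eta>) * E + (1 + 1 / \<eta>) * (2 * \<delta> + 2 * K\<^sup>2 * \<delta>)) + \<mu> * (1 + 1 / \<eta>) * \<delta>)"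
      using \<eta> \<delta> real(1) \<mu> by (simp add: mult.assoc flip: ennreal_plus ennreal_mult')
    finally have "ennreal (\<mu> * a) \<le> ennreal ((1 + \<eta>) * ((1 + \<eta>) * E + (1 + 1 / \<eta>) * (2 * \<delta> + 2 * K\<^sup>2 * \<delta>)) + \<mu> * (1 + 1 / \<eta>) * \<delta>)"
      using \<mu> by (simp add: ennreal_mult')
    then show ?thesis by (rule ennreal_le_iff[THEN iffD1, rotated]) (use \<eta> \<delta> real(1) \<mu> in auto)
  qed
  have step2: "\<mu> * a \<le> (1 + \<eta>) * ((1 + \<eta>) * E)" if \<eta>: "0 < \<eta>" for \<eta>
  proof -
    have "((\<lambda>\<delta>. (1 + \<eta>) * ((1 + \<eta>) * E + (1 + 1 / \<eta>) * (2 * \<delta> + 2 * K\<^sup>2 * \<delta>)) + \<mu> * (1 + 1 / \<eta>) * \<delta>) \<longlongrightarrow>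
       (1 + \<eta>) * ((1 + \<eta>) * E + (1 + 1 / \<eta>) * (2 * 0 + 2 * K\<^sup>2 * 0)) + \<mu> * (1 + 1 / \<eta>) * 0) (at_right 0)"
      by (intro tendsto_intros)
    then have "\<mu> * a \<le> (1 + \<eta>) * ((1 + \<eta>) * E + (1 + 1 / \<eta>) * (2 * 0 + 2 * K\<^sup>2 * 0)) + \<mu> * (1 + 1 / \<eta>) * 0"
      by (rule tendsto_lowerbound) (use step[OF \<eta>] in \<open>auto simp: eventually_at_right_field intro!: exI[of _ 1]\<close>)
    then show ?thesis by simp
  qed
  have "((\<lambda>\<eta>. (1 + \<eta>) * ((1 + \<eta>) * E)) \<longlongrightarrow> (1 + 0) * ((1 + 0) * E)) (at_right 0)" by (intro tendsto_intros)
  then have "\<mu> * a \<le> (1 + 0) * ((1 + 0) * E)"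
    by (rule tendsto_lowerbound) (use step2 in \<open>auto simp: eventually_at_right_field intro!: exI[of _ 1]\<close>)
  then have "ennreal (\<mu> * a) \<le> ennreal E" by (intro ennreal_leI) simp
  then show ?thesis unfolding a(2) real(2) using \<mu> by (simp add: ennreal_mult')
qed simp

context polygonal_foliation
begin

text \<open>Multiplying u, g and A by the indicator of K turns integrals over K into integrals over
  the plane with a bounded form, to which \<open>magnetic_inequality_closure\<close>
  applies.\<close>

lemma area_estimate_H1:
  assumes s: "0 < s0" "s1 < 1"
    and \<Psi>: "\<And>x. x \<in> C - cball p r \<Longrightarrow> (\<Psi> has_derivative (\<lambda>h. A x \<bullet> h - \<alpha> * angle_form p x h)) (at x)"
    and A: "continuous_on (C - cball p r) A" and \<gamma>: "\<gamma> \<le> infdist \<alpha> \<int>" "0 \<le> \<gamma>"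
    and K: "K = (\<Union>i<N. quad s0 s1 i)"
    and \<Omega>: "open \<Omega>" "bounded \<Omega>" "C - cball p r \<subseteq> \<Omega>" and H: "H1_with_gradient \<Omega> u g"
    and \<mu>: "0 \<le> \<mu>" "\<mu> * (L\<^sup>2 * B\<^sup>2) \<le> (2 * pi * \<gamma>)\<^sup>2 * m\<^sup>2 \<or> \<mu> * ((m + B)\<^sup>2 * L\<^sup>2) \<le> (4 * \<gamma>)\<^sup>2 * (4 * m * B)"
  shows "ennreal \<mu> * (\<integral>\<^sup>+x\<in>K. ennreal ((norm (u x))\<^sup>2) \<partial>lborel) \<le> (\<integral>\<^sup>+x\<in>K. ennreal ((norm (magnetic_gradient A u g x))\<^sup>2) \<partial>lborel)"
proof -
  have KC: "K \<subseteq> C - cball p r" unfolding K using quad_in[OF s] by blast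
  have cK: "compact K" unfolding K by (intro compact_UN compact_quad s) auto
  have bK[measurable]: "K \<in> sets borel" using cK by (simp add: borel_compact)
  have K\<Omega>: "K \<subseteq> \<Omega>" using KC \<Omega> by blast
  have sq: "(\<integral>\<^sup>+x\<in>K. ennreal ((norm (f x))\<^sup>2) \<partial>lborel) = (\<integral>\<^sup>+x. ennreal ((norm (indicator K x *\<^sub>R f x))\<^sup>2) \<partial>lborel)" for f :: "real^2 \<Rightarrow> 'x::real_normed_vector"
    by (rule nn_integral_cong) (auto split: split_indicator)
  let ?i = "\<lambda>x. indicator K x :: real"
  have mg: "indicator K x *\<^sub>R magnetic_gradient A f h x = magnetic_gradient (\<lambda>x. ?i x *\<^sub>R A x) (\<lambda>x. ?i x *\<^sub>R f x) (\<lambda>x. ?i x *\<^sub>R h x) x" for f h x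
    by (simp add: magnetic_gradient_def vec_eq_iff split: split_indicator)
  have cAK: "continuous_on K A" by (rule continuous_on_subset[OF A KC])
  obtain M where M: "\<And>x. x \<in> K \<Longrightarrow> norm (A x) \<le> M" "0 \<le> M"
  proof -
    have "bounded (A ` K)" by (rule compact_imp_bounded[OF compact_continuous_image[OF cAK cK]])
    then obtain M where "\<forall>y\<in>A ` K. norm y \<le> M" unfolding bounded_iff by blast
    then show ?thesis using that[of "max M 0"] by fastforce
  qed
  have meas: "(\<lambda>x. ?i x *\<^sub>R f x) \<in> borel_measurable borel" if "set_borel_measurable lborel \<Omega> f" for f :: "real^2 \<Rightarrow> 'y::euclidean_space"
  proof -
    have "(\<lambda>x. ?i x *\<^sub>R (indicator \<Omega> x *\<^sub>R f x)) \<in> borel_measurable borel"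
      using that unfolding set_borel_measurable_def by measurable
    moreover have "(\<lambda>x. ?i x *\<^sub>R (indicator \<Omega> x *\<^sub>R f x)) = (\<lambda>x. ?i x *\<^sub>R f x)" by (intro ext) (use K\<Omega> in \<open>auto split: split_indicator\<close>)
    ultimately show ?thesis by simp
  qed
  have L2: "set_borel_measurable lborel \<Omega> u" "set_borel_measurable lborel \<Omega> g" "(\<integral>\<^sup>+x\<in>\<Omega>. ennreal ((norm (u x))\<^sup>2) \<partial>lborel) < \<infinity>"
    using H unfolding H1_with_gradient_def L2_on_def by auto
  show ?thesis
    unfolding sq mg
  proof (rule magnetic_inequality_closure[OF _ meas[OF L2(1)] meas[OF L2(2)] _ _ _ \<mu>(1)])
    show "(\<lambda>x. ?i x *\<^sub>R A x) \<in> borel_measurable borel"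
      by (rule borel_measurable_continuous_on_indicator[OF bK cAK])
    show "norm (?i x *\<^sub>R A x) \<le> M" for x using M by (auto split: split_indicator)
    show "(\<integral>\<^sup>+x. ennreal ((norm (?i x *\<^sub>R u x))\<^sup>2) \<partial>lborel) < \<infinity>"
    proof -
      have "(\<integral>\<^sup>+x. ennreal ((norm (?i x *\<^sub>R u x))\<^sup>2) \<partial>lborel) \<le> (\<integral>\<^sup>+x\<in>\<Omega>. ennreal ((norm (u x))\<^sup>2) \<partial>lborel)"
        by (rule nn_integral_mono) (use K\<Omega> in \<open>auto split: split_indicator\<close>)
      then show ?thesis using L2(3) by (rule le_less_trans)
    qed
    fix \<delta> :: real assume \<delta>: "0 < \<delta>"
    obtain v w where v: "\<forall>x\<in>K. (v has_derivative (\<lambda>h. \<Sum>i\<in>UNIV. (h $ i) *\<^sub>R (w x $ i))) (at x)" and cv: "continuous_on UNIV v" and cw: "continuous_on UNIV w"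
      and vu: "(\<integral>\<^sup>+x\<in>K. ennreal ((norm (v x - u x))\<^sup>2) \<partial>lborel) < ennreal \<delta>" and wg: "(\<integral>\<^sup>+x\<in>K. ennreal ((norm (w x - g x))\<^sup>2) \<partial>lborel) < ennreal \<delta>"
      using smooth_approximation[OF \<Omega>(1,2) H cK K\<Omega> \<delta>] by blast
    have e: "ennreal \<mu> * (\<integral>\<^sup>+x\<in>K. ennreal ((norm (v x))\<^sup>2) \<partial>lborel) \<le> (\<integral>\<^sup>+x\<in>K. ennreal ((norm (magnetic_gradient A v w x))\<^sup>2) \<partial>lborel)"
      by (rule area_estimate[OF s \<Psi> A \<gamma> K v[THEN bspec] cv cw \<mu>])
    have [measurable]: "v \<in> borel_measurable borel" "w \<in> borel_measurable borel"
      by (rule borel_measurable_continuous_onI[OF cv], rule borel_measurable_continuous_onI[OF cw])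
    show "\<exists>v w. v \<in> borel_measurable borel \<and> w \<in> borel_measurable borel \<and>
      (\<integral>\<^sup>+x. ennreal ((norm (v x - ?i x *\<^sub>R u x))\<^sup>2) \<partial>lborel) < ennreal \<delta> \<and> (\<integral>\<^sup>+x. ennreal ((norm (w x - ?i x *\<^sub>R g x))\<^sup>2) \<partial>lborel) < ennreal \<delta> \<and>
      ennreal \<mu> * (\<integral>\<^sup>+x. ennreal ((norm (v x))\<^sup>2) \<partial>lborel) \<le> (\<integral>\<^sup>+x. ennreal ((norm (magnetic_gradient (\<lambda>x. ?i x *\<^sub>R A x) v w x))\<^sup>2) \<partial>lborel)"
    proof (intro exI conjI)
      show "(\<lambda>x. ?i x *\<^sub>R v x) \<in> borel_measurable borel" "(\<lambda>x. ?i x *\<^sub>R w x) \<in> borel_measurable borel" by measurable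
      show "(\<integral>\<^sup>+x. ennreal ((norm (?i x *\<^sub>R v x - ?i x *\<^sub>R u x))\<^sup>2) \<partial>lborel) < ennreal \<delta>"
        using vu unfolding sq scaleR_diff_right .
      show "(\<integral>\<^sup>+x. ennreal ((norm (?i x *\<^sub>R w x - ?i x *\<^sub>R g x))\<^sup>2) \<partial>lborel) < ennreal \<delta>"
        using wg unfolding sq scaleR_diff_right .
      show "ennreal \<mu> * (\<integral>\<^sup>+x. ennreal ((norm (?i x *\<^sub>R v x))\<^sup>2) \<partial>lborel) \<le> (\<integral>\<^sup>+x. ennreal ((norm (magnetic_gradient (\<lambda>x. ?i x *\<^sub>R A x) (\<lambda>x. ?i x *\<^sub>R v x) (\<lambda>x. ?i x *\<^sub>R w x) x))\<^sup>2) \<partial>lborel)"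
        using e unfolding sq mg .
    qed
  qed
qed

end

subsection \<open>Exhaustion by the foliated regions\<close>

context polygonal_foliation
begin

text \<open>In coordinates y1, y2 along rays i and i + 1, the point lies on leaf s if h s = y1 / rad
  s i + y2 / rad s (i + 1) equals 1. At s0 the vertices are no farther out than t, so h is at least
  1; at s1 they are at distance at least t / cos (\<Delta> / 2), the cosine accounting for the sides
  being closer to p than their vertices, so h is at most 1. The intermediate value theorem gives
  s.\<close>

lemma quads_cover:
  assumes x: "x = p + t *\<^sub>R dir \<phi>" and t: "0 < t" and s: "0 < s0" "s0 \<le> s1" "s1 < 1"
    and inner: "r' + s0 * B \<le> t"
    and T: "\<And>\<theta>. \<bar>\<theta> - \<phi>\<bar> \<le> \<Delta> \<Longrightarrow> T \<le> radius C p (dir \<theta>)" and outer: "0 < T" "t \<le> s1 * T * cos (\<Delta> / 2)"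
  shows "x \<in> (\<Union>i<N. quad s0 s1 i)"
proof -
  \<comment> \<open>The sector containing the direction \<phi>; it is reduced modulo N because
    \<phi> is an arbitrary real number.\<close>
  define q where "q = \<lfloor>(\<phi> - \<theta>0) / \<Delta>\<rfloor>"
  define i where "i = nat (q mod int N)"
  have iN: "i < N" and iq: "int i = q mod int N" unfolding i_def using N by (auto simp: nat_less_iff)
  define b where "b = \<theta>0 + of_int q * \<Delta>"
  define \<psi> where "\<psi> = \<phi> - b"
  have "of_int q \<le> (\<phi> - \<theta>0) / \<Delta>" "(\<phi> - \<theta>0) / \<Delta> < of_int q + 1" unfolding q_def by linarith+
  then have \<psi>: "0 \<le> \<psi>" "\<psi> < \<Delta>" unfolding \<psi>_def b_def using \<Delta> by (auto simp: field_simps)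
  have di: "dir (ang i) = dir b" "dir (ang (Suc i)) = dir (b + \<Delta>)"
  proof -
    have "real_of_int q = real_of_int (q div int N * int N + int i)" unfolding iq by simp
    then have "b = \<theta>0 + real i * \<Delta> + 2 * pi * of_int (q div int N)"
      unfolding b_def \<Delta>_def using N by (simp add: field_simps)
    moreover have "ang i = \<theta>0 + real i * \<Delta>" unfolding ang_def \<Delta>_def by simp
    ultimately have b: "b = ang i + 2 * pi * of_int (q div int N)" by simp
    show "dir (ang i) = dir b" unfolding b dir_2pi_int ..
    have "b + \<Delta> = ang (Suc i) + 2 * pi * of_int (q div int N)" unfolding b ang_Suc by simp
    then show "dir (ang (Suc i)) = dir (b + \<Delta>)" by (simp only: dir_2pi_int)
  qed
  \<comment> \<open>Oblique coordinates of x by the law of sines.\<close>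
  define y1 where "y1 = t * sin (\<Delta> - \<psi>) / sin \<Delta>"
  define y2 where "y2 = t * sin \<psi> / sin \<Delta>"
  have y: "0 \<le> y1" "0 \<le> y2"
    unfolding y1_def y2_def using \<psi> \<Delta> t trig pi_gt_zero by (auto intro!: divide_nonneg_pos mult_nonneg_nonneg sin_ge_zero)
  have xy: "x = p + y1 *\<^sub>R dir (ang i) + y2 *\<^sub>R dir (ang (Suc i))"
  proof -
    have "sin \<Delta> * cos (b + \<psi>) = sin (\<Delta> - \<psi>) * cos b + sin \<psi> * cos (b + \<Delta>)"
      "sin \<Delta> * sin (b + \<psi>) = sin (\<Delta> - \<psi>) * sin b + sin \<psi> * sin (b + \<Delta>)"
      by (simp_all add: cos_add sin_add sin_diff algebra_simps)
    then have "sin \<Delta> *\<^sub>R dir (b + \<psi>) = sin (\<Delta> - \<psi>) *\<^sub>R dir b + sin \<psi> *\<^sub>R dir (b + \<Delta>)"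
      by (simp add: vec_eq_iff forall_2)
    then have "(t / sin \<Delta>) *\<^sub>R (sin \<Delta> *\<^sub>R dir (b + \<psi>)) = (t / sin \<Delta>) *\<^sub>R (sin (\<Delta> - \<psi>) *\<^sub>R dir b + sin \<psi> *\<^sub>R dir (b + \<Delta>))"
      by simp
    then have "t *\<^sub>R dir (b + \<psi>) = y1 *\<^sub>R dir b + y2 *\<^sub>R dir (b + \<Delta>)"
      unfolding y1_def y2_def using trig by (simp add: scaleR_add_right)
    then show ?thesis unfolding x di \<psi>_def by (simp add: add.assoc)
  qed
  have sum_ge: "t \<le> y1 + y2"
  proof -
    have "t = norm (x - p)" using t unfolding x by simp
    also have "\<dots> \<le> norm (y1 *\<^sub>R dir (ang i)) + norm (y2 *\<^sub>R dir (ang (Suc i)))"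
      unfolding xy using norm_triangle_ineq[of "y1 *\<^sub>R dir (ang i)" "y2 *\<^sub>R dir (ang (Suc i))"] by (simp only: add.assoc add_diff_cancel_left')
    finally show ?thesis using y by simp
  qed
  have sum_le: "(y1 + y2) * cos (\<Delta> / 2) \<le> t"
  proof -
    have "sin (\<Delta> - \<psi>) + sin \<psi> = 2 * sin (\<Delta> / 2) * cos (\<Delta> / 2 - \<psi>)"
      using sin_plus_sin[of "\<Delta> - \<psi>" \<psi>] by (simp add: diff_divide_distrib)
    also have "\<dots> \<le> 2 * sin (\<Delta> / 2) * 1" using trig by (intro mult_left_mono) auto
    finally have "(sin (\<Delta> - \<psi>) + sin \<psi>) * cos (\<Delta> / 2) \<le> sin \<Delta>" unfolding trig(7) using trig by simp
    then have "t / sin \<Delta> * ((sin (\<Delta> - \<psi>) + sin \<psi>) * cos (\<Delta> / 2)) \<le> t / sin \<Delta> * sin \<Delta>"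
      using t trig by (intro mult_left_mono) auto
    moreover have "t / sin \<Delta> * sin \<Delta> = t" using trig by simp
    moreover have "y1 + y2 = t / sin \<Delta> * (sin (\<Delta> - \<psi>) + sin \<psi>)" unfolding y1_def y2_def by (simp add: add_divide_distrib distrib_left)
    ultimately show ?thesis by simp
  qed
  define h where "h s = y1 / rad s i + y2 / rad s (Suc i)" for s
  have ch: "continuous_on {s0..s1} h"
  proof -
    have "rad s i \<noteq> 0" if "s \<in> {s0..s1}" for s i using rad_pos[of s i] that s by auto
    then have "\<forall>s\<in>{s0..s1}. rad s i \<noteq> 0" "\<forall>s\<in>{s0..s1}. rad s (Suc i) \<noteq> 0" by blast+
    then show ?thesis unfolding h_def rad_def by (intro continuous_intros)
  qed
  have h0: "1 \<le> h s0"
  proof -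
    have "rad s0 k \<le> t" for k
    proof -
      have "s0 * a k \<le> s0 * B" using s a_bounds by simp
      then show ?thesis using inner unfolding rad_def by linarith
    qed
    then have "y1 / t + y2 / t \<le> h s0"
      unfolding h_def using y rad_pos[of s0] s by (intro add_mono divide_left_mono) (auto intro: mult_pos_pos t)
    moreover have "1 \<le> y1 / t + y2 / t" using sum_ge t by (simp flip: add_divide_distrib)
    ultimately show ?thesis by linarith
  qed
  have h1: "h s1 \<le> 1"
  proof -
    have s1T: "0 < s1 * T" using s outer by simp
    have rT: "s1 * T \<le> rad s1 k" if "dir (ang k) = dir \<theta>" "\<bar>\<theta> - \<phi>\<bar> \<le> \<Delta>" for k \<theta>
    proof -
      have "s1 * T \<le> s1 * radius C p (dir (ang k))" using T[OF that(2)] that(1) s by simp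
      moreover have "rad s1 k = (1 - s1) * r' + s1 * radius C p (dir (ang k))" unfolding rad_def a_def by (simp add: algebra_simps)
      moreover have "0 \<le> (1 - s1) * r'" using s r' by simp
      ultimately show ?thesis by linarith
    qed
    have "s1 * T \<le> rad s1 i" "s1 * T \<le> rad s1 (Suc i)"
      by (rule rT[OF di(1)], use \<psi> in \<open>simp add: \<psi>_def\<close>) (rule rT[OF di(2)], use \<psi> in \<open>simp add: \<psi>_def\<close>)
    then have "h s1 \<le> y1 / (s1 * T) + y2 / (s1 * T)"
      unfolding h_def using y s1T rad_pos[of s1] s by (intro add_mono divide_left_mono) (auto intro: mult_pos_pos)
    also have "\<dots> = (y1 + y2) * cos (\<Delta> / 2) / (s1 * T * cos (\<Delta> / 2))" using trig by (simp add: add_divide_distrib distrib_right)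
    also have "\<dots> \<le> t / t" using sum_le outer t y trig by (intro frac_le) auto
    finally show ?thesis using t by simp
  qed
  obtain s where ss: "s0 \<le> s" "s \<le> s1" "h s = 1"
    using IVT2'[OF h1 h0 s(2) ch] by blast
  have rp: "0 < rad s i" "0 < rad s (Suc i)" using rad_pos[of s] ss s by auto
  define \<tau> where "\<tau> = y2 / rad s (Suc i)"
  have t1: "1 - \<tau> = y1 / rad s i" using ss(3) unfolding h_def \<tau>_def by simp
  have "0 \<le> \<tau>" "0 \<le> 1 - \<tau>" unfolding t1 using y rp unfolding \<tau>_def by auto
  then have \<tau>: "\<tau> \<in> {0..1}" by simp
  have "X s i \<tau> = x" unfolding X_rad t1 xy using rp by (simp add: \<tau>_def)
  then have "x \<in> quad s0 s1 i" unfolding quad_def using ss \<tau> by (force intro!: image_eqI[of _ _ "(s, \<tau>)"])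
  then show ?thesis using iN by blast
qed

end

text \<open>For every large N the estimate holds on the compact set \<open>Q N\<close>, and each
  point of the punctured cell eventually belongs to these sets. The limit is taken with Fatou's
  lemma, since the \<open>Q N\<close> need not be nested.\<close>

lemma (in convex_region) cell_estimate:
  assumes r: "0 < r" and ball_C: "ball p \<rho> \<subseteq> C" and m: "0 < m" "m < \<rho> - r"
    and B: "\<And>\<theta>. radius C p (dir \<theta>) - r \<le> B"
    and L: "\<And>N. 4 < N \<Longrightarrow> (\<Sum>i<N. norm (bpt (\<theta>0 + 2 * pi * real (Suc i) / real N) - bpt (\<theta>0 + 2 * pi * real i / real N))) \<le> L"
    and \<Psi>: "\<And>x. x \<in> C - cball p r \<Longrightarrow> (\<Psi> has_derivative (\<lambda>h. A x \<bullet> h - \<alpha> * angle_form p x h)) (at x)"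
    and A: "continuous_on (C - cball p r) A" and \<gamma>: "\<gamma> \<le> infdist \<alpha> \<int>" "0 \<le> \<gamma>"
    and \<Omega>: "open \<Omega>" "bounded \<Omega>" "C - cball p r \<subseteq> \<Omega>" and H: "H1_with_gradient \<Omega> u g"
    and \<mu>: "0 \<le> \<mu>" "\<mu> * (L\<^sup>2 * B\<^sup>2) \<le> (2 * pi * \<gamma>)\<^sup>2 * m\<^sup>2 \<or> \<mu> * ((m + B)\<^sup>2 * L\<^sup>2) \<le> (4 * \<gamma>)\<^sup>2 * (4 * m * B)"
  shows "ennreal \<mu> * (\<integral>\<^sup>+x\<in>C - cball p r. ennreal ((norm (u x))\<^sup>2) \<partial>lborel)
    \<le> (\<integral>\<^sup>+x\<in>C - cball p r. ennreal ((norm (magnetic_gradient A u g x))\<^sup>2) \<partial>lborel)"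
proof -
  define D where "D = C - cball p r"
  define E where "E = (\<integral>\<^sup>+x\<in>D. ennreal ((norm (magnetic_gradient A u g x))\<^sup>2) \<partial>lborel)"
  define Q where "Q N = (\<Union>i<N. polygonal_foliation.quad C p r \<theta>0 N (1 / real N) (1 - 1 / real N) i)" for N
  have lim: "((\<lambda>N. c / real N) \<longlongrightarrow> 0) sequentially" for c
    using tendsto_mult[OF tendsto_const[of c] lim_1_over_n] by simp
  have lim_cos: "((\<lambda>N. cos (c / real N)) \<longlongrightarrow> 1) sequentially" for c
    using tendsto_cos[OF lim[of c]] by simp
  have lim_r': "((\<lambda>N. r / cos (pi / real N)) \<longlongrightarrow> r) sequentially"
    using tendsto_divide[OF tendsto_const[of r] lim_cos[of pi]] by simp
  have "((\<lambda>N. \<rho> * cos (2 * pi / real N) - r / cos (pi / real N)) \<longlongrightarrow> \<rho> * 1 - r) sequentially"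
    by (intro tendsto_intros lim_cos lim_r')
  \<comment> \<open>The strict inequality m < \<rho> - r leaves room for what the polygons lose at
    finite N.\<close>
  then have "\<forall>\<^sub>F N in sequentially. m < \<rho> * cos (2 * pi / real N) - r / cos (pi / real N)"
    by (rule order_tendstoD) (use m in simp)
  then have fol: "\<forall>\<^sub>F N in sequentially. polygonal_foliation C p r \<rho> m B \<theta>0 L N"
    using eventually_gt_at_top[of 4]
  proof eventually_elim
    case (elim N)
    then show ?case using r ball_C m(1) B L by unfold_locales auto
  qed
  have Qle: "\<forall>\<^sub>F N in sequentially. (\<integral>\<^sup>+x\<in>Q N. ennreal \<mu> * ennreal ((norm (u x))\<^sup>2) \<partial>lborel) \<le> E"
    using fol eventually_gt_at_top[of 4]
  proof eventually_elim
    case (elim N)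
    interpret polygonal_foliation C p r \<rho> m B \<theta>0 L N by (rule elim(1))
    have s: "0 < 1 / real N" "1 - 1 / real N < 1" using N by auto
    have QD: "Q N \<subseteq> D" unfolding Q_def D_def using quad_in[OF s] by blast
    have bQ: "Q N \<in> sets borel" unfolding Q_def
      by (intro borel_compact compact_UN compact_quad s) auto
    have "(\<lambda>x. ennreal ((norm (u x))\<^sup>2) * indicator (Q N) x) \<in> borel_measurable lborel"
    proof -
      have "set_borel_measurable lborel \<Omega> u" using H unfolding H1_with_gradient_def L2_on_def by auto
      then have "(\<lambda>x. ennreal ((norm (indicator \<Omega> x *\<^sub>R u x))\<^sup>2) * indicator (Q N) x) \<in> borel_measurable lborel"
        unfolding set_borel_measurable_def using bQ by measurable
      also have "(\<lambda>x. ennreal ((norm (indicator \<Omega> x *\<^sub>R u x))\<^sup>2) * indicator (Q N) x) = (\<lambda>x. ennreal ((norm (u x))\<^sup>2) * indicator (Q N) x)"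
        by (intro ext) (use QD \<Omega>(3) in \<open>auto simp: D_def split: split_indicator\<close>)
      finally show ?thesis .
    qed
    then have "(\<integral>\<^sup>+x\<in>Q N. ennreal \<mu> * ennreal ((norm (u x))\<^sup>2) \<partial>lborel) = ennreal \<mu> * (\<integral>\<^sup>+x\<in>Q N. ennreal ((norm (u x))\<^sup>2) \<partial>lborel)"
      by (simp add: mult.assoc nn_integral_cmult)
    also have "\<dots> \<le> (\<integral>\<^sup>+x\<in>Q N. ennreal ((norm (magnetic_gradient A u g x))\<^sup>2) \<partial>lborel)"
      by (rule area_estimate_H1[OF s \<Psi> A \<gamma> _ \<Omega> H \<mu>]) (auto simp: Q_def)
    also have "\<dots> \<le> E" unfolding E_def by (rule nn_integral_mono) (use QD in \<open>auto split: split_indicator\<close>)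
    finally show ?case .
  qed
  have cover: "\<forall>\<^sub>F N in sequentially. x \<in> Q N" if x: "x \<in> D" for x
  proof -
    have xC: "x \<in> C" and xr: "r < norm (x - p)" using x unfolding D_def by (auto simp: dist_norm norm_minus_commute)
    define t where "t = norm (x - p)"
    have t: "0 < t" "r < t" using xr r unfolding t_def by auto
    obtain \<phi> where \<phi>: "x - p = t *\<^sub>R dir \<phi>" using polar_direction[of "x - p"] t unfolding t_def by auto
    then have xp: "x = p + t *\<^sub>R dir \<phi>" by (metis add.commute diff_add_cancel)
    have lt: "t < radius C p (dir \<phi>)" using radius_le_iff[of "dir \<phi>" t] xC t unfolding xp by simp
    \<comment> \<open>A radius strictly between t and the boundary. As C is open, it stays below the
      boundary in all nearby directions, in particular on both rays of the sector once \<Delta> is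
      small.\<close>
    define T where "T = (t + radius C p (dir \<phi>)) / 2"
    have T: "t < T" "T < radius C p (dir \<phi>)" using lt unfolding T_def by auto
    have "p + T *\<^sub>R dir \<phi> \<in> C" using radius_le_iff[of "dir \<phi>" T] T t by simp
    moreover have "open ((\<lambda>\<theta>. p + T *\<^sub>R dir \<theta>) -` C)"
      by (intro open_vimage open_C continuous_intros continuous_dir)
    ultimately obtain d where d: "0 < d" "\<And>\<theta>. dist \<theta> \<phi> < d \<Longrightarrow> p + T *\<^sub>R dir \<theta> \<in> C"
      unfolding open_dist by (auto simp: Ball_def)
    have "((\<lambda>N. r / cos (pi / real N) + 1 / real N * B) \<longlongrightarrow> r + 0 * B) sequentially"
      by (intro tendsto_intros lim_r' lim)
    then have e1: "\<forall>\<^sub>F N in sequentially. r / cos (pi / real N) + 1 / real N * B < t"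
      by (rule order_tendstoD) (use t in simp)
    have "((\<lambda>N. (1 - 1 / real N) * T * cos (pi / real N)) \<longlongrightarrow> (1 - 0) * T * 1) sequentially"
      by (intro tendsto_intros lim_cos lim)
    then have e2: "\<forall>\<^sub>F N in sequentially. t < (1 - 1 / real N) * T * cos (pi / real N)"
      by (rule order_tendstoD) (use T in simp)
    have e3: "\<forall>\<^sub>F N in sequentially. 2 * pi / real N < d"
      by (rule order_tendstoD(2)[OF lim d(1)])
    show ?thesis
      using fol e1 e2 e3
    proof eventually_elim
      case (elim N)
      interpret polygonal_foliation C p r \<rho> m B \<theta>0 L N by (rule elim(1))
      have s: "0 < 1 / real N" "1 / real N \<le> 1 - 1 / real N" "1 - 1 / real N < 1" using N by (auto simp: field_simps)
      have \<Delta>2: "\<Delta> / 2 = pi / real N" unfolding \<Delta>_def by simp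
      show ?case unfolding Q_def
      proof (rule quads_cover[OF xp t(1) s])
        show "r' + 1 / real N * B \<le> t" using elim(2) unfolding r'_def \<Delta>2 by simp
        show "t \<le> (1 - 1 / real N) * T * cos (\<Delta> / 2)" using elim(3) unfolding \<Delta>2 by simp
        show "0 < T" using T t by simp
        fix \<theta> assume "\<bar>\<theta> - \<phi>\<bar> \<le> \<Delta>"
        then have "p + T *\<^sub>R dir \<theta> \<in> C" using elim(4) by (intro d) (auto simp: dist_real_def \<Delta>_def)
        then show "T \<le> radius C p (dir \<theta>)" using radius_le_iff[of "dir \<theta>" T] T t by simp
      qed
    qed
  qed
  have oD: "D \<in> sets borel" unfolding D_def using open_C by auto
  have um: "(\<lambda>x. ennreal ((norm (u x))\<^sup>2) * indicator D x) \<in> borel_measurable lborel"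
  proof -
    have "set_borel_measurable lborel \<Omega> u" using H unfolding H1_with_gradient_def L2_on_def by auto
    then have "(\<lambda>x. ennreal ((norm (indicator \<Omega> x *\<^sub>R u x))\<^sup>2) * indicator D x) \<in> borel_measurable lborel"
      unfolding set_borel_measurable_def using oD by measurable
    also have "(\<lambda>x. ennreal ((norm (indicator \<Omega> x *\<^sub>R u x))\<^sup>2) * indicator D x) = (\<lambda>x. ennreal ((norm (u x))\<^sup>2) * indicator D x)"
      by (intro ext) (use \<Omega>(3) in \<open>auto simp: D_def split: split_indicator\<close>)
    finally show ?thesis .
  qed
  \<comment> \<open>Only finitely many N fail to give a foliation; for these the value 0 keeps
    \<open>f N\<close> measurable, as Fatou's lemma requires.\<close>
  define f where "f N = (if polygonal_foliation C p r \<rho> m B \<theta>0 L N then (\<lambda>x. ennreal \<mu> * (ennreal ((norm (u x))\<^sup>2) * indicator D x) * indicator (Q N) x) else (\<lambda>x. 0))" for N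
  have fm: "f N \<in> borel_measurable lborel" for N
  proof (cases "polygonal_foliation C p r \<rho> m B \<theta>0 L N")
    case True
    interpret polygonal_foliation C p r \<rho> m B \<theta>0 L N by (rule True)
    have "0 < 1 / real N" using N by auto
    then have "Q N \<in> sets borel" unfolding Q_def by (intro borel_compact compact_UN compact_quad) auto
    then show ?thesis unfolding f_def using True um by simp
  qed (simp add: f_def)
  have fE: "\<forall>\<^sub>F N in sequentially. integral\<^sup>N lborel (f N) \<le> E"
    using Qle
  proof eventually_elim
    case (elim N)
    have "integral\<^sup>N lborel (f N) \<le> (\<integral>\<^sup>+x\<in>Q N. ennreal \<mu> * ennreal ((norm (u x))\<^sup>2) \<partial>lborel)"
      unfolding f_def by (rule nn_integral_mono) (auto split: split_indicator)
    then show ?case using elim by (rule order_trans)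
  qed
  have "liminf (\<lambda>N. f N x) = ennreal \<mu> * (ennreal ((norm (u x))\<^sup>2) * indicator D x)" for x
  proof (rule lim_imp_Liminf)
    show "(\<lambda>N. f N x) \<longlonglongrightarrow> ennreal \<mu> * (ennreal ((norm (u x))\<^sup>2) * indicator D x)"
    proof (cases "x \<in> D")
      case True
      show ?thesis by (rule tendsto_eventually) (use fol cover[OF True] in \<open>eventually_elim, simp add: f_def\<close>)
    qed (simp add: f_def if_distrib[of "\<lambda>f. f x"] cong: if_cong)
  qed simp
  then have "ennreal \<mu> * (\<integral>\<^sup>+x\<in>D. ennreal ((norm (u x))\<^sup>2) \<partial>lborel) = (\<integral>\<^sup>+x. liminf (\<lambda>N. f N x) \<partial>lborel)"
    using um by (simp add: nn_integral_cmult)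
  also have "\<dots> \<le> liminf (\<lambda>N. integral\<^sup>N lborel (f N))" by (rule nn_integral_liminf) (rule fm)
  also have "\<dots> \<le> E" by (rule Liminf_le[OF _ fE]) simp
  finally show ?thesis unfolding E_def D_def .
qed

subsection \<open>The estimate on the perforated domain\<close>

text \<open>\<open>cell_estimate\<close> needs m strictly below the cell width. Taking m = t *
  cell_width with t < 1 gives the constant with a factor t^2, and here t tends to 1.\<close>

lemma ennreal_scaled_limit:
  assumes h: "\<And>t. 0 < t \<Longrightarrow> t < 1 \<Longrightarrow> ennreal (c * t\<^sup>2) * U \<le> E" and U: "U < \<infinity>" and c: "0 \<le> c"
  shows "ennreal c * U \<le> E"
proof (cases E rule: ennreal_cases)
  case (real e)
  obtain a where a: "0 \<le> a" "U = ennreal a" using U by (cases U rule: ennreal_cases) auto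
  have h': "c * t\<^sup>2 * a \<le> e" if "0 < t" "t < 1" for t
  proof -
    have "ennreal (c * t\<^sup>2 * a) \<le> ennreal e"
      using h[OF that] c a unfolding real(2) a(2) by (simp add: ennreal_mult')
    then show ?thesis using real(1) by simp
  qed
  have "((\<lambda>t. c * t\<^sup>2 * a) \<longlongrightarrow> c * 1\<^sup>2 * a) (at_left 1)" by (intro tendsto_intros)
  then have "c * 1\<^sup>2 * a \<le> e"
    by (rule tendsto_upperbound) (use h' in \<open>auto simp: eventually_at_left_field intro!: exI[of _ 0]\<close>)
  then have "ennreal (c * a) \<le> ennreal e" by (intro ennreal_leI) simp
  then show ?thesis unfolding real(2) a(2) using c a by (simp add: ennreal_mult')
qed simp

lemma le_infdist_Ints_minus:
  assumes "\<gamma> \<le> infdist a (\<int> :: real set)"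
  shows "\<gamma> \<le> infdist (- a) \<int>"
proof -
  have ne: "(\<int> :: real set) \<noteq> {}" using Ints_0 by blast
  have "\<gamma> \<le> dist (- a) k" if "k \<in> \<int>" for k
  proof -
    have "infdist a \<int> \<le> dist a (- k)" by (rule infdist_le) (use that in simp)
    also have "dist a (- k) = dist (- a) k" by (simp add: dist_real_def)
    finally show ?thesis using assms by simp
  qed
  then show ?thesis unfolding infdist_notempty[OF ne] by (intro cINF_greatest ne)
qed

text \<open>After cancelling one factor b, the left-hand side is largest at b = 1 / 2, where (b / 2
  + 1)^2 = (5 / 4)^2. With 3.2 in place of pi the product (16 / 5)^2 (1 / 2) (5 / 4)^2 is exactly
  8.\<close>

lemma multi_hole_constant:
  fixes b :: real
  assumes "0 \<le> b" "b \<le> 1 / 2"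
  shows "pi\<^sup>2 * b\<^sup>2 * (b / 2 + 1)\<^sup>2 \<le> 8 * b"
proof -
  have p: "pi\<^sup>2 \<le> (32 / 10)\<^sup>2" using pi_approx pi_gt_zero by (intro power_mono) auto
  have "(b / 2 + 1)\<^sup>2 \<le> (5 / 4)\<^sup>2" using assms by (intro power_mono) auto
  then have "pi\<^sup>2 * (b * (b / 2 + 1)\<^sup>2) \<le> (32 / 10)\<^sup>2 * (1 / 2 * (5 / 4)\<^sup>2)"
    using p assms by (intro mult_mono) auto
  also have "\<dots> = 8" by (simp add: power2_eq_square)
  finally have "b * (pi\<^sup>2 * (b * (b / 2 + 1)\<^sup>2)) \<le> b * 8" using assms by (intro mult_left_mono) auto
  then show ?thesis by (simp add: power2_eq_square mult_ac)
qed

context perforated_domain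
begin

lemma cell_rayleigh:
  assumes j: "j \<in> {1..n}" and C: "C = cell j \<inter> \<Omega>"
    and ex: "exact_on (\<lambda>x v. A x \<bullet> v - \<alpha> * angle_form (p j) x v) C"
    and A: "continuous_on \<Omega> A" and \<gamma>: "\<gamma> \<le> infdist \<alpha> \<int>" "0 \<le> \<gamma>" and H: "H1_with_gradient \<Omega> u g"
  shows "ennreal (4 * pi\<^sup>2 / (boundary_length F)\<^sup>2 * (\<beta>\<^sup>2 / B\<^sup>2) * \<gamma>\<^sup>2) * (\<integral>\<^sup>+x\<in>C. ennreal ((norm (u x))\<^sup>2) \<partial>lborel)
    \<le> (\<integral>\<^sup>+x\<in>C. ennreal ((norm (magnetic_gradient A u g x))\<^sup>2) \<partial>lborel)"
proof -
  interpret FR: convex_region F "p j" using region[OF j] .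
  interpret CR: convex_region "cell j" "p j" using cell_region[OF j] .
  let ?L = "boundary_length F"
  define c where "c = 4 * pi\<^sup>2 / ?L\<^sup>2 * (\<beta>\<^sup>2 / B\<^sup>2) * \<gamma>\<^sup>2"
  let ?U = "\<integral>\<^sup>+x\<in>C. ennreal ((norm (u x))\<^sup>2) \<partial>lborel"
  let ?E = "\<integral>\<^sup>+x\<in>C. ennreal ((norm (magnetic_gradient A u g x))\<^sup>2) \<partial>lborel"
  have C': "C = cell j - cball (p j) r" using cell_minus_disk[OF j] C by simp
  have c0: "0 \<le> c" unfolding c_def by simp
  show ?thesis
  \<comment> \<open>This case also absorbs vanishing widths and a vanishing length, where division
    by zero gives \<open>c = 0\<close>.\<close>
  proof (cases "c = 0")
    case True
    then show ?thesis unfolding c_def[symmetric] by simp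
  next
    case False
    then have nz: "\<beta> \<noteq> 0" "B \<noteq> 0" "?L \<noteq> 0" unfolding c_def by auto
    have \<beta>0: "0 < \<beta>" using nz \<beta>_nonneg by simp
    have w: "0 < cell_width" using \<beta>0 cell_width by linarith
    obtain \<theta>0 where \<theta>0: "\<forall>N>0. (\<Sum>i<N. norm (FR.bpt (\<theta>0 + 2*pi*real (Suc i) / real N) - FR.bpt (\<theta>0 + 2*pi*real i / real N))) \<le> ?L"
      using FR.inscribed_polygon_le_boundary_length by blast
    have L: "(\<Sum>i<N. norm (CR.bpt (\<theta>0 + 2*pi*real (Suc i) / real N) - CR.bpt (\<theta>0 + 2*pi*real i / real N))) \<le> ?L" if "4 < N" for N
      using inscribed_polygon_mono[OF CR.convex_region_axioms FR.convex_region_axioms cell_sub_F that, of \<theta>0] \<theta>0 that by (meson less_trans order_trans zero_less_numeral)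
    have B0: "0 < B"
    proof -
      have "r + cell_width \<le> radius (cell j) (p j) (dir 0)" by (rule CR.ball_radius_le[OF ball_in_cell[OF j]]) simp
      then show ?thesis using cell_radius_le[OF j, of 0] w by linarith
    qed
    obtain \<Psi> where \<Psi>: "\<And>x. x \<in> C \<Longrightarrow> (\<Psi> has_derivative (\<lambda>v. A x \<bullet> v - \<alpha> * angle_form (p j) x v)) (at x)"
      using ex unfolding exact_on_def by blast
    have b\<Omega>: "bounded \<Omega>" unfolding \<Omega> using F by (auto intro: bounded_subset)
    have main: "ennreal \<mu> * ?U \<le> ?E"
      if m: "0 < m" "m < cell_width" and \<mu>: "0 \<le> \<mu>" "\<mu> * (?L\<^sup>2 * B\<^sup>2) \<le> (2 * pi * \<gamma>)\<^sup>2 * m\<^sup>2 \<or> \<mu> * ((m + B)\<^sup>2 * ?L\<^sup>2) \<le> (4 * \<gamma>)\<^sup>2 * (4 * m * B)" for m \<mu>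
      unfolding C'
    proof (rule CR.cell_estimate[OF r ball_in_cell[OF j] m(1) _ cell_radius_le[OF j] L _ _ \<gamma> open_\<Omega> b\<Omega> _ H \<mu>])
      show "m < r + cell_width - r" using m by simp
      show "(\<Psi> has_derivative (\<lambda>h. A x \<bullet> h - \<alpha> * angle_form (p j) x h)) (at x)" if "x \<in> cell j - cball (p j) r" for x
        using \<Psi> that C' by blast
      show "continuous_on (cell j - cball (p j) r) A" by (rule continuous_on_subset[OF A]) (use C C' in blast)
      show "cell j - cball (p j) r \<subseteq> \<Omega>" using C C' by blast
    qed
    have "ennreal c * ?U \<le> ?E"
    proof (rule ennreal_scaled_limit[OF _ _ c0])
      show "?U < \<infinity>"
      proof -
        have "?U \<le> (\<integral>\<^sup>+x\<in>\<Omega>. ennreal ((norm (u x))\<^sup>2) \<partial>lborel)"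
          by (rule nn_integral_mono) (auto simp: C split: split_indicator)
        then show ?thesis using H unfolding H1_with_gradient_def L2_on_def by (auto intro: le_less_trans)
      qed
      fix t :: real assume t: "0 < t" "t < 1"
      have t2: "0 \<le> c * t\<^sup>2" using c0 by simp
      show "ennreal (c * t\<^sup>2) * ?U \<le> ?E"
      proof (rule main[OF _ _ t2])
        show "0 < t * cell_width" "t * cell_width < cell_width" using t w by auto
        \<comment> \<open>One hole uses the first alternative, with equality; several holes use the
          second.\<close>
        show "c * t\<^sup>2 * (?L\<^sup>2 * B\<^sup>2) \<le> (2 * pi * \<gamma>)\<^sup>2 * (t * cell_width)\<^sup>2 \<or>
          c * t\<^sup>2 * ((t * cell_width + B)\<^sup>2 * ?L\<^sup>2) \<le> (4 * \<gamma>)\<^sup>2 * (4 * (t * cell_width) * B)"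
        proof (cases "n = 1")
          case True
          then have "c * t\<^sup>2 * (?L\<^sup>2 * B\<^sup>2) = (2 * pi * \<gamma>)\<^sup>2 * (t * cell_width)\<^sup>2"
            unfolding c_def cell_width_def using nz by (simp add: field_simps)
          then show ?thesis by simp
        next
          case False
          then have n2: "n \<ge> 2" using n by simp
          have cw: "cell_width = \<beta> / 2" unfolding cell_width_def using False by simp
          define b where "b = \<beta> / B"
          have b: "0 \<le> b" "b \<le> 1 / 2" "\<beta> = b * B" using two_widths_le[OF n2] \<beta>0 B0 unfolding b_def by (auto simp: field_simps)
          have "c * ((cell_width + B)\<^sup>2 * ?L\<^sup>2) = 4 * \<gamma>\<^sup>2 * B\<^sup>2 * (pi\<^sup>2 * b\<^sup>2 * (b / 2 + 1)\<^sup>2)"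
          proof -
            have "cell_width + B = B * (b / 2 + 1)" unfolding cw b(3) by (simp add: algebra_simps)
            moreover have "c * ?L\<^sup>2 = 4 * pi\<^sup>2 * b\<^sup>2 * \<gamma>\<^sup>2" unfolding c_def b_def using nz by (simp add: power_divide)
            ultimately show ?thesis by (simp add: power_mult_distrib mult_ac)
          qed
          also have "\<dots> \<le> 4 * \<gamma>\<^sup>2 * B\<^sup>2 * (8 * b)"
            using multi_hole_constant[OF b(1,2)] by (intro mult_left_mono) auto
          also have "\<dots> = (4 * \<gamma>)\<^sup>2 * (4 * cell_width * B)" unfolding cw b(3) by (simp add: power2_eq_square)
          finally have 1: "c * ((cell_width + B)\<^sup>2 * ?L\<^sup>2) \<le> (4 * \<gamma>)\<^sup>2 * (4 * cell_width * B)" .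
          \<comment> \<open>The second bound is linear in m = t * cell_width, so one of the two
            factors t can be given away.\<close>
          have "t\<^sup>2 * (t * cell_width + B)\<^sup>2 \<le> t * (cell_width + B)\<^sup>2"
            using t w B0 by (intro mult_mono power_mono) (auto simp: power2_eq_square mult_left_le)
          then have "c * ?L\<^sup>2 * (t\<^sup>2 * (t * cell_width + B)\<^sup>2) \<le> c * ?L\<^sup>2 * (t * (cell_width + B)\<^sup>2)"
            using c0 by (intro mult_left_mono) auto
          then have "c * t\<^sup>2 * ((t * cell_width + B)\<^sup>2 * ?L\<^sup>2) \<le> c * t * ((cell_width + B)\<^sup>2 * ?L\<^sup>2)"
            by (simp add: mult_ac)
          also have "\<dots> = t * (c * ((cell_width + B)\<^sup>2 * ?L\<^sup>2))" by simp
          also have "\<dots> \<le> t * ((4 * \<gamma>)\<^sup>2 * (4 * cell_width * B))" using 1 t by (intro mult_left_mono) auto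
          finally show ?thesis by (simp add: mult_ac)
        qed
      qed
    qed
    then show ?thesis unfolding c_def .
  qed
qed

text \<open>The cells cover the domain up to a null set, which handles the left-hand side, and are
  disjoint, which handles the right-hand side.\<close>

lemma rayleigh_sum_cells:
  assumes cell: "\<And>j. j \<in> {1..n} \<Longrightarrow> c * (\<integral>\<^sup>+x\<in>cell j \<inter> \<Omega>. f x \<partial>lborel) \<le> (\<integral>\<^sup>+x\<in>cell j \<inter> \<Omega>. h x \<partial>lborel)"
    and f: "(\<lambda>x. f x * indicator \<Omega> x) \<in> borel_measurable borel" and h: "(\<lambda>x. h x * indicator \<Omega> x) \<in> borel_measurable borel"
  shows "c * (\<integral>\<^sup>+x\<in>\<Omega>. f x \<partial>lborel) \<le> (\<integral>\<^sup>+x\<in>\<Omega>. h x \<partial>lborel)"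
proof -
  let ?I = "{1..n}"
  have oc: "open (cell j)" if "j \<in> ?I" for j using cell_region[OF that] convex_region.open_C by blast
  have "(\<integral>\<^sup>+x\<in>\<Omega>. f x \<partial>lborel) \<le> (\<integral>\<^sup>+x. (\<Sum>j\<in>?I. (f x * indicator \<Omega> x) * indicator (cell j \<inter> \<Omega>) x) \<partial>lborel)"
  proof (rule nn_integral_mono_AE, rule AE_mp[OF AE_not_in_negligible[OF cells_cover]], intro AE_I2 impI)
    fix x assume x: "x \<notin> F - (\<Union>j\<in>?I. cell j)"
    show "f x * indicator \<Omega> x \<le> (\<Sum>j\<in>?I. (f x * indicator \<Omega> x) * indicator (cell j \<inter> \<Omega>) x)"
    proof (cases "x \<in> \<Omega>")
      case True
      then obtain j where j: "j \<in> ?I" "x \<in> cell j" using x \<Omega> by blast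
      have "f x * indicator \<Omega> x = (f x * indicator \<Omega> x) * indicator (cell j \<inter> \<Omega>) x" using True j by simp
      also have "\<dots> \<le> (\<Sum>j\<in>?I. (f x * indicator \<Omega> x) * indicator (cell j \<inter> \<Omega>) x)"
        by (rule member_le_sum) (use j in auto)
      finally show ?thesis .
    qed simp
  qed
  also have "\<dots> = (\<Sum>j\<in>?I. \<integral>\<^sup>+x. (f x * indicator \<Omega> x) * indicator (cell j \<inter> \<Omega>) x \<partial>lborel)"
    by (rule nn_integral_sum) (use f oc open_\<Omega> in \<open>auto intro!: borel_measurable_times_ennreal borel_measurable_indicator borel_open\<close>)
  also have "\<dots> = (\<Sum>j\<in>?I. \<integral>\<^sup>+x\<in>cell j \<inter> \<Omega>. f x \<partial>lborel)"
    by (intro sum.cong refl nn_integral_cong) (auto split: split_indicator)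
  finally have "c * (\<integral>\<^sup>+x\<in>\<Omega>. f x \<partial>lborel) \<le> c * (\<Sum>j\<in>?I. \<integral>\<^sup>+x\<in>cell j \<inter> \<Omega>. f x \<partial>lborel)"
    by (rule mult_left_mono) simp
  also have "\<dots> = (\<Sum>j\<in>?I. c * (\<integral>\<^sup>+x\<in>cell j \<inter> \<Omega>. f x \<partial>lborel))" by (rule sum_distrib_left)
  also have "\<dots> \<le> (\<Sum>j\<in>?I. \<integral>\<^sup>+x\<in>cell j \<inter> \<Omega>. h x \<partial>lborel)" by (rule sum_mono) (rule cell)
  also have "\<dots> \<le> (\<integral>\<^sup>+x\<in>\<Omega>. h x \<partial>lborel)"
    by (rule sum_nn_integral_almost_disjoint_le[where T = cell])
       (use oc open_\<Omega> h cells_disjoint in \<open>auto intro!: borel_open\<close>)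
  finally show ?thesis .
qed

end

theorem theorem13:
  fixes F \<Omega> :: "(real^2) set" and G :: "nat \<Rightarrow> (real^2) set" and p :: "nat \<Rightarrow> real^2"
    and r \<gamma> :: real and n :: nat and A :: "real^2 \<Rightarrow> real^2" and \<Phi> :: "nat \<Rightarrow> real"
  assumes "bounded F" and "open F" and "convex F" and "smooth_boundary F"
    and "n \<ge> 1" and "r > 0"
    and "\<And>j. j \<in> {1..n} \<Longrightarrow> G j = ball (p j) r"
    and "\<And>j. j \<in> {1..n} \<Longrightarrow> closure (G j) \<subseteq> F"
    and "\<And>j k. j \<in> {1..n} \<Longrightarrow> k \<in> {1..n} \<Longrightarrow> j \<noteq> k \<Longrightarrow> closure (G j) \<inter> closure (G k) = {}"
    and "\<Omega> = F - (\<Union>j\<in>{1..n}. closure (G j))"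
    and "smooth_on A \<Omega>" and "closed_form_on A \<Omega>"
    and "\<And>j. j \<in> {1..n} \<Longrightarrow> has_flux \<Omega> n G A j (\<Phi> j)"
    and "\<gamma> = Min ((\<lambda>j. infdist (\<Phi> j) \<int>) ` {1..n})"
  shows "lambda1 \<Omega> A \<ge>
    ennreal (4 * pi\<^sup>2 / (boundary_length F)\<^sup>2
      * ((min_width \<Omega> n p r)\<^sup>2 / (max_width \<Omega> n p r)\<^sup>2) * \<gamma>\<^sup>2)"
proof -
  have cl: "closure (G j) = cball (p j) r" if "j \<in> {1..n}" for j
    using assms(6,7) that by simp
  interpret perforated_domain F \<Omega> n p r
  proof
    show "cball (p j) r \<subseteq> F" if "j \<in> {1..n}" for j using assms(8)[OF that] cl[OF that] by simp
    show "cball (p j) r \<inter> cball (p k) r = {}" if "j \<in> {1..n}" "k \<in> {1..n}" "j \<noteq> k" for j k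
      using assms(9)[OF that] cl[OF that(1)] cl[OF that(2)] by simp
    show "\<Omega> = F - (\<Union>j\<in>{1..n}. cball (p j) r)" using assms(10) cl by simp
  qed (use assms in auto)
  let ?c = "ennreal (4 * pi\<^sup>2 / (boundary_length F)\<^sup>2 * (\<beta>\<^sup>2 / B\<^sup>2) * \<gamma>\<^sup>2)"
  have cA: "continuous_on \<Omega> A" using assms(11) unfolding smooth_on_def by (metis Ck_on.simps(1))
  have \<gamma>le: "\<gamma> \<le> infdist (\<Phi> j) \<int>" if "j \<in> {1..n}" for j
    unfolding assms(14) using that by (intro Min_le) auto
  have \<gamma>0: "0 \<le> \<gamma>" unfolding assms(14) using assms(5) by (subst Min_ge_iff) (auto simp: infdist_nonneg)
  have est: "?c * (\<integral>\<^sup>+x\<in>\<Omega>. ennreal ((norm (u x))\<^sup>2) \<partial>lborel) \<le> (\<integral>\<^sup>+x\<in>\<Omega>. ennreal ((norm (magnetic_gradient A u g x))\<^sup>2) \<partial>lborel)"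
    if H: "H1_with_gradient \<Omega> u g" for u g
  proof (rule rayleigh_sum_cells)
    fix j assume j: "j \<in> {1..n}"
    have "\<exists>a. (a = \<Phi> j \<or> a = - \<Phi> j) \<and> exact_on (\<lambda>x v. A x \<bullet> v - a * angle_form (p j) x v) (cell j \<inter> \<Omega>)"
      by (rule flux_potential[OF assms(3,2,6) assms(7) assms(8) assms(9) assms(10-12) assms(13) j])
         (use convex_region.convex[OF cell_region[OF j]] other_center_not_in_cell in auto)
    then obtain a where a: "a = \<Phi> j \<or> a = - \<Phi> j" and ex: "exact_on (\<lambda>x v. A x \<bullet> v - a * angle_form (p j) x v) (cell j \<inter> \<Omega>)" by blast
    \<comment> \<open>The orientation of the loop is unknown, but the distance to the integers is
      the same for both signs.\<close>
    have "\<gamma> \<le> infdist a \<int>" using a \<gamma>le[OF j] le_infdist_Ints_minus by blast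
    from cell_rayleigh[OF j refl ex cA this \<gamma>0 H]
    show "?c * (\<integral>\<^sup>+x\<in>cell j \<inter> \<Omega>. ennreal ((norm (u x))\<^sup>2) \<partial>lborel) \<le> (\<integral>\<^sup>+x\<in>cell j \<inter> \<Omega>. ennreal ((norm (magnetic_gradient A u g x))\<^sup>2) \<partial>lborel)" .
  next
    let ?i = "\<lambda>x. indicator \<Omega> x :: real"
    have m: "(\<lambda>x. ?i x *\<^sub>R u x) \<in> borel_measurable borel" "(\<lambda>x. ?i x *\<^sub>R g x) \<in> borel_measurable borel"
      using H unfolding H1_with_gradient_def L2_on_def set_borel_measurable_def by auto
    have mA: "(\<lambda>x. ?i x *\<^sub>R A x) \<in> borel_measurable borel"
      by (rule borel_measurable_continuous_on_indicator[OF borel_open[OF open_\<Omega>] cA])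
    have "(\<lambda>x. ennreal ((norm (?i x *\<^sub>R u x))\<^sup>2)) \<in> borel_measurable borel" using m by measurable
    also have "(\<lambda>x. ennreal ((norm (?i x *\<^sub>R u x))\<^sup>2)) = (\<lambda>x. ennreal ((norm (u x))\<^sup>2) * indicator \<Omega> x)"
      by (auto split: split_indicator)
    finally show "(\<lambda>x. ennreal ((norm (u x))\<^sup>2) * indicator \<Omega> x) \<in> borel_measurable borel" .
    have "(\<lambda>x. ennreal ((norm (magnetic_gradient (\<lambda>x. ?i x *\<^sub>R A x) (\<lambda>x. ?i x *\<^sub>R u x) (\<lambda>x. ?i x *\<^sub>R g x) x))\<^sup>2)) \<in> borel_measurable borel"
      using measurable_magnetic_gradient[OF mA m] by measurable
    also have "(\<lambda>x. ennreal ((norm (magnetic_gradient (\<lambda>x. ?i x *\<^sub>R A x) (\<lambda>x. ?i x *\<^sub>R u x) (\<lambda>x. ?i x *\<^sub>R g x) x))\<^sup>2)) =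
      (\<lambda>x. ennreal ((norm (magnetic_gradient A u g x))\<^sup>2) * indicator \<Omega> x)"
      by (auto simp: magnetic_gradient_def zero_vec_def[symmetric] split: split_indicator)
    finally show "(\<lambda>x. ennreal ((norm (magnetic_gradient A u g x))\<^sup>2) * indicator \<Omega> x) \<in> borel_measurable borel" .
  qed
  show ?thesis
    unfolding lambda1_def
  proof (rule INF_greatest, clarify)
    fix u g assume H: "H1_with_gradient \<Omega> u g" and nz: "\<not> (AE x in lborel. x \<in> \<Omega> \<longrightarrow> u x = 0)"
    let ?U = "\<integral>\<^sup>+x\<in>\<Omega>. ennreal ((norm (u x))\<^sup>2) \<partial>lborel"
    have m: "(\<lambda>x. indicator \<Omega> x *\<^sub>R u x) \<in> borel_measurable borel" and fin: "?U < \<infinity>"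
      using H unfolding H1_with_gradient_def L2_on_def set_borel_measurable_def by auto
    have "?U \<noteq> 0"
    proof
      assume "?U = 0"
      have U: "?U = (\<integral>\<^sup>+x. ennreal ((norm (indicator \<Omega> x *\<^sub>R u x))\<^sup>2) \<partial>lborel)"
        by (rule nn_integral_cong) (auto split: split_indicator)
      have mm: "(\<lambda>x. ennreal ((norm (indicator \<Omega> x *\<^sub>R u x))\<^sup>2)) \<in> borel_measurable lborel"
        using m by measurable
      have "AE x in lborel. ennreal ((norm (indicator \<Omega> x *\<^sub>R u x))\<^sup>2) = 0"
        using \<open>?U = 0\<close> unfolding U nn_integral_0_iff_AE[OF mm] .
      then have "AE x in lborel. x \<in> \<Omega> \<longrightarrow> u x = 0" by eventually_elim auto
      then show False using nz by blast
    qed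
    \<comment> \<open>\<open>?U\<close> is neither zero nor infinite, so multiplication and division
      cancel in \<open>ennreal\<close>.\<close>
    then have "?c = ?c * ?U / ?U" using fin by (simp add: ennreal_mult_divide_eq)
    also have "\<dots> \<le> (\<integral>\<^sup>+x\<in>\<Omega>. ennreal ((norm (magnetic_gradient A u g x))\<^sup>2) \<partial>lborel) / ?U"
      by (rule divide_right_mono_ennreal[OF est[OF H]])
    finally show "?c \<le> (\<integral>\<^sup>+x\<in>\<Omega>. ennreal ((norm (magnetic_gradient A u g x))\<^sup>2) \<partial>lborel) / ?U" .
  qed
qed

end
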